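(* Let $\kappa$ be a consistent positive definite kernel on $X$, let $\mathbf A=(A_i)_{i\in I}$ be an $(I^+,I^-)$-condenser, and let $\mathbf a$, $\mathbf g$ be as in the context. Assume that either $I^-=\varnothing$, or both $$\sum_{i\in I}a_i\,g_{i,\inf}^{-1}<\infty\qquad\text{and}\qquad \sup_{x\in A^+,\,y\in A^-}\kappa(x,y)<\infty .$$ Let $\mathbf f=(f_i)_{i\in I}$ satisfy one of the following: (I) there is $\nu\in\mathcal E(\mathbf A)$ with $\mathbf f=\kappa_\nu$; (II) there is $\sigma\in\mathcal E$ with $f_i=\alpha_i\kappa(\cdot,\sigma)$ for all $i\in I$; (III) $f_i\in\Phi(X)$ for all $i\in I$. Assume $G_{\mathbf f}(\mathbf A,\mathbf a,\mathbf g)<\infty$. Suppose moreover that for every $i\in I$ either $g_{i,\sup}<\infty$, or there exist $r_i\in(1,\infty)$ and $\omega_i\in\mathcal E$ such that $$g_i^{r_i}(x)\le\kappa(x,\omega_i)\quad\text{n.e. in }A_i.$$ If, in addition, for every $i\in I$ the set $A_i$ either is compact or has finite interior capacity, then the class $\mathcal G_{\mathbf f}(\mathbf A,\mathbf a,\mathbf g)$ of equilibrium measures is nonempty and $\mathbf A$-vaguely compact.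
   Context: Let $X$ be a locally compact Hausdorff space and $\mathfrak M$ the space of real-valued (signed) Radon measures on $X$ with the vague topology (pointwise convergence on continuous real functions with compact support). For a locally compact space $Y$, $\Phi(Y)$ is the set of lower semicontinuous $\psi:Y\to(-\infty,\infty]$, with $\psi\ge0$ required unless $Y$ is compact. Write $\langle u,\nu\rangle:=\int u\,d\nu$. A kernel is an element $\kappa\in\Phi(X\times X)$; $\kappa(\nu,\nu_1):=\int\kappa\,d(\nu\otimes\nu_1)$ and $\kappa(x,\nu):=\int\kappa(x,y)\,d\nu(y)$ whenever well defined. $\kappa$ is positive definite if it is symmetric and $\kappa(\nu,\nu)\ge0$ for every $\nu\in\mathfrak M$ for which it is defined. Then $\mathcal E:=\{\nu\in\mathfrak M:-\infty<\kappa(\nu,\nu)<\infty\}$ is a pre-Hilbert space with scalar product $\kappa(\nu,\nu_1)$ and seminorm $\|\nu\|:=\sqrt{\kappa(\nu,\nu)}$ (strong topology). $\mathfrak M^+(E)$ is the set of nonnegative measures supported by the closed set $E$; $\mathfrak M^+:=\mathfrak M^+(X)$, $\mathcal E^+:=\mathfrak M^+\cap\mathcal E$. $\kappa$ is consistent if every strong Cauchy net in $\mathcal E^+$ converges strongly to each of its vague cluster points (equivalently: every strongly bounded, vaguely convergent net in $\mathcal E^+$ converges to its vague limit weakly, i.e. after pairing $\kappa(\cdot,\mu)$ with each $\mu\in\mathcal E$). The interior capacity of $E\subset X$ is $C(E):=[\inf\|\nu\|^2]^{-1}$, the infimum over $\nu\in\mathcal E^+$ with $\nu(X)=1$ and compact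 support contained in $E$ ($\inf\varnothing=\infty$, $1/\infty=0$, $1/0=\infty$). A property holds nearly everywhere (n.e.) in $E$ if the set of $x\in E$ where it fails has interior capacity zero. $I^+$, $I^-$ are disjoint countable (finite or infinite) sets of indices in $\mathbb N$, $I^-$ possibly empty, $I=I^+\cup I^-$; $\alpha_i=+1$ for $i\in I^+$ and $\alpha_i=-1$ for $i\in I^-$. An $(I^+,I^-)$-condenser is a family $\mathbf A=(A_i)_{i\in I}$ of nonempty closed sets in $X$ such that every compact set meets at most finitely many $A_i$ and $A_i\cap A_j=\varnothing$ for $i\in I^+$, $j\in I^-$. $A^\pm:=\bigcup_{i\in I^\pm}A_i$. $\mathfrak M(\mathbf A):=\prod_{i\in I}\mathfrak M^+(A_i)$ consists of vector measures $\mu=(\mu^i)_{i\in I}$; the $\mathbf A$-vague topology is the product of the vague topologies. Put $\kappa(\mu,\mu_1):=\sum_{i,j\in I}\alpha_i\alpha_j\kappa(\mu^i,\mu_1^j)$ and $\kappa_\mu=(\kappa^i_\mu)_{i\in I}$ with $\kappa_\mu^i(x):=\sum_{j\in I}\alpha_i\alpha_j\kappa(x,\mu^j)$. $\mathcal E(\mathbf A)$ is the set of $\mu\in\mathfrak M(\mathbf A)$ with $\kappa(\mu,\mu)$ finite (finiteness meaning absolute convergence of the series). $\mathbf g=(g_i)_{i\in I}$ with $g_i:A_i\to(0,\infty)$ continuous; $\mathbf a=(a_i)_{i\in I}$ with $a_i>0$; $g_{i,\inf}:=\inf_{A_i}g_i$, $g_{i,\sup}:=\sup_{A_i}g_i$.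 $\langle\mathbf f,\mu\rangle:=\sum_{i\in I}\langle f_i,\mu^i\rangle$ (finite iff the series converges absolutely). $G_{\mathbf f}(\mu):=\kappa(\mu,\mu)+2\langle\mathbf f,\mu\rangle$. $\mathcal E_{\mathbf f}(\mathbf A,\mathbf a,\mathbf g)$ is the set of $\mu\in\mathcal E(\mathbf A)$ with $\langle g_i,\mu^i\rangle=a_i$ for all $i\in I$ and $\langle\mathbf f,\mu\rangle$ finite. $G_{\mathbf f}(\mathbf A,\mathbf a,\mathbf g):=\inf_{\mu\in\mathcal E_{\mathbf f}(\mathbf A,\mathbf a,\mathbf g)}G_{\mathbf f}(\mu)$ ($\inf\varnothing=+\infty$). $\mathcal G_{\mathbf f}(\mathbf A,\mathbf a,\mathbf g)$ is the set of $\lambda\in\mathcal E_{\mathbf f}(\mathbf A,\mathbf a,\mathbf g)$ with $G_{\mathbf f}(\lambda)=G_{\mathbf f}(\mathbf A,\mathbf a,\mathbf g)$ (equilibrium measures). *)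

theory Defs
  imports "HOL-Analysis.Analysis"
begin

text \<open>
  Integral of an extended-real function, \<open>\<integral> u\<^sup>+ - \<integral> u\<^sup>-\<close>.  As \<open>\<infinity> - \<infinity> = \<infinity>\<close> in type
  \<^typ>\<open>ereal\<close>, for measurable \<open>u\<close> the value is finite if and only if \<open>u\<close> is integrable.
  Over a counting measure this gives series, and a finite value means absolute convergence.
\<close>
definition ereal_integral :: "'b measure \<Rightarrow> ('b \<Rightarrow> ereal) \<Rightarrow> ereal" where
  "ereal_integral M u =
     enn2ereal (\<integral>\<^sup>+x. e2ennreal (u x) \<partial>M) - enn2ereal (\<integral>\<^sup>+x. e2ennreal (- u x) \<partial>M)"

definition ereal_series :: "'i set \<Rightarrow> ('i \<Rightarrow> ereal) \<Rightarrow> ereal" where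
  "ereal_series J u = ereal_integral (count_space J) u"


subsection \<open>Radon measures and the vague topology\<close>

text \<open>
  A nonnegative Radon measure is represented by its Borel measure that is inner regular with
  respect to compact sets on \<^emph>\<open>all\<close> Borel sets; on a locally compact Hausdorff space these
  correspond bijectively to the positive linear functionals on the continuous functions with
  compact support.
\<close>
definition radon :: "('a::topological_space) measure set" where
  "radon = {\<mu>. sets \<mu> = sets borel \<and>
               (\<forall>K. compact K \<longrightarrow> emeasure \<mu> K < \<infinity>) \<and>
               (\<forall>B\<in>sets borel. emeasure \<mu> B = (SUP K\<in>{K. compact K \<and> K \<subseteq> B}. emeasure \<mu> K))}"

definition msupport :: "('a::topological_space) measure \<Rightarrow> 'a set" where
  "msupport \<mu> = {x. \<forall>U. open U \<longrightarrow> x \<in> U \<longrightarrow> emeasure \<mu> U \<noteq> 0}"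

definition radon_on :: "('a::topological_space) set \<Rightarrow> 'a measure set" where
  "radon_on E = {\<mu> \<in> radon. msupport \<mu> \<subseteq> E}"

definition Cc :: "('a::topological_space \<Rightarrow> real) set" where
  "Cc = {\<phi>. continuous_on UNIV \<phi> \<and> compact (closure {x. \<phi> x \<noteq> 0})}"

definition vague :: "('a::topological_space) measure topology" where
  "vague = pullback_topology radon (\<lambda>\<mu>. \<lambda>\<phi>\<in>Cc. integral\<^sup>L \<mu> \<phi>)
             (product_topology (\<lambda>_. euclideanreal) Cc)"

text \<open>
  The Radon product.  If the space is not second countable, the Borel sets of the product space
  can be more than the product sigma-algebra, and a lower semicontinuous kernel need not be
  measurable for the latter; hence this is not \<^term>\<open>\<mu> \<Otimes>\<^sub>M \<nu>\<close>.
\<close>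
definition radon_prod :: "('a::topological_space) measure \<Rightarrow> 'a measure \<Rightarrow> ('a \<times> 'a) measure" where
  "radon_prod \<mu> \<nu> = (THE \<pi>. \<pi> \<in> radon \<and>
     (\<forall>B\<in>sets borel. \<forall>C\<in>sets borel. emeasure \<pi> (B \<times> C) = emeasure \<mu> B * emeasure \<nu> C))"

text \<open>
  A signed Radon measure is its Jordan decomposition \<open>(\<nu>\<^sup>+, \<nu>\<^sup>-)\<close>.  Mutual singularity is required
  on compact sets only: both parts may be infinite, and without sigma-finiteness a global
  Borel Hahn set need not exist.
\<close>
definition signed_radon :: "(('a::topological_space) measure \<times> 'a measure) set" where
  "signed_radon = {(\<mu>, \<nu>). \<mu> \<in> radon \<and> \<nu> \<in> radon \<and>
     (\<forall>K. compact K \<longrightarrow>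
        (\<exists>S\<in>sets borel. S \<subseteq> K \<and> emeasure \<mu> S = 0 \<and> emeasure \<nu> (K - S) = 0))}"


subsection \<open>Kernels, energy and capacity\<close>

definition lsc_class :: "('b::topological_space \<Rightarrow> ereal) set" where
  "lsc_class = {\<psi>. (\<forall>c. open {x. c < \<psi> x}) \<and> (\<forall>x. \<psi> x \<noteq> -\<infinity>) \<and>
                   (compact (UNIV :: 'b set) \<or> (\<forall>x. 0 \<le> \<psi> x))}"

definition mutual_energy ::
  "('a::topological_space \<times> 'a \<Rightarrow> ereal) \<Rightarrow> 'a measure \<Rightarrow> 'a measure \<Rightarrow> ereal" where
  "mutual_energy \<kappa> \<mu> \<nu> = ereal_integral (radon_prod \<mu> \<nu>) \<kappa>"

definition potential ::
  "('a::topological_space \<times> 'a \<Rightarrow> ereal) \<Rightarrow> 'a measure \<Rightarrow> 'a \<Rightarrow> ereal" where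
  "potential \<kappa> \<nu> x = ereal_integral \<nu> (\<lambda>y. \<kappa> (x, y))"

text \<open>
  For \<open>\<nu> = \<nu>\<^sup>+ - \<nu>\<^sup>-\<close>, the positive part of \<open>\<nu> \<otimes> \<nu>\<close> is \<open>\<nu>\<^sup>+ \<otimes> \<nu>\<^sup>+ + \<nu>\<^sup>- \<otimes> \<nu>\<^sup>-\<close> and the negative part
  is \<open>\<nu>\<^sup>+ \<otimes> \<nu>\<^sup>- + \<nu>\<^sup>- \<otimes> \<nu>\<^sup>+\<close>.
\<close>
definition energy_defined ::
  "('a::topological_space \<times> 'a \<Rightarrow> ereal) \<Rightarrow> 'a measure \<times> 'a measure \<Rightarrow> bool" where
  "energy_defined \<kappa> = (\<lambda>(\<mu>, \<nu>).
     \<not> (mutual_energy \<kappa> \<mu> \<mu> + mutual_energy \<kappa> \<nu> \<nu> = \<infinity> \<and>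
        mutual_energy \<kappa> \<mu> \<nu> + mutual_energy \<kappa> \<nu> \<mu> = \<infinity>))"

definition energy ::
  "('a::topological_space \<times> 'a \<Rightarrow> ereal) \<Rightarrow> 'a measure \<times> 'a measure \<Rightarrow> ereal" where
  "energy \<kappa> = (\<lambda>(\<mu>, \<nu>).
     (mutual_energy \<kappa> \<mu> \<mu> + mutual_energy \<kappa> \<nu> \<nu>) - (mutual_energy \<kappa> \<mu> \<nu> + mutual_energy \<kappa> \<nu> \<mu>))"

definition spotential_defined ::
  "('a::topological_space \<times> 'a \<Rightarrow> ereal) \<Rightarrow> 'a measure \<times> 'a measure \<Rightarrow> 'a \<Rightarrow> bool" where
  "spotential_defined \<kappa> = (\<lambda>(\<mu>, \<nu>) x. \<not> (potential \<kappa> \<mu> x = \<infinity> \<and> potential \<kappa> \<nu> x = \<infinity>))"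

definition spotential ::
  "('a::topological_space \<times> 'a \<Rightarrow> ereal) \<Rightarrow> 'a measure \<times> 'a measure \<Rightarrow> 'a \<Rightarrow> ereal" where
  "spotential \<kappa> = (\<lambda>(\<mu>, \<nu>) x. potential \<kappa> \<mu> x - potential \<kappa> \<nu> x)"

definition positive_definite :: "('a::topological_space \<times> 'a \<Rightarrow> ereal) \<Rightarrow> bool" where
  "positive_definite \<kappa> \<longleftrightarrow> (\<forall>x y. \<kappa> (x, y) = \<kappa> (y, x)) \<and>
     (\<forall>\<nu>\<in>signed_radon. energy_defined \<kappa> \<nu> \<longrightarrow> 0 \<le> energy \<kappa> \<nu>)"

definition finite_energy ::
  "('a::topological_space \<times> 'a \<Rightarrow> ereal) \<Rightarrow> ('a measure \<times> 'a measure) set" where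
  "finite_energy \<kappa> = {\<nu> \<in> signed_radon. energy_defined \<kappa> \<nu> \<and> \<bar>energy \<kappa> \<nu>\<bar> \<noteq> \<infinity>}"

definition finite_energy_pos ::
  "('a::topological_space \<times> 'a \<Rightarrow> ereal) \<Rightarrow> 'a measure set" where
  "finite_energy_pos \<kappa> = {\<mu> \<in> radon. \<bar>mutual_energy \<kappa> \<mu> \<mu>\<bar> \<noteq> \<infinity>}"

text \<open>
  \<open>\<parallel>\<mu> - \<nu>\<parallel>\<close> for nonnegative \<open>\<mu>\<close>, \<open>\<nu>\<close> of finite energy: by bilinearity of the scalar product,
  \<^term>\<open>energy\<close> may be evaluated at \<open>(\<mu>, \<nu>)\<close> also when this is not the Jordan decomposition of
  \<open>\<mu> - \<nu>\<close>.
\<close>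
definition strong_dist ::
  "('a::topological_space \<times> 'a \<Rightarrow> ereal) \<Rightarrow> 'a measure \<Rightarrow> 'a measure \<Rightarrow> real" where
  "strong_dist \<kappa> \<mu> \<nu> = sqrt (real_of_ereal (energy \<kappa> (\<mu>, \<nu>)))"

text \<open>
  Nets are rendered by filters: a net is strong Cauchy, has a vague cluster point, or converges
  strongly exactly if this holds for the filter generated by its tails, and every proper
  filter arises in this way.
\<close>
definition consistent :: "('a::topological_space \<times> 'a \<Rightarrow> ereal) \<Rightarrow> bool" where
  "consistent \<kappa> \<longleftrightarrow>
     (\<forall>F. F \<noteq> bot \<longrightarrow>
        (\<forall>\<^sub>F \<mu> in F. \<mu> \<in> finite_energy_pos \<kappa>) \<longrightarrow>
        (\<forall>\<epsilon>>0. \<exists>P. eventually P F \<and> (\<forall>\<mu> \<nu>. P \<mu> \<longrightarrow> P \<nu> \<longrightarrow> strong_dist \<kappa> \<mu> \<nu> < \<epsilon>)) \<longrightarrow>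
        (\<forall>\<mu>\<^sub>0\<in>radon. (\<forall>U. openin vague U \<longrightarrow> \<mu>\<^sub>0 \<in> U \<longrightarrow> (\<exists>\<^sub>F \<mu> in F. \<mu> \<in> U)) \<longrightarrow>
           \<mu>\<^sub>0 \<in> finite_energy_pos \<kappa> \<and> ((\<lambda>\<mu>. strong_dist \<kappa> \<mu> \<mu>\<^sub>0) \<longlongrightarrow> 0) F))"

text \<open>In \<^typ>\<open>ennreal\<close>, \<open>inverse 0 = \<infinity>\<close>, \<open>inverse \<infinity> = 0\<close> and the infimum of the empty set is \<open>\<infinity>\<close>.\<close>
definition capacity :: "('a::topological_space \<times> 'a \<Rightarrow> ereal) \<Rightarrow> 'a set \<Rightarrow> ennreal" where
  "capacity \<kappa> E = inverse (INF \<nu>\<in>{\<nu> \<in> finite_energy_pos \<kappa>. emeasure \<nu> UNIV = 1 \<and>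
      compact (msupport \<nu>) \<and> msupport \<nu> \<subseteq> E}. e2ennreal (mutual_energy \<kappa> \<nu> \<nu>))"

definition nearly_everywhere ::
  "('a::topological_space \<times> 'a \<Rightarrow> ereal) \<Rightarrow> 'a set \<Rightarrow> ('a \<Rightarrow> bool) \<Rightarrow> bool" where
  "nearly_everywhere \<kappa> E P \<longleftrightarrow> capacity \<kappa> {x \<in> E. \<not> P x} = 0"


subsection \<open>Condensers and vector measures\<close>

definition condenser ::
  "nat set \<Rightarrow> nat set \<Rightarrow> (nat \<Rightarrow> ('a::topological_space) set) \<Rightarrow> bool" where
  "condenser Ipos Ineg A \<longleftrightarrow>
     Ipos \<inter> Ineg = {} \<and>
     (\<forall>i\<in>Ipos \<union> Ineg. closed (A i) \<and> A i \<noteq> {}) \<and>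
     (\<forall>K. compact K \<longrightarrow> finite {i \<in> Ipos \<union> Ineg. A i \<inter> K \<noteq> {}}) \<and>
     (\<forall>i\<in>Ipos. \<forall>j\<in>Ineg. A i \<inter> A j = {})"

definition plate_sign :: "nat set \<Rightarrow> nat \<Rightarrow> real" where
  "plate_sign Ipos i = (if i \<in> Ipos then 1 else - 1)"

definition vmeasures ::
  "nat set \<Rightarrow> nat set \<Rightarrow> (nat \<Rightarrow> ('a::topological_space) set) \<Rightarrow> (nat \<Rightarrow> 'a measure) set" where
  "vmeasures Ipos Ineg A = (\<Pi>\<^sub>E i\<in>Ipos \<union> Ineg. radon_on (A i))"

definition vvague ::
  "nat set \<Rightarrow> nat set \<Rightarrow> (nat \<Rightarrow> ('a::topological_space) set) \<Rightarrow> (nat \<Rightarrow> 'a measure) topology" where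
  "vvague Ipos Ineg A = product_topology (\<lambda>i. subtopology vague (radon_on (A i))) (Ipos \<union> Ineg)"

definition vmutual_energy ::
  "('a::topological_space \<times> 'a \<Rightarrow> ereal) \<Rightarrow> nat set \<Rightarrow> nat set \<Rightarrow>
   (nat \<Rightarrow> 'a measure) \<Rightarrow> (nat \<Rightarrow> 'a measure) \<Rightarrow> ereal" where
  "vmutual_energy \<kappa> Ipos Ineg \<mu> \<nu> =
     ereal_series ((Ipos \<union> Ineg) \<times> (Ipos \<union> Ineg))
       (\<lambda>(i, j). ereal (plate_sign Ipos i * plate_sign Ipos j) * mutual_energy \<kappa> (\<mu> i) (\<nu> j))"

text \<open>
  At points where the series has both positive and negative part infinite (for measures
  of finite energy, a set of interior capacity zero) the value is \<open>\<infinity>\<close> by convention; likewise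
  for \<^const>\<open>spotential\<close>.
\<close>
definition vpotential ::
  "('a::topological_space \<times> 'a \<Rightarrow> ereal) \<Rightarrow> nat set \<Rightarrow> nat set \<Rightarrow>
   (nat \<Rightarrow> 'a measure) \<Rightarrow> nat \<Rightarrow> 'a \<Rightarrow> ereal" where
  "vpotential \<kappa> Ipos Ineg \<mu> i x =
     ereal_series (Ipos \<union> Ineg)
       (\<lambda>j. ereal (plate_sign Ipos i * plate_sign Ipos j) * potential \<kappa> (\<mu> j) x)"

definition vfinite_energy ::
  "('a::topological_space \<times> 'a \<Rightarrow> ereal) \<Rightarrow> nat set \<Rightarrow> nat set \<Rightarrow> (nat \<Rightarrow> 'a set) \<Rightarrow>
   (nat \<Rightarrow> 'a measure) set" where
  "vfinite_energy \<kappa> Ipos Ineg A =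
     {\<mu> \<in> vmeasures Ipos Ineg A. \<bar>vmutual_energy \<kappa> Ipos Ineg \<mu> \<mu>\<bar> \<noteq> \<infinity>}"


subsection \<open>The weighted minimum energy problem\<close>

definition vpairing ::
  "nat set \<Rightarrow> nat set \<Rightarrow> (nat \<Rightarrow> 'a::topological_space \<Rightarrow> ereal) \<Rightarrow> (nat \<Rightarrow> 'a measure) \<Rightarrow> ereal" where
  "vpairing Ipos Ineg f \<mu> = ereal_series (Ipos \<union> Ineg) (\<lambda>i. ereal_integral (\<mu> i) (f i))"

definition weighted_energy ::
  "('a::topological_space \<times> 'a \<Rightarrow> ereal) \<Rightarrow> nat set \<Rightarrow> nat set \<Rightarrow> (nat \<Rightarrow> 'a \<Rightarrow> ereal) \<Rightarrow>
   (nat \<Rightarrow> 'a measure) \<Rightarrow> ereal" where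
  "weighted_energy \<kappa> Ipos Ineg f \<mu> = vmutual_energy \<kappa> Ipos Ineg \<mu> \<mu> + 2 * vpairing Ipos Ineg f \<mu>"

definition admissible ::
  "('a::topological_space \<times> 'a \<Rightarrow> ereal) \<Rightarrow> nat set \<Rightarrow> nat set \<Rightarrow> (nat \<Rightarrow> 'a \<Rightarrow> ereal) \<Rightarrow>
   (nat \<Rightarrow> 'a set) \<Rightarrow> (nat \<Rightarrow> real) \<Rightarrow> (nat \<Rightarrow> 'a \<Rightarrow> real) \<Rightarrow> (nat \<Rightarrow> 'a measure) set" where
  "admissible \<kappa> Ipos Ineg f A a g =
     {\<mu> \<in> vfinite_energy \<kappa> Ipos Ineg A.
        (\<forall>i\<in>Ipos \<union> Ineg. (\<integral>\<^sup>+x\<in>A i. ennreal (g i x) \<partial>\<mu> i) = ennreal (a i)) \<and>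
        \<bar>vpairing Ipos Ineg f \<mu>\<bar> \<noteq> \<infinity>}"

definition min_weighted_energy ::
  "('a::topological_space \<times> 'a \<Rightarrow> ereal) \<Rightarrow> nat set \<Rightarrow> nat set \<Rightarrow> (nat \<Rightarrow> 'a \<Rightarrow> ereal) \<Rightarrow>
   (nat \<Rightarrow> 'a set) \<Rightarrow> (nat \<Rightarrow> real) \<Rightarrow> (nat \<Rightarrow> 'a \<Rightarrow> real) \<Rightarrow> ereal" where
  "min_weighted_energy \<kappa> Ipos Ineg f A a g =
     (INF \<mu>\<in>admissible \<kappa> Ipos Ineg f A a g. weighted_energy \<kappa> Ipos Ineg f \<mu>)"

definition equilibrium_measures ::
  "('a::topological_space \<times> 'a \<Rightarrow> ereal) \<Rightarrow> nat set \<Rightarrow> nat set \<Rightarrow> (nat \<Rightarrow> 'a \<Rightarrow> ereal) \<Rightarrow>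
   (nat \<Rightarrow> 'a set) \<Rightarrow> (nat \<Rightarrow> real) \<Rightarrow> (nat \<Rightarrow> 'a \<Rightarrow> real) \<Rightarrow> (nat \<Rightarrow> 'a measure) set" where
  "equilibrium_measures \<kappa> Ipos Ineg f A a g =
     {\<mu> \<in> admissible \<kappa> Ipos Ineg f A a g.
        weighted_energy \<kappa> Ipos Ineg f \<mu> = min_weighted_energy \<kappa> Ipos Ineg f A a g}"

end

theory Submission
  imports Defs
begin

text \<open>
  A vector measure \<open>\<mu>\<close> of finite energy is regarded as the difference of the two positive measures
  \<open>R\<^sup>+ \<mu> = \<Sum>i\<in>I\<^sup>+. \<mu>\<^sup>i\<close> and \<open>R\<^sup>- \<mu> = \<Sum>i\<in>I\<^sup>-. \<mu>\<^sup>i\<close>.  The constraints \<open>\<langle>g\<^sub>i, \<mu>\<^sup>i\<rangle> = a\<^sub>i\<close> bound the measures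
  on compact sets, hence the admissible vector measures lie in a vaguely compact set, and it
  suffices that the sublevel sets \<open>{\<mu>. G(\<mu>) \<le> r}\<close> of the functional are vaguely closed: the equilibrium
  measures are the intersection of those with \<open>r\<close> greater than the infimum.  A sublevel set is convex, so
  if \<open>\<mu>\<^sub>0\<close> is in its vague closure, then by the parallelogram law the measures of almost minimal energy in
  small vague neighbourhoods of \<open>\<mu>\<^sub>0\<close> form a strong Cauchy filter; by consistency this filter converges to
  \<open>\<mu>\<^sub>0\<close> strongly as well as vaguely, and the functional is lower semicontinuous along it.  The constraints
  pass to the limit because no mass of \<open>g\<^sub>i \<mu>\<^sup>i\<close> escapes to infinity: on a set of finite capacity, measures
  of bounded energy are uniformly small off large compact sets, and the bound \<open>g\<^sub>i powr r \<le> \<kappa>(\<cdot>, \<omega>)\<close>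
  makes \<open>g\<^sub>i\<close> uniformly integrable with respect to them.
\<close>

subsection \<open>Radon measures on locally compact Hausdorff spaces\<close>

text \<open>A bound on the functional controls only
  \<open>\<parallel>R\<^sup>+ \<mu> - R\<^sup>- \<mu>\<parallel>\<close>, whereas consistency
  concerns Cauchy filters of positive measures. The assumptions on the masses and on the kernel over
  \<open>A\<^sup>+ \<times> A\<^sup>-\<close> bound the cross term, so \<open>\<parallel>R\<^sup>+
  \<mu>\<parallel>\<^sup>2 + \<parallel>R\<^sup>- \<mu>\<parallel>\<^sup>2\<close> stays bounded on
  sublevel sets; this sum, and not the functional itself, is nearly minimised to obtain the Cauchy
  filter. Neither second countability nor sigma-compactness is available. The Borel sets of the
  square can exceed the product sigma-algebra, so Radon products and the exchange of integrals come
  from the Riesz theorem and from monotone convergence along directed families instead of sequences.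
  Positive definiteness is given only for Jordan decompositions with defined energy. Finiteness of
  mutual energies and the Cauchy-Schwarz inequality have to be extended to arbitrary pairs of
  positive measures of finite energy, by splitting off their common part.\<close>

lemma CcI:
  fixes \<phi> :: "'a::t2_space \<Rightarrow> real"
  assumes "continuous_on UNIV \<phi>" "compact K" "\<And>x. x \<notin> K \<Longrightarrow> \<phi> x = 0"
  shows "\<phi> \<in> Cc"
proof -
  have "closure {x. \<phi> x \<noteq> 0} \<subseteq> K"
    using assms by (intro closure_minimal compact_imp_closed) auto
  then have "closure {x. \<phi> x \<noteq> 0} = K \<inter> closure {x. \<phi> x \<noteq> 0}" by auto
  then have "compact (closure {x. \<phi> x \<noteq> 0})"
    using assms(2) compact_Int_closed[of K "closure {x. \<phi> x \<noteq> 0}"] by simp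
  then show ?thesis using assms(1) by (simp add: Cc_def)
qed

lemma CcE:
  assumes "\<phi> \<in> Cc"
  obtains K where "compact K" "\<And>x. x \<notin> K \<Longrightarrow> \<phi> x = 0"
proof (rule that)
  show "compact (closure {x. \<phi> x \<noteq> 0})" using assms by (simp add: Cc_def)
  show "\<phi> x = 0" if "x \<notin> closure {x. \<phi> x \<noteq> 0}" for x using that by (rule contrapos_np) (simp add: closure_subset[THEN subsetD])
qed

lemma Cc_cont: "\<phi> \<in> Cc \<Longrightarrow> continuous_on UNIV \<phi>"
  by (simp add: Cc_def)

lemma Cc_bounded:
  fixes \<phi> :: "'a::t2_space \<Rightarrow> real"
  assumes "\<phi> \<in> Cc"
  obtains B where "0 < B" "\<And>x. \<bar>\<phi> x\<bar> \<le> B"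
proof -
  obtain K where K: "compact K" "\<And>x. x \<notin> K \<Longrightarrow> \<phi> x = 0" using CcE[OF assms] by blast
  have "compact (\<phi> ` K)"
    using K(1) Cc_cont[OF assms] continuous_on_subset compact_continuous_image by blast
  then obtain B where B: "\<And>x. x \<in> K \<Longrightarrow> \<bar>\<phi> x\<bar> \<le> B"
    using compact_imp_bounded bounded_iff by (metis imageI real_norm_def)
  have "\<bar>\<phi> x\<bar> \<le> max B 1" for x using B K(2) by (cases "x \<in> K") (fastforce simp: le_max_iff_disj)+
  then show ?thesis using that[of "max B 1"] by simp
qed

text \<open>With \<open>h 0 0 = 0\<close> the result vanishes off the union of two compact sets. The
  closure properties of \<open>Cc\<close> below are instances, the unary ones with both arguments
  equal.\<close>

lemma Cc_comp2:
  fixes \<phi> \<psi> :: "'a::t2_space \<Rightarrow> real"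
  assumes "\<phi> \<in> Cc" "\<psi> \<in> Cc" "continuous_on UNIV (\<lambda>x. h (\<phi> x) (\<psi> x))" "h 0 0 = 0"
  shows "(\<lambda>x. h (\<phi> x) (\<psi> x)) \<in> Cc"
proof -
  obtain K where K: "compact K" "\<And>x. x \<notin> K \<Longrightarrow> \<phi> x = 0" using CcE[OF assms(1)] by blast
  obtain L where L: "compact L" "\<And>x. x \<notin> L \<Longrightarrow> \<psi> x = 0" using CcE[OF assms(2)] by blast
  show ?thesis by (rule CcI[of _ "K \<union> L"]) (use K L assms in auto)
qed

lemma Cc_add:
  assumes "\<phi> \<in> Cc" "\<psi> \<in> Cc"
  shows "(\<lambda>x::'a::t2_space. \<phi> x + \<psi> x) \<in> Cc"
  by (rule Cc_comp2[OF assms, of "\<lambda>a b. a + b"]) (use assms[THEN Cc_cont] in \<open>auto intro: continuous_on_add\<close>)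
lemma Cc_diff:
  assumes "\<phi> \<in> Cc" "\<psi> \<in> Cc"
  shows "(\<lambda>x::'a::t2_space. \<phi> x - \<psi> x) \<in> Cc"
  by (rule Cc_comp2[OF assms, of "\<lambda>a b. a - b"]) (use assms[THEN Cc_cont] in \<open>auto intro: continuous_on_diff\<close>)
lemma Cc_mult:
  assumes "\<phi> \<in> Cc" "\<psi> \<in> Cc"
  shows "(\<lambda>x::'a::t2_space. \<phi> x * \<psi> x) \<in> Cc"
  by (rule Cc_comp2[OF assms, of "\<lambda>a b. a * b"]) (use assms[THEN Cc_cont] in \<open>auto intro: continuous_on_mult\<close>)
lemma Cc_max:
  assumes "\<phi> \<in> Cc" "\<psi> \<in> Cc"
  shows "(\<lambda>x::'a::t2_space. max (\<phi> x) (\<psi> x)) \<in> Cc"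
  by (rule Cc_comp2[OF assms, of "\<lambda>a b. max a b"]) (use assms[THEN Cc_cont] in \<open>auto intro: continuous_on_max\<close>)
lemma Cc_cmult:
  assumes "\<phi> \<in> Cc"
  shows "(\<lambda>x::'a::t2_space. c * \<phi> x) \<in> Cc"
  by (rule Cc_comp2[OF assms assms, of "\<lambda>a b. c * a"]) (use Cc_cont[OF assms] in \<open>auto intro: continuous_on_mult_left\<close>)
lemma Cc_abs:
  assumes "\<phi> \<in> Cc"
  shows "(\<lambda>x::'a::t2_space. \<bar>\<phi> x\<bar>) \<in> Cc"
  by (rule Cc_comp2[OF assms assms, of "\<lambda>a b. \<bar>a\<bar>"]) (use Cc_cont[OF assms] in \<open>auto intro: continuous_on_rabs\<close>)
lemma Cc_zero: "(\<lambda>x::'a::t2_space. 0) \<in> Cc"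
  by (rule CcI[of _ "{}"]) auto

lemma Cc_measurable: "\<phi> \<in> Cc \<Longrightarrow> \<phi> \<in> borel_measurable borel"
  by (intro borel_measurable_continuous_onI Cc_cont)

lemma radon_sets: "\<mu> \<in> radon \<Longrightarrow> sets \<mu> = sets borel"
  unfolding radon_def mem_Collect_eq by (elim conjE)
lemma radon_space: "\<mu> \<in> radon \<Longrightarrow> space \<mu> = UNIV"
  using sets_eq_imp_space_eq[OF radon_sets] by (metis space_borel)
lemma radon_measurable: "\<mu> \<in> radon \<Longrightarrow> (f \<in> borel_measurable \<mu>) = (f \<in> borel_measurable borel)"
  by (rule measurable_cong_sets[OF radon_sets, THEN eqset_imp_iff]) auto
lemma radon_compact: "\<mu> \<in> radon \<Longrightarrow> compact K \<Longrightarrow> emeasure \<mu> K < \<infinity>"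
  unfolding radon_def mem_Collect_eq by (elim conjE allE[of _ K] impE)
lemma radon_inner: "\<mu> \<in> radon \<Longrightarrow> B \<in> sets borel \<Longrightarrow>
    emeasure \<mu> B = (SUP K\<in>{K. compact K \<and> K \<subseteq> B}. emeasure \<mu> K)"
  unfolding radon_def mem_Collect_eq by (elim conjE) (erule bspec)

lemma Cc_integrable:
  fixes \<phi> :: "'a::t2_space \<Rightarrow> real"
  assumes "\<mu> \<in> radon" "\<phi> \<in> Cc"
  shows "integrable \<mu> \<phi>"
proof -
  obtain K where K: "compact K" "\<And>x. x \<notin> K \<Longrightarrow> \<phi> x = 0" using CcE[OF assms(2)] by blast
  obtain B where B: "0 < B" "\<And>x. \<bar>\<phi> x\<bar> \<le> B" using Cc_bounded[OF assms(2)] by blast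
  have Ks: "K \<in> sets \<mu>" using K(1) radon_sets[OF assms(1)] by (auto intro: borel_compact)
  have "integrable \<mu> (\<lambda>x. B * indicator K x :: real)"
    using radon_compact[OF assms(1) K(1)] Ks by (intro integrable_mult_right integrable_real_indicator) auto
  then show ?thesis
    by (rule Bochner_Integration.integrable_bound)
      (use B K(2) Cc_measurable[OF assms(2)] radon_measurable[OF assms(1)] in \<open>auto simp: indicator_def\<close>)
qed

section \<open>Monotone convergence along directed families\<close>

text \<open>Finitely many of the neighbourhoods cover \<open>K\<close>, and directedness gives one
  index whose property is implied by each of theirs. Read with \<open>P i z\<close> as membership of
  \<open>z\<close> in the i-th set, it absorbs compact sets into directed open covers.\<close>

lemma compact_directed:
  assumes K: "compact K" and ne: "D \<noteq> {}"
    and dir: "\<And>i j. i \<in> D \<Longrightarrow> j \<in> D \<Longrightarrow> \<exists>k\<in>D. \<forall>z. P i z \<or> P j z \<longrightarrow> P k z"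
    and loc: "\<And>x. x \<in> K \<Longrightarrow> \<exists>i\<in>D. \<exists>N. open N \<and> x \<in> N \<and> (\<forall>z\<in>N. P i z)"
  shows "\<exists>i\<in>D. \<forall>z\<in>K. P i z"
proof -
  define \<C> where "\<C> = {N. open N \<and> (\<exists>i\<in>D. \<forall>z\<in>N. P i z)}"
  have "\<And>N. N \<in> \<C> \<Longrightarrow> open N" "K \<subseteq> \<Union>\<C>" using loc unfolding \<C>_def by blast+
  then obtain T where T: "T \<subseteq> \<C>" "finite T" "K \<subseteq> \<Union>T" using compactE[OF K] by metis
  have "\<exists>i\<in>D. \<forall>z\<in>\<Union>T. P i z" using T(2,1)
  proof (induction T rule: finite_induct)
    case empty then show ?case using ne by auto
  next
    case (insert N T)
    then obtain i where i: "i \<in> D" "\<forall>z\<in>\<Union>T. P i z" by auto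
    obtain j where j: "j \<in> D" "\<forall>z\<in>N. P j z" using insert.prems unfolding \<C>_def by auto
    obtain k where "k \<in> D" "\<forall>z. P i z \<or> P j z \<longrightarrow> P k z" using dir[OF i(1) j(1)] by blast
    with i j show ?case by (intro bexI[of _ k]) auto
  qed
  then show ?thesis using T(3) by blast
qed

text \<open>Finitely many suprema are approached simultaneously, so it suffices to bound the sum for
  every choice function \<open>k\<close>. The summand \<open>c\<close> collects the terms already
  chosen during the induction.\<close>

lemma sum_SUP_le_ennreal:
  fixes h :: "'b \<Rightarrow> 'c \<Rightarrow> ennreal"
  assumes "finite Y" "\<And>y. y \<in> Y \<Longrightarrow> A y \<noteq> {}"
    and "\<And>k. (\<forall>y\<in>Y. k y \<in> A y) \<Longrightarrow> c + (\<Sum>y\<in>Y. h y (k y)) \<le> S"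
  shows "c + (\<Sum>y\<in>Y. SUP a\<in>A y. h y a) \<le> S"
  using assms
proof (induction Y arbitrary: c rule: finite_induct)
  case empty then show ?case by simp
next
  case (insert y Y)
  have *: "(c + h y a) + (\<Sum>y\<in>Y. SUP a\<in>A y. h y a) \<le> S" if a: "a \<in> A y" for a
  proof (rule insert.IH)
    fix k assume k: "\<forall>y\<in>Y. k y \<in> A y"
    have "c + (\<Sum>z\<in>insert y Y. h z ((k(y:=a)) z)) \<le> S"
      by (rule insert.prems) (use k a insert.hyps in auto)
    moreover have "(\<Sum>z\<in>Y. h z ((k(y:=a)) z)) = (\<Sum>z\<in>Y. h z (k z))"
      by (rule sum.cong) (use insert.hyps in auto)
    ultimately show "c + h y a + (\<Sum>y\<in>Y. h y (k y)) \<le> S"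
      using insert.hyps by (simp add: add.assoc)
  qed (use insert in auto)
  have "c + (\<Sum>y\<in>insert y Y. SUP a\<in>A y. h y a) = (SUP a\<in>A y. h y a) + (c + (\<Sum>y\<in>Y. SUP a\<in>A y. h y a))"
    using insert.hyps by (simp add: ac_simps)
  also have "\<dots> = (SUP a\<in>A y. h y a + (c + (\<Sum>y\<in>Y. SUP a\<in>A y. h y a)))"
    using insert.prems(1)[of y] by (intro ennreal_SUP_add_left[symmetric]) auto
  also have "\<dots> \<le> S" using * by (intro SUP_least) (simp add: ac_simps)
  finally show ?case .
qed

text \<open>Monotone convergence along directed families; it rests on inner regularity and compactness,
  and no measurability of the \<open>v i\<close> is involved.\<close>
lemma radon_nn_integral_directed:
  fixes \<mu> :: "'a::t2_space measure" and u :: "'a \<Rightarrow> ennreal" and v :: "'i \<Rightarrow> 'a \<Rightarrow> ennreal"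
  assumes \<mu>: "\<mu> \<in> radon" and ne: "D \<noteq> {}"
    and dir: "\<And>i j. i \<in> D \<Longrightarrow> j \<in> D \<Longrightarrow> \<exists>k\<in>D. \<forall>x. v i x \<le> v k x \<and> v j x \<le> v k x"
    and app: "\<And>x t. t < u x \<Longrightarrow> \<exists>i\<in>D. \<exists>N. open N \<and> x \<in> N \<and> (\<forall>z\<in>N. t \<le> v i z)"
  shows "(\<integral>\<^sup>+x. u x \<partial>\<mu>) \<le> (SUP i\<in>D. \<integral>\<^sup>+x. v i x \<partial>\<mu>)"
  unfolding nn_integral_def_finite[of \<mu> u]
proof (rule SUP_least)
  fix g assume "g \<in> {g. simple_function \<mu> g \<and> g \<le> u \<and> (\<forall>x. g x < top)}"
  then have g: "simple_function \<mu> g" "\<And>x. g x \<le> u x" by (auto simp: le_fun_def)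
  have sp: "space \<mu> = UNIV" using radon_space[OF \<mu>] .
  define Y where "Y = range g"
  have fY: "finite Y" using g(1) sp by (auto simp: simple_function_def Y_def)
  have gs: "g -` {y} \<in> sets borel" for y
  proof (cases "y \<in> Y")
    case True then show ?thesis using g(1) sp radon_sets[OF \<mu>] by (auto simp: simple_function_def Y_def)
  next
    case False then have "g -` {y} = {}" by (auto simp: Y_def) then show ?thesis by simp
  qed
  \<comment> \<open>A height below \<open>y\<close> and a compact part of the level set approximate
    the contribution of the value \<open>y\<close>. The height 0 keeps the index set nonempty when
    \<open>y = 0\<close>.\<close>
  define A where "A y = ({..<y} \<union> {0}) \<times> {K. compact K \<and> K \<subseteq> g -` {y}}" for y
  have le: "y * emeasure \<mu> (g -` {y}) \<le> (SUP (t,K)\<in>A y. t * emeasure \<mu> K)" for y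
  proof -
    have y: "y = (SUP t\<in>{..<y} \<union> {0}. t)"
    proof (rule antisym)
      show "y \<le> (SUP t\<in>{..<y} \<union> {0}. t)"
        by (rule dense_le) (meson SUP_upper UnI1 lessThan_iff)
    qed (auto intro!: SUP_least)
    have "y * emeasure \<mu> (g -` {y}) =
        (SUP t\<in>{..<y} \<union> {0}. SUP K\<in>{K. compact K \<and> K \<subseteq> g -` {y}}. t * emeasure \<mu> K)"
      apply (subst y, subst radon_inner[OF \<mu> gs])
      apply (subst SUP_mult_right_ennreal, subst SUP_mult_left_ennreal, rule refl)
      done
    also have "\<dots> \<le> (SUP (t,K)\<in>A y. t * emeasure \<mu> K)"
      unfolding A_def by (intro SUP_least) (auto intro!: SUP_upper2)
    finally show ?thesis .
  qed
  have "integral\<^sup>S \<mu> g = (\<Sum>y\<in>Y. y * emeasure \<mu> (g -` {y}))"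
    by (simp add: simple_integral_def sp Y_def)
  also have "\<dots> \<le> (\<Sum>y\<in>Y. SUP p\<in>A y. fst p * emeasure \<mu> (snd p))"
    using le by (intro sum_mono) (auto simp: case_prod_beta)
  also have "\<dots> = 0 + \<dots>" by simp
  also have "\<dots> \<le> (SUP i\<in>D. \<integral>\<^sup>+x. v i x \<partial>\<mu>)"
  proof (rule sum_SUP_le_ennreal[OF fY])
    show "A y \<noteq> {}" for y unfolding A_def by auto
    fix k assume k: "\<forall>y\<in>Y. k y \<in> A y"
    define t where "t = fst \<circ> k"
    define K where "K = snd \<circ> k"
    have tK: "t y < y \<or> t y = 0" "compact (K y)" "K y \<subseteq> g -` {y}" if "y \<in> Y" for y
      using k that by (fastforce simp: A_def t_def K_def mem_Times_iff)+
    \<comment> \<open>On \<open>K y\<close> the function \<open>g\<close> has the value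
      \<open>y\<close>, so \<open>t y < u x\<close> there unless the height is 0; \<open>app\<close>
      then applies near each point and compactness makes the index uniform.\<close>
    have 1: "\<exists>i\<in>D. \<forall>z\<in>K y. t y \<le> v i z" if y: "y \<in> Y" for y
    proof (rule compact_directed[OF tK(2)[OF y] ne])
      show "\<exists>k\<in>D. \<forall>z. t y \<le> v i z \<or> t y \<le> v j z \<longrightarrow> t y \<le> v k z" if "i \<in> D" "j \<in> D" for i j
        using dir[OF that] by (meson order_trans)
      show "\<exists>i\<in>D. \<exists>N. open N \<and> x \<in> N \<and> (\<forall>z\<in>N. t y \<le> v i z)" if x: "x \<in> K y" for x
      proof (cases "t y = 0")
        case True then show ?thesis using ne by (auto intro!: exI[of _ UNIV])
      next
        case False
        then have "t y < u x" using tK(1,3)[OF y] x g(2)[of x] by auto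
        then show ?thesis by (rule app)
      qed
    qed
    have "\<exists>i\<in>D. \<forall>y\<in>Z. \<forall>z\<in>K y. t y \<le> v i z" if "finite Z" "Z \<subseteq> Y" for Z using that
    proof (induction Z rule: finite_induct)
      case empty then show ?case using ne by auto
    next
      case (insert y Z)
      then obtain i j where "i \<in> D" "\<forall>y\<in>Z. \<forall>z\<in>K y. t y \<le> v i z" "j \<in> D" "\<forall>z\<in>K y. t y \<le> v j z"
        using 1[of y] by auto
      moreover obtain k where "k \<in> D" "\<forall>x. v i x \<le> v k x \<and> v j x \<le> v k x" using dir calculation by blast
      ultimately show ?case by (intro bexI[of _ k]) (metis insert_iff order_trans, blast)
    qed
    from this[OF fY] obtain i where i: "i \<in> D" "\<And>y z. y \<in> Y \<Longrightarrow> z \<in> K y \<Longrightarrow> t y \<le> v i z" by auto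
    have Ks: "K y \<in> sets \<mu>" if "y \<in> Y" for y
      using tK(2)[OF that] radon_sets[OF \<mu>] by (auto intro: borel_compact)
    have "(\<Sum>y\<in>Y. t y * emeasure \<mu> (K y)) = (\<integral>\<^sup>+x. (\<Sum>y\<in>Y. t y * indicator (K y) x) \<partial>\<mu>)"
      using Ks by (subst nn_integral_sum) (auto simp: nn_integral_cmult_indicator)
    also have "\<dots> \<le> (\<integral>\<^sup>+x. v i x \<partial>\<mu>)"
    proof (rule nn_integral_mono)
      fix x
      \<comment> \<open>The level sets are disjoint: only the summand of the value
        \<open>g x\<close> can be nonzero at \<open>x\<close>.\<close>
      have "(\<Sum>y\<in>Y. t y * indicator (K y) x) = (\<Sum>y\<in>{g x}. t y * indicator (K y) x)"
        by (rule sum.mono_neutral_right) (use fY tK(3) in \<open>fastforce simp: Y_def indicator_def split: if_splits\<close>)+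
      also have "\<dots> \<le> v i x" using i(2)[of "g x" x] by (cases "x \<in> K (g x)") (auto simp: Y_def)
      finally show "(\<Sum>y\<in>Y. t y * indicator (K y) x) \<le> v i x" .
    qed
    also have "\<dots> \<le> (SUP i\<in>D. \<integral>\<^sup>+x. v i x \<partial>\<mu>)" using i(1) by (rule SUP_upper)
    finally show "0 + (\<Sum>y\<in>Y. fst (k y) * emeasure \<mu> (snd (k y))) \<le> (SUP i\<in>D. \<integral>\<^sup>+x. v i x \<partial>\<mu>)"
      by (simp add: t_def K_def)
  qed
  finally show "integral\<^sup>S \<mu> g \<le> (SUP i\<in>D. \<integral>\<^sup>+x. v i x \<partial>\<mu>)" .
qed

section \<open>Separation in locally compact Hausdorff spaces\<close>

lemma Hausdorff_space_t2: "Hausdorff_space (euclidean :: 'a::t2_space topology)"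
  unfolding Hausdorff_space_def using hausdorff by (fastforce simp: disjnt_def)

locale lch_space =
  fixes T :: "'a::t2_space itself"
  assumes lc: "locally_compact_space (euclidean :: 'a topology)"
begin

text \<open>Regularity puts a closed neighbourhood of each point inside \<open>U\<close>, local
  compactness a relatively compact one. Their intersection settles points, and sets of this kind are
  closed under finite unions.\<close>

lemma compact_nbhd:
  fixes K U :: "'a set"
  assumes "compact K" "open U" "K \<subseteq> U"
  obtains V where "open V" "K \<subseteq> V" "compact (closure V)" "closure V \<subseteq> U"
proof -
  have nb: "neighbourhood_base_of (\<lambda>T. compactin euclidean (euclidean closure_of T)) (euclidean :: 'a topology)"
    using lc locally_compact_space_neighbourhood_base_closure_of[of "euclidean :: 'a topology"] by (simp add: Hausdorff_space_t2)
  have 1: "\<exists>W. open W \<and> x \<in> W \<and> compact (closure W) \<and> closure W \<subseteq> U" if x: "x \<in> K" for x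
  proof -
    have rs: "regular_space (euclidean :: 'a topology)"
      using lc Hausdorff_space_t2 by (rule locally_compact_Hausdorff_imp_regular_space)
    obtain W1 where W1: "open W1" "x \<in> W1" "closure W1 \<subseteq> U"
    proof -
      have "neighbourhood_base_of (closedin euclidean) (euclidean :: 'a topology)"
        using rs neighbourhood_base_of_closedin[of "euclidean :: 'a topology"] by simp
      then obtain W C where "open W" "closed C" "x \<in> W" "W \<subseteq> C" "C \<subseteq> U"
        using assms x unfolding neighbourhood_base_of
        by (metis (no_types, lifting) closed_closedin open_openin subsetD)
      then show thesis using that[of W] closure_minimal[of W C] by blast
    qed
    obtain W2 V where W2: "open W2" "x \<in> W2" "W2 \<subseteq> V" "compact (closure V)"
      using nb W1 x unfolding neighbourhood_base_of
      by (metis (no_types, lifting) compactin_euclidean_iff euclidean_closure_of open_openin)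
    have "compact (closure (W1 \<inter> W2))"
    proof -
      have "closure (W1 \<inter> W2) \<subseteq> closure V" using W2 by (intro closure_mono) auto
      then have "closure (W1 \<inter> W2) = closure V \<inter> closure (W1 \<inter> W2)" by auto
      then show ?thesis using compact_Int_closed[OF W2(4), of "closure (W1 \<inter> W2)"] by simp
    qed
    moreover have "closure (W1 \<inter> W2) \<subseteq> U" using W1(3) closure_mono[of "W1 \<inter> W2" W1] by blast
    ultimately show ?thesis using W1 W2 by (intro exI[of _ "W1 \<inter> W2"]) auto
  qed
  have "\<exists>W\<in>{W. open W \<and> compact (closure W) \<and> closure W \<subseteq> U}. \<forall>z\<in>K. z \<in> W"
  proof (rule compact_directed[OF assms(1)])
    show "{W. open W \<and> compact (closure W) \<and> closure W \<subseteq> U} \<noteq> {}" by (auto intro!: exI[of _ "{}"])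
    show "\<exists>k\<in>{W. open W \<and> compact (closure W) \<and> closure W \<subseteq> U}. \<forall>z. z \<in> i \<or> z \<in> j \<longrightarrow> z \<in> k"
      if "i \<in> {W. open W \<and> compact (closure W) \<and> closure W \<subseteq> U}"
        "j \<in> {W. open W \<and> compact (closure W) \<and> closure W \<subseteq> U}" for i j
      using that by (intro bexI[of _ "i \<union> j"]) (auto simp: closure_Un compact_Un)
  qed (use 1 in blast)
  then show thesis using that by blast
qed

text \<open>The function is made to vanish outside a relatively compact \<open>V\<close> with
  closure in \<open>U\<close>, which gives compact support; the \<open>C\<close> returned is that
  closure.\<close>

lemma urysohn:
  fixes K U :: "'a set"
  assumes "compact K" "open U" "K \<subseteq> U"
  obtains \<phi> :: "'a \<Rightarrow> real" and C where "\<phi> \<in> Cc" "\<And>x. 0 \<le> \<phi> x" "\<And>x. \<phi> x \<le> 1" "\<And>x. x \<in> K \<Longrightarrow> \<phi> x = 1"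
    "compact C" "C \<subseteq> U" "\<And>x. x \<notin> C \<Longrightarrow> \<phi> x = 0"
proof -
  obtain V where V: "open V" "K \<subseteq> V" "compact (closure V)" "closure V \<subseteq> U"
    using compact_nbhd[OF assms] by blast
  have cr: "completely_regular_space (euclidean :: 'a topology)"
    using lc Hausdorff_space_t2 by (intro locally_compact_regular_imp_completely_regular_space) auto
  obtain f where f: "continuous_map (euclidean :: 'a topology) (top_of_set {0..1::real}) f"
    "f ` K \<subseteq> {1}" "f ` (- V) \<subseteq> {0}"
  proof -
    obtain h where h: "continuous_map (euclidean :: 'a topology) (top_of_set {0..1::real}) h"
      "h ` K \<subseteq> {0}" "h ` (- V) \<subseteq> {1}"
      by (rule Urysohn_completely_regular_closed_compact[OF _ cr, of 0 1 "-V" K])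
         (use V assms in \<open>auto simp: disjnt_def\<close>)
    show thesis
      by (rule that[of "\<lambda>x. 1 - h x"])
         (use h in \<open>auto simp: continuous_map_in_subtopology Pi_iff image_subset_iff intro!: continuous_intros\<close>)
  qed
  have fc: "continuous_on UNIV f" "\<And>x. 0 \<le> f x \<and> f x \<le> 1"
    using f(1) by (auto simp: continuous_map_in_subtopology Pi_iff)
  have f0: "f x = 0" if "x \<notin> closure V" for x using f(3) that closure_subset[of V] by blast
  show thesis
    by (rule that[of f "closure V"]) (use fc f f0 V in \<open>auto intro: CcI\<close>)
qed

text \<open>The test function is a bump of height \<open>r\<close> at \<open>x\<close>, with
  \<open>ennreal r\<close> strictly between \<open>t\<close> and \<open>u x\<close>, supported in
  the open set where \<open>u\<close> exceeds \<open>ennreal r\<close>.\<close>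

lemma lsc_Cc_approx:
  fixes u :: "'a \<Rightarrow> ennreal"
  assumes u: "\<And>c. open {x. c < u x}" and t: "t < u x"
  shows "\<exists>\<phi>\<in>{\<phi>\<in>Cc. \<forall>x. 0 \<le> \<phi> x \<and> ennreal (\<phi> x) \<le> u x}. \<exists>N. open N \<and> x \<in> N \<and> (\<forall>z\<in>N. t \<le> ennreal (\<phi> z))"
proof -
  obtain s where s: "t < s" "s < u x" using dense[OF t] by blast
  define r where "r = enn2real s"
  have sfin: "s < top" using s(2) top_greatest by (rule order_less_le_trans)
  then have r: "s = ennreal r" unfolding r_def by simp
  have "0 < s" using s(1) zero_le by (rule order_le_less_trans[rotated])
  then have r0: "0 < r" using r by simp
  have tfin: "t < top" using s(1) sfin by (rule less_trans)
  have tr: "enn2real t < r" using s(1) tfin r r0 by (cases t) (auto simp: ennreal_less_iff)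
  obtain \<phi> C where \<phi>: "\<phi> \<in> Cc" "\<And>x. 0 \<le> \<phi> x" "\<And>x. \<phi> x \<le> 1" "\<And>y. y \<in> {x} \<Longrightarrow> \<phi> y = (1::real)"
    "C \<subseteq> {x. s < u x}" "\<And>x. x \<notin> C \<Longrightarrow> \<phi> x = 0"
    by (rule urysohn[of "{x}" "{x. s < u x}"]) (use u s in auto)
  have le: "ennreal (r * \<phi> y) \<le> u y" for y
  proof (cases "y \<in> C")
    case True
    have "ennreal (r * \<phi> y) \<le> s" unfolding r using r0 \<phi>(2,3)[of y] by (intro ennreal_leI) (simp add: mult_left_le)
    moreover have "s < u y" using True \<phi>(5) by auto
    ultimately show ?thesis by (rule order_trans[OF _ less_imp_le])
  qed (simp add: \<phi>(6))
  have op: "open {z. enn2real t < r * \<phi> z}"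
    by (intro open_Collect_less continuous_intros Cc_cont \<phi>)
  have bd: "t \<le> ennreal (r * \<phi> z)" if "enn2real t < r * \<phi> z" for z
    using that tfin by (cases t) (auto intro: ennreal_leI)
  have mem: "(\<lambda>z. r * \<phi> z) \<in> {\<phi>\<in>Cc. \<forall>x. 0 \<le> \<phi> x \<and> ennreal (\<phi> x) \<le> u x}"
    using \<phi>(1,2) r0 le by (simp add: Cc_cmult)
  have pt: "x \<in> {z. enn2real t < r * \<phi> z}" using tr \<phi>(4)[of x] by simp
  show ?thesis
    by (rule bexI[OF _ mem], rule exI[of _ "{z. enn2real t < r * \<phi> z}"], intro conjI ballI op pt) (simp add: bd)
qed

text \<open>It carries identities from \<open>Cc\<close> to lower semicontinuous integrands and
  makes the integrals of the latter vaguely lower semicontinuous.\<close>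

lemma nn_integral_lsc_Cc:
  fixes u :: "'a \<Rightarrow> ennreal"
  assumes \<mu>: "\<mu> \<in> radon" and u: "\<And>c. open {x. c < u x}"
  shows "(\<integral>\<^sup>+x. u x \<partial>\<mu>) = (SUP \<phi>\<in>{\<phi>\<in>Cc. \<forall>x. 0 \<le> \<phi> x \<and> ennreal (\<phi> x) \<le> u x}. \<integral>\<^sup>+x. ennreal (\<phi> x) \<partial>\<mu>)"
proof (rule antisym)
  let ?D = "{\<phi>\<in>Cc. \<forall>x. 0 \<le> \<phi> x \<and> ennreal (\<phi> x) \<le> u x}"
  show "(\<integral>\<^sup>+x. u x \<partial>\<mu>) \<le> (SUP \<phi>\<in>?D. \<integral>\<^sup>+x. ennreal (\<phi> x) \<partial>\<mu>)"
  proof (rule radon_nn_integral_directed[OF \<mu>])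
    have "(\<lambda>x. 0) \<in> ?D" using Cc_zero by auto
    then show "?D \<noteq> {}" by blast
    show "\<exists>k\<in>?D. \<forall>x. ennreal (i x) \<le> ennreal (k x) \<and> ennreal (j x) \<le> ennreal (k x)" if "i \<in> ?D" "j \<in> ?D" for i j
      using that Cc_max[of i j] by (intro bexI[of _ "\<lambda>x. max (i x) (j x)"]) (auto simp: max_def ennreal_leI)
  qed (rule lsc_Cc_approx[OF u])
qed (auto intro!: SUP_least nn_integral_mono)

end

lemma lch_prod:
  assumes "lch_space TYPE('a::t2_space)"
  shows "lch_space TYPE('a \<times> 'a)"
proof
  show "locally_compact_space (euclidean :: ('a \<times> 'a) topology)"
    using assms unfolding lch_space_def prod_topology_euclidean[symmetric] locally_compact_space_prod_topology by simp
qed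

subsection \<open>The Riesz representation theorem\<close>

definition positive_linear :: "(('a::topological_space \<Rightarrow> real) \<Rightarrow> real) \<Rightarrow> bool" where
  "positive_linear L \<longleftrightarrow>
     (\<forall>\<phi>\<in>Cc. \<forall>\<psi>\<in>Cc. L (\<lambda>x. \<phi> x + \<psi> x) = L \<phi> + L \<psi>) \<and>
     (\<forall>c. \<forall>\<phi>\<in>Cc. L (\<lambda>x. c * \<phi> x) = c * L \<phi>) \<and>
     (\<forall>\<phi>\<in>Cc. (\<forall>x. 0 \<le> \<phi> x) \<longrightarrow> 0 \<le> L \<phi>)"

definition riesz_content :: "(('a::topological_space \<Rightarrow> real) \<Rightarrow> real) \<Rightarrow> 'a set \<Rightarrow> ennreal" where
  "riesz_content L K = (INF \<phi>\<in>{\<phi>\<in>Cc. (\<forall>x. 0 \<le> \<phi> x) \<and> (\<forall>x\<in>K. 1 \<le> \<phi> x)}. ennreal (L \<phi>))"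

lemma positive_linear_add: "positive_linear L \<Longrightarrow> \<phi> \<in> Cc \<Longrightarrow> \<psi> \<in> Cc \<Longrightarrow> L (\<lambda>x. \<phi> x + \<psi> x) = L \<phi> + L \<psi>"
  by (simp add: positive_linear_def)
lemma positive_linear_cmult: "positive_linear L \<Longrightarrow> \<phi> \<in> Cc \<Longrightarrow> L (\<lambda>x. c * \<phi> x) = c * L \<phi>"
  by (simp add: positive_linear_def)
lemma positive_linear_nonneg: "positive_linear L \<Longrightarrow> \<phi> \<in> Cc \<Longrightarrow> (\<And>x. 0 \<le> \<phi> x) \<Longrightarrow> 0 \<le> L \<phi>"
  by (simp add: positive_linear_def)

lemma positive_linear_diff:
  fixes \<phi> \<psi> :: "'a::t2_space \<Rightarrow> real"
  assumes "positive_linear L" "\<phi> \<in> Cc" "\<psi> \<in> Cc"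
  shows "L (\<lambda>x. \<phi> x - \<psi> x) = L \<phi> - L \<psi>"
  using positive_linear_add[OF assms(1) assms(2) Cc_cmult[OF assms(3), of "-1"]]
    positive_linear_cmult[OF assms(1,3), of "-1"] by simp

lemma positive_linear_mono:
  fixes \<phi> \<psi> :: "'a::t2_space \<Rightarrow> real"
  assumes "positive_linear L" "\<phi> \<in> Cc" "\<psi> \<in> Cc" "\<And>x. \<phi> x \<le> \<psi> x"
  shows "L \<phi> \<le> L \<psi>"
  using positive_linear_nonneg[OF assms(1) Cc_diff[OF assms(3,2)]] positive_linear_diff[OF assms(1,3,2)] assms(4)
  by simp

lemma positive_linear_zero: "positive_linear L \<Longrightarrow> L (\<lambda>x::'a::t2_space. 0) = 0"
  using positive_linear_cmult[of L "\<lambda>x. 0" 0] Cc_zero by simp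

lemma positive_linear_sum:
  fixes \<phi> :: "'i \<Rightarrow> 'a::t2_space \<Rightarrow> real"
  assumes L: "positive_linear L" and "finite I" "\<And>i. i \<in> I \<Longrightarrow> \<phi> i \<in> Cc"
  shows "(\<lambda>x. \<Sum>i\<in>I. \<phi> i x) \<in> Cc \<and> L (\<lambda>x. \<Sum>i\<in>I. \<phi> i x) = (\<Sum>i\<in>I. L (\<phi> i))"
  using assms(2,3)
proof (induction I rule: finite_induct)
  case empty then show ?case using Cc_zero positive_linear_zero[OF L] by simp
next
  case (insert i I)
  then have *: "(\<lambda>x. \<Sum>i\<in>I. \<phi> i x) \<in> Cc" "L (\<lambda>x. \<Sum>i\<in>I. \<phi> i x) = (\<Sum>i\<in>I. L (\<phi> i))" by auto
  show ?case
    using Cc_add[OF insert.prems[of i] *(1)] positive_linear_add[OF L insert.prems[of i] *(1)] *(2) insert.hyps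
    by simp
qed

lemma riesz_content_le:
  "\<phi> \<in> Cc \<Longrightarrow> (\<And>x. 0 \<le> \<phi> x) \<Longrightarrow> (\<And>x. x \<in> K \<Longrightarrow> 1 \<le> \<phi> x) \<Longrightarrow> riesz_content L K \<le> ennreal (L \<phi>)"
  unfolding riesz_content_def by (rule INF_lower) auto

lemma riesz_content_subadd:
  fixes L :: "('a::t2_space \<Rightarrow> real) \<Rightarrow> real"
  assumes L: "positive_linear L"
  shows "riesz_content L (K \<union> K') \<le> riesz_content L K + riesz_content L K'"
proof -
  let ?S = "\<lambda>K. {\<phi>\<in>Cc. (\<forall>x. 0 \<le> \<phi> x) \<and> (\<forall>x\<in>K. 1 \<le> \<phi> x)}"
  have le: "riesz_content L (K \<union> K') \<le> ennreal (L \<phi>) + ennreal (L \<psi>)" if "\<phi> \<in> ?S K" "\<psi> \<in> ?S K'" for \<phi> \<psi>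
  proof -
    have "riesz_content L (K \<union> K') \<le> ennreal (L (\<lambda>x. \<phi> x + \<psi> x))"
      by (rule riesz_content_le) (use that in \<open>auto intro: Cc_add add_increasing add_increasing2\<close>)
    also have "\<dots> = ennreal (L \<phi>) + ennreal (L \<psi>)"
      using that positive_linear_add[OF L, of \<phi> \<psi>] positive_linear_nonneg[OF L]
      by (simp add: ennreal_plus)
    finally show ?thesis .
  qed
  show ?thesis
  proof (rule ennreal_le_epsilon)
    fix e :: real assume e: "0 < e" and fin: "riesz_content L K + riesz_content L K' < top"
    have ex: "\<exists>\<phi>\<in>?S M. ennreal (L \<phi>) < riesz_content L M + ennreal (e / 2)" if "riesz_content L M < top" for M
    proof -
      have "riesz_content L M < riesz_content L M + ennreal (e / 2)"
        using that e by (cases "riesz_content L M") (auto simp flip: ennreal_plus simp: ennreal_less_iff)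
      then show ?thesis unfolding riesz_content_def[of L M] INF_less_iff .
    qed
    have "riesz_content L K < top" "riesz_content L K' < top" using fin by auto
    from ex[OF this(1)] ex[OF this(2)] obtain \<phi> \<psi> where *:
      "\<phi> \<in> ?S K" "ennreal (L \<phi>) < riesz_content L K + ennreal (e / 2)"
      "\<psi> \<in> ?S K'" "ennreal (L \<psi>) < riesz_content L K' + ennreal (e / 2)" by (elim bexE)
    have "riesz_content L (K \<union> K') \<le> ennreal (L \<phi>) + ennreal (L \<psi>)" by (rule le[OF *(1,3)])
    also have "\<dots> \<le> (riesz_content L K + ennreal (e / 2)) + (riesz_content L K' + ennreal (e / 2))"
      using * by (intro add_mono) auto
    also have "\<dots> = riesz_content L K + riesz_content L K' + (ennreal (e / 2) + ennreal (e / 2))"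
      by (simp only: ac_simps)
    also have "ennreal (e / 2) + ennreal (e / 2) = ennreal e" using e by (simp flip: ennreal_plus)
    finally show "riesz_content L (K \<union> K') \<le> riesz_content L K + riesz_content L K' + ennreal e" .
  qed
qed

context lch_space begin

lemma riesz_content_finite:
  fixes L :: "('a \<Rightarrow> real) \<Rightarrow> real"
  assumes "compact K"
  shows "riesz_content L K < \<infinity>"
proof -
  obtain \<phi> :: "'a \<Rightarrow> real" and C where "\<phi> \<in> Cc" "\<And>x. 0 \<le> \<phi> x" "\<And>x. x \<in> K \<Longrightarrow> \<phi> x = 1"
    using urysohn[OF assms open_UNIV] by (metis subset_UNIV)
  then have "riesz_content L K \<le> ennreal (L \<phi>)" by (intro riesz_content_le) auto
  then show ?thesis by (metis ennreal_less_top infinity_ennreal_def order_le_less_trans)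
qed

text \<open>A Urysohn function \<open>\<psi>\<close> that is 1 on \<open>K\<close> and 0 on
  \<open>K'\<close> splits a dominating \<open>h\<close> into \<open>h \<psi>\<close> and
  \<open>h - h \<psi>\<close>; these dominate the two indicators separately, and their values under
  \<open>L\<close> add up to that of \<open>h\<close>.\<close>

lemma riesz_content_add:
  fixes L :: "('a \<Rightarrow> real) \<Rightarrow> real"
  assumes L: "positive_linear L" and K: "compact K" "compact K'" "K \<inter> K' = {}"
  shows "riesz_content L K + riesz_content L K' \<le> riesz_content L (K \<union> K')"
  unfolding riesz_content_def[of L "K \<union> K'"]
proof (rule INF_greatest)
  fix h :: "'a \<Rightarrow> real" assume "h \<in> {\<phi>\<in>Cc. (\<forall>x. 0 \<le> \<phi> x) \<and> (\<forall>x\<in>K \<union> K'. 1 \<le> \<phi> x)}"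
  then have h: "h \<in> Cc" "\<And>x. 0 \<le> h x" "\<And>x. x \<in> K \<Longrightarrow> 1 \<le> h x" "\<And>x. x \<in> K' \<Longrightarrow> 1 \<le> h x" by auto
  have "open (- K')" "K \<subseteq> - K'" using K compact_imp_closed by auto
  from urysohn[OF K(1) this] obtain \<psi> C where \<psi>: "\<psi> \<in> Cc" "\<And>x. 0 \<le> \<psi> x" "\<And>x. \<psi> x \<le> (1::real)"
    "\<And>x. x \<in> K \<Longrightarrow> \<psi> x = 1" "C \<subseteq> - K'" "\<And>x. x \<notin> C \<Longrightarrow> \<psi> x = 0" by metis
  have h1: "(\<lambda>x. h x * \<psi> x) \<in> Cc" by (rule Cc_mult[OF h(1) \<psi>(1)])
  have h2: "(\<lambda>x. h x - h x * \<psi> x) \<in> Cc" by (rule Cc_diff[OF h(1) h1])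
  have h2pos: "0 \<le> h x - h x * \<psi> x" for x using h(2)[of x] \<psi>(3)[of x] by (simp add: mult_left_le)
  have h1pos: "0 \<le> h x * \<psi> x" for x using h(2)[of x] \<psi>(2)[of x] by simp
  have z: "\<psi> x = 0" if "x \<in> K'" for x using that \<psi>(5,6) by blast
  have "riesz_content L K + riesz_content L K' \<le> ennreal (L (\<lambda>x. h x * \<psi> x)) + ennreal (L (\<lambda>x. h x - h x * \<psi> x))"
    by (intro add_mono riesz_content_le h1 h2 h1pos h2pos) (use h \<psi>(4) z in auto)
  also have "\<dots> = ennreal (L h)"
    using positive_linear_diff[OF L h(1) h1] positive_linear_nonneg[OF L h1 h1pos] positive_linear_nonneg[OF L h2 h2pos]
    by (simp flip: ennreal_plus)
  finally show "riesz_content L K + riesz_content L K' \<le> ennreal (L h)" .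
qed

text \<open>\<open>\<phi>\<close> is sliced at the heights \<open>k / n\<close>. The rescaled slice
  \<open>\<psi> k\<close> is 1 where \<open>\<phi>\<close> is at least \<open>(k + 1) / n\<close>
  and 0 where it is at most \<open>k / n\<close>, so its value under \<open>L\<close> lies between
  two consecutive contents. \<open>D 0\<close> is \<open>C\<close>, since the set where
  \<open>0 \<le> \<phi>\<close> is the whole space and need not be compact.\<close>

lemma riesz_content_layers:
  fixes L :: "('a \<Rightarrow> real) \<Rightarrow> real"
  assumes L: "positive_linear L" and \<phi>: "\<phi> \<in> Cc" "\<And>x. 0 \<le> \<phi> x" "\<And>x. \<phi> x \<le> 1"
    and C: "\<And>x. x \<notin> C \<Longrightarrow> \<phi> x = 0" and n: "0 < n"
  defines "D k \<equiv> if k = 0 then C else {x. real k / real n \<le> \<phi> x}"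
  shows "(\<Sum>k<n. riesz_content L (D (Suc k))) \<le> ennreal (real n * L \<phi>)"
    and "ennreal (real n * L \<phi>) \<le> (\<Sum>k<n. riesz_content L (D k))"
proof -
  define \<psi> where "\<psi> k x = real n * (min (max (\<phi> x) (real k / real n)) (real (Suc k) / real n) - real k / real n)" for k x
  have \<psi>_eq: "\<psi> k x = (if \<phi> x \<le> real k / real n then 0 else if real (Suc k) / real n \<le> \<phi> x then 1
      else real n * \<phi> x - real k)" for k x
    using n by (auto simp: \<psi>_def min_def max_def field_simps)
  have \<psi>01: "0 \<le> \<psi> k x" "\<psi> k x \<le> 1" for k x
    using n unfolding \<psi>_eq by (auto simp: field_simps)
  have \<psi>Cc: "\<psi> k \<in> Cc" for k
  proof -
    obtain K where K: "compact K" "\<And>x. x \<notin> K \<Longrightarrow> \<phi> x = 0" using CcE[OF \<phi>(1)] by blast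
    show ?thesis
    proof (rule CcI[OF _ K(1)])
      show "continuous_on UNIV (\<psi> k)" unfolding \<psi>_def using Cc_cont[OF \<phi>(1)] by (intro continuous_intros)
      show "\<psi> k x = 0" if "x \<notin> K" for x unfolding \<psi>_eq using K(2)[OF that] n by simp
    qed
  qed
  have part: "(\<Sum>k<m. \<psi> k x) = real n * min (\<phi> x) (real m / real n)" for m x
  proof (induction m)
    case 0 then show ?case using \<phi>(2)[of x] by simp
  next
    case (Suc m) then show ?case using n by (auto simp: \<psi>_eq min_def field_simps)
  qed
  have sum: "(\<Sum>k<n. \<psi> k x) = real n * \<phi> x" for x using part[where m=n and x=x] \<phi>(3)[of x] n by simp
  have nL: "real n * L \<phi> = (\<Sum>k<n. L (\<psi> k))"
    using positive_linear_sum[OF L, of "{..<n}" \<psi>] \<psi>Cc positive_linear_cmult[OF L \<phi>(1), of "real n"] by (simp add: sum)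
  have Lnn: "0 \<le> L (\<psi> k)" for k by (rule positive_linear_nonneg[OF L \<psi>Cc \<psi>01(1)])
  have eq: "ennreal (real n * L \<phi>) = (\<Sum>k<n. ennreal (L (\<psi> k)))"
    unfolding nL using Lnn by (simp add: sum_ennreal)
  show "(\<Sum>k<n. riesz_content L (D (Suc k))) \<le> ennreal (real n * L \<phi>)"
    unfolding eq
  proof (intro sum_mono riesz_content_le \<psi>Cc \<psi>01)
    fix k x assume "x \<in> D (Suc k)"
    then have "real (Suc k) / real n \<le> \<phi> x" by (simp add: D_def)
    moreover have "real k / real n < real (Suc k) / real n" using n by (simp add: divide_strict_right_mono)
    ultimately show "1 \<le> \<psi> k x" unfolding \<psi>_eq by auto
  qed
  show "ennreal (real n * L \<phi>) \<le> (\<Sum>k<n. riesz_content L (D k))"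
    unfolding eq
  proof (rule sum_mono)
    fix k
    show "ennreal (L (\<psi> k)) \<le> riesz_content L (D k)"
      unfolding riesz_content_def
    proof (rule INF_greatest)
      fix h :: "'a \<Rightarrow> real" assume "h \<in> {\<phi> \<in> Cc. (\<forall>x. 0 \<le> \<phi> x) \<and> (\<forall>x\<in>D k. 1 \<le> \<phi> x)}"
      then have h: "h \<in> Cc" "\<And>x. 0 \<le> h x" "\<And>x. x \<in> D k \<Longrightarrow> 1 \<le> h x" by auto
      have "\<psi> k x \<le> h x" for x
      proof (cases "x \<in> D k")
        case True then show ?thesis using h(3) \<psi>01(2) order_trans by blast
      next
        case False
        then have "\<phi> x \<le> real k / real n" using C by (auto simp: D_def split: if_splits)
        then show ?thesis using h(2) by (simp add: \<psi>_eq)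
      qed
      then show "ennreal (L (\<psi> k)) \<le> ennreal (L h)"
        by (intro ennreal_leI positive_linear_mono[OF L \<psi>Cc h(1)])
    qed
  qed
qed

text \<open>The lower and upper sums of \<open>riesz_content_layers\<close> differ by a shift of the
  index, so passing from \<open>L\<close> through the common content to \<open>M\<close> costs at
  most the content of \<open>C\<close>. This error stays fixed while the difference of the
  functionals is multiplied by \<open>n\<close>.\<close>

lemma riesz_content_determines_le:
  fixes L M :: "('a \<Rightarrow> real) \<Rightarrow> real"
  assumes L: "positive_linear L" and M: "positive_linear M"
    and eq: "\<And>K. compact K \<Longrightarrow> riesz_content L K = riesz_content M K"
    and \<phi>: "\<phi> \<in> Cc" "\<And>x. 0 \<le> \<phi> x" "\<And>x. \<phi> x \<le> 1"
  shows "L \<phi> \<le> M \<phi>"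
proof -
  obtain C where C: "compact C" "\<And>x. x \<notin> C \<Longrightarrow> \<phi> x = 0" using CcE[OF \<phi>(1)] by blast
  define c where "c = enn2real (riesz_content M C)"
  have c: "riesz_content M C = ennreal c" "0 \<le> c"
    using riesz_content_finite[OF C(1), of M] by (auto simp: c_def)
  have Mnn: "0 \<le> M \<phi>" by (rule positive_linear_nonneg[OF M \<phi>(1,2)])
  have "real n * (L \<phi> - M \<phi>) \<le> c" if n: "0 < n" for n
  proof -
    define D where "D k = (if k = 0 then C else {x. real k / real n \<le> \<phi> x})" for k
    have cD: "compact (D k)" for k
    proof (cases "k = 0")
      case False
      then have "D k = C \<inter> {x. real k / real n \<le> \<phi> x}"
        using C(2) n by (fastforce simp: D_def field_simps)
      moreover have "closed {x. real k / real n \<le> \<phi> x}"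
        using Cc_cont[OF \<phi>(1)] by (intro closed_Collect_le continuous_intros) auto
      ultimately show ?thesis using C(1) by (simp add: compact_Int_closed)
    qed (simp add: D_def C)
    have "ennreal (real n * L \<phi>) \<le> (\<Sum>k<n. riesz_content L (D k))"
      unfolding D_def by (rule riesz_content_layers(2)[OF L \<phi> C(2) n])
    also have "\<dots> = (\<Sum>k<n. riesz_content M (D k))" using eq cD by simp
    also have "\<dots> \<le> (\<Sum>k<Suc n. riesz_content M (D k))" by (rule sum_mono2) auto
    also have "\<dots> = riesz_content M C + (\<Sum>k<n. riesz_content M (D (Suc k)))"
      by (subst sum.lessThan_Suc_shift) (simp add: D_def)
    also have "\<dots> \<le> riesz_content M C + ennreal (real n * M \<phi>)"
      unfolding D_def by (intro add_left_mono riesz_content_layers(1)[OF M \<phi> C(2) n])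
    also have "\<dots> = ennreal (c + real n * M \<phi>)" using c Mnn by (simp flip: ennreal_plus)
    finally have "real n * L \<phi> \<le> c + real n * M \<phi>" using c Mnn by (subst (asm) ennreal_le_iff) auto
    then show ?thesis by (simp add: algebra_simps)
  qed
  then have *: "real n * (L \<phi> - M \<phi>) \<le> c" if "0 < n" for n using that .
  show ?thesis
  proof (rule ccontr)
    assume "\<not> L \<phi> \<le> M \<phi>"
    then have pos: "0 < L \<phi> - M \<phi>" by simp
    obtain n where "c / (L \<phi> - M \<phi>) < real n" using reals_Archimedean2 by blast
    then have "c < real n * (L \<phi> - M \<phi>)" using pos by (simp add: field_simps)
    moreover have "0 < n" using \<open>c / (L \<phi> - M \<phi>) < real n\<close> c(2) pos
      by (metis divide_nonneg_pos less_le_not_le not_gr_zero of_nat_0 order_less_le_trans)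
    ultimately show False using *[of n] by simp
  qed
qed

lemma riesz_content_determines:
  fixes L M :: "('a \<Rightarrow> real) \<Rightarrow> real"
  assumes L: "positive_linear L" and M: "positive_linear M"
    and eq: "\<And>K. compact K \<Longrightarrow> riesz_content L K = riesz_content M K"
    and \<phi>: "\<phi> \<in> Cc"
  shows "L \<phi> = M \<phi>"
proof -
  have 1: "L \<psi> = M \<psi>" if "\<psi> \<in> Cc" "\<And>x. 0 \<le> \<psi> x" "\<And>x. \<psi> x \<le> 1" for \<psi>
    using riesz_content_determines_le[OF L M eq that] riesz_content_determines_le[OF M L eq[symmetric] that] by simp
  have 2: "L \<psi> = M \<psi>" if \<psi>: "\<psi> \<in> Cc" "\<And>x. 0 \<le> \<psi> x" for \<psi>
  proof -
    obtain B where B: "0 < B" "\<And>x. \<bar>\<psi> x\<bar> \<le> B" using Cc_bounded[OF \<psi>(1)] by blast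
    have "L (\<lambda>x. inverse B * \<psi> x) = M (\<lambda>x. inverse B * \<psi> x)"
      by (rule 1[OF Cc_cmult[OF \<psi>(1)]]) (use \<psi>(2) B in \<open>auto simp: field_simps abs_le_iff\<close>)
    then show ?thesis using positive_linear_cmult[OF L \<psi>(1)] positive_linear_cmult[OF M \<psi>(1)] B(1) by simp
  qed
  have p: "(\<lambda>x. max (\<phi> x) 0) \<in> Cc" by (rule Cc_max[OF \<phi> Cc_zero])
  have m: "(\<lambda>x. max (\<phi> x) 0 - \<phi> x) \<in> Cc" by (rule Cc_diff[OF p \<phi>])
  have "L (\<lambda>x. max (\<phi> x) 0) = M (\<lambda>x. max (\<phi> x) 0)" by (rule 2[OF p]) simp
  moreover have "L (\<lambda>x. max (\<phi> x) 0 - \<phi> x) = M (\<lambda>x. max (\<phi> x) 0 - \<phi> x)" by (rule 2[OF m]) simp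
  ultimately show ?thesis using positive_linear_diff[OF L p \<phi>] positive_linear_diff[OF M p \<phi>] by simp
qed

end

section \<open>From the content to a Radon measure\<close>

definition riesz_open :: "(('a::topological_space \<Rightarrow> real) \<Rightarrow> real) \<Rightarrow> 'a set \<Rightarrow> ennreal" where
  "riesz_open L U = (SUP K\<in>{K. compact K \<and> K \<subseteq> U}. riesz_content L K)"

text \<open>Inner extension of the content to open sets, then outer extension to all sets: the outer
  measure to which Caratheodory's theorem is applied.\<close>

definition riesz_outer :: "(('a::topological_space \<Rightarrow> real) \<Rightarrow> real) \<Rightarrow> 'a set \<Rightarrow> ennreal" where
  "riesz_outer L E = (INF U\<in>{U. open U \<and> E \<subseteq> U}. riesz_open L U)"

lemma riesz_open_mono: "U \<subseteq> V \<Longrightarrow> riesz_open L U \<le> riesz_open L V"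
  unfolding riesz_open_def by (rule SUP_subset_mono) auto

lemma riesz_outer_mono: "E \<subseteq> F \<Longrightarrow> riesz_outer L E \<le> riesz_outer L F"
  unfolding riesz_outer_def by (rule INF_superset_mono) auto

lemma riesz_outer_open: "open U \<Longrightarrow> riesz_outer L U = riesz_open L U"
  unfolding riesz_outer_def by (rule antisym) (auto intro: INF_lower2 INF_greatest riesz_open_mono)

lemma riesz_open_upper: "compact K \<Longrightarrow> K \<subseteq> U \<Longrightarrow> riesz_content L K \<le> riesz_open L U"
  unfolding riesz_open_def by (rule SUP_upper) auto

context lch_space begin

text \<open>The part of \<open>K\<close> outside \<open>U\<close> is compact and lies in
  \<open>V\<close>; a neighbourhood \<open>W\<close> of it with closure in \<open>V\<close> makes
  both pieces compact.\<close>

lemma compact_split: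
  fixes K :: "'a set"
  assumes K: "compact K" "K \<subseteq> U \<union> V" and o: "open U" "open V"
  obtains K1 K2 where "compact K1" "compact K2" "K = K1 \<union> K2" "K1 \<subseteq> U" "K2 \<subseteq> V"
proof -
  have "compact (K - U)" using K o by (simp add: compact_diff)
  moreover have "K - U \<subseteq> V" using K by auto
  ultimately obtain W where W: "open W" "K - U \<subseteq> W" "compact (closure W)" "closure W \<subseteq> V"
    using compact_nbhd[OF _ o(2)] by metis
  show thesis
  proof (rule that)
    show "compact (K - W)" using K W by (simp add: compact_diff)
    show "compact (K \<inter> closure W)" using K by (intro compact_Int_closed) auto
    show "K = (K - W) \<union> (K \<inter> closure W)" using closure_subset[of W] by auto
    show "K - W \<subseteq> U" using W by auto
    show "K \<inter> closure W \<subseteq> V" using W by auto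
  qed
qed

lemma riesz_content_finite_cover:
  fixes L :: "('a \<Rightarrow> real) \<Rightarrow> real"
  assumes L: "positive_linear L" and U: "\<And>n::nat. open (U n)"
  shows "compact K \<Longrightarrow> K \<subseteq> (\<Union>n<N. U n) \<Longrightarrow> riesz_content L K \<le> (\<Sum>n<N. riesz_open L (U n))"
proof (induction N arbitrary: K)
  case 0
  then have "K = {}" by simp
  then have "riesz_content L K \<le> ennreal (L (\<lambda>x. 0))" by (intro riesz_content_le) (auto simp: Cc_zero)
  then show ?case using positive_linear_zero[OF L] by simp
next
  case (Suc N)
  have "K \<subseteq> (\<Union>n<N. U n) \<union> U N" using Suc.prems(2) by (auto simp: lessThan_Suc)
  then obtain K1 K2 where K: "compact K1" "compact K2" "K = K1 \<union> K2" "K1 \<subseteq> (\<Union>n<N. U n)" "K2 \<subseteq> U N"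
    using compact_split[OF Suc.prems(1)] U by (metis open_UN)
  have "riesz_content L K \<le> riesz_content L K1 + riesz_content L K2"
    unfolding K(3) by (rule riesz_content_subadd[OF L])
  also have "\<dots> \<le> (\<Sum>n<N. riesz_open L (U n)) + riesz_open L (U N)"
    by (intro add_mono Suc.IH K riesz_open_upper)
  finally show ?case by simp
qed

lemma riesz_open_countable_subadd:
  fixes L :: "('a \<Rightarrow> real) \<Rightarrow> real"
  assumes L: "positive_linear L" and U: "\<And>n::nat. open (U n)"
  shows "riesz_open L (\<Union>n. U n) \<le> (\<Sum>n. riesz_open L (U n))"
  unfolding riesz_open_def[of L "\<Union>n. U n"]
proof (rule SUP_least)
  fix K assume "K \<in> {K. compact K \<and> K \<subseteq> (\<Union>n. U n)}"
  then have K: "compact K" "K \<subseteq> (\<Union>n. U n)" by auto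
  have "\<exists>N\<in>UNIV. \<forall>z\<in>K. z \<in> (\<Union>n<N. U n)"
  proof (rule compact_directed[OF K(1)])
    show "\<exists>k\<in>UNIV. \<forall>z. z \<in> (\<Union>n<i. U n) \<or> z \<in> (\<Union>n<j. U n) \<longrightarrow> z \<in> (\<Union>n<k. U n)" for i j :: nat
      by (rule bexI[of _ "max i j"]) auto
    show "\<exists>i\<in>UNIV. \<exists>N. open N \<and> x \<in> N \<and> (\<forall>z\<in>N. z \<in> (\<Union>n<i. U n))" if x: "x \<in> K" for x
    proof -
      obtain n where "x \<in> U n" using K(2) x by auto
      then show ?thesis using U by (intro bexI[of _ "Suc n"] exI[of _ "U n"]) auto
    qed
  qed auto
  then obtain N where "\<forall>z\<in>K. z \<in> (\<Union>n<N. U n)" by (elim bexE)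
  then have "K \<subseteq> (\<Union>n<N. U n)" by blast
  then have "riesz_content L K \<le> (\<Sum>n<N. riesz_open L (U n))"
    by (rule riesz_content_finite_cover[OF L U K(1)])
  also have "\<dots> \<le> (\<Sum>n. riesz_open L (U n))" by (rule sum_le_suminf) auto
  finally show "riesz_content L K \<le> (\<Sum>n. riesz_open L (U n))" .
qed

lemma riesz_outer_countable_subadd:
  fixes L :: "('a \<Rightarrow> real) \<Rightarrow> real"
  assumes L: "positive_linear L"
  shows "riesz_outer L (\<Union>n. A n) \<le> (\<Sum>n. riesz_outer L (A n))"
proof (rule ennreal_le_epsilon)
  fix e :: real assume e: "0 < e" and fin: "(\<Sum>n. riesz_outer L (A n)) < top"
  then have lt: "\<And>n. riesz_outer L (A n) < riesz_outer L (A n) + e * (1/2)^Suc n"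
    by (auto simp add: less_top dest!: ennreal_suminf_lessD)
  have "\<exists>U. open U \<and> A n \<subseteq> U \<and> riesz_open L U < riesz_outer L (A n) + e * (1/2)^Suc n" for n
    using lt[of n] unfolding riesz_outer_def[of L "A n"] INF_less_iff by blast
  then obtain U where U: "\<And>n. open (U n)" "\<And>n. A n \<subseteq> U n"
    "\<And>n. riesz_open L (U n) < riesz_outer L (A n) + e * (1/2)^Suc n" by metis
  have "riesz_outer L (\<Union>n. A n) \<le> riesz_outer L (\<Union>n. U n)" using U(2) by (intro riesz_outer_mono) auto
  also have "\<dots> = riesz_open L (\<Union>n. U n)" using U(1) by (intro riesz_outer_open) auto
  also have "\<dots> \<le> (\<Sum>n. riesz_open L (U n))" by (rule riesz_open_countable_subadd[OF L U(1)])
  also have "\<dots> \<le> (\<Sum>n. riesz_outer L (A n) + e * (1/2) ^ Suc n)"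
    using U(3) by (intro suminf_le less_imp_le) auto
  also have "\<dots> = (\<Sum>n. riesz_outer L (A n)) + (\<Sum>n. ennreal e * ennreal ((1/2) ^ Suc n))"
    using e by (subst suminf_add[symmetric])
      (auto simp del: ennreal_suminf_cmult simp add: ennreal_mult[symmetric])
  also have "\<dots> = (\<Sum>n. riesz_outer L (A n)) + e"
    unfolding ennreal_suminf_cmult
    by (subst suminf_ennreal_eq[OF zero_le_power power_half_series]) auto
  finally show "riesz_outer L (\<Union>n. A n) \<le> (\<Sum>n. riesz_outer L (A n)) + e" .
qed

lemma riesz_outer_empty:
  fixes L :: "('a \<Rightarrow> real) \<Rightarrow> real"
  assumes L: "positive_linear L"
  shows "riesz_outer L {} = 0"
proof -
  have "riesz_content L {} \<le> ennreal (L (\<lambda>x. 0))" by (rule riesz_content_le) (auto simp: Cc_zero)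
  then have "riesz_open L {} = 0" using positive_linear_zero[OF L] by (simp add: riesz_open_def)
  then show ?thesis by (simp add: riesz_outer_open)
qed

text \<open>If \<open>h\<close> dominates the indicator of \<open>K\<close> and
  \<open>t > 1\<close>, the open set where \<open>t * h\<close> exceeds 1 contains \<open>K\<close>,
  and its compact subsets have content at most \<open>t * L h\<close>. Then \<open>t\<close> tends
  to 1.\<close>

lemma riesz_outer_compact:
  fixes L :: "('a \<Rightarrow> real) \<Rightarrow> real"
  assumes L: "positive_linear L" and K: "compact K"
  shows "riesz_outer L K = riesz_content L K"
proof (rule antisym)
  show "riesz_content L K \<le> riesz_outer L K"
    unfolding riesz_outer_def by (rule INF_greatest) (auto intro: riesz_open_upper K)
  show "riesz_outer L K \<le> riesz_content L K"
    unfolding riesz_content_def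
  proof (rule INF_greatest)
    fix h :: "'a \<Rightarrow> real" assume "h \<in> {\<phi>\<in>Cc. (\<forall>x. 0 \<le> \<phi> x) \<and> (\<forall>x\<in>K. 1 \<le> \<phi> x)}"
    then have h: "h \<in> Cc" "\<And>x. 0 \<le> h x" "\<And>x. x \<in> K \<Longrightarrow> 1 \<le> h x" by auto
    have Lh: "0 \<le> L h" by (rule positive_linear_nonneg[OF L h(1,2)])
    have *: "riesz_outer L K \<le> ennreal (t * L h)" if t: "1 < t" for t
    proof -
      have "riesz_outer L K \<le> riesz_open L {x. 1 < t * h x}"
        unfolding riesz_outer_def
      proof (rule INF_lower, intro CollectI conjI subsetI)
        show "open {x. 1 < t * h x}" using Cc_cont[OF h(1)] by (intro open_Collect_less continuous_intros)
        show "1 < t * h x" if "x \<in> K" for x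
          using h(3)[OF that] t by (metis less_le_trans mult.right_neutral mult_le_cancel_left_pos zero_less_one order.strict_trans)
      qed
      also have "\<dots> \<le> ennreal (L (\<lambda>x. t * h x))"
        unfolding riesz_open_def
        by (intro SUP_least riesz_content_le) (use t h in \<open>auto intro: Cc_cmult simp: subset_eq less_imp_le\<close>)
      finally show ?thesis using positive_linear_cmult[OF L h(1)] by simp
    qed
    have "riesz_outer L K \<le> ennreal (L h) + ennreal e" if "0 < e" for e
    proof (cases "L h = 0")
      case True then show ?thesis using *[of 2] by simp
    next
      case False
      then have "riesz_outer L K \<le> ennreal ((1 + e / L h) * L h)" using Lh that by (intro *) simp
      also have "(1 + e / L h) * L h = L h + e" using False by (simp add: field_simps)
      finally show ?thesis using Lh that by simp
    qed
    then show "riesz_outer L K \<le> ennreal (L h)" by (rule ennreal_le_epsilon)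
  qed
qed

text \<open>Caratheodory's condition for open sets. A compact \<open>K\<close> in
  \<open>V \<inter> U\<close> leaves the open set \<open>V - K\<close> around \<open>V - U\<close>,
  and the contents of disjoint compact sets add.\<close>

lemma riesz_outer_split:
  fixes L :: "('a \<Rightarrow> real) \<Rightarrow> real"
  assumes L: "positive_linear L" and U: "open U"
  shows "riesz_outer L (E \<inter> U) + riesz_outer L (E - U) = riesz_outer L E"
proof (rule antisym)
  show "riesz_outer L (E \<inter> U) + riesz_outer L (E - U) \<le> riesz_outer L E"
    unfolding riesz_outer_def[of L E]
  proof (rule INF_greatest)
    fix V assume "V \<in> {V. open V \<and> E \<subseteq> V}"
    then have V: "open V" "E \<subseteq> V" by auto
    have 1: "riesz_content L K + riesz_outer L (V - U) \<le> riesz_open L V" if K: "compact K" "K \<subseteq> V \<inter> U" for K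
    proof -
      have oK: "open (V - K)" using V K(1) by (intro open_Diff compact_imp_closed) auto
      have "riesz_outer L (V - U) \<le> riesz_open L (V - K)"
        using K(2) oK riesz_outer_mono[of "V - U" "V - K" L] by (simp add: riesz_outer_open Diff_mono)
      then have "riesz_content L K + riesz_outer L (V - U) \<le> riesz_content L K + riesz_open L (V - K)"
        by (rule add_left_mono)
      also have "\<dots> = (SUP K'\<in>{K'. compact K' \<and> K' \<subseteq> V - K}. riesz_content L K + riesz_content L K')"
        unfolding riesz_open_def by (rule ennreal_SUP_add_right) auto
      also have "\<dots> \<le> riesz_open L V"
      proof (rule SUP_least)
        fix K' assume "K' \<in> {K'. compact K' \<and> K' \<subseteq> V - K}"
        then have K': "compact K'" "K' \<subseteq> V - K" by auto
        have "riesz_content L K + riesz_content L K' \<le> riesz_content L (K \<union> K')"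
          using K' by (intro riesz_content_add L K) auto
        also have "\<dots> \<le> riesz_open L V" using K K' by (intro riesz_open_upper compact_Un) auto
        finally show "riesz_content L K + riesz_content L K' \<le> riesz_open L V" .
      qed
      finally show ?thesis .
    qed
    have "riesz_outer L (E \<inter> U) + riesz_outer L (E - U) \<le> riesz_open L (V \<inter> U) + riesz_outer L (V - U)"
      using V U riesz_outer_mono[of "E \<inter> U" "V \<inter> U" L]
      by (intro add_mono riesz_outer_mono) (auto simp: riesz_outer_open open_Int)
    also have "\<dots> = (SUP K\<in>{K. compact K \<and> K \<subseteq> V \<inter> U}. riesz_content L K + riesz_outer L (V - U))"
      unfolding riesz_open_def by (intro ennreal_SUP_add_left[symmetric]) auto
    also have "\<dots> \<le> riesz_open L V" using 1 by (intro SUP_least) auto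
    finally show "riesz_outer L (E \<inter> U) + riesz_outer L (E - U) \<le> riesz_open L V" .
  qed
  have "E = (\<Union>n::nat. if n = 0 then E \<inter> U else if n = 1 then E - U else {})" (is "_ = (\<Union>n. ?A n)")
    by (auto split: if_splits)
  then have "riesz_outer L E \<le> (\<Sum>n. riesz_outer L (?A n))" using riesz_outer_countable_subadd[OF L, of ?A] by simp
  also have "\<dots> = (\<Sum>n\<in>{0,1}. riesz_outer L (?A n))"
    by (rule suminf_finite) (auto simp: riesz_outer_empty[OF L])
  finally show "riesz_outer L E \<le> riesz_outer L (E \<inter> U) + riesz_outer L (E - U)" by simp
qed

text \<open>The sets satisfying Caratheodory's condition form a sigma-algebra on which the outer
  measure is countably additive; by \<open>riesz_outer_split\<close> it contains the open
  sets.\<close>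

lemma riesz_outer_countably_additive:
  fixes L :: "('a \<Rightarrow> real) \<Rightarrow> real"
  assumes L: "positive_linear L"
  shows "countably_additive (sets borel) (riesz_outer L)"
proof -
  let ?\<Lambda> = "lambda_system UNIV (Pow UNIV) (riesz_outer L)"
  have oms: "outer_measure_space (Pow UNIV) (riesz_outer L)"
    unfolding outer_measure_space_def positive_def increasing_def countably_subadditive_def
    by (intro conjI ballI allI impI riesz_outer_empty[OF L] riesz_outer_mono riesz_outer_countable_subadd[OF L])
  have ms: "measure_space UNIV ?\<Lambda> (riesz_outer L)"
    by (rule sigma_algebra.caratheodory_lemma[OF sigma_algebra_Pow oms])
  then have sa: "sigma_algebra UNIV ?\<Lambda>" by (simp add: measure_space_def)
  have "{U. open U} \<subseteq> ?\<Lambda>"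
    using riesz_outer_split[OF L] by (auto simp: lambda_system_def Int_commute Diff_eq)
  then have "sigma_sets UNIV {U. open U} \<subseteq> ?\<Lambda>" by (rule sigma_algebra.sigma_sets_subset[OF sa])
  then have "sets (borel :: 'a measure) \<subseteq> ?\<Lambda>" by (simp add: borel_def)
  moreover have "countably_additive ?\<Lambda> (riesz_outer L)" using ms by (simp add: measure_space_def)
  ultimately show ?thesis unfolding countably_additive_def by blast
qed

text \<open>The outer measure of Riesz' construction is regular from outside but may fail to be
  inner regular on large sets, while \<open>radon\<close> demands inner regularity on all Borel
  sets. The supremum over \<open>B \<inter> K\<close> repairs this and keeps the values on compact
  sets; countable additivity survives because compact sets are directed.\<close>

lemma finite_measure_SUP_compact:
  assumes ca: "countably_additive (sets (borel :: 'a measure)) m" and p: "m {} = 0"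
  defines "\<mu> \<equiv> measure_of UNIV (sets borel) (\<lambda>B. SUP K\<in>{K. compact K}. m (B \<inter> K))"
  shows "sets \<mu> = sets borel" "\<And>B. B \<in> sets borel \<Longrightarrow> emeasure \<mu> B = (SUP K\<in>{K. compact K}. m (B \<inter> K))"
proof -
  show s: "sets \<mu> = sets borel" unfolding \<mu>_def using sets.sets_measure_of_eq[of "borel :: 'a measure"] by simp
  have mono: "m A \<le> m B" if "A \<in> sets borel" "B \<in> sets borel" "A \<subseteq> B" for A B
  proof -
    have "increasing (sets (borel :: 'a measure)) m"
    proof (rule ring_of_sets.additive_increasing)
      show "ring_of_sets UNIV (sets (borel :: 'a measure))"
        using sets.ring_of_sets_axioms[of "borel :: 'a measure"] by simp
      show pos: "positive (sets (borel :: 'a measure)) m" using p by (simp add: positive_def)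
      show "additive (sets (borel :: 'a measure)) m"
        by (rule ring_of_sets.countably_additive_additive[OF \<open>ring_of_sets UNIV _\<close> pos ca])
    qed
    then show ?thesis using that by (auto simp: increasing_def)
  qed
  show "emeasure \<mu> B = (SUP K\<in>{K. compact K}. m (B \<inter> K))" if "B \<in> sets borel" for B
    using that s
  proof (intro emeasure_measure_of[OF meta_eq_to_obj_eq[OF \<mu>_def]])
    show "countably_additive (sets \<mu>) (\<lambda>B. SUP K\<in>{K. compact K}. m (B \<inter> K))"
      unfolding s countably_additive_def
    proof (intro allI impI)
      fix A :: "nat \<Rightarrow> 'a set" assume A: "range A \<subseteq> sets borel" "disjoint_family A" "\<Union>(range A) \<in> sets borel"
      have AK: "A n \<inter> K \<in> sets borel" if "compact K" for n K
        using A(1) borel_compact[OF that] by auto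
      have "(\<Sum>n. SUP K\<in>{K. compact K}. m (A n \<inter> K)) = (SUP K\<in>{K. compact K}. \<Sum>n. m (A n \<inter> K))"
      proof (rule ennreal_suminf_SUP_eq_directed)
        fix N :: "nat set" and K K' :: "'a set" assume "K \<in> {K. compact K}" "K' \<in> {K. compact K}"
        then show "\<exists>k\<in>{K. compact K}. \<forall>n\<in>N. m (A n \<inter> K) \<le> m (A n \<inter> k) \<and> m (A n \<inter> K') \<le> m (A n \<inter> k)"
          by (intro bexI[of _ "K \<union> K'"] ballI conjI mono AK) (auto simp: compact_Un)
      qed
      also have "\<dots> = (SUP K\<in>{K. compact K}. m (\<Union>(range A) \<inter> K))"
      proof (rule SUP_cong[OF refl])
        fix K :: "'a set" assume "K \<in> {K. compact K}"
        then have K: "compact K" by simp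
        have ra: "range (\<lambda>n. A n \<inter> K) \<subseteq> sets borel" using AK[OF K] by auto
        have df: "disjoint_family (\<lambda>n. A n \<inter> K)" using A(2) by (rule disjoint_family_on_bisimulation) auto
        have un: "(\<Union>n. A n \<inter> K) \<in> sets borel" using AK[OF K] by (intro sets.countable_UN) auto
        have "(\<Sum>n. m (A n \<inter> K)) = m (\<Union>n. A n \<inter> K)"
          by (rule ca[unfolded countably_additive_def, rule_format, OF ra df un])
        moreover have "(\<Union>n. A n \<inter> K) = \<Union>(range A) \<inter> K" by blast
        ultimately show "(\<Sum>n. m (A n \<inter> K)) = m (\<Union>(range A) \<inter> K)" by (simp only:)
      qed
      finally show "(\<Sum>n. SUP K\<in>{K. compact K}. m (A n \<inter> K)) = (SUP K\<in>{K. compact K}. m (\<Union>(range A) \<inter> K))" .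
    qed
    show "positive (sets \<mu>) (\<lambda>B. SUP K\<in>{K. compact K}. m (B \<inter> K))"
      using p by (auto simp: positive_def intro!: antisym SUP_least)
  qed auto
qed

lemma riesz_content_measure:
  fixes L :: "('a \<Rightarrow> real) \<Rightarrow> real"
  assumes L: "positive_linear L"
  obtains \<mu> where "\<mu> \<in> radon" "\<And>K. compact K \<Longrightarrow> emeasure \<mu> K = riesz_content L K"
proof -
  let ?m = "riesz_outer L"
  note ca = riesz_outer_countably_additive[OF L]
  define \<mu>0 where "\<mu>0 = measure_of UNIV (sets borel) ?m"
  have s0: "sets \<mu>0 = sets borel" unfolding \<mu>0_def using sets.sets_measure_of_eq[of "borel :: 'a measure"] by simp
  have e0: "emeasure \<mu>0 B = ?m B" if "B \<in> sets borel" for B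
    by (rule emeasure_measure_of[OF \<mu>0_def]) (use that s0 ca riesz_outer_empty[OF L] in \<open>auto simp: positive_def\<close>)
  define \<mu> where "\<mu> = measure_of UNIV (sets borel) (\<lambda>B. SUP K\<in>{K. compact K}. ?m (B \<inter> K))"
  note \<mu> = finite_measure_SUP_compact[OF ca riesz_outer_empty[OF L], folded \<mu>_def]
  have \<mu>K: "emeasure \<mu> K = riesz_content L K" if K: "compact K" for K
  proof -
    have "(SUP K'\<in>{K. compact K}. ?m (K \<inter> K')) = ?m K"
      by (rule antisym) (use K in \<open>auto intro!: SUP_least riesz_outer_mono SUP_upper2[of K]\<close>)
    then show ?thesis using \<mu>(2)[OF borel_compact[OF K]] riesz_outer_compact[OF L K] by simp
  qed
  \<comment> \<open>Outer regularity at \<open>K - B\<close> becomes inner regularity at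
    \<open>B \<inter> K\<close>: an open \<open>W\<close> around \<open>K - B\<close> of nearly the
    same measure leaves the compact set \<open>K - W\<close> inside \<open>B\<close>. Finiteness on
    \<open>K\<close> permits the cancellation.\<close>
  have inner: "?m (B \<inter> K) \<le> (SUP C\<in>{C. compact C \<and> C \<subseteq> B}. emeasure \<mu> C)" if B: "B \<in> sets borel" and K: "compact K" for B K
  proof (rule ennreal_le_epsilon)
    fix e :: real assume e: "0 < e"
    have fK: "?m K < \<infinity>" using riesz_outer_compact[OF L K] riesz_content_finite[OF K] by simp
    have Ks: "K \<in> sets borel" using borel_compact[OF K] .
    have "?m (K - B) < \<infinity>" using riesz_outer_mono[of "K - B" K L] fK by (simp add: order_le_less_trans)
    then have "?m (K - B) < ?m (K - B) + ennreal e"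
      using e by (cases "?m (K - B)") (auto simp flip: ennreal_plus simp: ennreal_less_iff)
    then obtain W where W: "open W" "K - B \<subseteq> W" "riesz_open L W < ?m (K - B) + ennreal e"
      unfolding riesz_outer_def[of L "K - B"] INF_less_iff by blast
    have cC: "compact (K - W)" using K W(1) by (simp add: compact_diff)
    have WB: "W \<in> sets borel" using W(1) by simp
    have a: "?m K = ?m (K \<inter> B) + ?m (K - B)"
      using plus_emeasure[of "K \<inter> B" \<mu>0 "K - B"] B Ks s0 e0[of "K \<inter> B"] e0[of "K - B"] e0[of K]
      by (simp add: Int_Diff_disjoint Int_Diff_Un)
    have b: "?m K = ?m (K \<inter> W) + ?m (K - W)" using riesz_outer_split[OF L W(1), of K] by simp
    have "?m (K \<inter> B) + ?m (K - B) \<le> ?m (K - W) + ?m W"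
      using a b riesz_outer_mono[of "K \<inter> W" W L] by (metis Int_lower2 add.commute add_left_mono)
    also have "\<dots> \<le> ?m (K - W) + (?m (K - B) + ennreal e)"
      using W(1,3) by (intro add_left_mono less_imp_le) (simp add: riesz_outer_open)
    finally have "?m (K - B) + ?m (K \<inter> B) \<le> ?m (K - B) + (?m (K - W) + ennreal e)" by (simp add: ac_simps)
    then have "?m (K \<inter> B) \<le> ?m (K - W) + ennreal e"
      using \<open>?m (K - B) < \<infinity>\<close> by (subst (asm) ennreal_add_left_cancel_le) auto
    also have "?m (K - W) = emeasure \<mu> (K - W)" using \<mu>K[OF cC] riesz_outer_compact[OF L cC] by simp
    also have "\<dots> \<le> (SUP C\<in>{C. compact C \<and> C \<subseteq> B}. emeasure \<mu> C)" using cC W(2) by (intro SUP_upper) auto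
    finally show "?m (B \<inter> K) \<le> (SUP C\<in>{C. compact C \<and> C \<subseteq> B}. emeasure \<mu> C) + ennreal e"
      by (simp add: Int_commute add_right_mono)
  qed
  have "\<mu> \<in> radon"
    unfolding radon_def
  proof (intro CollectI conjI allI impI ballI)
    show "sets \<mu> = sets borel" by (rule \<mu>(1))
    show "emeasure \<mu> K < \<infinity>" if "compact K" for K using \<mu>K[OF that] riesz_content_finite[OF that] by simp
    show "emeasure \<mu> B = (SUP C\<in>{C. compact C \<and> C \<subseteq> B}. emeasure \<mu> C)" if B: "B \<in> sets borel" for B
    proof (rule antisym)
      show "emeasure \<mu> B \<le> (SUP C\<in>{C. compact C \<and> C \<subseteq> B}. emeasure \<mu> C)"
        unfolding \<mu>(2)[OF B] using inner[OF B] by (intro SUP_least) auto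
      show "(SUP C\<in>{C. compact C \<and> C \<subseteq> B}. emeasure \<mu> C) \<le> emeasure \<mu> B"
        using B \<mu>(1) by (intro SUP_least emeasure_mono) auto
    qed
  qed
  then show thesis using that \<mu>K by blast
qed

text \<open>For a relatively compact \<open>V\<close> around \<open>K\<close>, inner regularity
  gives a compact \<open>C\<close> in \<open>V - K\<close> carrying all but \<open>e\<close> of its
  mass; \<open>V - C\<close> is the desired open set.\<close>

lemma radon_outer_compact:
  assumes \<mu>: "\<mu> \<in> radon" and K: "compact (K :: 'a set)" and e: "0 < (e :: real)"
  obtains U where "open U" "K \<subseteq> U" "compact (closure U)" "emeasure \<mu> U \<le> emeasure \<mu> K + ennreal e"
proof -
  have sets: "sets \<mu> = sets borel" by (rule radon_sets[OF \<mu>])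
  obtain V where V: "open V" "K \<subseteq> V" "compact (closure V)" using compact_nbhd[OF K open_UNIV subset_UNIV] by metis
  have fV: "emeasure \<mu> V < \<infinity>"
  proof -
    have "emeasure \<mu> V \<le> emeasure \<mu> (closure V)" using sets by (intro emeasure_mono closure_subset) auto
    then show ?thesis using radon_compact[OF \<mu> V(3)] by (rule order_le_less_trans)
  qed
  have Ks: "K \<in> sets borel" by (rule borel_compact[OF K])
  have VK: "V - K \<in> sets borel" using V(1) Ks by auto
  have eq: "emeasure \<mu> V = emeasure \<mu> K + emeasure \<mu> (V - K)"
    using plus_emeasure[of K \<mu> "V - K"] Ks VK sets V(2) by (simp add: Un_absorb1)
  have fVK: "emeasure \<mu> (V - K) < \<infinity>"
    using emeasure_mono[of "V - K" V \<mu>] fV V(1) sets by (simp add: order_le_less_trans)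
  have "\<exists>C. compact C \<and> C \<subseteq> V - K \<and> emeasure \<mu> (V - K) \<le> emeasure \<mu> C + ennreal e"
  proof (cases "emeasure \<mu> (V - K) \<le> ennreal e")
    case True then show ?thesis by (intro exI[of _ "{}"]) auto
  next
    case False
    then have "0 < emeasure \<mu> (V - K)" by (intro le_less_trans[OF zero_le]) (simp add: not_le)
    then have "emeasure \<mu> (V - K) - ennreal e < emeasure \<mu> (V - K)"
      using fVK e by (intro ennreal_between) auto
    then obtain C where C: "compact C" "C \<subseteq> V - K" "emeasure \<mu> (V - K) - ennreal e < emeasure \<mu> C"
      using radon_inner[OF \<mu> VK] by (auto simp: less_SUP_iff)
    then show ?thesis
      by (intro exI[of _ C]) (auto simp: ennreal_minus_le_iff add.commute dest!: less_imp_le)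
  qed
  then obtain C where C: "compact C" "C \<subseteq> V - K" "emeasure \<mu> (V - K) \<le> emeasure \<mu> C + ennreal e" by blast
  have Cs: "C \<in> sets borel" by (rule borel_compact[OF C(1)])
  have fC: "emeasure \<mu> C < \<infinity>" by (rule radon_compact[OF \<mu> C(1)])
  have "emeasure \<mu> V = emeasure \<mu> (V - C) + emeasure \<mu> C"
  proof -
    have "(V - C) \<inter> C = {}" "(V - C) \<union> C = V" using C(2) by auto
    then show ?thesis using plus_emeasure[of "V - C" \<mu> C] Cs V(1) sets by auto
  qed 
  then have "emeasure \<mu> C + emeasure \<mu> (V - C) \<le> emeasure \<mu> C + (emeasure \<mu> K + ennreal e)"
    using eq C(3) by (metis add.commute add.left_commute add_left_mono)
  then have le: "emeasure \<mu> (V - C) \<le> emeasure \<mu> K + ennreal e"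
    using fC by (subst (asm) ennreal_add_left_cancel_le) auto
  show thesis
  proof (rule that[of "V - C"])
    show "open (V - C)" using V(1) C(1) by (intro open_Diff compact_imp_closed)
    show "K \<subseteq> V - C" using V(2) C(2) by auto
    have "closure (V - C) \<subseteq> closure V" by (intro closure_mono) auto
    then have "closure (V - C) = closure V \<inter> closure (V - C)" by auto
    then show "compact (closure (V - C))" using compact_Int_closed[OF V(3), of "closure (V - C)"] by simp
  qed (rule le)
qed

lemma positive_linear_integral: "\<mu> \<in> radon \<Longrightarrow> positive_linear (\<lambda>\<phi>::'a \<Rightarrow> real. integral\<^sup>L \<mu> \<phi>)"
  unfolding positive_linear_def by (auto simp: Cc_integrable)

lemma riesz_content_integral:
  assumes \<mu>: "\<mu> \<in> radon" and K: "compact (K :: 'a set)"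
  shows "riesz_content (integral\<^sup>L \<mu>) K = emeasure \<mu> K"
proof (rule antisym)
  have sets: "sets \<mu> = sets borel" by (rule radon_sets[OF \<mu>])
  show "emeasure \<mu> K \<le> riesz_content (integral\<^sup>L \<mu>) K"
    unfolding riesz_content_def
  proof (rule INF_greatest)
    fix h :: "'a \<Rightarrow> real" assume "h \<in> {\<phi>\<in>Cc. (\<forall>x. 0 \<le> \<phi> x) \<and> (\<forall>x\<in>K. 1 \<le> \<phi> x)}"
    then have h: "h \<in> Cc" "\<And>x. 0 \<le> h x" "\<And>x. x \<in> K \<Longrightarrow> 1 \<le> h x" by auto
    have "emeasure \<mu> K = (\<integral>\<^sup>+x. indicator K x \<partial>\<mu>)" using borel_compact[OF K] sets by simp
    also have "\<dots> \<le> (\<integral>\<^sup>+x. ennreal (h x) \<partial>\<mu>)"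
      using h(3) by (intro nn_integral_mono) (auto simp: indicator_def ennreal_ge_1)
    also have "\<dots> = ennreal (integral\<^sup>L \<mu> h)"
      by (intro nn_integral_eq_integral Cc_integrable[OF \<mu> h(1)]) (simp add: h(2))
    finally show "emeasure \<mu> K \<le> ennreal (integral\<^sup>L \<mu> h)" .
  qed
  show "riesz_content (integral\<^sup>L \<mu>) K \<le> emeasure \<mu> K"
  proof (rule ennreal_le_epsilon)
    fix e :: real assume "0 < e"
    then obtain U where U: "open U" "K \<subseteq> U" "emeasure \<mu> U \<le> emeasure \<mu> K + ennreal e"
      using radon_outer_compact[OF \<mu> K] by metis
    obtain \<phi> :: "'a \<Rightarrow> real" and C where \<phi>: "\<phi> \<in> Cc" "\<And>x. 0 \<le> \<phi> x" "\<And>x. \<phi> x \<le> 1" "\<And>x. x \<in> K \<Longrightarrow> \<phi> x = 1"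
      "C \<subseteq> U" "\<And>x. x \<notin> C \<Longrightarrow> \<phi> x = 0" using urysohn[OF K U(1,2)] by metis
    have "riesz_content (integral\<^sup>L \<mu>) K \<le> ennreal (integral\<^sup>L \<mu> \<phi>)"
      by (rule riesz_content_le) (use \<phi> in auto)
    also have "\<dots> = (\<integral>\<^sup>+x. ennreal (\<phi> x) \<partial>\<mu>)"
      by (intro nn_integral_eq_integral[symmetric] Cc_integrable[OF \<mu> \<phi>(1)]) (simp add: \<phi>(2))
    also have "\<dots> \<le> (\<integral>\<^sup>+x. indicator U x \<partial>\<mu>)"
    proof (rule nn_integral_mono)
      fix x show "ennreal (\<phi> x) \<le> indicator U x"
        using \<phi>(3)[of x] \<phi>(5,6) by (cases "x \<in> U") (auto simp: ennreal_le_1 subset_eq)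
    qed
    also have "\<dots> = emeasure \<mu> U" using U(1) sets by simp
    finally show "riesz_content (integral\<^sup>L \<mu>) K \<le> emeasure \<mu> K + ennreal e" using U(3) by simp
  qed
qed

text \<open>\<open>\<mu>\<close> is built to have the content of \<open>L\<close>, integration
  against \<open>\<mu>\<close> has the content given by \<open>\<mu>\<close> itself, and a
  functional on \<open>Cc\<close> is determined by its content.\<close>

theorem riesz_representation:
  fixes L :: "('a \<Rightarrow> real) \<Rightarrow> real"
  assumes "positive_linear L"
  obtains \<mu> where "\<mu> \<in> radon" "\<And>\<phi>. \<phi> \<in> Cc \<Longrightarrow> integral\<^sup>L \<mu> \<phi> = L \<phi>"
proof -
  obtain \<mu> where \<mu>: "\<mu> \<in> radon" "\<And>K. compact K \<Longrightarrow> emeasure \<mu> K = riesz_content L K"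
    using riesz_content_measure[OF assms] by blast
  show thesis
  proof (rule that[OF \<mu>(1)])
    show "integral\<^sup>L \<mu> \<phi> = L \<phi>" if "\<phi> \<in> Cc" for \<phi>
      by (rule riesz_content_determines[OF positive_linear_integral[OF \<mu>(1)] assms _ that])
        (simp add: riesz_content_integral[OF \<mu>(1)] \<mu>(2))
  qed
qed

lemma radon_eqI_compact:
  fixes \<mu> \<nu> :: "'a measure"
  assumes "\<mu> \<in> radon" "\<nu> \<in> radon" "\<And>K. compact K \<Longrightarrow> emeasure \<mu> K = emeasure \<nu> K"
  shows "\<mu> = \<nu>"
proof (rule measure_eqI)
  show "sets \<mu> = sets \<nu>" using assms radon_sets by metis
  fix B assume "B \<in> sets \<mu>"
  then have B: "B \<in> sets borel" using radon_sets[OF assms(1)] by simp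
  show "emeasure \<mu> B = emeasure \<nu> B"
    unfolding radon_inner[OF assms(1) B] radon_inner[OF assms(2) B] using assms(3) by (intro SUP_cong) auto
qed

end

subsection \<open>Products of Radon measures\<close>

lemma lsc_measurable:
  fixes u :: "'b::topological_space \<Rightarrow> ennreal"
  assumes "\<And>c. open {x. c < u x}"
  shows "u \<in> borel_measurable borel"
  using assms by (intro borel_measurableI_greater) (simp add: borel_open)

lemma Borel_Times:
  fixes B C :: "'a::topological_space set"
  assumes "B \<in> sets borel" "C \<in> sets borel"
  shows "B \<times> C \<in> sets borel"
proof -
  have "fst -` B \<inter> space borel \<in> sets (borel :: ('a \<times> 'a) measure)"
    using assms(1) by (intro measurable_sets[of fst _ borel] borel_measurable_continuous_onI continuous_intros)
  moreover have "snd -` C \<inter> space borel \<in> sets (borel :: ('a \<times> 'a) measure)"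
    using assms(2) by (intro measurable_sets[of snd _ borel] borel_measurable_continuous_onI continuous_intros)
  ultimately have "(fst -` B \<inter> space borel) \<inter> (snd -` C \<inter> space borel) \<in> sets (borel :: ('a \<times> 'a) measure)" by auto
  moreover have "(fst -` B \<inter> space borel) \<inter> (snd -` C \<inter> space borel) = B \<times> C" by auto
  ultimately show ?thesis by simp
qed

lemma emeasure_Diff_Int:
  assumes "A \<in> sets M" "B \<in> sets M"
  shows "emeasure M A = emeasure M (A - B) + emeasure M (A \<inter> B)"
proof -
  have "(A - B) \<union> (A \<inter> B) = A" "(A - B) \<inter> (A \<inter> B) = {}" by auto
  then show ?thesis using plus_emeasure[of "A - B" M "A \<inter> B"] assms by auto
qed

text \<open>The infima of \<open>k (x, y)\<close> over neighbourhoods \<open>W\<close> of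
  \<open>x0\<close> increase to \<open>k (x0, y)\<close>, with lower bounds that are locally uniform
  in \<open>y\<close>. Such infima may be nonmeasurable, which is why
  \<open>radon_nn_integral_directed\<close> admits arbitrary \<open>v\<close>.\<close>

lemma lsc_nn_integral_param:
  fixes \<nu> :: "'a::t2_space measure" and k :: "'a \<times> 'a \<Rightarrow> ennreal"
  assumes \<nu>: "\<nu> \<in> radon" and k: "\<And>c. open {p. c < k p}"
  shows "open {x. c < (\<integral>\<^sup>+y. k (x, y) \<partial>\<nu>)}"
proof (subst open_subopen, intro ballI)
  fix x0 assume "x0 \<in> {x. c < (\<integral>\<^sup>+y. k (x, y) \<partial>\<nu>)}"
  then have x0: "c < (\<integral>\<^sup>+y. k (x0, y) \<partial>\<nu>)" by simp
  let ?D = "{W. open W \<and> x0 \<in> W}"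
  let ?v = "\<lambda>W y. INF x\<in>W. k (x, y)"
  have "(\<integral>\<^sup>+y. k (x0, y) \<partial>\<nu>) \<le> (SUP W\<in>?D. \<integral>\<^sup>+y. ?v W y \<partial>\<nu>)"
  proof (rule radon_nn_integral_directed[OF \<nu>])
    show "?D \<noteq> {}" by (auto intro!: exI[of _ UNIV])
    show "\<exists>W\<in>?D. \<forall>y. ?v W1 y \<le> ?v W y \<and> ?v W2 y \<le> ?v W y" if "W1 \<in> ?D" "W2 \<in> ?D" for W1 W2
      using that by (intro bexI[of _ "W1 \<inter> W2"] allI conjI INF_superset_mono) auto
    fix y t assume "t < k (x0, y)"
    then have "(x0, y) \<in> {p. t < k p}" by simp
    then obtain W N where WN: "open W" "open N" "x0 \<in> W" "y \<in> N" "W \<times> N \<subseteq> {p. t < k p}"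
      using k[of t] unfolding open_prod_def by (metis mem_Sigma_iff)
    have "t \<le> ?v W z" if "z \<in> N" for z
      by (rule INF_greatest, rule less_imp_le) (use WN(5) that in auto)
    then show "\<exists>W\<in>?D. \<exists>N. open N \<and> y \<in> N \<and> (\<forall>z\<in>N. t \<le> ?v W z)" using WN by blast
  qed
  then obtain W where W: "open W" "x0 \<in> W" "c < (\<integral>\<^sup>+y. ?v W y \<partial>\<nu>)"
    using x0 by (force simp: less_SUP_iff dest: less_le_trans)
  have "c < (\<integral>\<^sup>+y. k (x, y) \<partial>\<nu>)" if "x \<in> W" for x
    using that by (intro less_le_trans[OF W(3)] nn_integral_mono INF_lower)
  then show "\<exists>T. open T \<and> x0 \<in> T \<and> T \<subseteq> {x. c < (\<integral>\<^sup>+y. k (x, y) \<partial>\<nu>)}" using W by blast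
qed

lemma lsc_indicator: "open W \<Longrightarrow> open {p. c < (indicator W p :: ennreal)}"
proof -
  assume "open W"
  have "{p. c < (indicator W p :: ennreal)} = (if c < 1 then W else {})"
    by (auto simp: indicator_def split: if_splits)
  then show ?thesis using \<open>open W\<close> by simp
qed

lemma lsc_ennreal_cont:
  fixes \<phi> :: "'b::topological_space \<Rightarrow> real"
  assumes "continuous_on UNIV \<phi>"
  shows "open {x. c < ennreal (\<phi> x)}"
proof -
  have "continuous_on UNIV (\<lambda>x. ennreal (\<phi> x))"
    using assms by (rule continuous_on_ennreal)
  then show ?thesis by (intro open_Collect_less continuous_on_const)
qed

lemma Cc_slice:
  fixes \<phi> :: "'a::t2_space \<times> 'a \<Rightarrow> real"
  assumes \<phi>: "\<phi> \<in> Cc"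
  obtains K where "compact K" "\<And>x y. x \<notin> K \<or> y \<notin> K \<Longrightarrow> \<phi> (x, y) = 0" "\<And>x. (\<lambda>y. \<phi> (x, y)) \<in> Cc"
proof -
  obtain C where C: "compact C" "\<And>p. p \<notin> C \<Longrightarrow> \<phi> p = 0" using CcE[OF \<phi>] by metis
  let ?K = "fst ` C \<union> snd ` C"
  have K: "compact ?K"
    using C(1) by (intro compact_Un compact_continuous_image continuous_intros)
  have z: "\<phi> (x, y) = 0" if "x \<notin> ?K \<or> y \<notin> ?K" for x y
    using that by (intro C(2)) force
  have c: "continuous_on UNIV (\<lambda>y. \<phi> (x, y))" for x
    by (rule continuous_on_compose2[OF Cc_cont[OF \<phi>] continuous_on_Pair[OF continuous_on_const continuous_on_id]]) simp
  have "(\<lambda>y. \<phi> (x, y)) \<in> Cc" for x by (rule CcI[OF c K]) (use z in auto)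
  then show thesis using that[OF K] z by blast
qed

lemma Cc_slice_integral:
  fixes \<phi> :: "'a::t2_space \<times> 'a \<Rightarrow> real"
  assumes \<mu>: "\<mu> \<in> radon" and \<nu>: "\<nu> \<in> radon" and \<phi>: "\<phi> \<in> Cc"
  shows "integrable \<nu> (\<lambda>y. \<phi> (x, y))" and "integrable \<mu> (\<lambda>x. \<integral>y. \<phi> (x, y) \<partial>\<nu>)"
proof -
  obtain K where K: "compact K" "\<And>x y. x \<notin> K \<or> y \<notin> K \<Longrightarrow> \<phi> (x, y) = 0" "\<And>x. (\<lambda>y. \<phi> (x, y)) \<in> Cc"
    using Cc_slice[OF \<phi>] by metis
  show int: "integrable \<nu> (\<lambda>y. \<phi> (x, y))" for x by (rule Cc_integrable[OF \<nu> K(3)])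
  obtain B where B: "0 < B" "\<And>p. \<bar>\<phi> p\<bar> \<le> B" using Cc_bounded[OF \<phi>] by blast
  let ?F = "\<lambda>x. \<integral>y. \<phi> (x, y) \<partial>\<nu>"
  have Ks: "K \<in> sets borel" by (rule borel_compact[OF K(1)])
  define m where "m = measure \<nu> K"
  have em: "emeasure \<nu> K < \<infinity>" by (rule radon_compact[OF \<nu> K(1)])
  have bd: "\<bar>?F x\<bar> \<le> B * m * indicator K x" for x
  proof (cases "x \<in> K")
    case True
    have "\<bar>?F x\<bar> \<le> (\<integral>y. \<bar>\<phi> (x, y)\<bar> \<partial>\<nu>)" by (rule integral_abs_bound)
    also have "\<dots> \<le> (\<integral>y. B * indicator K y \<partial>\<nu>)"
    proof (rule integral_mono)
      show "integrable \<nu> (\<lambda>y. \<bar>\<phi> (x, y)\<bar>)" using int by (rule integrable_abs)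
      show "integrable \<nu> (\<lambda>y. B * indicator K y)"
        using em Ks radon_sets[OF \<nu>] by (intro integrable_mult_right integrable_real_indicator) auto
      show "\<bar>\<phi> (x, y)\<bar> \<le> B * indicator K y" for y using B K(2)[of x y] by (auto simp: indicator_def)
    qed
    also have "\<dots> = B * m" using Ks radon_sets[OF \<nu>] radon_space[OF \<nu>] by (simp add: m_def)
    finally show ?thesis using True by simp
  next
    case False then show ?thesis using K(2) by simp
  qed
  \<comment> \<open>The positive and negative parts of \<open>\<phi>\<close> are lower
    semicontinuous, hence so are their partial integrals; \<open>s = 1\<close> and
    \<open>s = -1\<close> select the two parts.\<close>
  have meas: "?F \<in> borel_measurable borel"
  proof -
    have eq: "?F x = enn2real (\<integral>\<^sup>+y. ennreal (\<phi> (x, y)) \<partial>\<nu>) - enn2real (\<integral>\<^sup>+y. ennreal (- \<phi> (x, y)) \<partial>\<nu>)" for x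
      by (rule real_lebesgue_integral_def[OF int])
    have "(\<lambda>x. \<integral>\<^sup>+y. ennreal (s * \<phi> (x, y)) \<partial>\<nu>) \<in> borel_measurable borel" for s
      using Cc_cont[OF \<phi>]
      by (intro lsc_measurable lsc_nn_integral_param[OF \<nu>, where k = "\<lambda>p. ennreal (s * \<phi> p)"] lsc_ennreal_cont continuous_intros)
    from this[of 1] this[of "-1"] show ?thesis unfolding eq by simp
  qed
  show "integrable \<mu> ?F"
  proof (rule Bochner_Integration.integrable_bound)
    show "integrable \<mu> (\<lambda>x. B * m * indicator K x)"
      using radon_compact[OF \<mu> K(1)] Ks radon_sets[OF \<mu>]
      by (intro integrable_mult_right integrable_real_indicator) auto
    show "?F \<in> borel_measurable \<mu>" using meas radon_measurable[OF \<mu>] by blast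
    have "norm (?F x) \<le> norm (B * m * indicator K x)" for x
      using bd[of x] B(1) by (simp add: m_def)
    then show "AE x in \<mu>. norm (?F x) \<le> norm (B * m * indicator K x)" by simp
  qed
qed

section \<open>Existence, uniqueness and symmetry of the Radon product\<close>

context lch_space begin

text \<open>The iterated integral is a positive linear functional on \<open>Cc\<close> of the
  square, so it has a representing measure. Directed monotone convergence, used once for each
  integration, extends the formula to lower semicontinuous \<open>k\<close>.\<close>

lemma radon_product_exists:
  fixes \<mu> \<nu> :: "'a measure"
  assumes \<mu>: "\<mu> \<in> radon" and \<nu>: "\<nu> \<in> radon"
  obtains \<pi> where "\<pi> \<in> radon"
    "\<And>k :: 'a \<times> 'a \<Rightarrow> ennreal. (\<And>c. open {p. c < k p}) \<Longrightarrow>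
       (\<integral>\<^sup>+p. k p \<partial>\<pi>) = (\<integral>\<^sup>+x. \<integral>\<^sup>+y. k (x, y) \<partial>\<nu> \<partial>\<mu>)"
proof -
  interpret pr: lch_space "TYPE('a \<times> 'a)" by (rule lch_prod[OF lch_space_axioms])
  define L where "L \<phi> = (\<integral>x. \<integral>y. \<phi> (x, y) \<partial>\<nu> \<partial>\<mu>)" for \<phi> :: "'a \<times> 'a \<Rightarrow> real"
  have "positive_linear L"
    unfolding positive_linear_def L_def
    by (auto simp: Cc_slice_integral[OF \<mu> \<nu>] intro!: integral_nonneg_AE)
  then obtain \<pi> where \<pi>: "\<pi> \<in> radon" "\<And>\<phi>. \<phi> \<in> Cc \<Longrightarrow> integral\<^sup>L \<pi> \<phi> = L \<phi>"
    using pr.riesz_representation by metis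
  have 1: "(\<integral>\<^sup>+p. ennreal (\<phi> p) \<partial>\<pi>) = (\<integral>\<^sup>+x. \<integral>\<^sup>+y. ennreal (\<phi> (x, y)) \<partial>\<nu> \<partial>\<mu>)"
    if \<phi>: "\<phi> \<in> Cc" "\<And>p. 0 \<le> \<phi> p" for \<phi>
  proof -
    have "(\<integral>\<^sup>+p. ennreal (\<phi> p) \<partial>\<pi>) = ennreal (L \<phi>)"
      using nn_integral_eq_integral[OF Cc_integrable[OF \<pi>(1) \<phi>(1)]] \<phi> \<pi>(2) by simp
    also have "\<dots> = (\<integral>\<^sup>+x. ennreal (\<integral>y. \<phi> (x, y) \<partial>\<nu>) \<partial>\<mu>)"
      unfolding L_def
      by (rule nn_integral_eq_integral[symmetric]) (use Cc_slice_integral[OF \<mu> \<nu> \<phi>(1)] \<phi>(2) in auto)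
    also have "\<dots> = (\<integral>\<^sup>+x. \<integral>\<^sup>+y. ennreal (\<phi> (x, y)) \<partial>\<nu> \<partial>\<mu>)"
      using Cc_slice_integral(1)[OF \<mu> \<nu> \<phi>(1)] \<phi>(2) by (intro nn_integral_cong nn_integral_eq_integral[symmetric]) auto
    finally show ?thesis .
  qed
  have "(\<integral>\<^sup>+p. k p \<partial>\<pi>) = (\<integral>\<^sup>+x. \<integral>\<^sup>+y. k (x, y) \<partial>\<nu> \<partial>\<mu>)" if k: "\<And>c. open {p. c < k p}"
    for k :: "'a \<times> 'a \<Rightarrow> ennreal"
  proof -
    let ?D = "{\<phi>\<in>Cc. \<forall>p. 0 \<le> \<phi> p \<and> ennreal (\<phi> p) \<le> k p}"
    have ne: "?D \<noteq> {}" using Cc_zero by fastforce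
    have dir: "\<exists>h\<in>?D. \<forall>p. i p \<le> h p \<and> j p \<le> h p" if "i \<in> ?D" "j \<in> ?D" for i j
    proof (rule bexI[of _ "\<lambda>p. max (i p) (j p)"])
      show "(\<lambda>p. max (i p) (j p)) \<in> ?D" using that Cc_max[of i j] by (auto simp: max_def)
    qed auto
    have "(\<integral>\<^sup>+x. \<integral>\<^sup>+y. k (x, y) \<partial>\<nu> \<partial>\<mu>) \<le> (SUP \<phi>\<in>?D. \<integral>\<^sup>+x. \<integral>\<^sup>+y. ennreal (\<phi> (x, y)) \<partial>\<nu> \<partial>\<mu>)"
    proof (rule radon_nn_integral_directed[OF \<mu> ne])
      fix i j assume "i \<in> ?D" "j \<in> ?D"
      from dir[OF this] obtain h where h: "h \<in> ?D" "\<And>p. i p \<le> h p" "\<And>p. j p \<le> h p" by blast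
      show "\<exists>h\<in>?D. \<forall>x. (\<integral>\<^sup>+y. ennreal (i (x, y)) \<partial>\<nu>) \<le> (\<integral>\<^sup>+y. ennreal (h (x, y)) \<partial>\<nu>) \<and>
          (\<integral>\<^sup>+y. ennreal (j (x, y)) \<partial>\<nu>) \<le> (\<integral>\<^sup>+y. ennreal (h (x, y)) \<partial>\<nu>)"
        by (rule bexI[OF _ h(1)]) (intro allI conjI nn_integral_mono ennreal_leI h)
    next
      \<comment> \<open>A single test function below \<open>k\<close> brings the inner integral
        above \<open>t\<close> at \<open>x\<close>, and by lower semicontinuity of its partial
        integral also near \<open>x\<close>: this is the local approximation that the outer
        integration demands.\<close>
      fix x t assume t: "t < (\<integral>\<^sup>+y. k (x, y) \<partial>\<nu>)"
      have "(\<integral>\<^sup>+y. k (x, y) \<partial>\<nu>) \<le> (SUP \<phi>\<in>?D. \<integral>\<^sup>+y. ennreal (\<phi> (x, y)) \<partial>\<nu>)"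
      proof (rule radon_nn_integral_directed[OF \<nu> ne])
        fix i j assume "i \<in> ?D" "j \<in> ?D"
        from dir[OF this] obtain h where h: "h \<in> ?D" "\<And>p. i p \<le> h p" "\<And>p. j p \<le> h p" by blast
        show "\<exists>h\<in>?D. \<forall>y. ennreal (i (x, y)) \<le> ennreal (h (x, y)) \<and> ennreal (j (x, y)) \<le> ennreal (h (x, y))"
          by (rule bexI[OF _ h(1)]) (intro allI conjI ennreal_leI h)
      next
        fix y s assume "s < k (x, y)"
        from pr.lsc_Cc_approx[of k, OF k this] obtain \<phi> N where
          N: "\<phi> \<in> ?D" "open N" "(x, y) \<in> N" "\<And>z. z \<in> N \<Longrightarrow> s \<le> ennreal (\<phi> z)" by blast
        obtain M' M where "open M'" and M: "open M" "(x, y) \<in> M' \<times> M" "M' \<times> M \<subseteq> N"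
          by (rule open_prod_elim[OF N(2,3)])
        from M have "y \<in> M" "\<And>z. z \<in> M \<Longrightarrow> (x, z) \<in> N" by auto
        with M(1) show "\<exists>\<phi>\<in>?D. \<exists>N. open N \<and> y \<in> N \<and> (\<forall>z\<in>N. s \<le> ennreal (\<phi> (x, z)))"
          using N by (intro bexI[OF _ N(1)] exI[of _ M]) auto
      qed
      then obtain \<phi> where \<phi>: "\<phi> \<in> ?D" "t < (\<integral>\<^sup>+y. ennreal (\<phi> (x, y)) \<partial>\<nu>)"
        using t by (force simp: less_SUP_iff dest: less_le_trans)
      have "open {x. t < (\<integral>\<^sup>+y. ennreal (\<phi> (x, y)) \<partial>\<nu>)}"
        using \<phi>(1) Cc_cont[of \<phi>] by (intro lsc_nn_integral_param[OF \<nu>, where k = "\<lambda>p. ennreal (\<phi> p)"] lsc_ennreal_cont) auto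
      then show "\<exists>\<phi>\<in>?D. \<exists>N. open N \<and> x \<in> N \<and> (\<forall>z\<in>N. t \<le> (\<integral>\<^sup>+y. ennreal (\<phi> (z, y)) \<partial>\<nu>))"
        using \<phi>(2) by (intro bexI[OF _ \<phi>(1)] exI[of _ "{x. t < (\<integral>\<^sup>+y. ennreal (\<phi> (x, y)) \<partial>\<nu>)}"]) auto
    qed
    also have "\<dots> = (SUP \<phi>\<in>?D. \<integral>\<^sup>+p. ennreal (\<phi> p) \<partial>\<pi>)"
      by (intro SUP_cong refl 1[symmetric]) auto
    also have "\<dots> = (\<integral>\<^sup>+p. k p \<partial>\<pi>)" by (rule pr.nn_integral_lsc_Cc[OF \<pi>(1) k, symmetric])
    finally have "(\<integral>\<^sup>+x. \<integral>\<^sup>+y. k (x, y) \<partial>\<nu> \<partial>\<mu>) \<le> (\<integral>\<^sup>+p. k p \<partial>\<pi>)" .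
    moreover have "(\<integral>\<^sup>+p. k p \<partial>\<pi>) \<le> (\<integral>\<^sup>+x. \<integral>\<^sup>+y. k (x, y) \<partial>\<nu> \<partial>\<mu>)"
      unfolding pr.nn_integral_lsc_Cc[OF \<pi>(1) k]
    proof (rule SUP_least)
      fix \<phi> assume "\<phi> \<in> ?D"
      then have \<phi>: "\<phi> \<in> Cc" "\<And>p. 0 \<le> \<phi> p" "\<And>p. ennreal (\<phi> p) \<le> k p" by auto
      show "(\<integral>\<^sup>+p. ennreal (\<phi> p) \<partial>\<pi>) \<le> (\<integral>\<^sup>+x. \<integral>\<^sup>+y. k (x, y) \<partial>\<nu> \<partial>\<mu>)"
        unfolding 1[OF \<phi>(1,2)] by (intro nn_integral_mono \<phi>(3))
    qed
    ultimately show ?thesis by (rule antisym[rotated])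
  qed
  then show thesis using that[OF \<pi>(1)] by blast
qed

text \<open>The indicator of a compact rectangle is in general not lower semicontinuous. The formula
  \<open>F\<close> is applied to an open rectangle \<open>U \<times> V\<close> and to the open
  difference \<open>W\<close>, which have finite measure, and the compact rectangle arises by
  subtraction.\<close>

lemma radon_rectangle_compact:
  fixes \<mu> \<nu> :: "'a measure"
  assumes \<mu>: "\<mu> \<in> radon" and \<nu>: "\<nu> \<in> radon" and \<pi>: "\<pi> \<in> radon"
    and F: "\<And>k :: 'a \<times> 'a \<Rightarrow> ennreal. (\<And>c. open {p. c < k p}) \<Longrightarrow>
       (\<integral>\<^sup>+p. k p \<partial>\<pi>) = (\<integral>\<^sup>+x. \<integral>\<^sup>+y. k (x, y) \<partial>\<nu> \<partial>\<mu>)"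
    and K: "compact K" "compact K'"
  shows "emeasure \<pi> (K \<times> K') = emeasure \<mu> K * emeasure \<nu> K'"
proof -
  obtain U where U: "open U" "K \<subseteq> U" "compact (closure U)" using compact_nbhd[OF K(1) open_UNIV subset_UNIV] by metis
  obtain V where V: "open V" "K' \<subseteq> V" "compact (closure V)" using compact_nbhd[OF K(2) open_UNIV subset_UNIV] by metis
  define W where "W = U \<times> V - K \<times> K'"
  have oW: "open W" unfolding W_def
    using U V K by (intro open_Diff open_Times compact_imp_closed compact_Times)
  have oUV: "open (U \<times> V)" using U V by (intro open_Times)
  have sets: "sets \<mu> = sets borel" "sets \<nu> = sets borel" "sets \<pi> = sets borel" using \<mu> \<nu> \<pi> radon_sets by blast+
  have KK: "K \<times> K' \<in> sets borel" using K by (intro borel_compact compact_Times)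
  have ii: "(\<integral>\<^sup>+x. \<integral>\<^sup>+y. indicator (B \<times> C) (x, y) \<partial>\<nu> \<partial>\<mu>) = emeasure \<mu> B * emeasure \<nu> C"
    if "B \<in> sets borel" "C \<in> sets borel" for B C
  proof -
    have "(\<integral>\<^sup>+x. \<integral>\<^sup>+y. indicator (B \<times> C) (x, y) \<partial>\<nu> \<partial>\<mu>) = (\<integral>\<^sup>+x. emeasure \<nu> C * indicator B x \<partial>\<mu>)"
      using that sets by (intro nn_integral_cong) (auto simp: indicator_times nn_integral_cmult mult.commute)
    also have "\<dots> = emeasure \<nu> C * emeasure \<mu> B" using that sets by (intro nn_integral_cmult_indicator) auto
    finally show ?thesis by (simp add: mult.commute)
  qed
  define w where "w = (\<integral>\<^sup>+x. \<integral>\<^sup>+y. indicator W (x, y) \<partial>\<nu> \<partial>\<mu>)"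
  have \<pi>W: "emeasure \<pi> W = w"
    using F[OF lsc_indicator[OF oW]] oW sets by (simp add: w_def)
  have \<pi>UV: "emeasure \<pi> (U \<times> V) = emeasure \<mu> U * emeasure \<nu> V"
    using F[OF lsc_indicator[OF oUV]] oUV sets U V by (simp add: ii)
  have "emeasure \<mu> U * emeasure \<nu> V = (\<integral>\<^sup>+x. \<integral>\<^sup>+y. indicator W (x, y) + indicator (K \<times> K') (x, y) \<partial>\<nu> \<partial>\<mu>)"
    unfolding ii[OF borel_open borel_open, OF U(1) V(1), symmetric]
    by (intro nn_integral_cong) (use U V in \<open>auto simp: W_def indicator_def\<close>)
  also have "\<dots> = (\<integral>\<^sup>+x. (\<integral>\<^sup>+y. indicator W (x, y) \<partial>\<nu>) + (\<integral>\<^sup>+y. indicator (K \<times> K') (x, y) \<partial>\<nu>) \<partial>\<mu>)"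
  proof (intro nn_integral_cong nn_integral_add)
    fix x
    have "Pair x -` W \<in> sets borel"
      using oW by (intro borel_open open_vimage) (auto intro!: continuous_intros)
    moreover have eq: "(\<lambda>y. indicator W (x, y)) = (indicator (Pair x -` W) :: 'a \<Rightarrow> ennreal)"
      by (auto simp: indicator_def fun_eq_iff)
    ultimately show "(\<lambda>y. indicator W (x, y) :: ennreal) \<in> borel_measurable \<nu>"
      unfolding eq using sets(2) by (intro borel_measurable_indicator) simp
    show "(\<lambda>y. indicator (K \<times> K') (x, y) :: ennreal) \<in> borel_measurable \<nu>"
      using sets(2) borel_compact[OF K(2)] by (auto simp: indicator_times)
  qed
  also have "\<dots> = w + emeasure \<mu> K * emeasure \<nu> K'"
  proof (subst nn_integral_add)
    have "(\<lambda>x. \<integral>\<^sup>+y. indicator W (x, y) \<partial>\<nu>) \<in> borel_measurable borel"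
      by (intro lsc_measurable lsc_nn_integral_param[OF \<nu>] lsc_indicator oW)
    then show "(\<lambda>x. \<integral>\<^sup>+y. indicator W (x, y) \<partial>\<nu>) \<in> borel_measurable \<mu>" using radon_measurable[OF \<mu>] by blast
    show "(\<lambda>x. \<integral>\<^sup>+y. indicator (K \<times> K') (x, y) \<partial>\<nu>) \<in> borel_measurable \<mu>"
      using sets borel_compact[OF K(1)] borel_compact[OF K(2)] by (simp add: indicator_times nn_integral_cmult)
    show "(\<integral>\<^sup>+x. \<integral>\<^sup>+y. indicator W (x, y) \<partial>\<nu> \<partial>\<mu>) + (\<integral>\<^sup>+x. \<integral>\<^sup>+y. indicator (K \<times> K') (x, y) \<partial>\<nu> \<partial>\<mu>) =
        w + emeasure \<mu> K * emeasure \<nu> K'"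
      using ii[OF borel_compact borel_compact, OF K] by (simp add: w_def)
  qed
  finally have eq1: "emeasure \<mu> U * emeasure \<nu> V = w + emeasure \<mu> K * emeasure \<nu> K'" .
  have "W \<inter> K \<times> K' = {}" "W \<union> K \<times> K' = U \<times> V" using U V unfolding W_def by auto
  then have eq2: "emeasure \<mu> U * emeasure \<nu> V = w + emeasure \<pi> (K \<times> K')"
    using plus_emeasure[of W \<pi> "K \<times> K'"] KK oW sets \<pi>W \<pi>UV by simp
  have "w < \<infinity>"
  proof -
    have "w \<le> emeasure \<pi> (closure U \<times> closure V)"
      unfolding \<pi>W[symmetric] using closure_subset[of U] closure_subset[of V] sets U V
      by (intro emeasure_mono) (auto simp: W_def intro!: borel_compact compact_Times)
    also have "\<dots> < \<infinity>" by (intro radon_compact[OF \<pi>] compact_Times U V)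
    finally show ?thesis .
  qed
  moreover have "w + emeasure \<pi> (K \<times> K') = w + emeasure \<mu> K * emeasure \<nu> K'" using eq1 eq2 by simp
  ultimately show ?thesis by (metis ennreal_add_left_cancel infinity_ennreal_def order_less_irrefl)
qed

text \<open>A compact subset of \<open>B \<times> C\<close> lies in the product of its compact
  projections, and products of compact sets are compact; inner regularity of the three measures does
  the rest.\<close>

lemma radon_rectangle:
  fixes \<mu> \<nu> :: "'a measure"
  assumes \<mu>: "\<mu> \<in> radon" and \<nu>: "\<nu> \<in> radon" and \<pi>: "\<pi> \<in> radon"
    and K: "\<And>K K'. compact K \<Longrightarrow> compact K' \<Longrightarrow> emeasure \<pi> (K \<times> K') = emeasure \<mu> K * emeasure \<nu> K'"
    and B: "B \<in> sets borel" and C: "C \<in> sets borel"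
  shows "emeasure \<pi> (B \<times> C) = emeasure \<mu> B * emeasure \<nu> C"
proof (rule antisym)
  have sets: "sets \<mu> = sets borel" "sets \<nu> = sets borel" "sets \<pi> = sets borel" using \<mu> \<nu> \<pi> radon_sets by blast+
  have BC: "B \<times> C \<in> sets borel" by (rule Borel_Times[OF B C])
  show "emeasure \<pi> (B \<times> C) \<le> emeasure \<mu> B * emeasure \<nu> C"
    unfolding radon_inner[OF \<pi> BC]
  proof (rule SUP_least)
    fix Q assume "Q \<in> {K. compact K \<and> K \<subseteq> B \<times> C}"
    then have Q: "compact Q" "Q \<subseteq> B \<times> C" by auto
    have c: "compact (fst ` Q)" "compact (snd ` Q)"
      using Q(1) by (auto intro!: compact_continuous_image continuous_intros)
    have "emeasure \<pi> Q \<le> emeasure \<pi> (fst ` Q \<times> snd ` Q)"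
      using c sets by (intro emeasure_mono subset_fst_snd) (auto intro!: borel_compact compact_Times)
    also have "\<dots> = emeasure \<mu> (fst ` Q) * emeasure \<nu> (snd ` Q)" using K c by blast
    also have "\<dots> \<le> emeasure \<mu> B * emeasure \<nu> C"
      using Q(2) B C sets by (intro mult_mono emeasure_mono) auto
    finally show "emeasure \<pi> Q \<le> emeasure \<mu> B * emeasure \<nu> C" .
  qed
  show "emeasure \<mu> B * emeasure \<nu> C \<le> emeasure \<pi> (B \<times> C)"
    unfolding radon_inner[OF \<mu> B] radon_inner[OF \<nu> C] SUP_mult_left_ennreal SUP_mult_right_ennreal
  proof (intro SUP_least)
    fix K1 K2 assume "K1 \<in> {K. compact K \<and> K \<subseteq> B}" "K2 \<in> {K. compact K \<and> K \<subseteq> C}"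
    then have "emeasure \<mu> K1 * emeasure \<nu> K2 = emeasure \<pi> (K1 \<times> K2)" "K1 \<times> K2 \<subseteq> B \<times> C" using K by auto
    then show "emeasure \<mu> K1 * emeasure \<nu> K2 \<le> emeasure \<pi> (B \<times> C)" using BC sets by (simp add: emeasure_mono)
  qed
qed

text \<open>Rectangles need not generate the Borel sets of the square, so uniqueness comes from
  regularity: \<open>Q\<close> is covered by finitely many open rectangles inside an open
  \<open>U\<close> of almost the same \<open>\<rho>\<close>-measure, and both measures agree on
  finite unions of rectangles by inclusion-exclusion.\<close>

lemma radon_rectangles_unique_le:
  fixes \<pi> \<rho> :: "('a \<times> 'a) measure"
  assumes \<pi>: "\<pi> \<in> radon" and \<rho>: "\<rho> \<in> radon"
    and eq: "\<And>B C. B \<in> sets borel \<Longrightarrow> C \<in> sets borel \<Longrightarrow> emeasure \<pi> (B \<times> C) = emeasure \<rho> (B \<times> C)"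
    and Q: "compact Q"
  shows "emeasure \<pi> Q \<le> emeasure \<rho> Q"
proof (rule ennreal_le_epsilon)
  interpret pr: lch_space "TYPE('a \<times> 'a)" by (rule lch_prod[OF lch_space_axioms])
  fix e :: real assume "0 < e"
  then obtain U where U: "open U" "Q \<subseteq> U" "compact (closure U)" "emeasure \<rho> U \<le> emeasure \<rho> Q + ennreal e"
    using pr.radon_outer_compact[OF \<rho> Q] by metis
  have sets: "sets \<pi> = sets borel" "sets \<rho> = sets borel" using \<pi> \<rho> radon_sets by blast+
  have fin: "emeasure \<pi> S < \<infinity>" "emeasure \<rho> S < \<infinity>" if "S \<subseteq> U" for S
  proof -
    have "S \<subseteq> closure U" using that closure_subset by blast
    then have "emeasure \<pi> S \<le> emeasure \<pi> (closure U)" "emeasure \<rho> S \<le> emeasure \<rho> (closure U)"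
      using sets by (auto intro!: emeasure_mono)
    then show "emeasure \<pi> S < \<infinity>" "emeasure \<rho> S < \<infinity>"
      using radon_compact[OF \<pi> U(3)] radon_compact[OF \<rho> U(3)] by (auto intro: le_less_trans)
  qed
  let ?R = "{B \<times> C | B C. B \<in> sets (borel :: 'a measure) \<and> C \<in> sets (borel :: 'a measure)}"
  have RB: "R \<in> sets borel" if "R \<in> ?R" for R using that by (auto intro: Borel_Times)
  have eqR: "emeasure \<pi> R = emeasure \<rho> R" if "R \<in> ?R" for R using that by (auto simp: eq)
  have Rint: "R \<inter> S \<in> ?R" if RS: "R \<in> ?R" "S \<in> ?R" for R S
  proof -
    from RS obtain B C B' C' where "R = B \<times> C" "S = B' \<times> C'" "B \<in> sets borel" "C \<in> sets borel" "B' \<in> sets borel" "C' \<in> sets borel" by blast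
    then have "R \<inter> S = (B \<inter> B') \<times> (C \<inter> C')" "B \<inter> B' \<in> sets borel" "C \<inter> C' \<in> sets borel" by auto
    then show ?thesis by blast
  qed
  \<comment> \<open>Inclusion-exclusion for a union involves the intersection of one rectangle with
    the union of the others; these intersections come first, for all \<open>R\<close> at once.
    Staying inside \<open>U\<close> keeps the subtracted terms finite.\<close>
  have agree: "emeasure \<pi> (R \<inter> \<Union>F) = emeasure \<rho> (R \<inter> \<Union>F)"
    if "finite F" "F \<subseteq> ?R" "R \<in> ?R" "R \<subseteq> U" for F R
    using that
  proof (induction F arbitrary: R rule: finite_induct)
    case empty then show ?case by simp
  next
    case (insert S F)
    have S: "S \<in> ?R" and F: "F \<subseteq> ?R" using insert.prems(1) by blast+
    have FB: "\<Union>F \<in> sets borel" by (intro sets.finite_Union subsetI RB) (use insert.hyps(1) F in blast)+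
    note B = RB[OF insert.prems(2)] RB[OF S] FB
    have dec: "emeasure m (R \<inter> \<Union>(insert S F)) + emeasure m ((R \<inter> S) \<inter> \<Union>F) =
        emeasure m (R \<inter> \<Union>F) + emeasure m (R \<inter> S)" if m: "sets m = sets borel" for m
    proof -
      have "R \<inter> \<Union>(insert S F) = (R \<inter> \<Union>F) \<union> (R \<inter> S - \<Union>F)" by auto
      then have "emeasure m (R \<inter> \<Union>(insert S F)) = emeasure m (R \<inter> \<Union>F) + emeasure m (R \<inter> S - \<Union>F)"
        using plus_emeasure[of "R \<inter> \<Union>F" m "R \<inter> S - \<Union>F"] B m by fastforce
      moreover have "emeasure m (R \<inter> S) = emeasure m (R \<inter> S - \<Union>F) + emeasure m ((R \<inter> S) \<inter> \<Union>F)"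
        using B m by (intro emeasure_Diff_Int) auto
      ultimately show ?thesis by (simp add: ac_simps)
    qed
    have RS: "R \<inter> S \<in> ?R" by (rule Rint[OF insert.prems(2) S])
    have "emeasure \<pi> (R \<inter> \<Union>F) = emeasure \<rho> (R \<inter> \<Union>F)" by (rule insert.IH[OF F insert.prems(2,3)])
    moreover have "emeasure \<pi> ((R \<inter> S) \<inter> \<Union>F) = emeasure \<rho> ((R \<inter> S) \<inter> \<Union>F)"
      by (rule insert.IH[OF F RS]) (use insert.prems(3) in auto)
    moreover have "emeasure \<pi> (R \<inter> S) = emeasure \<rho> (R \<inter> S)" using RS by (rule eqR)
    ultimately have "emeasure \<rho> ((R \<inter> S) \<inter> \<Union>F) + emeasure \<pi> (R \<inter> \<Union>(insert S F)) =
        emeasure \<rho> ((R \<inter> S) \<inter> \<Union>F) + emeasure \<rho> (R \<inter> \<Union>(insert S F))"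
      using dec[OF sets(1)] dec[OF sets(2)] by (simp add: add.commute)
    moreover have "emeasure \<rho> ((R \<inter> S) \<inter> \<Union>F) < \<infinity>" using insert.prems(3) by (intro fin) auto
    ultimately show ?case by (metis ennreal_add_left_cancel infinity_ennreal_def order_less_irrefl)
  qed
  have agree': "emeasure \<pi> (\<Union>F) = emeasure \<rho> (\<Union>F)" if "finite F" "F \<subseteq> ?R" "\<Union>F \<subseteq> U" for F
    using that
  proof (induction F rule: finite_induct)
    case empty then show ?case by simp
  next
    case (insert S F)
    have S: "S \<in> ?R" "S \<subseteq> U" and F: "F \<subseteq> ?R" "\<Union>F \<subseteq> U" using insert.prems by blast+
    have FB: "\<Union>F \<in> sets borel" by (intro sets.finite_Union subsetI RB) (use insert.hyps(1) F in blast)+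
    have dec: "emeasure m (\<Union>(insert S F)) + emeasure m (S \<inter> \<Union>F) = emeasure m (\<Union>F) + emeasure m S" if m: "sets m = sets borel" for m
    proof -
      have "\<Union>(insert S F) = \<Union>F \<union> (S - \<Union>F)" by auto
      then have "emeasure m (\<Union>(insert S F)) = emeasure m (\<Union>F) + emeasure m (S - \<Union>F)"
        using plus_emeasure[of "\<Union>F" m "S - \<Union>F"] FB RB[OF S(1)] m by fastforce
      moreover have "emeasure m S = emeasure m (S - \<Union>F) + emeasure m (S \<inter> \<Union>F)"
        using FB RB[OF S(1)] m by (intro emeasure_Diff_Int) auto
      ultimately show ?thesis by (simp add: ac_simps)
    qed
    have "emeasure \<pi> (\<Union>F) = emeasure \<rho> (\<Union>F)" by (rule insert.IH[OF F])
    moreover have "emeasure \<pi> (S \<inter> \<Union>F) = emeasure \<rho> (S \<inter> \<Union>F)" by (rule agree[OF insert.hyps(1) F(1) S])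
    moreover have "emeasure \<pi> S = emeasure \<rho> S" using S(1) by (rule eqR)
    ultimately have "emeasure \<rho> (S \<inter> \<Union>F) + emeasure \<pi> (\<Union>(insert S F)) = emeasure \<rho> (S \<inter> \<Union>F) + emeasure \<rho> (\<Union>(insert S F))"
      using dec[OF sets(1)] dec[OF sets(2)] by (simp add: add.commute)
    moreover have "emeasure \<rho> (S \<inter> \<Union>F) < \<infinity>" using S by (intro fin) auto
    ultimately show ?case by (metis ennreal_add_left_cancel infinity_ennreal_def order_less_irrefl)
  qed
  have "\<exists>F\<in>{F. finite F \<and> F \<subseteq> ?R \<and> \<Union>F \<subseteq> U}. \<forall>z\<in>Q. z \<in> \<Union>F"
  proof (rule compact_directed[OF Q])
    show "{F. finite F \<and> F \<subseteq> ?R \<and> \<Union>F \<subseteq> U} \<noteq> {}" by (auto intro!: exI[of _ "{}"])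
    show "\<exists>k\<in>{F. finite F \<and> F \<subseteq> ?R \<and> \<Union>F \<subseteq> U}. \<forall>z. z \<in> \<Union>i \<or> z \<in> \<Union>j \<longrightarrow> z \<in> \<Union>k"
      if "i \<in> {F. finite F \<and> F \<subseteq> ?R \<and> \<Union>F \<subseteq> U}" "j \<in> {F. finite F \<and> F \<subseteq> ?R \<and> \<Union>F \<subseteq> U}" for i j
      using that by (intro bexI[of _ "i \<union> j"]) auto
    fix p assume "p \<in> Q"
    then have pU: "p \<in> U" using U(2) by blast
    obtain M N where MN: "open M" "open N" "p \<in> M \<times> N" "M \<times> N \<subseteq> U"
      by (rule open_prod_elim[OF U(1) pU])
    have "M \<times> N \<in> ?R"
      by (rule CollectI, rule exI[of _ M], rule exI[of _ N]) (simp add: MN(1,2) borel_open)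
    then have "{M \<times> N} \<in> {F. finite F \<and> F \<subseteq> ?R \<and> \<Union>F \<subseteq> U}" using MN(4) by simp
    then show "\<exists>F\<in>{F. finite F \<and> F \<subseteq> ?R \<and> \<Union>F \<subseteq> U}. \<exists>N. open N \<and> p \<in> N \<and> (\<forall>z\<in>N. z \<in> \<Union>F)"
      using MN open_Times[OF MN(1,2)] by (intro bexI[of _ "{M \<times> N}"] exI[of _ "M \<times> N"]) auto
  qed
  then obtain F where F0: "F \<in> {F. finite F \<and> F \<subseteq> ?R \<and> \<Union>F \<subseteq> U}" "\<forall>z\<in>Q. z \<in> \<Union>F" by (elim bexE)
  then have F: "finite F" "F \<subseteq> ?R" "\<Union>F \<subseteq> U" by simp_all
  have QF: "Q \<subseteq> \<Union>F" using F0(2) by (intro subsetI) (erule bspec)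
  have FB: "\<Union>F \<in> sets borel" by (intro sets.finite_Union subsetI RB) (use F in blast)+
  have "emeasure \<pi> Q \<le> emeasure \<pi> (\<Union>F)" using QF FB sets by (intro emeasure_mono) auto
  also have "\<dots> = emeasure \<rho> (\<Union>F)" by (rule agree'[OF F(1,2,3)])
  also have "\<dots> \<le> emeasure \<rho> U" using F(3) U(1) sets by (intro emeasure_mono) auto
  finally show "emeasure \<pi> Q \<le> emeasure \<rho> Q + ennreal e" using U(4) by simp
qed

lemma radon_rectangles_unique:
  fixes \<pi> \<rho> :: "('a \<times> 'a) measure"
  assumes "\<pi> \<in> radon" "\<rho> \<in> radon"
    "\<And>B C. B \<in> sets borel \<Longrightarrow> C \<in> sets borel \<Longrightarrow> emeasure \<pi> (B \<times> C) = emeasure \<rho> (B \<times> C)"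
  shows "\<pi> = \<rho>"
proof -
  interpret pr: lch_space "TYPE('a \<times> 'a)" by (rule lch_prod[OF lch_space_axioms])
  show ?thesis
  proof (rule pr.radon_eqI_compact[OF assms(1,2)])
    fix Q :: "('a \<times> 'a) set" assume Q: "compact Q"
    show "emeasure \<pi> Q = emeasure \<rho> Q"
      by (rule antisym; rule radon_rectangles_unique_le) (use assms Q in auto)
  qed
qed

lemma nn_integral_radon_prod:
  fixes \<mu> \<nu> :: "'a measure" and k :: "'a \<times> 'a \<Rightarrow> ennreal"
  assumes \<mu>: "\<mu> \<in> radon" and \<nu>: "\<nu> \<in> radon" and k: "\<And>c. open {p. c < k p}"
  shows "(\<integral>\<^sup>+p. k p \<partial>radon_prod \<mu> \<nu>) = (\<integral>\<^sup>+x. \<integral>\<^sup>+y. k (x, y) \<partial>\<nu> \<partial>\<mu>)"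
    and "radon_prod \<mu> \<nu> \<in> radon"
    and "\<And>B C. B \<in> sets borel \<Longrightarrow> C \<in> sets borel \<Longrightarrow> emeasure (radon_prod \<mu> \<nu>) (B \<times> C) = emeasure \<mu> B * emeasure \<nu> C"
proof -
  obtain \<pi> where \<pi>: "\<pi> \<in> radon"
    "\<And>k :: 'a \<times> 'a \<Rightarrow> ennreal. (\<And>c. open {p. c < k p}) \<Longrightarrow>
       (\<integral>\<^sup>+p. k p \<partial>\<pi>) = (\<integral>\<^sup>+x. \<integral>\<^sup>+y. k (x, y) \<partial>\<nu> \<partial>\<mu>)"
    using radon_product_exists[OF \<mu> \<nu>] by metis
  have r: "emeasure \<pi> (B \<times> C) = emeasure \<mu> B * emeasure \<nu> C" if "B \<in> sets borel" "C \<in> sets borel" for B C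
    by (rule radon_rectangle[OF \<mu> \<nu> \<pi>(1) radon_rectangle_compact[OF \<mu> \<nu> \<pi>] that])
  have "radon_prod \<mu> \<nu> = \<pi>"
    unfolding radon_prod_def
  proof (rule the_equality)
    fix \<rho> assume "\<rho> \<in> radon \<and> (\<forall>B\<in>sets borel. \<forall>C\<in>sets borel. emeasure \<rho> (B \<times> C) = emeasure \<mu> B * emeasure \<nu> C)"
    then show "\<rho> = \<pi>" by (intro radon_rectangles_unique) (use \<pi>(1) r in auto)
  qed (use \<pi>(1) r in auto)
  then show "(\<integral>\<^sup>+p. k p \<partial>radon_prod \<mu> \<nu>) = (\<integral>\<^sup>+x. \<integral>\<^sup>+y. k (x, y) \<partial>\<nu> \<partial>\<mu>)" "radon_prod \<mu> \<nu> \<in> radon"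
    "\<And>B C. B \<in> sets borel \<Longrightarrow> C \<in> sets borel \<Longrightarrow> emeasure (radon_prod \<mu> \<nu>) (B \<times> C) = emeasure \<mu> B * emeasure \<nu> C"
    using \<pi> k r by auto
qed

text \<open>Tonelli's theorem beyond sigma-finite measures: the image of
  \<open>radon_prod \<nu> \<mu>\<close> under exchange of coordinates is Radon and has the same
  values on rectangles as \<open>radon_prod \<mu> \<nu>\<close>, hence equals it.\<close>

lemma nn_integral_radon_swap:
  fixes \<mu> \<nu> :: "'a measure" and k :: "'a \<times> 'a \<Rightarrow> ennreal"
  assumes \<mu>: "\<mu> \<in> radon" and \<nu>: "\<nu> \<in> radon" and k: "\<And>c. open {p. c < k p}"
  shows "(\<integral>\<^sup>+x. \<integral>\<^sup>+y. k (x, y) \<partial>\<nu> \<partial>\<mu>) = (\<integral>\<^sup>+y. \<integral>\<^sup>+x. k (x, y) \<partial>\<mu> \<partial>\<nu>)"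
proof -
  let ?\<pi> = "radon_prod \<nu> \<mu>"
  define \<rho> where "\<rho> = distr ?\<pi> borel prod.swap"
  have lsc1: "\<And>c. open {p::'a \<times> 'a. c < (1::ennreal)}" by simp
  have \<pi>: "?\<pi> \<in> radon" by (rule nn_integral_radon_prod(2)[OF \<nu> \<mu> lsc1])
  have sp: "space ?\<pi> = UNIV" "sets ?\<pi> = sets borel" using radon_space[OF \<pi>] radon_sets[OF \<pi>] .
  have cs: "continuous_on UNIV (prod.swap :: 'a \<times> 'a \<Rightarrow> _)"
    unfolding prod.swap_def by (intro continuous_intros)
  have ms: "prod.swap \<in> measurable ?\<pi> (borel :: ('a \<times> 'a) measure)"
    using borel_measurable_continuous_onI[OF cs] sp(2) measurable_cong_sets by blast
  have em: "emeasure \<rho> B = emeasure ?\<pi> (prod.swap -` B)" if "B \<in> sets borel" for B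
    unfolding \<rho>_def using emeasure_distr[OF ms that] sp by simp
  have cK: "compact (prod.swap -` K)" if "compact K" for K :: "('a \<times> 'a) set"
  proof -
    have "prod.swap -` K = prod.swap ` K" by force
    then show ?thesis using compact_continuous_image[OF continuous_on_subset[OF cs subset_UNIV] that] by simp
  qed
  have \<rho>: "\<rho> \<in> radon"
    unfolding radon_def
  proof (intro CollectI conjI allI impI ballI)
    show "sets \<rho> = sets borel" by (simp add: \<rho>_def)
    show "emeasure \<rho> K < \<infinity>" if "compact K" for K
      using em[OF borel_compact[OF that]] radon_compact[OF \<pi> cK[OF that]] by simp
    show "emeasure \<rho> B = (SUP K\<in>{K. compact K \<and> K \<subseteq> B}. emeasure \<rho> K)" if B: "B \<in> sets borel" for B
    proof (rule antisym)
      have sB: "prod.swap -` B \<in> sets borel" using measurable_sets[OF ms B] sp by simp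
      show "emeasure \<rho> B \<le> (SUP K\<in>{K. compact K \<and> K \<subseteq> B}. emeasure \<rho> K)"
        unfolding em[OF B] radon_inner[OF \<pi> sB]
      proof (rule SUP_least)
        fix K assume "K \<in> {K. compact K \<and> K \<subseteq> prod.swap -` B}"
        then have K: "compact (prod.swap -` K)" "prod.swap -` K \<subseteq> B" "prod.swap -` (prod.swap -` K) = K"
          using cK by (auto simp: vimage_def subset_eq)
        have "emeasure ?\<pi> K = emeasure \<rho> (prod.swap -` K)" using em[OF borel_compact[OF K(1)]] K(3) by simp
        also have "\<dots> \<le> (SUP K\<in>{K. compact K \<and> K \<subseteq> B}. emeasure \<rho> K)" using K by (intro SUP_upper) auto
        finally show "emeasure ?\<pi> K \<le> (SUP K\<in>{K. compact K \<and> K \<subseteq> B}. emeasure \<rho> K)" .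
      qed
      show "(SUP K\<in>{K. compact K \<and> K \<subseteq> B}. emeasure \<rho> K) \<le> emeasure \<rho> B"
        using B by (intro SUP_least emeasure_mono) (auto simp: \<rho>_def)
    qed
  qed
  have rect: "radon_prod \<mu> \<nu> = \<rho>"
  proof (rule radon_rectangles_unique[OF nn_integral_radon_prod(2)[OF \<mu> \<nu> lsc1] \<rho>])
    fix B C :: "'a set" assume BC: "B \<in> sets borel" "C \<in> sets borel"
    have "prod.swap -` (B \<times> C) = C \<times> B" by auto
    then show "emeasure (radon_prod \<mu> \<nu>) (B \<times> C) = emeasure \<rho> (B \<times> C)"
      using BC em[OF Borel_Times[OF BC]] nn_integral_radon_prod(3)[OF \<mu> \<nu> lsc1 BC] nn_integral_radon_prod(3)[OF \<nu> \<mu> lsc1 BC(2,1)]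
      by (simp add: mult.commute)
  qed
  have k': "open {p. c < k (prod.swap p)}" for c
    using open_vimage[OF k[of c] cs] by (simp add: vimage_def)
  have "(\<integral>\<^sup>+x. \<integral>\<^sup>+y. k (x, y) \<partial>\<nu> \<partial>\<mu>) = (\<integral>\<^sup>+p. k p \<partial>\<rho>)"
    using nn_integral_radon_prod(1)[OF \<mu> \<nu> k] rect by simp
  also have "\<dots> = (\<integral>\<^sup>+p. k (prod.swap p) \<partial>?\<pi>)"
    unfolding \<rho>_def by (rule nn_integral_distr[OF ms]) (simp add: lsc_measurable[OF k])
  also have "\<dots> = (\<integral>\<^sup>+y. \<integral>\<^sup>+x. k (x, y) \<partial>\<mu> \<partial>\<nu>)"
    using nn_integral_radon_prod(1)[OF \<nu> \<mu> k'] by simp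
  finally show ?thesis .
qed

end

subsection \<open>Sums, restrictions and supports of Radon measures\<close>

text \<open>One construction for three uses: midpoints, combinations with nonnegative coefficients,
  and sums of possibly infinitely many plate measures. With weights in \<open>ennreal\<close> no
  question of convergence arises.\<close>

definition wsum :: "nat set \<Rightarrow> (nat \<Rightarrow> ennreal) \<Rightarrow> (nat \<Rightarrow> 'a::topological_space measure) \<Rightarrow> 'a measure" where
  "wsum J w \<mu> = measure_of UNIV (sets borel) (\<lambda>B. \<integral>\<^sup>+i. w i * emeasure (\<mu> i) B \<partial>count_space J)"

lemma sets_wsum: "sets (wsum J w \<mu>) = sets (borel :: 'a::topological_space measure)"
  unfolding wsum_def using sets.sets_measure_of_eq[of "borel :: 'a measure"] by simp

lemma emeasure_wsum:
  fixes \<mu> :: "nat \<Rightarrow> 'a::topological_space measure"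
  assumes s: "\<And>i. i \<in> J \<Longrightarrow> sets (\<mu> i) = sets borel" and B: "B \<in> sets borel"
  shows "emeasure (wsum J w \<mu>) B = (\<integral>\<^sup>+i. w i * emeasure (\<mu> i) B \<partial>count_space J)"
proof (rule emeasure_measure_of[OF wsum_def])
  show "countably_additive (sets (wsum J w \<mu>)) (\<lambda>B. \<integral>\<^sup>+i. w i * emeasure (\<mu> i) B \<partial>count_space J)"
    unfolding countably_additive_def sets_wsum
  proof (intro allI impI)
    fix A :: "nat \<Rightarrow> 'a set" assume A: "range A \<subseteq> sets borel" "disjoint_family A" "\<Union>(range A) \<in> sets borel"
    have "(\<Sum>n. \<integral>\<^sup>+i. w i * emeasure (\<mu> i) (A n) \<partial>count_space J) = (\<integral>\<^sup>+i. (\<Sum>n. w i * emeasure (\<mu> i) (A n)) \<partial>count_space J)"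
      by (rule nn_integral_suminf[symmetric]) simp
    also have "\<dots> = (\<integral>\<^sup>+i. w i * emeasure (\<mu> i) (\<Union>(range A)) \<partial>count_space J)"
      using A s by (intro nn_integral_cong) (simp add: suminf_emeasure)
    finally show "(\<Sum>n. \<integral>\<^sup>+i. w i * emeasure (\<mu> i) (A n) \<partial>count_space J) =
        (\<integral>\<^sup>+i. w i * emeasure (\<mu> i) (\<Union>(range A)) \<partial>count_space J)" .
  qed
qed (use B in \<open>auto simp: positive_def sets_wsum\<close>)

lemma nn_integral_wsum:
  fixes \<mu> :: "nat \<Rightarrow> 'a::topological_space measure"
  assumes s: "\<And>i. i \<in> J \<Longrightarrow> sets (\<mu> i) = sets borel" and u: "u \<in> borel_measurable borel"
  shows "(\<integral>\<^sup>+x. u x \<partial>wsum J w \<mu>) = (\<integral>\<^sup>+i. w i * (\<integral>\<^sup>+x. u x \<partial>\<mu> i) \<partial>count_space J)"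
  using u
proof (induction u rule: borel_measurable_induct)
  case (cong f g)
  then show ?case by (simp add: space_borel)
next
  case (set A)
  have "(\<integral>\<^sup>+x. indicator A x \<partial>wsum J w \<mu>) = emeasure (wsum J w \<mu>) A" using set by (simp add: sets_wsum)
  also have "\<dots> = (\<integral>\<^sup>+i. w i * emeasure (\<mu> i) A \<partial>count_space J)" by (rule emeasure_wsum[OF s]) (use set in auto)
  also have "\<dots> = (\<integral>\<^sup>+i. w i * (\<integral>\<^sup>+x. indicator A x \<partial>\<mu> i) \<partial>count_space J)"
    using set s by (intro nn_integral_cong) simp
  finally show ?case .
next
  case (mult u c)
  have m: "u \<in> borel_measurable (wsum J w \<mu>)" "\<And>i. i \<in> J \<Longrightarrow> u \<in> borel_measurable (\<mu> i)"
    using mult(2) measurable_cong_sets[OF sets_wsum refl] measurable_cong_sets[OF s refl] by blast+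
  have "(\<integral>\<^sup>+x. c * u x \<partial>wsum J w \<mu>) = c * (\<integral>\<^sup>+i. w i * (\<integral>\<^sup>+x. u x \<partial>\<mu> i) \<partial>count_space J)"
    using m mult by (simp add: nn_integral_cmult)
  also have "\<dots> = (\<integral>\<^sup>+i. w i * (\<integral>\<^sup>+x. c * u x \<partial>\<mu> i) \<partial>count_space J)"
    using m by (subst nn_integral_cmult[symmetric], simp, intro nn_integral_cong)
      (simp add: nn_integral_cmult mult.left_commute[of c])
  finally show ?case .
next
  case (add u v)
  have m: "u \<in> borel_measurable (wsum J w \<mu>)" "\<And>i. i \<in> J \<Longrightarrow> u \<in> borel_measurable (\<mu> i)"
    "v \<in> borel_measurable (wsum J w \<mu>)" "\<And>i. i \<in> J \<Longrightarrow> v \<in> borel_measurable (\<mu> i)"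
    using add measurable_cong_sets[OF sets_wsum refl] measurable_cong_sets[OF s refl] by blast+
  have "(\<integral>\<^sup>+x. v x + u x \<partial>wsum J w \<mu>) =
      (\<integral>\<^sup>+i. w i * (\<integral>\<^sup>+x. v x \<partial>\<mu> i) \<partial>count_space J) + (\<integral>\<^sup>+i. w i * (\<integral>\<^sup>+x. u x \<partial>\<mu> i) \<partial>count_space J)"
    using m add by (simp add: nn_integral_add)
  also have "\<dots> = (\<integral>\<^sup>+i. w i * (\<integral>\<^sup>+x. v x + u x \<partial>\<mu> i) \<partial>count_space J)"
    using m by (subst nn_integral_add[symmetric], simp, simp, intro nn_integral_cong)
      (simp add: nn_integral_add distrib_left)
  finally show ?case .
next
  case (seq U)
  have m: "\<And>n. U n \<in> borel_measurable (wsum J w \<mu>)" "\<And>i n. i \<in> J \<Longrightarrow> U n \<in> borel_measurable (\<mu> i)"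
    using seq measurable_cong_sets[OF sets_wsum refl] measurable_cong_sets[OF s refl] by blast+
  have "(\<integral>\<^sup>+x. (SUP n. U n x) \<partial>wsum J w \<mu>) = (SUP n. \<integral>\<^sup>+i. w i * (\<integral>\<^sup>+x. U n x \<partial>\<mu> i) \<partial>count_space J)"
    using m seq by (subst nn_integral_monotone_convergence_SUP) auto
  also have "\<dots> = (\<integral>\<^sup>+i. (SUP n. w i * (\<integral>\<^sup>+x. U n x \<partial>\<mu> i)) \<partial>count_space J)"
    using seq by (intro nn_integral_monotone_convergence_SUP[symmetric])
      (auto simp: incseq_def le_fun_def intro!: mult_left_mono nn_integral_mono)
  also have "\<dots> = (\<integral>\<^sup>+i. w i * (\<integral>\<^sup>+x. (SUP n. U n x) \<partial>\<mu> i) \<partial>count_space J)"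
    using m seq by (intro nn_integral_cong) (simp add: nn_integral_monotone_convergence_SUP SUP_mult_left_ennreal)
  finally show ?case by (simp add: image_comp)
qed

lemma nn_integral_count_space_SUP_directed:
  fixes h :: "nat \<Rightarrow> 'b \<Rightarrow> ennreal"
  assumes "\<And>a b. a \<in> D \<Longrightarrow> b \<in> D \<Longrightarrow> \<exists>c\<in>D. \<forall>i. h i a \<le> h i c \<and> h i b \<le> h i c"
  shows "(\<integral>\<^sup>+i. (SUP a\<in>D. h i a) \<partial>count_space J) = (SUP a\<in>D. \<integral>\<^sup>+i. h i a \<partial>count_space J)"
proof -
  have eq: "(\<integral>\<^sup>+i. f i \<partial>count_space J) = (\<Sum>i. f i * indicator J i)" for f :: "nat \<Rightarrow> ennreal"
    by (simp add: nn_integral_count_space_indicator nn_integral_count_space_nat)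
  have "(\<Sum>i. (SUP a\<in>D. h i a * indicator J i)) = (SUP a\<in>D. \<Sum>i. h i a * indicator J i)"
  proof (rule ennreal_suminf_SUP_eq_directed)
    fix N :: "nat set" and a b assume "a \<in> D" "b \<in> D"
    then obtain c where "c \<in> D" "\<And>i. h i a \<le> h i c \<and> h i b \<le> h i c" using assms by blast
    then show "\<exists>k\<in>D. \<forall>n\<in>N. h n a * indicator J n \<le> h n k * indicator J n \<and> h n b * indicator J n \<le> h n k * indicator J n"
      by (intro bexI[of _ c]) (auto simp: indicator_def)
  qed
  then show ?thesis unfolding eq by (simp add: SUP_mult_right_ennreal)
qed

text \<open>Inner regularity passes to the sum because suprema over compact subsets, being directed,
  commute with the summation over indices.\<close>

lemma radon_wsum:
  fixes \<mu> :: "nat \<Rightarrow> 'a::t2_space measure"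
  assumes r: "\<And>i. i \<in> J \<Longrightarrow> \<mu> i \<in> radon"
    and fin: "\<And>K. compact K \<Longrightarrow> (\<integral>\<^sup>+i. w i * emeasure (\<mu> i) K \<partial>count_space J) < \<infinity>"
  shows "wsum J w \<mu> \<in> radon"
  unfolding radon_def
proof (intro CollectI conjI allI impI ballI)
  have s: "\<And>i. i \<in> J \<Longrightarrow> sets (\<mu> i) = sets borel" using r radon_sets by blast
  show "sets (wsum J w \<mu>) = sets borel" by (rule sets_wsum)
  show "emeasure (wsum J w \<mu>) K < \<infinity>" if "compact K" for K
    using emeasure_wsum[OF s borel_compact[OF that], where w = w] fin[OF that] by simp
  show "emeasure (wsum J w \<mu>) B = (SUP K\<in>{K. compact K \<and> K \<subseteq> B}. emeasure (wsum J w \<mu>) K)"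
    if B: "B \<in> sets borel" for B
  proof -
    let ?D = "{K. compact K \<and> K \<subseteq> B}"
    define h where "h i K = (if i \<in> J then w i * emeasure (\<mu> i) K else 0)" for i K
    have "emeasure (wsum J w \<mu>) B = (\<integral>\<^sup>+i. w i * emeasure (\<mu> i) B \<partial>count_space J)"
      by (rule emeasure_wsum[OF s B])
    also have "\<dots> = (\<integral>\<^sup>+i. (SUP K\<in>?D. h i K) \<partial>count_space J)"
      using radon_inner[OF r B] by (intro nn_integral_cong) (simp add: h_def SUP_mult_left_ennreal)
    also have "\<dots> = (SUP K\<in>?D. \<integral>\<^sup>+i. h i K \<partial>count_space J)"
    proof (rule nn_integral_count_space_SUP_directed)
      fix K K' assume K: "K \<in> ?D" "K' \<in> ?D"
      have "h i K \<le> h i (K \<union> K') \<and> h i K' \<le> h i (K \<union> K')" for i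
        using K s by (auto simp: h_def intro!: mult_left_mono emeasure_mono borel_compact compact_Un)
      then show "\<exists>c\<in>?D. \<forall>i. h i K \<le> h i c \<and> h i K' \<le> h i c"
        using K by (intro bexI[of _ "K \<union> K'"]) (auto simp: compact_Un)
    qed
    also have "\<dots> = (SUP K\<in>?D. emeasure (wsum J w \<mu>) K)"
      by (intro SUP_cong refl) (auto simp: h_def emeasure_wsum[OF s borel_compact] intro!: nn_integral_cong)
    finally show ?thesis .
  qed
qed

definition mid :: "'a::topological_space measure \<Rightarrow> 'a measure \<Rightarrow> 'a measure" where
  "mid \<mu> \<nu> = wsum {0, 1} (\<lambda>_. ennreal (1/2)) (\<lambda>i. if i = 0 then \<mu> else \<nu>)"

lemma nn_integral_mid:
  assumes "\<mu> \<in> radon" "\<nu> \<in> radon" "u \<in> borel_measurable borel"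
  shows "(\<integral>\<^sup>+x. u x \<partial>mid \<mu> \<nu>) = ennreal (1/2) * (\<integral>\<^sup>+x. u x \<partial>\<mu>) + ennreal (1/2) * (\<integral>\<^sup>+x. u x \<partial>\<nu>)"
  unfolding mid_def
  by (subst nn_integral_wsum) (use assms radon_sets in \<open>auto simp: nn_integral_count_space_finite\<close>)

lemma emeasure_mid:
  assumes "\<mu> \<in> radon" "\<nu> \<in> radon" "B \<in> sets borel"
  shows "emeasure (mid \<mu> \<nu>) B = ennreal (1/2) * emeasure \<mu> B + ennreal (1/2) * emeasure \<nu> B"
  unfolding mid_def
  by (subst emeasure_wsum) (use assms radon_sets in \<open>auto simp: nn_integral_count_space_finite\<close>)

lemma inverse_2_less_top: "inverse (2::ennreal) < top"
  using ennreal_less_top[of "1/2"] by simp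

lemma radon_mid:
  assumes "\<mu> \<in> radon" "\<nu> \<in> (radon :: 'a::t2_space measure set)"
  shows "mid \<mu> \<nu> \<in> radon"
  unfolding mid_def
  by (rule radon_wsum)
    (use assms in \<open>auto simp: nn_integral_count_space_finite ennreal_mult_less_top inverse_2_less_top dest: radon_compact\<close>)

lemma radon_integrable_measurable:
  "\<mu> \<in> radon \<Longrightarrow> integrable \<mu> u \<Longrightarrow> (u :: _ \<Rightarrow> real) \<in> borel_measurable borel"
  using radon_measurable by (blast dest: borel_measurable_integrable)

lemma integral_wsum:
  fixes u :: "'a::t2_space \<Rightarrow> real"
  assumes s: "\<And>i. i \<in> J \<Longrightarrow> sets (\<mu> i) = sets borel" and J: "finite J"
    and u: "u \<in> borel_measurable borel" "\<And>i. i \<in> J \<Longrightarrow> integrable (\<mu> i) u" and w: "\<And>i. i \<in> J \<Longrightarrow> 0 \<le> w i"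
  shows "integrable (wsum J (\<lambda>i. ennreal (w i)) \<mu>) u"
    "integral\<^sup>L (wsum J (\<lambda>i. ennreal (w i)) \<mu>) u = (\<Sum>i\<in>J. w i * integral\<^sup>L (\<mu> i) u)"
proof -
  let ?W = "wsum J (\<lambda>i. ennreal (w i)) \<mu>"
  have nn: "(\<integral>\<^sup>+x. ennreal (v x) \<partial>?W) = (\<Sum>i\<in>J. ennreal (w i) * (\<integral>\<^sup>+x. ennreal (v x) \<partial>\<mu> i))"
    if "v \<in> borel_measurable borel" for v :: "'a \<Rightarrow> real"
    using nn_integral_wsum[OF s, where u = "\<lambda>x. ennreal (v x)"] that J by (simp add: nn_integral_count_space_finite)
  have fin: "(\<integral>\<^sup>+x. ennreal (norm (u x)) \<partial>\<mu> i) < \<infinity>" if "i \<in> J" for i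
    using u(2)[OF that] by (simp add: integrable_iff_bounded)
  show int: "integrable ?W u"
    unfolding integrable_iff_bounded
  proof
    show "u \<in> borel_measurable ?W" using u(1) measurable_cong_sets[OF sets_wsum refl] by blast
    show "(\<integral>\<^sup>+x. ennreal (norm (u x)) \<partial>?W) < \<infinity>"
      using fin u(1) by (subst nn) (auto simp: ennreal_mult_less_top ennreal_sum_less_top[OF J])
  qed
  have e: "enn2real (\<integral>\<^sup>+x. ennreal (v x) \<partial>?W) = (\<Sum>i\<in>J. w i * enn2real (\<integral>\<^sup>+x. ennreal (v x) \<partial>\<mu> i))"
    if v: "v \<in> borel_measurable borel" "\<And>x. v x \<le> norm (u x)" for v :: "'a \<Rightarrow> real"
  proof -
    have f: "(\<integral>\<^sup>+x. ennreal (v x) \<partial>\<mu> i) < top" if "i \<in> J" for i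
      using fin[OF that] nn_integral_mono[of "\<mu> i" "\<lambda>x. ennreal (v x)" "\<lambda>x. ennreal (norm (u x))"] v(2)
      by (auto intro: le_less_trans ennreal_leI)
    show ?thesis unfolding nn[OF v(1)] using w f by (subst enn2real_sum) (auto simp: enn2real_mult ennreal_mult_less_top)
  qed
  show "integral\<^sup>L ?W u = (\<Sum>i\<in>J. w i * integral\<^sup>L (\<mu> i) u)"
    unfolding real_lebesgue_integral_def[OF int]
    using u by (simp add: e real_lebesgue_integral_def sum_subtractf right_diff_distrib)
qed

lemma integral_mid:
  fixes u :: "'a::t2_space \<Rightarrow> real"
  assumes "\<mu> \<in> radon" "\<nu> \<in> radon" "integrable \<mu> u" "integrable \<nu> u"
  shows "integrable (mid \<mu> \<nu>) u" "integral\<^sup>L (mid \<mu> \<nu>) u = (integral\<^sup>L \<mu> u + integral\<^sup>L \<nu> u) / 2"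
proof -
  have s: "\<And>i. i \<in> {0::nat, 1} \<Longrightarrow> sets (if i = 0 then \<mu> else \<nu>) = sets borel" using assms radon_sets by auto
  have int: "\<And>i. i \<in> {0::nat, 1} \<Longrightarrow> integrable (if i = 0 then \<mu> else \<nu>) u" using assms by auto
  have "integrable (wsum {0, 1} (\<lambda>i. ennreal (1/2)) (\<lambda>i. if i = 0 then \<mu> else \<nu>)) u"
    by (rule integral_wsum(1)[OF s _ radon_integrable_measurable[OF assms(1,3)] int]) auto
  then show "integrable (mid \<mu> \<nu>) u" unfolding mid_def .
  have "integral\<^sup>L (wsum {0, 1} (\<lambda>i. ennreal (1/2)) (\<lambda>i. if i = 0 then \<mu> else \<nu>)) u =
      (\<Sum>i\<in>{0::nat, 1}. 1/2 * integral\<^sup>L (if i = 0 then \<mu> else \<nu>) u)"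
    by (rule integral_wsum(2)[OF s _ radon_integrable_measurable[OF assms(1,3)] int]) auto
  then show "integral\<^sup>L (mid \<mu> \<nu>) u = (integral\<^sup>L \<mu> u + integral\<^sup>L \<nu> u) / 2" unfolding mid_def by simp
qed

section \<open>Restriction, domination and support\<close>

lemma radon_restrict:
  fixes \<mu> :: "'a::t2_space measure"
  assumes \<mu>: "\<mu> \<in> radon" and S: "S \<in> sets borel"
  shows "density \<mu> (indicator S) \<in> radon" 
    and "\<And>B. B \<in> sets borel \<Longrightarrow> emeasure (density \<mu> (indicator S)) B = emeasure \<mu> (S \<inter> B)"
proof -
  note s = radon_sets[OF \<mu>]
  show em: "emeasure (density \<mu> (indicator S)) B = emeasure \<mu> (S \<inter> B)" if "B \<in> sets borel" for B
  proof -
    have "emeasure (density \<mu> (indicator S)) B = (\<integral>\<^sup>+x. indicator S x * indicator B x \<partial>\<mu>)"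
      using S that s by (intro emeasure_density) auto
    also have "\<dots> = (\<integral>\<^sup>+x. indicator (S \<inter> B) x \<partial>\<mu>)" by (simp only: indicator_inter_arith)
    also have "\<dots> = emeasure \<mu> (S \<inter> B)" using S that s by (intro nn_integral_indicator) auto
    finally show ?thesis .
  qed
  have leS: "emeasure (density \<mu> (indicator S)) B \<le> emeasure \<mu> B" if "B \<in> sets borel" for B
    using em[OF that] that s by (simp add: emeasure_mono)
  show "density \<mu> (indicator S) \<in> radon"
    unfolding radon_def
  proof (intro CollectI conjI allI impI ballI)
    show "sets (density \<mu> (indicator S)) = sets borel" using s by simp
    show "emeasure (density \<mu> (indicator S)) K < \<infinity>" if "compact K" for K
      using leS[OF borel_compact[OF that]] radon_compact[OF \<mu> that] by (rule le_less_trans)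
    fix B :: "'a set" assume B: "B \<in> sets borel"
    show "emeasure (density \<mu> (indicator S)) B = (SUP K\<in>{K. compact K \<and> K \<subseteq> B}. emeasure (density \<mu> (indicator S)) K)"
    proof (rule antisym)
      have SB: "S \<inter> B \<in> sets borel" using S B by auto
      show "emeasure (density \<mu> (indicator S)) B \<le> (SUP K\<in>{K. compact K \<and> K \<subseteq> B}. emeasure (density \<mu> (indicator S)) K)"
        unfolding em[OF B] radon_inner[OF \<mu> SB]
      proof (rule SUP_least)
        fix K assume "K \<in> {K. compact K \<and> K \<subseteq> S \<inter> B}"
        then have K: "compact K" "K \<subseteq> B" "S \<inter> K = K" by auto
        have "emeasure \<mu> K = emeasure (density \<mu> (indicator S)) K" using em[OF borel_compact[OF K(1)]] K(3) by simp
        also have "\<dots> \<le> (SUP K\<in>{K. compact K \<and> K \<subseteq> B}. emeasure (density \<mu> (indicator S)) K)"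
          using K by (intro SUP_upper) auto
        finally show "emeasure \<mu> K \<le> (SUP K\<in>{K. compact K \<and> K \<subseteq> B}. emeasure (density \<mu> (indicator S)) K)" .
      qed
      show "(SUP K\<in>{K. compact K \<and> K \<subseteq> B}. emeasure (density \<mu> (indicator S)) K) \<le> emeasure (density \<mu> (indicator S)) B"
        using B s by (intro SUP_least emeasure_mono) auto
    qed
  qed
qed

lemma nn_integral_restrict:
  assumes "\<mu> \<in> radon" "S \<in> sets borel" "u \<in> borel_measurable borel"
  shows "(\<integral>\<^sup>+x. u x \<partial>density \<mu> (indicator S)) = (\<integral>\<^sup>+x. indicator S x * u x \<partial>\<mu>)"
  using assms radon_measurable[OF assms(1)] radon_sets[OF assms(1)] by (intro nn_integral_density) auto

text \<open>A compact part of \<open>B\<close> that misses little of the \<open>\<mu>\<close>-mass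
  misses no more of the \<open>\<nu>\<close>-mass. It serves the differences arising from the Hahn
  decomposition.\<close>

lemma radon_dominated:
  fixes \<mu> \<nu> :: "'a::t2_space measure"
  assumes \<mu>: "\<mu> \<in> radon" "emeasure \<mu> UNIV < \<infinity>" and s: "sets \<nu> = sets borel"
    and le: "\<And>B. B \<in> sets borel \<Longrightarrow> emeasure \<nu> B \<le> emeasure \<mu> B"
  shows "\<nu> \<in> radon"
  unfolding radon_def
proof (intro CollectI conjI allI impI ballI)
  note sm = radon_sets[OF \<mu>(1)]
  show "sets \<nu> = sets borel" by (rule s)
  show "emeasure \<nu> K < \<infinity>" if "compact K" for K
    using le[OF borel_compact[OF that]] radon_compact[OF \<mu>(1) that] by (rule le_less_trans)
  fix B :: "'a set" assume B: "B \<in> sets borel"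
  show "emeasure \<nu> B = (SUP K\<in>{K. compact K \<and> K \<subseteq> B}. emeasure \<nu> K)"
  proof (rule antisym)
    show "emeasure \<nu> B \<le> (SUP K\<in>{K. compact K \<and> K \<subseteq> B}. emeasure \<nu> K)"
    proof (rule ennreal_le_epsilon)
      fix e :: real assume e: "0 < e"
      have "\<exists>K. compact K \<and> K \<subseteq> B \<and> emeasure \<mu> B \<le> emeasure \<mu> K + ennreal e"
      proof (cases "emeasure \<mu> B \<le> ennreal e")
        case True then show ?thesis by (intro exI[of _ "{}"]) auto
      next
        case False
        have fB: "emeasure \<mu> B < \<infinity>" using emeasure_mono[of B UNIV \<mu>] \<mu>(2) sm by (auto intro: le_less_trans)
        have "0 < emeasure \<mu> B" using False by (intro le_less_trans[OF zero_le]) (simp add: not_le)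
        then have "emeasure \<mu> B - ennreal e < emeasure \<mu> B"
          using fB e by (intro ennreal_between) auto
        then obtain K where "compact K" "K \<subseteq> B" "emeasure \<mu> B - ennreal e < emeasure \<mu> K"
          using radon_inner[OF \<mu>(1) B] by (auto simp: less_SUP_iff)
        then show ?thesis
          by (intro exI[of _ K]) (auto simp: ennreal_minus_le_iff add.commute dest!: less_imp_le)
      qed
      then obtain K where K: "compact K" "K \<subseteq> B" "emeasure \<mu> B \<le> emeasure \<mu> K + ennreal e" by blast
      have Ks: "K \<in> sets borel" by (rule borel_compact[OF K(1)])
      have i: "B \<inter> K = K" using K(2) by auto
      have "emeasure \<mu> B = emeasure \<mu> K + emeasure \<mu> (B - K)"
        using emeasure_Diff_Int[of B \<mu> K] B Ks sm i by (simp add: add.commute)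
      then have "emeasure \<mu> (B - K) \<le> ennreal e"
        using K(3) radon_compact[OF \<mu>(1) K(1)] by (metis ennreal_add_left_cancel_le infinity_ennreal_def order_less_irrefl)
      then have "emeasure \<nu> (B - K) \<le> ennreal e" using le[of "B - K"] B Ks by (auto intro: order_trans)
      then have "emeasure \<nu> B \<le> emeasure \<nu> K + ennreal e"
        using emeasure_Diff_Int[of B \<nu> K] B Ks s i by (simp add: add.commute add_left_mono)
      also have "emeasure \<nu> K \<le> (SUP K\<in>{K. compact K \<and> K \<subseteq> B}. emeasure \<nu> K)" using K by (intro SUP_upper) auto
      finally show "emeasure \<nu> B \<le> (SUP K\<in>{K. compact K \<and> K \<subseteq> B}. emeasure \<nu> K) + ennreal e"
        by (simp add: add_right_mono)
    qed
    show "(SUP K\<in>{K. compact K \<and> K \<subseteq> B}. emeasure \<nu> K) \<le> emeasure \<nu> B"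
      using B s by (intro SUP_least emeasure_mono) auto
  qed
qed

lemma closed_msupport: "closed (msupport \<mu>)"
proof -
  have "- msupport \<mu> = \<Union>{U. open U \<and> emeasure \<mu> U = 0}" by (auto simp: msupport_def)
  then show ?thesis by (metis (no_types, lifting) closed_def mem_Collect_eq open_Union)
qed

text \<open>The complement of the support is a union of possibly uncountably many null open sets;
  finitely many of them cover a given compact subset, and inner regularity passes from compact
  subsets to the complement of \<open>A\<close>.\<close>

lemma msupport_subset_iff:
  fixes \<mu> :: "'a::t2_space measure"
  assumes \<mu>: "\<mu> \<in> radon" and A: "closed A"
  shows "msupport \<mu> \<subseteq> A \<longleftrightarrow> emeasure \<mu> (- A) = 0"
proof
  have s: "sets \<mu> = sets borel" by (rule radon_sets[OF \<mu>])
  assume sub: "msupport \<mu> \<subseteq> A"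
  have "emeasure \<mu> K = 0" if K: "compact K" "K \<subseteq> - A" for K
  proof -
    have "\<exists>U\<in>{U. open U \<and> emeasure \<mu> U = 0}. \<forall>z\<in>K. z \<in> U"
    proof (rule compact_directed[OF K(1)])
      show "{U. open U \<and> emeasure \<mu> U = 0} \<noteq> {}" by (auto intro!: exI[of _ "{}"])
      fix U V assume "U \<in> {U. open U \<and> emeasure \<mu> U = 0}" "V \<in> {U. open U \<and> emeasure \<mu> U = 0}"
      then have UV: "open U" "emeasure \<mu> U = 0" "open V" "emeasure \<mu> V = 0" by auto
      have "emeasure \<mu> (U \<union> V) \<le> emeasure \<mu> U + emeasure \<mu> V" using UV s by (intro emeasure_subadditive) auto
      then have "emeasure \<mu> (U \<union> V) = 0" using UV by simp
      then show "\<exists>k\<in>{U. open U \<and> emeasure \<mu> U = 0}. \<forall>z. z \<in> U \<or> z \<in> V \<longrightarrow> z \<in> k"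
        using UV by (intro bexI[of _ "U \<union> V"]) auto
    next
      fix x assume "x \<in> K"
      then have "x \<notin> msupport \<mu>" using K(2) sub by auto
      then show "\<exists>U\<in>{U. open U \<and> emeasure \<mu> U = 0}. \<exists>N. open N \<and> x \<in> N \<and> (\<forall>z\<in>N. z \<in> U)"
        unfolding msupport_def by blast
    qed
    then obtain U where "open U" "emeasure \<mu> U = 0" "K \<subseteq> U" by blast
    then show ?thesis using emeasure_mono[of K U \<mu>] s by simp
  qed
  then have "emeasure \<mu> (- A) \<le> 0"
    using A unfolding radon_inner[OF \<mu> borel_open[OF open_Compl[OF A]]] by (intro SUP_least) auto
  then show "emeasure \<mu> (- A) = 0" by simp
next
  assume "emeasure \<mu> (- A) = 0"
  then show "msupport \<mu> \<subseteq> A" using A unfolding msupport_def by (auto simp: open_Compl)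
qed

lemma radon_on_AE:
  fixes \<mu> :: "'a::t2_space measure"
  assumes "\<mu> \<in> radon_on A" "closed A"
  shows "AE x in \<mu>. x \<in> A"
proof -
  have \<mu>: "\<mu> \<in> radon" "msupport \<mu> \<subseteq> A" using assms(1) by (auto simp: radon_on_def)
  have "emeasure \<mu> (- A) = 0" using msupport_subset_iff[OF \<mu>(1) assms(2)] \<mu>(2) by blast
  then show ?thesis
    using assms(2) radon_sets[OF \<mu>(1)] radon_space[OF \<mu>(1)] by (intro AE_I[of _ _ "- A"]) auto
qed

lemma radon_on_cong:
  fixes \<mu> :: "'a::t2_space measure"
  assumes "\<mu> \<in> radon_on A" "closed A" "\<And>x. x \<in> A \<Longrightarrow> u x = v x"
  shows "(\<integral>\<^sup>+x. u x \<partial>\<mu>) = (\<integral>\<^sup>+x. v x \<partial>\<mu>)"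
  using radon_on_AE[OF assms(1,2)] assms(3) by (intro nn_integral_cong_AE) auto

lemma mid_radon_on:
  fixes \<mu> \<nu> :: "'a::t2_space measure"
  assumes "\<mu> \<in> radon_on A" "\<nu> \<in> radon_on A" "closed A"
  shows "mid \<mu> \<nu> \<in> radon_on A"
proof -
  have r: "\<mu> \<in> radon" "\<nu> \<in> radon" "msupport \<mu> \<subseteq> A" "msupport \<nu> \<subseteq> A" using assms by (auto simp: radon_on_def)
  have "emeasure (mid \<mu> \<nu>) (- A) = 0"
    using emeasure_mid[OF r(1,2), of "- A"] assms(3) msupport_subset_iff[OF r(1) assms(3)]
      msupport_subset_iff[OF r(2) assms(3)] r(3,4) by auto
  then show ?thesis
    using msupport_subset_iff[OF radon_mid[OF r(1,2)] assms(3)] radon_mid[OF r(1,2)] by (simp add: radon_on_def)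
qed

subsection \<open>Energies of Radon measures\<close>

text \<open>\<open>p\<close> and \<open>n\<close> may overlap, so they need not be the positive and
  negative parts of \<open>u\<close>; still \<open>u\<^sup>+ + n = p + u\<^sup>-\<close> almost
  everywhere, which can be integrated term by term, and the finite integral of \<open>n\<close>
  cancels. Signed series and integrals are evaluated through this rule.\<close>

lemma ereal_integral_diff:
  assumes m: "p \<in> borel_measurable M" "n \<in> borel_measurable M" and fin: "(\<integral>\<^sup>+x. n x \<partial>M) < \<infinity>"
    and u: "AE x in M. u x = enn2ereal (p x) - enn2ereal (n x)"
  shows "ereal_integral M u = enn2ereal (\<integral>\<^sup>+x. p x \<partial>M) - enn2ereal (\<integral>\<^sup>+x. n x \<partial>M)"
proof -
  define v where "v x = enn2ereal (p x) - enn2ereal (n x)" for x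
  have mv: "v \<in> borel_measurable M" unfolding v_def using m by measurable
  let ?P = "\<integral>\<^sup>+x. e2ennreal (v x) \<partial>M"
  let ?N = "\<integral>\<^sup>+x. e2ennreal (- v x) \<partial>M"
  have e: "ereal_integral M u = enn2ereal ?P - enn2ereal ?N"
    unfolding ereal_integral_def
    using u by (intro arg_cong2[where f = minus] arg_cong[where f = enn2ereal] nn_integral_cong_AE)
      (auto simp: v_def elim!: eventually_mono)
  have nf: "AE x in M. n x \<noteq> \<infinity>" using m(2) fin by (intro nn_integral_noteq_infinite) auto
  have pw: "e2ennreal (v x) + n x = p x + e2ennreal (- v x) \<and> e2ennreal (- v x) \<le> n x" if nx: "n x \<noteq> \<infinity>" for x
  proof -
    obtain r where r: "n x = ennreal r" "0 \<le> r" using nx by (cases "n x") auto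
    show ?thesis
    proof (cases "p x")
      case (real q)
      then have v: "v x = ereal (q - r)" using r by (simp add: v_def enn2ereal_ennreal)
      show ?thesis using real r by (cases "r \<le> q")
        (auto simp: v e2ennreal_ereal ennreal_neg ennreal_leI simp flip: ennreal_plus)
    next
      case top
      then show ?thesis using r by (simp add: v_def enn2ereal_ennreal e2ennreal_neg)
    qed
  qed
  have "?P + (\<integral>\<^sup>+x. n x \<partial>M) = (\<integral>\<^sup>+x. e2ennreal (v x) + n x \<partial>M)"
    using m mv by (subst nn_integral_add) auto
  also have "\<dots> = (\<integral>\<^sup>+x. p x + e2ennreal (- v x) \<partial>M)"
    using nf by (intro nn_integral_cong_AE) (auto elim!: eventually_mono simp: pw)
  also have "\<dots> = (\<integral>\<^sup>+x. p x \<partial>M) + ?N"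
    using m mv by (subst nn_integral_add) auto
  finally have eq: "?P + (\<integral>\<^sup>+x. n x \<partial>M) = (\<integral>\<^sup>+x. p x \<partial>M) + ?N" .
  have "?N \<le> (\<integral>\<^sup>+x. n x \<partial>M)"
    using nf by (intro nn_integral_mono_AE) (auto elim!: eventually_mono simp: pw)
  then have "?N < \<infinity>" using fin by (rule le_less_trans)
  then obtain b where b: "?N = ennreal b" "0 \<le> b" by (cases ?N) auto
  obtain r where r: "(\<integral>\<^sup>+x. n x \<partial>M) = ennreal r" "0 \<le> r" using fin by (cases "\<integral>\<^sup>+x. n x \<partial>M") auto
  show ?thesis
  proof (cases "\<integral>\<^sup>+x. p x \<partial>M")
    case (real q)
    then have "?P + ennreal r = ennreal (q + b)" using eq b r by (simp flip: ennreal_plus)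
    then obtain a where a: "?P = ennreal a" "0 \<le> a" by (cases ?P) auto
    then have "a + r = q + b" using eq b r real by (simp flip: ennreal_plus)
    then show ?thesis unfolding e a(1) b(1) r(1) real(2) using a b r real by (simp add: enn2ereal_ennreal)
  next
    case top
    then have "?P + ennreal r = top" using eq r by simp
    then have "?P = top" by (simp add: ennreal_add_eq_top)
    then show ?thesis unfolding e b(1) r(1) top using b r by (simp add: enn2ereal_ennreal)
  qed
qed

text \<open>Either nothing is shifted or the mass is finite, so the subtracted term is finite and
  correct even where \<open>measure\<close> returns its default value.\<close>

lemma ereal_integral_shift:
  fixes u :: "'b \<Rightarrow> ereal"
  assumes u: "u \<in> borel_measurable M" and b: "0 \<le> b" "\<And>x. - ereal b \<le> u x"
    and fin: "b = 0 \<or> emeasure M (space M) < \<infinity>"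
  shows "ereal_integral M u = enn2ereal (\<integral>\<^sup>+x. e2ennreal (u x + ereal b) \<partial>M) - ereal (b * measure M (space M))"
proof -
  have bm: "ennreal b * emeasure M (space M) = ennreal (b * measure M (space M))"
    using fin b(1) by (auto simp: emeasure_eq_ennreal_measure ennreal_mult less_top)
  have pw: "u x = enn2ereal (e2ennreal (u x + ereal b)) - enn2ereal (ennreal b)" for x
  proof -
    have "0 \<le> u x + ereal b" using b(2)[of x] by (cases "u x") auto
    then show ?thesis using b(1) by (cases "u x") (auto simp: enn2ereal_e2ennreal enn2ereal_ennreal)
  qed
  have "ereal_integral M u = enn2ereal (\<integral>\<^sup>+x. e2ennreal (u x + ereal b) \<partial>M) - enn2ereal (\<integral>\<^sup>+x. ennreal b \<partial>M)"
    by (rule ereal_integral_diff) (use u bm pw in auto)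
  then show ?thesis using bm b(1) by (simp add: enn2ereal_ennreal)
qed

lemma lsc_shift:
  fixes \<psi> :: "'b::topological_space \<Rightarrow> ereal"
  assumes "\<psi> \<in> lsc_class" "\<And>x. - ereal b \<le> \<psi> x"
  shows "open {x. t < e2ennreal (\<psi> x + ereal b)}"
proof (cases t)
  case (real r)
  have "{x. t < e2ennreal (\<psi> x + ereal b)} = {x. ereal (r - b) < \<psi> x}"
  proof (rule Collect_cong)
    fix x
    show "t < e2ennreal (\<psi> x + ereal b) \<longleftrightarrow> ereal (r - b) < \<psi> x"
      using real assms(2)[of x] by (cases "\<psi> x") (auto simp: e2ennreal_ereal ennreal_less_iff)
  qed
  then show ?thesis using assms(1) by (simp add: lsc_class_def)
qed simp

text \<open>
  The constant \<open>c\<close> makes \<open>\<kappa> + c\<close> nonnegative, so that energies and potentials become integrals in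
  \<^typ>\<open>ennreal\<close>, corrected by multiples of total masses.  The latter are finite if \<open>c \<noteq> 0\<close>, since the
  space is then compact; if \<open>c = 0\<close>, the correction vanishes although \<^const>\<open>measure\<close> may be a junk value.
\<close>
locale kernel_space = lch_space T for T :: "'a::t2_space itself" +
  fixes \<kappa> :: "'a \<times> 'a \<Rightarrow> ereal" and c :: real
  assumes kernel_lsc: "\<kappa> \<in> lsc_class"
    and kernel_pd: "positive_definite \<kappa>"
    and c_nonneg: "0 \<le> c"
    and kernel_lower: "\<And>p. - ereal c \<le> \<kappa> p"
    and c_compact: "c = 0 \<or> compact (UNIV :: 'a set)"
begin

definition kp :: "'a \<times> 'a \<Rightarrow> ennreal" where
  "kp p = e2ennreal (\<kappa> p + ereal c)"

definition J :: "'a measure \<Rightarrow> 'a measure \<Rightarrow> ennreal" where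
  "J \<mu> \<nu> = (\<integral>\<^sup>+x. \<integral>\<^sup>+y. kp (x, y) \<partial>\<nu> \<partial>\<mu>)"

text \<open>If \<open>J \<mu> \<nu>\<close> is infinite, \<open>enn2real\<close> returns 0 and this
  is not the mutual energy; \<open>mutual_energy_ee\<close> makes the identification under
  finiteness.\<close>

definition ee :: "'a measure \<Rightarrow> 'a measure \<Rightarrow> real" where
  "ee \<mu> \<nu> = enn2real (J \<mu> \<nu>) - c * measure \<mu> UNIV * measure \<nu> UNIV"

definition E :: "'a measure set" where
  "E = {\<mu> \<in> radon. J \<mu> \<mu> < \<infinity>}"

lemma E_radon: "\<mu> \<in> E \<Longrightarrow> \<mu> \<in> radon"
  by (simp add: E_def)

lemma kernel_open: "open {p. t < \<kappa> p}"
  using kernel_lsc by (simp add: lsc_class_def)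

lemma kp_lsc: "open {p. t < kp p}"
  unfolding kp_def by (rule lsc_shift[OF kernel_lsc kernel_lower])

lemma kp_sym: "kp (x, y) = kp (y, x)"
  using kernel_pd by (simp add: kp_def positive_definite_def)

lemma potential_measurable: "\<nu> \<in> radon \<Longrightarrow> (\<lambda>x. \<integral>\<^sup>+y. kp (x, y) \<partial>\<nu>) \<in> borel_measurable borel"
  by (intro lsc_measurable lsc_nn_integral_param kp_lsc)

lemma radon_finite: "\<mu> \<in> radon \<Longrightarrow> c = 0 \<or> emeasure \<mu> (UNIV :: 'a set) < \<infinity>"
  using c_compact radon_compact[of \<mu> UNIV] by auto

lemma radon_prod_total:
  assumes "\<mu> \<in> radon" "\<nu> \<in> (radon :: 'a measure set)"
  shows "emeasure (radon_prod \<mu> \<nu>) UNIV = emeasure \<mu> UNIV * emeasure \<nu> UNIV"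
  using nn_integral_radon_prod(3)[OF assms kp_lsc, of UNIV UNIV] by simp

lemma mutual_energy_eq:
  assumes \<mu>: "\<mu> \<in> radon" and \<nu>: "\<nu> \<in> radon"
  shows "mutual_energy \<kappa> \<mu> \<nu> = enn2ereal (J \<mu> \<nu>) - ereal (c * measure \<mu> UNIV * measure \<nu> UNIV)"
proof -
  let ?\<pi> = "radon_prod \<mu> \<nu>"
  have \<pi>: "?\<pi> \<in> radon" by (rule nn_integral_radon_prod(2)[OF \<mu> \<nu> kp_lsc])
  have sp: "space ?\<pi> = UNIV" by (rule radon_space[OF \<pi>])
  have "\<kappa> \<in> borel_measurable borel"
    by (intro borel_measurableI_greater) (simp add: kernel_open borel_open)
  then have m: "\<kappa> \<in> borel_measurable ?\<pi>" using measurable_cong_sets[OF radon_sets[OF \<pi>] refl] by blast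
  have tot: "emeasure ?\<pi> UNIV = emeasure \<mu> UNIV * emeasure \<nu> UNIV" by (rule radon_prod_total[OF \<mu> \<nu>])
  have "ereal_integral ?\<pi> \<kappa> = enn2ereal (\<integral>\<^sup>+p. kp p \<partial>?\<pi>) - ereal (c * measure ?\<pi> (space ?\<pi>))"
    unfolding kp_def
    by (rule ereal_integral_shift[OF m c_nonneg kernel_lower])
      (use radon_finite[OF \<mu>] radon_finite[OF \<nu>] in \<open>auto simp: sp tot ennreal_mult_less_top\<close>)
  also have "measure ?\<pi> (space ?\<pi>) = measure \<mu> UNIV * measure \<nu> UNIV"
    by (simp add: measure_def sp tot enn2real_mult)
  finally show ?thesis
    unfolding mutual_energy_def J_def nn_integral_radon_prod(1)[OF \<mu> \<nu> kp_lsc] by (simp add: mult.assoc)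
qed

lemma potential_eq:
  assumes \<nu>: "\<nu> \<in> radon"
  shows "potential \<kappa> \<nu> x = enn2ereal (\<integral>\<^sup>+y. kp (x, y) \<partial>\<nu>) - ereal (c * measure \<nu> UNIV)"
proof -
  have "open {y. t < \<kappa> (x, y)}" for t
    using open_vimage[OF kernel_open[of t], of "Pair x"] by (simp add: vimage_def continuous_on_Pair)
  then have "(\<lambda>y. \<kappa> (x, y)) \<in> borel_measurable borel"
    by (intro borel_measurableI_greater) (simp add: borel_open)
  then have m: "(\<lambda>y. \<kappa> (x, y)) \<in> borel_measurable \<nu>" using measurable_cong_sets[OF radon_sets[OF \<nu>] refl] by blast
  show ?thesis
    unfolding potential_def kp_def
    using ereal_integral_shift[OF m c_nonneg kernel_lower] radon_finite[OF \<nu>] radon_space[OF \<nu>] by simp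
qed

lemma J_sym:
  assumes "\<mu> \<in> radon" "\<nu> \<in> radon"
  shows "J \<mu> \<nu> = J \<nu> \<mu>"
  unfolding J_def nn_integral_radon_swap[OF assms kp_lsc] by (subst kp_sym) (rule refl)

lemma ee_sym: "\<mu> \<in> radon \<Longrightarrow> \<nu> \<in> radon \<Longrightarrow> ee \<mu> \<nu> = ee \<nu> \<mu>"
  by (simp add: ee_def J_sym mult_ac)

lemma mutual_energy_ee: "\<mu> \<in> radon \<Longrightarrow> \<nu> \<in> radon \<Longrightarrow> J \<mu> \<nu> < \<infinity> \<Longrightarrow> mutual_energy \<kappa> \<mu> \<nu> = ereal (ee \<mu> \<nu>)"
  by (cases "J \<mu> \<nu>") (auto simp: mutual_energy_eq ee_def enn2ereal_ennreal)

lemma mutual_energy_top: "\<mu> \<in> radon \<Longrightarrow> \<nu> \<in> radon \<Longrightarrow> J \<mu> \<nu> = \<infinity> \<Longrightarrow> mutual_energy \<kappa> \<mu> \<nu> = \<infinity>"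
  by (simp add: mutual_energy_eq)

lemma finite_energy_pos_eq: "finite_energy_pos \<kappa> = E"
proof -
  have "\<bar>mutual_energy \<kappa> \<mu> \<mu>\<bar> \<noteq> \<infinity> \<longleftrightarrow> J \<mu> \<mu> < \<infinity>" if "\<mu> \<in> radon" for \<mu>
    using mutual_energy_ee[OF that that] mutual_energy_top[OF that that]
    by (cases "J \<mu> \<mu> = \<infinity>") (auto simp: less_top)
  then show ?thesis unfolding finite_energy_pos_def E_def by (intro Collect_cong conj_cong refl)
qed

lemma J_mono:
  assumes "sets \<mu> = sets borel" "sets \<mu>' = sets borel" "\<And>B. B \<in> sets borel \<Longrightarrow> emeasure \<mu> B \<le> emeasure \<mu>' B"
    "sets \<nu> = sets borel" "sets \<nu>' = sets borel" "\<And>B. B \<in> sets borel \<Longrightarrow> emeasure \<nu> B \<le> emeasure \<nu>' B"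
  shows "J \<mu> \<nu> \<le> J \<mu>' \<nu>'"
proof -
  have "\<mu> \<le> \<mu>'" "\<nu> \<le> \<nu>'"
    using assms by (auto simp: le_measure)
  then show ?thesis unfolding J_def
    using assms by (intro order_trans[OF nn_integral_mono nn_integral_mono_measure] nn_integral_mono_measure) auto
qed

lemma J_wsum_left:
  assumes "\<And>i. i \<in> I \<Longrightarrow> \<mu> i \<in> radon" "\<nu> \<in> radon"
  shows "J (wsum I w \<mu>) \<nu> = (\<integral>\<^sup>+i. w i * J (\<mu> i) \<nu> \<partial>count_space I)"
  unfolding J_def by (rule nn_integral_wsum) (use assms radon_sets potential_measurable in auto)

lemma J_wsum_right:
  assumes "\<And>i. i \<in> I \<Longrightarrow> \<mu> i \<in> radon" "\<nu> \<in> radon" "wsum I w \<mu> \<in> radon"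
  shows "J \<nu> (wsum I w \<mu>) = (\<integral>\<^sup>+i. w i * J \<nu> (\<mu> i) \<partial>count_space I)"
  unfolding J_sym[OF assms(2,3)]
  by (subst J_wsum_left) (use assms in \<open>auto simp: J_sym intro!: nn_integral_cong\<close>)

text \<open>\<open>ennreal\<close> sends negative coefficients to 0, so the linearity rules for
  \<open>ee\<close> assume \<open>a\<close> and \<open>b\<close> nonnegative; differences are
  expressed by moving terms to the other side.\<close>

definition comb :: "real \<Rightarrow> 'a measure \<Rightarrow> real \<Rightarrow> 'a measure \<Rightarrow> 'a measure" where
  "comb a \<mu> b \<nu> = wsum {0, 1} (\<lambda>i. ennreal (if i = 0 then a else b)) (\<lambda>i. if i = 0 then \<mu> else \<nu>)"

lemma emeasure_comb:
  assumes "\<mu> \<in> radon" "\<nu> \<in> radon" "B \<in> sets borel"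
  shows "emeasure (comb a \<mu> b \<nu>) B = ennreal a * emeasure \<mu> B + ennreal b * emeasure \<nu> B"
  unfolding comb_def
  by (subst emeasure_wsum) (use assms radon_sets in \<open>auto simp: nn_integral_count_space_finite\<close>)

lemma radon_comb:
  assumes "\<mu> \<in> radon" "\<nu> \<in> radon"
  shows "comb a \<mu> b \<nu> \<in> radon"
  unfolding comb_def
  by (rule radon_wsum)
    (use assms in \<open>auto simp: nn_integral_count_space_finite ennreal_mult_less_top dest: radon_compact\<close>)

lemma J_comb_left:
  assumes "\<mu> \<in> radon" "\<nu> \<in> radon" "\<tau> \<in> radon"
  shows "J (comb a \<mu> b \<nu>) \<tau> = ennreal a * J \<mu> \<tau> + ennreal b * J \<nu> \<tau>"
  unfolding comb_def
  by (subst J_wsum_left) (use assms in \<open>auto simp: nn_integral_count_space_finite\<close>)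

lemma J_comb_right:
  assumes "\<mu> \<in> radon" "\<nu> \<in> radon" "\<tau> \<in> radon"
  shows "J \<tau> (comb a \<mu> b \<nu>) = ennreal a * J \<tau> \<mu> + ennreal b * J \<tau> \<nu>"
  using assms J_comb_left[OF assms] J_sym radon_comb by simp

text \<open>Stated with the factor \<open>c\<close> because \<open>measure\<close> is additive only
  for finite masses; infinite ones occur only for \<open>c = 0\<close>, where both sides
  vanish.\<close>

lemma c_measure_comb:
  assumes "\<mu> \<in> radon" "\<nu> \<in> radon" "0 \<le> a" "0 \<le> b"
  shows "c * measure (comb a \<mu> b \<nu>) UNIV = a * (c * measure \<mu> UNIV) + b * (c * measure \<nu> UNIV)"
proof (cases "c = 0")
  case False
  then have f: "emeasure \<mu> UNIV < \<infinity>" "emeasure \<nu> UNIV < \<infinity>" using radon_finite assms by auto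
  have "measure (comb a \<mu> b \<nu>) UNIV = a * measure \<mu> UNIV + b * measure \<nu> UNIV"
    using f assms emeasure_comb[OF assms(1,2), of UNIV a b]
    by (simp add: measure_def enn2real_plus enn2real_mult ennreal_mult_less_top)
  then show ?thesis by (simp add: algebra_simps)
qed simp

lemma ee_comb_left:
  assumes "\<mu> \<in> radon" "\<nu> \<in> radon" "\<tau> \<in> radon" "0 \<le> a" "0 \<le> b" "J \<mu> \<tau> < \<infinity>" "J \<nu> \<tau> < \<infinity>"
  shows "ee (comb a \<mu> b \<nu>) \<tau> = a * ee \<mu> \<tau> + b * ee \<nu> \<tau>"
proof -
  have "enn2real (J (comb a \<mu> b \<nu>) \<tau>) = a * enn2real (J \<mu> \<tau>) + b * enn2real (J \<nu> \<tau>)"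
    using assms by (simp add: J_comb_left enn2real_plus enn2real_mult ennreal_mult_less_top)
  then show ?thesis unfolding ee_def c_measure_comb[OF assms(1,2,4,5)] by (simp add: algebra_simps)
qed

lemma ee_comb_right:
  assumes "\<mu> \<in> radon" "\<nu> \<in> radon" "\<tau> \<in> radon" "0 \<le> a" "0 \<le> b" "J \<tau> \<mu> < \<infinity>" "J \<tau> \<nu> < \<infinity>"
  shows "ee \<tau> (comb a \<mu> b \<nu>) = a * ee \<tau> \<mu> + b * ee \<tau> \<nu>"
  using ee_comb_left[OF assms(1-5)] assms J_sym ee_sym radon_comb by simp

section \<open>Positive definiteness and the Cauchy-Schwarz inequality\<close>

text \<open>Positive definiteness speaks of mutually singular pairs. Once the common part of
  \<open>\<mu>\<close> and \<open>\<nu>\<close> is removed, the remainders form such a pair, and the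
  terms with the common part cancel in the quadratic form.\<close>

lemma energy_form_finite:
  assumes \<mu>: "\<mu> \<in> radon" and \<nu>: "\<nu> \<in> radon"
    and fin: "emeasure \<mu> UNIV < \<infinity>" "emeasure \<nu> UNIV < \<infinity>"
    and en: "J \<mu> \<mu> < \<infinity>" "J \<nu> \<nu> < \<infinity>"
  shows "J \<mu> \<nu> < \<infinity>" and "2 * ee \<mu> \<nu> \<le> ee \<mu> \<mu> + ee \<nu> \<nu>"
proof -
  note s = radon_sets[OF \<mu>] radon_sets[OF \<nu>]
  obtain Y where Y: "Y \<in> sets borel" "\<And>X. X \<in> sets borel \<Longrightarrow> X \<subseteq> Y \<Longrightarrow> emeasure \<nu> X \<le> emeasure \<mu> X"
    "\<And>X. X \<in> sets borel \<Longrightarrow> X \<inter> Y = {} \<Longrightarrow> emeasure \<mu> X \<le> emeasure \<nu> X"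
    using unsigned_Hahn_decomposition[of \<nu> \<mu> UNIV] s fin by (auto simp: less_top)
  have nY: "- Y \<in> sets borel" using Y(1) by auto
  define \<mu>Y where "\<mu>Y = density \<mu> (indicator Y)"
  define \<nu>Y where "\<nu>Y = density \<nu> (indicator Y)"
  define \<mu>N where "\<mu>N = density \<mu> (indicator (- Y))"
  define \<nu>N where "\<nu>N = density \<nu> (indicator (- Y))"
  note rY = radon_restrict[OF \<mu> Y(1), folded \<mu>Y_def] radon_restrict[OF \<nu> Y(1), folded \<nu>Y_def]
    radon_restrict[OF \<mu> nY, folded \<mu>N_def] radon_restrict[OF \<nu> nY, folded \<nu>N_def]
  have le1: "emeasure \<mu> X \<le> emeasure \<mu> UNIV" "emeasure \<nu> X \<le> emeasure \<nu> UNIV" for X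
    using emeasure_space[of \<mu> X] emeasure_space[of \<nu> X] radon_space[OF \<mu>] radon_space[OF \<nu>] by auto
  have fm: "finite_measure \<mu>Y" "finite_measure \<nu>Y" "finite_measure \<mu>N" "finite_measure \<nu>N"
    using rY(2)[of UNIV] rY(4)[of UNIV] rY(6)[of UNIV] rY(8)[of UNIV] le1[of Y] le1[of "- Y"] fin
      radon_space[OF rY(1)] radon_space[OF rY(3)] radon_space[OF rY(5)] radon_space[OF rY(7)]
    by (auto intro!: finite_measureI simp: less_top[symmetric] top_unique intro: le_less_trans)
  have sY: "sets \<mu>Y = sets borel" "sets \<nu>Y = sets borel" "sets \<mu>N = sets borel" "sets \<nu>N = sets borel"
    using rY(1,3,5,7)[THEN radon_sets] by auto
  \<comment> \<open>On \<open>Y\<close> the measure \<open>\<mu>\<close> dominates, off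
    \<open>Y\<close> the measure \<open>\<nu>\<close> does. So \<open>\<eta>\<close> is the minimum
    of the two measures, and subtracting it leaves mutually singular remainders.\<close>
  define \<mu>' where "\<mu>' = diff_measure \<mu>Y \<nu>Y"
  define \<nu>' where "\<nu>' = diff_measure \<nu>N \<mu>N"
  define \<eta> where "\<eta> = comb 1 \<nu>Y 1 \<mu>N"
  have em\<mu>': "emeasure \<mu>' B = emeasure \<mu> (Y \<inter> B) - emeasure \<nu> (Y \<inter> B)" if "B \<in> sets borel" for B
    unfolding \<mu>'_def using that fm sY rY Y by (subst emeasure_diff_measure) auto
  have em\<nu>': "emeasure \<nu>' B = emeasure \<nu> (- Y \<inter> B) - emeasure \<mu> (- Y \<inter> B)" if "B \<in> sets borel" for B
    unfolding \<nu>'_def using that fm sY rY Y nY by (subst emeasure_diff_measure) auto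
  have s': "sets \<mu>' = sets borel" "sets \<nu>' = sets borel" using sY by (auto simp: \<mu>'_def \<nu>'_def)
  have dle: "a - b \<le> (a :: ennreal)" for a b by (simp add: ennreal_minus_le_iff)
  have r\<mu>': "\<mu>' \<in> radon"
    by (rule radon_dominated[OF \<mu> fin(1) s'(1)])
      (use em\<mu>' Y(1) s in \<open>auto intro!: order_trans[OF dle] emeasure_mono\<close>)
  have r\<nu>': "\<nu>' \<in> radon"
    by (rule radon_dominated[OF \<nu> fin(2) s'(2)])
      (use em\<nu>' Y(1) s in \<open>auto intro!: order_trans[OF dle] emeasure_mono\<close>)
  have r\<eta>: "\<eta> \<in> radon" unfolding \<eta>_def by (rule radon_comb[OF rY(3,5)])
  have em\<eta>: "emeasure \<eta> B = emeasure \<nu> (Y \<inter> B) + emeasure \<mu> (- Y \<inter> B)" if "B \<in> sets borel" for B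
    unfolding \<eta>_def using that rY by (simp add: emeasure_comb[OF rY(3,5) that])
  have \<mu>_dec: "\<mu> = comb 1 \<mu>' 1 \<eta>"
  proof (rule measure_eqI)
    show "sets \<mu> = sets (comb 1 \<mu>' 1 \<eta>)" using s by (simp add: comb_def sets_wsum)
    fix B assume "B \<in> sets \<mu>"
    then have B: "B \<in> sets borel" using s by simp
    have "emeasure (comb 1 \<mu>' 1 \<eta>) B = (emeasure \<mu> (Y \<inter> B) - emeasure \<nu> (Y \<inter> B)) + (emeasure \<nu> (Y \<inter> B) + emeasure \<mu> (- Y \<inter> B))"
      using B by (simp add: emeasure_comb[OF r\<mu>' r\<eta> B] em\<mu>' em\<eta>)
    also have "\<dots> = emeasure \<mu> (Y \<inter> B) + emeasure \<mu> (- Y \<inter> B)"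
      using Y(2)[of "Y \<inter> B"] Y(1) B by (simp flip: add.assoc add: diff_add_cancel_ennreal)
    also have "\<dots> = emeasure \<mu> B"
      using emeasure_Diff_Int[of B \<mu> Y] B Y(1) s by (simp add: Int_commute Diff_eq add.commute)
    finally show "emeasure \<mu> B = emeasure (comb 1 \<mu>' 1 \<eta>) B" by simp
  qed
  have \<nu>_dec: "\<nu> = comb 1 \<nu>' 1 \<eta>"
  proof (rule measure_eqI)
    show "sets \<nu> = sets (comb 1 \<nu>' 1 \<eta>)" using s by (simp add: comb_def sets_wsum)
    fix B assume "B \<in> sets \<nu>"
    then have B: "B \<in> sets borel" using s by simp
    have "emeasure (comb 1 \<nu>' 1 \<eta>) B = (emeasure \<nu> (- Y \<inter> B) - emeasure \<mu> (- Y \<inter> B)) + (emeasure \<mu> (- Y \<inter> B) + emeasure \<nu> (Y \<inter> B))"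
      using B by (simp add: emeasure_comb[OF r\<nu>' r\<eta> B] em\<nu>' em\<eta> add.commute)
    also have "\<dots> = emeasure \<nu> (- Y \<inter> B) + emeasure \<nu> (Y \<inter> B)"
      using Y(3)[of "- Y \<inter> B"] Y(1) nY B by (simp flip: add.assoc add: diff_add_cancel_ennreal Int_assoc Int_commute Int_left_commute)
    also have "\<dots> = emeasure \<nu> B"
      using emeasure_Diff_Int[of B \<nu> Y] B Y(1) s by (simp add: Int_commute Diff_eq)
    finally show "emeasure \<nu> B = emeasure (comb 1 \<nu>' 1 \<eta>) B" by simp
  qed
  have J\<mu>: "J \<mu> \<mu> = J \<mu>' \<mu>' + J \<mu>' \<eta> + (J \<eta> \<mu>' + J \<eta> \<eta>)"
    by (subst (1 2) \<mu>_dec) (simp add: J_comb_left J_comb_right r\<mu>' r\<eta> radon_comb)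
  have J\<nu>: "J \<nu> \<nu> = J \<nu>' \<nu>' + J \<nu>' \<eta> + (J \<eta> \<nu>' + J \<eta> \<eta>)"
    by (subst (1 2) \<nu>_dec) (simp add: J_comb_left J_comb_right r\<nu>' r\<eta> radon_comb)
  have J\<mu>\<nu>: "J \<mu> \<nu> = J \<mu>' \<nu>' + J \<mu>' \<eta> + (J \<eta> \<nu>' + J \<eta> \<eta>)"
    by (subst \<mu>_dec, subst \<nu>_dec) (simp add: J_comb_left J_comb_right r\<mu>' r\<nu>' r\<eta> radon_comb)
  have f: "J \<mu>' \<mu>' < \<infinity>" "J \<mu>' \<eta> < \<infinity>" "J \<eta> \<mu>' < \<infinity>" "J \<eta> \<eta> < \<infinity>" "J \<nu>' \<nu>' < \<infinity>" "J \<nu>' \<eta> < \<infinity>" "J \<eta> \<nu>' < \<infinity>"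
    using en J\<mu> J\<nu> by auto
  have sr: "(\<mu>', \<nu>') \<in> signed_radon"
    unfolding signed_radon_def
  proof (intro CollectI case_prodI conjI r\<mu>' r\<nu>' allI impI)
    fix K :: "'a set" assume "compact K"
    then have K: "K \<in> sets borel" by (rule borel_compact)
    show "\<exists>S\<in>sets borel. S \<subseteq> K \<and> emeasure \<mu>' S = 0 \<and> emeasure \<nu>' (K - S) = 0"
    proof (intro bexI[of _ "K - Y"] conjI)
      have "Y \<inter> (K - Y) = {}" "- Y \<inter> (K - (K - Y)) = {}" by auto
      then show "emeasure \<mu>' (K - Y) = 0" "emeasure \<nu>' (K - (K - Y)) = 0"
        using em\<mu>'[of "K - Y"] em\<nu>'[of "K - (K - Y)"] K Y(1) by auto
    qed (use K Y(1) in auto)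
  qed
  have m1: "mutual_energy \<kappa> \<mu>' \<mu>' = ereal (ee \<mu>' \<mu>')" "mutual_energy \<kappa> \<nu>' \<nu>' = ereal (ee \<nu>' \<nu>')"
    using mutual_energy_ee r\<mu>' r\<nu>' f by auto
  have def: "energy_defined \<kappa> (\<mu>', \<nu>')" unfolding energy_defined_def by (simp add: m1)
  have pos: "0 \<le> energy \<kappa> (\<mu>', \<nu>')" using kernel_pd sr def unfolding positive_definite_def by blast
  \<comment> \<open>The self-energies are finite, so the energy is defined in any case; an infinite
    mutual energy would make it \<open>-\<infinity>\<close>.\<close>
  have f': "J \<mu>' \<nu>' < \<infinity>"
  proof (rule ccontr)
    assume "\<not> J \<mu>' \<nu>' < \<infinity>"
    then have "J \<mu>' \<nu>' = \<infinity>" by (simp add: less_top[symmetric])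
    then have "mutual_energy \<kappa> \<mu>' \<nu>' = \<infinity>" "mutual_energy \<kappa> \<nu>' \<mu>' = \<infinity>"
      using mutual_energy_top r\<mu>' r\<nu>' J_sym by auto
    then show False using pos m1 by (simp add: energy_def)
  qed
  then show "J \<mu> \<nu> < \<infinity>" using J\<mu>\<nu> f by auto
  have f'': "J \<nu>' \<mu>' < \<infinity>" using f' J_sym r\<mu>' r\<nu>' by simp
  have key: "2 * ee \<mu>' \<nu>' \<le> ee \<mu>' \<mu>' + ee \<nu>' \<nu>'"
    using pos m1 mutual_energy_ee[OF r\<mu>' r\<nu>' f'] mutual_energy_ee[OF r\<nu>' r\<mu>' f''] ee_sym[OF r\<mu>' r\<nu>']
    by (simp add: energy_def)
  have e\<mu>: "ee \<mu> \<mu> = ee \<mu>' \<mu>' + ee \<mu>' \<eta> + (ee \<eta> \<mu>' + ee \<eta> \<eta>)"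
    using f by (subst (1 2) \<mu>_dec) (simp add: ee_comb_left ee_comb_right J_comb_right r\<mu>' r\<eta> radon_comb)
  have e\<nu>: "ee \<nu> \<nu> = ee \<nu>' \<nu>' + ee \<nu>' \<eta> + (ee \<eta> \<nu>' + ee \<eta> \<eta>)"
    using f by (subst (1 2) \<nu>_dec) (simp add: ee_comb_left ee_comb_right J_comb_right r\<nu>' r\<eta> radon_comb)
  have e\<mu>\<nu>: "ee \<mu> \<nu> = ee \<mu>' \<nu>' + ee \<mu>' \<eta> + (ee \<eta> \<nu>' + ee \<eta> \<eta>)"
  proof -
    have rc: "comb 1 \<nu>' 1 \<eta> \<in> radon" by (rule radon_comb[OF r\<nu>' r\<eta>])
    have "ee (comb 1 \<mu>' 1 \<eta>) (comb 1 \<nu>' 1 \<eta>) = 1 * ee \<mu>' (comb 1 \<nu>' 1 \<eta>) + 1 * ee \<eta> (comb 1 \<nu>' 1 \<eta>)"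
      by (rule ee_comb_left[OF r\<mu>' r\<eta> rc]) (use f f' in \<open>auto simp: J_comb_right r\<mu>' r\<nu>' r\<eta>\<close>)
    moreover have "ee \<mu>' (comb 1 \<nu>' 1 \<eta>) = 1 * ee \<mu>' \<nu>' + 1 * ee \<mu>' \<eta>"
      by (rule ee_comb_right[OF r\<nu>' r\<eta> r\<mu>']) (use f f' in auto)
    moreover have "ee \<eta> (comb 1 \<nu>' 1 \<eta>) = 1 * ee \<eta> \<nu>' + 1 * ee \<eta> \<eta>"
      by (rule ee_comb_right[OF r\<nu>' r\<eta> r\<eta>]) (use f f' in auto)
    moreover have "ee \<mu> \<nu> = ee (comb 1 \<mu>' 1 \<eta>) (comb 1 \<nu>' 1 \<eta>)" using \<mu>_dec \<nu>_dec by (rule arg_cong2)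
    ultimately show ?thesis by simp
  qed
  show "2 * ee \<mu> \<nu> \<le> ee \<mu> \<mu> + ee \<nu> \<nu>"
    using key e\<mu> e\<nu> e\<mu>\<nu> ee_sym[OF r\<mu>' r\<eta>] ee_sym[OF r\<nu>' r\<eta>] by simp
qed

text \<open>A test function on the square vanishes outside some \<open>K \<times> K\<close>, so
  restrictions to compact sets, which have finite mass, already account for the whole
  energy.\<close>

lemma J_SUP_compact:
  assumes \<mu>: "\<mu> \<in> radon" and \<nu>: "\<nu> \<in> radon"
  shows "J \<mu> \<nu> \<le> (SUP K\<in>{K. compact K}. J (density \<mu> (indicator K)) (density \<nu> (indicator K)))"
proof -
  interpret pr: lch_space "TYPE('a \<times> 'a)" by (rule lch_prod[OF lch_space_axioms])
  let ?\<pi> = "radon_prod \<mu> \<nu>"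
  have \<pi>: "?\<pi> \<in> radon" by (rule nn_integral_radon_prod(2)[OF \<mu> \<nu> kp_lsc])
  have "J \<mu> \<nu> = (\<integral>\<^sup>+p. kp p \<partial>?\<pi>)" unfolding J_def by (rule nn_integral_radon_prod(1)[OF \<mu> \<nu> kp_lsc, symmetric])
  also have "\<dots> \<le> (SUP K\<in>{K. compact K}. J (density \<mu> (indicator K)) (density \<nu> (indicator K)))"
    unfolding pr.nn_integral_lsc_Cc[OF \<pi> kp_lsc]
  proof (rule SUP_least)
    fix \<phi> assume "\<phi> \<in> {\<phi>\<in>Cc. \<forall>p. 0 \<le> \<phi> p \<and> ennreal (\<phi> p) \<le> kp p}"
    then have \<phi>: "\<phi> \<in> Cc" "\<And>p. 0 \<le> \<phi> p" "\<And>p. ennreal (\<phi> p) \<le> kp p" by auto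
    obtain K where K: "compact K" "\<And>x y. x \<notin> K \<or> y \<notin> K \<Longrightarrow> \<phi> (x, y) = 0" using Cc_slice[OF \<phi>(1)] by metis
    have Ks: "K \<in> sets borel" by (rule borel_compact[OF K(1)])
    let ?\<mu> = "density \<mu> (indicator K)" and ?\<nu> = "density \<nu> (indicator K)"
    note r = radon_restrict(1)[OF \<mu> Ks] radon_restrict(1)[OF \<nu> Ks]
    have kx: "(\<lambda>y. kp (x, y)) \<in> borel_measurable borel" for x
      using open_vimage[OF kp_lsc, of "Pair x"] by (intro lsc_measurable) (simp add: vimage_def continuous_on_Pair)
    have "(\<integral>\<^sup>+p. ennreal (\<phi> p) \<partial>?\<pi>) = (\<integral>\<^sup>+x. \<integral>\<^sup>+y. ennreal (\<phi> (x, y)) \<partial>\<nu> \<partial>\<mu>)"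
      by (rule nn_integral_radon_prod(1)[OF \<mu> \<nu>]) (intro lsc_ennreal_cont Cc_cont \<phi>)
    also have "\<dots> \<le> (\<integral>\<^sup>+x. indicator K x * (\<integral>\<^sup>+y. indicator K y * kp (x, y) \<partial>\<nu>) \<partial>\<mu>)"
    proof (rule nn_integral_mono)
      fix x
      show "(\<integral>\<^sup>+y. ennreal (\<phi> (x, y)) \<partial>\<nu>) \<le> indicator K x * (\<integral>\<^sup>+y. indicator K y * kp (x, y) \<partial>\<nu>)"
      proof (cases "x \<in> K")
        case True
        then show ?thesis using K(2) \<phi>(3) by (auto intro!: nn_integral_mono simp: indicator_def)
      qed (simp add: K(2))
    qed
    also have "\<dots> = J ?\<mu> ?\<nu>"
      unfolding J_def nn_integral_restrict[OF \<mu> Ks potential_measurable[OF r(2)]]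
      using nn_integral_restrict[OF \<nu> Ks kx] by simp
    also have "\<dots> \<le> (SUP K\<in>{K. compact K}. J (density \<mu> (indicator K)) (density \<nu> (indicator K)))"
      using K(1) by (intro SUP_upper) auto
    finally show "(\<integral>\<^sup>+p. ennreal (\<phi> p) \<partial>?\<pi>) \<le> (SUP K\<in>{K. compact K}. J (density \<mu> (indicator K)) (density \<nu> (indicator K)))" .
  qed
  finally show ?thesis .
qed

lemma J_restrict_le:
  assumes \<mu>: "\<mu> \<in> radon" and S: "S \<in> sets borel"
  shows "J (density \<mu> (indicator S)) (density \<mu> (indicator S)) \<le> J \<mu> \<mu>"
  using radon_restrict[OF \<mu> S] radon_sets[OF \<mu>] S
  by (intro J_mono) (auto intro!: emeasure_mono)

text \<open>If \<open>c \<noteq> 0\<close>, the space is compact and all masses are finite. If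
  \<open>c = 0\<close>, the kernel is nonnegative, restriction lowers the self-energies, and the
  inequality for restrictions to compact sets passes to the supremum.\<close>

lemma energy_form:
  assumes \<mu>: "\<mu> \<in> E" and \<nu>: "\<nu> \<in> E"
  shows "J \<mu> \<nu> < \<infinity>" and "2 * ee \<mu> \<nu> \<le> ee \<mu> \<mu> + ee \<nu> \<nu>"
proof -
  have r: "\<mu> \<in> radon" "\<nu> \<in> radon" and f: "J \<mu> \<mu> < \<infinity>" "J \<nu> \<nu> < \<infinity>" using \<mu> \<nu> by (auto simp: E_def)
  have "J \<mu> \<nu> < \<infinity> \<and> 2 * ee \<mu> \<nu> \<le> ee \<mu> \<mu> + ee \<nu> \<nu>"
  proof (cases "c = 0")
    case False
    then show ?thesis using radon_finite r f energy_form_finite by blast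
  next
    case True
    have bd: "2 * J (density \<mu> (indicator K)) (density \<nu> (indicator K)) \<le> J \<mu> \<mu> + J \<nu> \<nu>" if K: "compact K" for K
    proof -
      have Ks: "K \<in> sets borel" by (rule borel_compact[OF K])
      let ?\<mu> = "density \<mu> (indicator K)" and ?\<nu> = "density \<nu> (indicator K)"
      note rr = radon_restrict[OF r(1) Ks] radon_restrict[OF r(2) Ks]
      have fm: "emeasure ?\<mu> UNIV < \<infinity>" "emeasure ?\<nu> UNIV < \<infinity>"
        using rr(2)[of UNIV] rr(4)[of UNIV] radon_compact[OF r(1) K] radon_compact[OF r(2) K] by auto
      have fJ: "J ?\<mu> ?\<mu> \<le> J \<mu> \<mu>" "J ?\<nu> ?\<nu> \<le> J \<nu> \<nu>" by (rule J_restrict_le[OF r(1) Ks], rule J_restrict_le[OF r(2) Ks])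
      then have fJ': "J ?\<mu> ?\<mu> < \<infinity>" "J ?\<nu> ?\<nu> < \<infinity>" using f by (auto intro: le_less_trans)
      note ef = energy_form_finite[OF rr(1,3) fm fJ']
      have "2 * enn2real (J ?\<mu> ?\<nu>) \<le> enn2real (J ?\<mu> ?\<mu>) + enn2real (J ?\<nu> ?\<nu>)"
        using ef(2)[unfolded ee_def] True by simp
      then have "ennreal (2 * enn2real (J ?\<mu> ?\<nu>)) \<le> ennreal (enn2real (J ?\<mu> ?\<mu>) + enn2real (J ?\<nu> ?\<nu>))"
        by (rule ennreal_leI)
      then have "2 * J ?\<mu> ?\<nu> \<le> J ?\<mu> ?\<mu> + J ?\<nu> ?\<nu>"
        using ef(1) fJ' by (simp add: ennreal_mult ennreal_plus)
      also have "\<dots> \<le> J \<mu> \<mu> + J \<nu> \<nu>" using fJ by (rule add_mono)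
      finally show ?thesis .
    qed
    have "2 * J \<mu> \<nu> \<le> 2 * (SUP K\<in>{K. compact K}. J (density \<mu> (indicator K)) (density \<nu> (indicator K)))"
      by (intro mult_left_mono J_SUP_compact r) auto
    also have "\<dots> \<le> J \<mu> \<mu> + J \<nu> \<nu>"
      unfolding SUP_mult_left_ennreal using bd by (intro SUP_least) auto
    finally have le: "2 * J \<mu> \<nu> \<le> J \<mu> \<mu> + J \<nu> \<nu>" .
    have "2 * J \<mu> \<nu> < \<infinity>" using le f by (auto intro: le_less_trans)
    then have fin: "J \<mu> \<nu> < \<infinity>" by (auto simp: ennreal_mult_less_top)
    have "enn2real (2 * J \<mu> \<nu>) \<le> enn2real (J \<mu> \<mu> + J \<nu> \<nu>)" using le f by (intro enn2real_mono) auto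
    then show ?thesis unfolding ee_def using fin True f by (simp add: enn2real_mult enn2real_plus)
  qed
  then show "J \<mu> \<nu> < \<infinity>" "2 * ee \<mu> \<nu> \<le> ee \<mu> \<mu> + ee \<nu> \<nu>" by auto
qed

lemma E_comb: "\<mu> \<in> E \<Longrightarrow> \<nu> \<in> E \<Longrightarrow> comb a \<mu> b \<nu> \<in> E"
  using energy_form(1)[of \<mu> \<nu>] energy_form(1)[of \<nu> \<mu>]
  by (auto simp: E_def radon_comb J_comb_left J_comb_right ennreal_mult_less_top)

lemma ee_bilinear:
  assumes "\<mu> \<in> E" "\<nu> \<in> E" "\<tau> \<in> E" "0 \<le> a" "0 \<le> b"
  shows "ee (comb a \<mu> b \<nu>) \<tau> = a * ee \<mu> \<tau> + b * ee \<nu> \<tau>" "ee \<tau> (comb a \<mu> b \<nu>) = a * ee \<tau> \<mu> + b * ee \<tau> \<nu>"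
  using assms energy_form(1) by (auto intro!: ee_comb_left ee_comb_right E_radon)

lemma ee_symE: "\<mu> \<in> E \<Longrightarrow> \<nu> \<in> E \<Longrightarrow> ee \<mu> \<nu> = ee \<nu> \<mu>"
  by (intro ee_sym E_radon)

text \<open>The square of \<open>\<parallel>\<mu> - \<nu>\<parallel>\<close>, expanded so that no
  signed measure has to be formed.\<close>

definition dsq :: "'a measure \<Rightarrow> 'a measure \<Rightarrow> real" where
  "dsq \<mu> \<nu> = ee \<mu> \<mu> + ee \<nu> \<nu> - 2 * ee \<mu> \<nu>"

lemma dsq_nonneg: "\<mu> \<in> E \<Longrightarrow> \<nu> \<in> E \<Longrightarrow> 0 \<le> dsq \<mu> \<nu>"
  using energy_form(2)[of \<mu> \<nu>] by (simp add: dsq_def)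

lemma energy_eq:
  assumes "\<mu> \<in> E" "\<nu> \<in> E"
  shows "energy \<kappa> (\<mu>, \<nu>) = ereal (dsq \<mu> \<nu>)"
  using assms energy_form(1) mutual_energy_ee E_radon ee_symE[OF assms]
  by (simp add: energy_def dsq_def)

lemma strong_dist_eq: "\<mu> \<in> E \<Longrightarrow> \<nu> \<in> E \<Longrightarrow> strong_dist \<kappa> \<mu> \<nu> = sqrt (dsq \<mu> \<nu>)"
  by (simp add: strong_dist_def energy_eq)

lemma null_E: "comb 0 \<mu> 0 \<mu> \<in> E" if "\<mu> \<in> radon"
  using that by (simp add: E_def radon_comb J_comb_left J_comb_right)

text \<open>The inequality of \<open>energy_form\<close> against the zero measure, which is written
  as a combination with coefficients 0.\<close>

lemma ee_nonneg: "\<mu> \<in> E \<Longrightarrow> 0 \<le> ee \<mu> \<mu>"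
  using energy_form(2)[of \<mu> "comb 0 \<mu> 0 \<mu>"] null_E[OF E_radon] ee_bilinear[of \<mu> \<mu> \<mu> 0 0]
    ee_bilinear[of \<mu> \<mu> "comb 0 \<mu> 0 \<mu>" 0 0] by simp

text \<open>The polynomial \<open>\<parallel>P - Q + s \<sigma>\<parallel>\<^sup>2\<close> in
  \<open>s\<close> is nonnegative, and its discriminant gives the claim. Only positive measures can
  be combined, so for negative \<open>s\<close> the term is moved over to \<open>Q\<close>.\<close>

lemma ee_CS:
  assumes P: "P \<in> E" and Q: "Q \<in> E" and \<sigma>: "\<sigma> \<in> E"
  shows "(ee P \<sigma> - ee Q \<sigma>)\<^sup>2 \<le> dsq P Q * ee \<sigma> \<sigma>"
proof -
  define d where "d = ee P \<sigma> - ee Q \<sigma>"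
  have 1: "0 \<le> dsq P Q + 2 * s * d + s\<^sup>2 * ee \<sigma> \<sigma>" if s: "0 \<le> s" for s
  proof -
    have "0 \<le> dsq (comb 1 P s \<sigma>) Q" by (intro dsq_nonneg E_comb P Q \<sigma>)
    also have "\<dots> = dsq P Q + 2 * s * d + s\<^sup>2 * ee \<sigma> \<sigma>"
      using s P Q \<sigma> ee_symE[OF P \<sigma>] ee_symE[OF Q \<sigma>]
      by (simp add: dsq_def ee_bilinear E_comb d_def algebra_simps power2_eq_square)
    finally show ?thesis .
  qed
  have 2: "0 \<le> dsq P Q - 2 * s * d + s\<^sup>2 * ee \<sigma> \<sigma>" if s: "0 \<le> s" for s
  proof -
    have "0 \<le> dsq P (comb 1 Q s \<sigma>)" by (intro dsq_nonneg E_comb P Q \<sigma>)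
    also have "\<dots> = dsq P Q - 2 * s * d + s\<^sup>2 * ee \<sigma> \<sigma>"
      using s P Q \<sigma> ee_symE[OF P \<sigma>] ee_symE[OF Q \<sigma>]
      by (simp add: dsq_def ee_bilinear E_comb d_def algebra_simps power2_eq_square)
    finally show ?thesis .
  qed
  have 3: "0 \<le> dsq P Q + 2 * s * d + s\<^sup>2 * ee \<sigma> \<sigma>" for s
    using 1[of s] 2[of "- s"] by (cases "0 \<le> s") auto
  show ?thesis
  proof (cases "ee \<sigma> \<sigma> = 0")
    case True
    have "d = 0"
    proof (rule ccontr)
      assume d: "d \<noteq> 0"
      \<comment> \<open>For \<open>ee \<sigma> \<sigma> = 0\<close> the polynomial is affine, and
        this value of \<open>s\<close> makes it equal to -1.\<close>
      have "0 \<le> dsq P Q + 2 * (- (dsq P Q + 1) / (2 * d)) * d" using 3[of "- (dsq P Q + 1) / (2 * d)"] True by simp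
      then show False using d by (simp add: field_simps)
    qed
    then show ?thesis using True by (simp add: d_def)
  next
    case False
    then have pos: "0 < ee \<sigma> \<sigma>" using ee_nonneg[OF \<sigma>] by simp
    \<comment> \<open>The minimiser \<open>s = - d / ee \<sigma> \<sigma>\<close> of the
      polynomial.\<close>
    have "0 \<le> dsq P Q + 2 * (- d / ee \<sigma> \<sigma>) * d + (- d / ee \<sigma> \<sigma>)\<^sup>2 * ee \<sigma> \<sigma>" by (rule 3)
    also have "\<dots> = dsq P Q - d\<^sup>2 / ee \<sigma> \<sigma>" using pos by (simp add: field_simps power2_eq_square)
    finally show ?thesis using pos by (simp add: field_simps d_def)
  qed
qed

lemma mid_comb: "mid \<mu> \<nu> = comb (1/2) \<mu> (1/2) \<nu>"
  unfolding mid_def comb_def by (intro arg_cong2[where f="wsum {0, 1}"]) auto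

lemma ee_mid:
  assumes "\<mu> \<in> E" "\<nu> \<in> E"
  shows "mid \<mu> \<nu> \<in> E" "2 * ee \<mu> \<mu> + 2 * ee \<nu> \<nu> - 4 * ee (mid \<mu> \<nu>) (mid \<mu> \<nu>) = dsq \<mu> \<nu>"
    "\<tau> \<in> E \<Longrightarrow> ee (mid \<mu> \<nu>) \<tau> = (ee \<mu> \<tau> + ee \<nu> \<tau>) / 2"
  using assms ee_symE[OF assms]
  by (simp_all add: mid_comb E_comb ee_bilinear dsq_def field_simps)

end

subsection \<open>Cauchy filters of almost minimal elements\<close>

text \<open>The parallelogram law makes almost minimal elements of a directed family of convex sets Cauchy.
  This replaces the use of weakly convergent nets.\<close>
lemma Cauchy_filter_of_convex_sets:
  fixes H :: "'b \<Rightarrow> real" and mid :: "'b \<Rightarrow> 'b \<Rightarrow> 'b"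
  assumes ne: "\<S> \<noteq> {}" and nes: "\<And>S. S \<in> \<S> \<Longrightarrow> S \<noteq> {}"
    and dir: "\<And>S S'. S \<in> \<S> \<Longrightarrow> S' \<in> \<S> \<Longrightarrow> \<exists>U\<in>\<S>. U \<subseteq> S \<inter> S'"
    and mid: "\<And>S x y. S \<in> \<S> \<Longrightarrow> x \<in> S \<Longrightarrow> y \<in> S \<Longrightarrow> mid x y \<in> S"
    and H: "\<And>S x. S \<in> \<S> \<Longrightarrow> x \<in> S \<Longrightarrow> 0 \<le> H x \<and> H x \<le> B"
  obtains F where "F \<noteq> bot" "\<And>S. S \<in> \<S> \<Longrightarrow> eventually (\<lambda>x. x \<in> S) F"
    "\<And>e. 0 < e \<Longrightarrow> \<exists>S\<in>\<S>. \<exists>P. eventually P F \<and> (\<forall>x. P x \<longrightarrow> x \<in> S) \<and>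
       (\<forall>x y. P x \<longrightarrow> P y \<longrightarrow> 2 * H x + 2 * H y - 4 * H (mid x y) < e)"
proof -
  define d where "d S = (INF x\<in>S. H x)" for S
  have bdb: "bdd_below (H ` S)" if "S \<in> \<S>" for S using H[OF that] by (auto intro!: bdd_belowI2)
  have dB: "d S \<le> B" if S: "S \<in> \<S>" for S
  proof -
    obtain x where x: "x \<in> S" using nes[OF S] by blast
    have "d S \<le> H x" unfolding d_def by (rule cINF_lower[OF bdb[OF S] x])
    then show ?thesis using H[OF S x] by simp
  qed
  have bda: "bdd_above (d ` \<S>)" using dB by (auto intro!: bdd_aboveI2)
  \<comment> \<open>The infima grow as the sets shrink, and \<open>D\<close> is their limit. Every
    set contains points with \<open>H\<close> at most \<open>D + e\<close>; in a set whose infimum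
    is close to \<open>D\<close>, the midpoint of two such points cannot do much better than they
    do.\<close>
  define D where "D = (SUP S\<in>\<S>. d S)"
  have dD: "d S \<le> D" if "S \<in> \<S>" for S unfolding D_def by (rule cSUP_upper[OF that bda])
  define V where "V = (\<lambda>(S, e::real). {x\<in>S. H x \<le> D + e})"
  define I where "I = \<S> \<times> {e::real. 0 < e}"
  define F where "F = (INF p\<in>I. principal (V p))"
  have Ine: "I \<noteq> {}" using ne by (auto simp: I_def intro!: exI[of _ 1])
  have ev: "eventually P F \<longleftrightarrow> (\<exists>p\<in>I. \<forall>x\<in>V p. P x)" for P
    unfolding F_def
  proof (subst eventually_INF_base[OF Ine])
    fix p q assume "p \<in> I" "q \<in> I"
    then obtain S e S' e' where pq: "p = (S, e)" "q = (S', e')" "S \<in> \<S>" "S' \<in> \<S>" "0 < e" "0 < e'"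
      by (auto simp: I_def)
    obtain U where U: "U \<in> \<S>" "U \<subseteq> S \<inter> S'" using dir pq by blast
    have "V (U, min e e') \<subseteq> V p \<inter> V q" using U pq by (auto simp: V_def)
    then show "\<exists>x\<in>I. principal (V x) \<le> inf (principal (V p)) (principal (V q))"
      using U pq by (intro bexI[of _ "(U, min e e')"]) (auto simp: I_def)
  qed (simp add: eventually_principal)
  have Vne: "V p \<noteq> {}" if p: "p \<in> I" for p
  proof -
    obtain S e where p: "p = (S, e)" "S \<in> \<S>" "0 < e" using p by (auto simp: I_def)
    have "(INF x\<in>S. H x) < D + e" using dD[OF p(2)] p(3) by (simp add: d_def)
    then obtain x where "x \<in> S" "H x < D + e" using cINF_less_iff[OF nes[OF p(2)] bdb[OF p(2)]] by blast
    then show ?thesis using p by (auto simp: V_def)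
  qed
  show thesis
  proof (rule that[of F])
    show "F \<noteq> bot" using Vne ev[of "\<lambda>_. False"] by (auto simp: trivial_limit_def)
    show "eventually (\<lambda>x. x \<in> S) F" if "S \<in> \<S>" for S
      unfolding ev using that by (intro bexI[of _ "(S, 1)"]) (auto simp: V_def I_def)
    fix e :: real assume e: "0 < e"
    \<comment> \<open>Two values at most \<open>D + e / 9\<close> and a midpoint value above
      \<open>D - e / 9\<close> give less than \<open>8 * e / 9\<close> in the parallelogram
      expression.\<close>
    have "D - e / 9 < (SUP S\<in>\<S>. d S)" using e by (simp add: D_def)
    then obtain S where S: "S \<in> \<S>" "D - e / 9 < d S" using less_cSUP_iff[OF ne bda] by blast
    show "\<exists>S\<in>\<S>. \<exists>P. eventually P F \<and> (\<forall>x. P x \<longrightarrow> x \<in> S) \<and>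
       (\<forall>x y. P x \<longrightarrow> P y \<longrightarrow> 2 * H x + 2 * H y - 4 * H (mid x y) < e)"
    proof (intro bexI[of _ S] exI[of _ "\<lambda>x. x \<in> V (S, e / 9)"] conjI allI impI)
      show "eventually (\<lambda>x. x \<in> V (S, e / 9)) F"
        unfolding ev using S e by (intro bexI[of _ "(S, e / 9)"]) (auto simp: I_def)
      show "x \<in> S" if "x \<in> V (S, e / 9)" for x using that by (auto simp: V_def)
      fix x y assume "x \<in> V (S, e / 9)" "y \<in> V (S, e / 9)"
      then have xy: "x \<in> S" "y \<in> S" "H x \<le> D + e / 9" "H y \<le> D + e / 9" by (auto simp: V_def)
      have "d S \<le> H (mid x y)" unfolding d_def by (rule cINF_lower[OF bdb[OF S(1)] mid[OF S(1) xy(1,2)]])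
      then show "2 * H x + 2 * H y - 4 * H (mid x y) < e" using xy S(2) e by argo
    qed (rule S(1))
  qed
qed

subsection \<open>The vague topology\<close>

lemma vague_nbhd_eventually:
  fixes G :: "'a::topological_space measure filter"
  assumes r: "eventually (\<lambda>\<mu>. \<mu> \<in> radon) G" and \<mu>0: "\<mu>0 \<in> radon"
    and lim: "\<And>\<phi>. \<phi> \<in> Cc \<Longrightarrow> ((\<lambda>\<mu>. integral\<^sup>L \<mu> \<phi>) \<longlongrightarrow> integral\<^sup>L \<mu>0 \<phi>) G"
    and U: "openin vague U" "\<mu>0 \<in> U"
  shows "eventually (\<lambda>\<mu>. \<mu> \<in> U) G"
proof -
  let ?P = "product_topology (\<lambda>_. euclideanreal) (Cc :: ('a \<Rightarrow> real) set)"
  let ?f = "\<lambda>\<mu>::'a measure. \<lambda>\<phi>\<in>Cc. integral\<^sup>L \<mu> \<phi>"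
  obtain T where T: "openin ?P T" "U = ?f -` T \<inter> radon"
    using U(1) unfolding vague_def openin_pullback_topology by blast
  have "limitin ?P ?f (?f \<mu>0) G"
    unfolding limitin_componentwise
    using lim by (auto simp: limitin_canonical_iff)
  moreover have "?f \<mu>0 \<in> T" using U(2) T(2) by blast
  ultimately have "eventually (\<lambda>\<mu>. ?f \<mu> \<in> T) G" using T(1) unfolding limitin_def by blast
  then show ?thesis using r by eventually_elim (use T(2) in auto)
qed

text \<open>Open sets of the pullback are traces of preimages, so an open cover of \<open>Q\<close>
  comes from an open cover of its image.\<close>

lemma compactin_pullback:
  assumes Q: "Q \<subseteq> D" and f: "f ` Q \<subseteq> topspace T" and comp: "compactin T (f ` Q)"
  shows "compactin (pullback_topology D f T) Q"
  unfolding compactin_def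
proof (intro conjI allI impI)
  show "Q \<subseteq> topspace (pullback_topology D f T)" using Q f by (auto simp: topspace_pullback_topology)
  fix \<U> assume "Ball \<U> (openin (pullback_topology D f T)) \<and> Q \<subseteq> \<Union> \<U>"
  then have \<U>: "\<And>U. U \<in> \<U> \<Longrightarrow> openin (pullback_topology D f T) U" "Q \<subseteq> \<Union>\<U>" by auto
  have "\<exists>W. openin T W \<and> U = f -` W \<inter> D" if "U \<in> \<U>" for U using \<U>(1)[OF that] by (simp add: openin_pullback_topology)
  then obtain W where W: "\<And>U. U \<in> \<U> \<Longrightarrow> openin T (W U) \<and> U = f -` W U \<inter> D" by metis
  have cov: "f ` Q \<subseteq> \<Union>(W ` \<U>)" using \<U>(2) W by fastforce
  have "\<forall>w\<in>W ` \<U>. openin T w" using W by blast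
  then obtain \<F> where \<F>: "finite \<F>" "\<F> \<subseteq> W ` \<U>" "f ` Q \<subseteq> \<Union>\<F>"
    using comp cov unfolding compactin_def by (metis (no_types, lifting))
  then obtain \<V> where \<V>: "\<V> \<subseteq> \<U>" "finite \<V>" "\<F> = W ` \<V>" by (metis finite_subset_image)
  show "\<exists>\<F>. finite \<F> \<and> \<F> \<subseteq> \<U> \<and> Q \<subseteq> \<Union> \<F>"
  proof (intro exI[of _ \<V>] conjI \<V> subsetI)
    fix q assume q: "q \<in> Q"
    then obtain U where U: "U \<in> \<V>" "f q \<in> W U" using \<F>(3) \<V>(3) by blast
    then have "q \<in> U" using W[of U] \<V>(1) q Q by auto
    then show "q \<in> \<Union>\<V>" using U(1) by blast
  qed
qed

text \<open>Closed conditions are encoded as inequalities \<open>0 \<le> h L\<close>; an equation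
  contributes two opposite functions.\<close>

lemma compactin_constraints:
  assumes "compactin P Box" "\<And>h. h \<in> \<H> \<Longrightarrow> continuous_map P euclideanreal h"
  shows "compactin P {L\<in>Box. \<forall>h\<in>\<H>. 0 \<le> h L}"
proof -
  have cl: "closedin P {L\<in>topspace P. h L \<in> {0..}}" if "h \<in> \<H>" for h
    by (rule closedin_continuous_map_preimage[OF assms(2)[OF that]]) (simp flip: closed_closedin)
  have "closedin P (topspace P \<inter> (\<Inter>h\<in>\<H>. {L\<in>topspace P. h L \<in> {0..}}))"
  proof (cases "\<H> = {}")
    case False
    then have "closedin P (\<Inter>h\<in>\<H>. {L\<in>topspace P. h L \<in> {0..}})" using cl by (intro closedin_INT) auto
    then show ?thesis by (intro closedin_Int closedin_topspace)
  qed simp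
  then have "compactin P ((topspace P \<inter> (\<Inter>h\<in>\<H>. {L\<in>topspace P. h L \<in> {0..}})) \<inter> Box)"
    using assms(1) by (rule closed_Int_compactin)
  moreover have "(topspace P \<inter> (\<Inter>h\<in>\<H>. {L\<in>topspace P. h L \<in> {0..}})) \<inter> Box = {L\<in>Box. \<forall>h\<in>\<H>. 0 \<le> h L}"
    using compactin_subset_topspace[OF assms(1)] by auto
  ultimately show ?thesis by simp
qed

text \<open>The box is compact by Tychonoff's theorem, and \<open>\<H>\<close> cuts out the positive
  linear functionals that vanish on nonnegative test functions zero on \<open>A\<close>. By the
  Riesz theorem each of these is integration against a Radon measure, so the image of the set under
  evaluation is closed in the box.\<close>

lemma (in lch_space) compactin_vague_bounded:
  fixes A :: "'a set" and b :: "('a \<Rightarrow> real) \<Rightarrow> real"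
  assumes A: "closed A"
  shows "compactin vague {\<mu> \<in> radon_on A. \<forall>\<phi>\<in>Cc. \<bar>integral\<^sup>L \<mu> \<phi>\<bar> \<le> b \<phi>}"
    (is "compactin _ ?Q")
  unfolding vague_def
proof (rule compactin_pullback)
  let ?P = "product_topology (\<lambda>_. euclideanreal) (Cc :: ('a \<Rightarrow> real) set)"
  let ?ev = "\<lambda>\<mu>::'a measure. \<lambda>\<phi>\<in>Cc. integral\<^sup>L \<mu> \<phi>"
  let ?Box = "\<Pi>\<^sub>E \<phi>\<in>(Cc :: ('a \<Rightarrow> real) set). {- b \<phi>..b \<phi>}"
  show "?Q \<subseteq> radon" by (auto simp: radon_on_def)
  show "?ev ` ?Q \<subseteq> topspace ?P" by auto
  define \<H> where "\<H> =
    (\<Union>\<phi>\<in>(Cc :: ('a \<Rightarrow> real) set). \<Union>\<psi>\<in>Cc. {\<lambda>L. L (\<lambda>x. \<phi> x + \<psi> x) - (L \<phi> + L \<psi>), \<lambda>L. (L \<phi> + L \<psi>) - L (\<lambda>x. \<phi> x + \<psi> x)}) \<union>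
    (\<Union>\<phi>\<in>(Cc :: ('a \<Rightarrow> real) set). \<Union>c. {\<lambda>L. L (\<lambda>x. c * \<phi> x) - c * L \<phi>, \<lambda>L. c * L \<phi> - L (\<lambda>x. c * \<phi> x)}) \<union>
    {\<lambda>L. L \<phi> | \<phi>. \<phi> \<in> (Cc :: ('a \<Rightarrow> real) set) \<and> (\<forall>x. 0 \<le> \<phi> x)} \<union>
    {\<lambda>L. - L \<phi> | \<phi>. \<phi> \<in> (Cc :: ('a \<Rightarrow> real) set) \<and> (\<forall>x. 0 \<le> \<phi> x) \<and> (\<forall>x\<in>A. \<phi> x = 0)}"
  have proj: "continuous_map ?P euclideanreal (\<lambda>L. L \<phi>)" if "\<phi> \<in> Cc" for \<phi>
    using continuous_map_product_projection[OF that, of "\<lambda>_. euclideanreal"] by simp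
  have cont: "continuous_map ?P euclideanreal h" if "h \<in> \<H>" for h
    using that unfolding \<H>_def
    by (auto intro!: continuous_map_diff continuous_map_add continuous_map_real_mult_left continuous_map_minus proj Cc_add Cc_cmult)
  have cS: "compactin ?P {L\<in>?Box. \<forall>h\<in>\<H>. 0 \<le> h L}"
    by (rule compactin_constraints[OF _ cont]) (auto simp: compactin_PiE)
  have "?ev ` ?Q = {L\<in>?Box. \<forall>h\<in>\<H>. 0 \<le> h L}"
  proof (intro equalityI subsetI)
    fix L assume "L \<in> ?ev ` ?Q"
    then obtain \<mu> where \<mu>: "\<mu> \<in> radon_on A" "\<And>\<phi>. \<phi> \<in> Cc \<Longrightarrow> \<bar>integral\<^sup>L \<mu> \<phi>\<bar> \<le> b \<phi>" and L: "L = ?ev \<mu>" by blast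
    have r: "\<mu> \<in> radon" using \<mu>(1) by (simp add: radon_on_def)
    have z: "integral\<^sup>L \<mu> \<phi> = 0" if "\<forall>x\<in>A. \<phi> x = 0" for \<phi> :: "'a \<Rightarrow> real"
      using radon_on_AE[OF \<mu>(1) A] that by (intro integral_eq_zero_AE) auto
    have "L \<in> ?Box" using \<mu>(2) by (auto simp: L abs_le_iff minus_le_iff)
    moreover have "0 \<le> h L" if "h \<in> \<H>" for h
      using that unfolding \<H>_def
      by (auto simp: L Cc_add Cc_cmult Cc_integrable[OF r] z intro!: integral_nonneg_AE)
    ultimately show "L \<in> {L\<in>?Box. \<forall>h\<in>\<H>. 0 \<le> h L}" by blast
  next
    fix L assume "L \<in> {L\<in>?Box. \<forall>h\<in>\<H>. 0 \<le> h L}"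
    then have box: "L \<in> ?Box" and h: "\<And>h. h \<in> \<H> \<Longrightarrow> 0 \<le> h L" by auto
    have "positive_linear L"
      unfolding positive_linear_def
    proof (intro conjI ballI allI impI)
      fix \<phi> \<psi> :: "'a \<Rightarrow> real" assume *: "\<phi> \<in> Cc" "\<psi> \<in> Cc"
      have "(\<lambda>L. L (\<lambda>x. \<phi> x + \<psi> x) - (L \<phi> + L \<psi>)) \<in> \<H>" "(\<lambda>L. (L \<phi> + L \<psi>) - L (\<lambda>x. \<phi> x + \<psi> x)) \<in> \<H>"
        unfolding \<H>_def using * by blast+
      from h[OF this(1)] h[OF this(2)] show "L (\<lambda>x. \<phi> x + \<psi> x) = L \<phi> + L \<psi>" by simp
    next
      fix c and \<phi> :: "'a \<Rightarrow> real" assume *: "\<phi> \<in> Cc"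
      have "(\<lambda>L. L (\<lambda>x. c * \<phi> x) - c * L \<phi>) \<in> \<H>" "(\<lambda>L. c * L \<phi> - L (\<lambda>x. c * \<phi> x)) \<in> \<H>"
        unfolding \<H>_def using * by blast+
      from h[OF this(1)] h[OF this(2)] show "L (\<lambda>x. c * \<phi> x) = c * L \<phi>" by simp
    next
      fix \<phi> :: "'a \<Rightarrow> real" assume *: "\<phi> \<in> Cc" "\<forall>x. 0 \<le> \<phi> x"
      have "(\<lambda>L. L \<phi>) \<in> \<H>" unfolding \<H>_def using * by blast
      from h[OF this] show "0 \<le> L \<phi>" .
    qed
    then obtain \<mu> where \<mu>: "\<mu> \<in> radon" "\<And>\<phi>. \<phi> \<in> Cc \<Longrightarrow> integral\<^sup>L \<mu> \<phi> = L \<phi>"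
      using riesz_representation by metis
    have ev: "?ev \<mu> = L" using \<mu>(2) box by (intro ext) (auto simp: restrict_def PiE_def extensional_def)
    have bd: "\<bar>integral\<^sup>L \<mu> \<phi>\<bar> \<le> b \<phi>" if "\<phi> \<in> Cc" for \<phi>
      using PiE_mem[OF box that] \<mu>(2)[OF that] by (auto simp: abs_le_iff)
    \<comment> \<open>A Urysohn function for a compact set off \<open>A\<close> can be supported off
      \<open>A\<close>, where \<open>\<H>\<close> forces its integral to be 0.\<close>
    have "emeasure \<mu> (- A) \<le> 0"
      unfolding radon_inner[OF \<mu>(1) borel_open[OF open_Compl[OF A]]]
    proof (rule SUP_least)
      fix K assume "K \<in> {K. compact K \<and> K \<subseteq> - A}"
      then have K: "compact K" "K \<subseteq> - A" by auto
      obtain \<phi> :: "'a \<Rightarrow> real" and C where \<phi>: "\<phi> \<in> Cc" "\<And>x. 0 \<le> \<phi> x" "\<And>x. \<phi> x \<le> 1" "\<And>x. x \<in> K \<Longrightarrow> \<phi> x = 1"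
        "compact C" "C \<subseteq> - A" "\<And>x. x \<notin> C \<Longrightarrow> \<phi> x = 0" using urysohn[OF K(1) open_Compl[OF A] K(2)] by metis
      have "\<forall>x\<in>A. \<phi> x = 0" using \<phi>(6,7) by blast
      then have "(\<lambda>L. - L \<phi>) \<in> \<H>" unfolding \<H>_def using \<phi>(1,2) by blast
      from h[OF this] have "integral\<^sup>L \<mu> \<phi> \<le> 0" using \<mu>(2)[OF \<phi>(1)] by simp
      moreover have "emeasure \<mu> K \<le> ennreal (integral\<^sup>L \<mu> \<phi>)"
        using riesz_content_integral[OF \<mu>(1) K(1)] riesz_content_le[of \<phi> K "integral\<^sup>L \<mu>"] \<phi> by simp
      ultimately show "emeasure \<mu> K \<le> 0" by (simp add: ennreal_neg)
    qed
    then have "\<mu> \<in> radon_on A" using msupport_subset_iff[OF \<mu>(1) A] \<mu>(1) by (simp add: radon_on_def)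
    then have "\<mu> \<in> ?Q" using bd by blast
    then show "L \<in> ?ev ` ?Q" using ev by blast
  qed
  then show "compactin ?P (?ev ` ?Q)" using cS by simp
qed

text \<open>One test function below \<open>u\<close> brings the integral against
  \<open>\<mu>0\<close> above \<open>y\<close>, and its own integrals converge.\<close>

lemma (in lch_space) nn_integral_lsc_vague_le:
  fixes G :: "'b filter" and \<mu> :: "'b \<Rightarrow> 'a measure" and u :: "'a \<Rightarrow> ennreal"
  assumes r: "eventually (\<lambda>i. \<mu> i \<in> radon) G" and \<mu>0: "\<mu>0 \<in> radon"
    and lim: "\<And>\<phi>. \<phi> \<in> Cc \<Longrightarrow> ((\<lambda>i. integral\<^sup>L (\<mu> i) \<phi>) \<longlongrightarrow> integral\<^sup>L \<mu>0 \<phi>) G"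
    and u: "\<And>t. open {x. t < u x}" and y: "y < (\<integral>\<^sup>+x. u x \<partial>\<mu>0)"
  shows "eventually (\<lambda>i. y < (\<integral>\<^sup>+x. u x \<partial>\<mu> i)) G"
proof -
  obtain \<phi> where \<phi>: "\<phi> \<in> Cc" "\<And>x. 0 \<le> \<phi> x" "\<And>x. ennreal (\<phi> x) \<le> u x" "y < (\<integral>\<^sup>+x. ennreal (\<phi> x) \<partial>\<mu>0)"
    using y unfolding nn_integral_lsc_Cc[OF \<mu>0 u] less_SUP_iff by blast
  have eq: "(\<integral>\<^sup>+x. ennreal (\<phi> x) \<partial>\<nu>) = ennreal (integral\<^sup>L \<nu> \<phi>)" if "\<nu> \<in> radon" for \<nu>
    using nn_integral_eq_integral[OF Cc_integrable[OF that \<phi>(1)]] \<phi>(2) by simp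
  have "y < ennreal (integral\<^sup>L \<mu>0 \<phi>)" using \<phi>(4) eq[OF \<mu>0] by simp
  then have "eventually (\<lambda>i. y < ennreal (integral\<^sup>L (\<mu> i) \<phi>)) G"
    by (rule order_tendstoD(1)[OF tendsto_ennrealI[OF lim[OF \<phi>(1)]]])
  then show ?thesis using r
  proof eventually_elim
    case (elim i)
    then show ?case using eq[of "\<mu> i"] nn_integral_mono[of "\<mu> i" "\<lambda>x. ennreal (\<phi> x)" u] \<phi>(3)
      by (simp add: less_le_trans)
  qed
qed

locale consistent_kernel = kernel_space +
  assumes kernel_consistent: "consistent \<kappa>"
begin

text \<open>Convergence on test functions along a proper filter makes \<open>\<mu>0\<close> a vague
  cluster point, as consistency requires; \<open>dsq\<close> replaces \<open>strong_dist\<close> so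
  that later estimates are polynomial identities.\<close>

lemma consistentD:
  assumes F: "F \<noteq> bot" and E: "eventually (\<lambda>\<mu>. \<mu> \<in> E) F"
    and cau: "\<And>e. 0 < e \<Longrightarrow> \<exists>P. eventually P F \<and> (\<forall>\<mu> \<nu>. P \<mu> \<longrightarrow> P \<nu> \<longrightarrow> dsq \<mu> \<nu> < e)"
    and \<mu>0: "\<mu>0 \<in> radon"
    and lim: "\<And>\<phi>. \<phi> \<in> Cc \<Longrightarrow> ((\<lambda>\<mu>. integral\<^sup>L \<mu> \<phi>) \<longlongrightarrow> integral\<^sup>L \<mu>0 \<phi>) F"
  shows "\<mu>0 \<in> E" "((\<lambda>\<mu>. dsq \<mu> \<mu>0) \<longlongrightarrow> 0) F"
proof -
  have r: "eventually (\<lambda>\<mu>. \<mu> \<in> radon) F" using E by eventually_elim (rule E_radon)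
  have 1: "\<exists>P. eventually P F \<and> (\<forall>\<mu> \<nu>. P \<mu> \<longrightarrow> P \<nu> \<longrightarrow> strong_dist \<kappa> \<mu> \<nu> < e)" if e: "0 < e" for e
  proof -
    obtain P where P: "eventually P F" "\<And>\<mu> \<nu>. P \<mu> \<Longrightarrow> P \<nu> \<Longrightarrow> dsq \<mu> \<nu> < e\<^sup>2"
      using cau[of "e\<^sup>2"] e by auto
    have "eventually (\<lambda>\<mu>. P \<mu> \<and> \<mu> \<in> E) F" using P(1) E by (rule eventually_conj)
    moreover have "strong_dist \<kappa> \<mu> \<nu> < e" if "P \<mu> \<and> \<mu> \<in> E" "P \<nu> \<and> \<nu> \<in> E" for \<mu> \<nu>
      using that P(2)[of \<mu> \<nu>] e by (simp add: strong_dist_eq real_less_lsqrt)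
    ultimately show ?thesis by (intro exI[of _ "\<lambda>\<mu>. P \<mu> \<and> \<mu> \<in> E"]) blast
  qed
  have 2: "frequently (\<lambda>\<mu>. \<mu> \<in> U) F" if "openin vague U" "\<mu>0 \<in> U" for U
    by (rule eventually_frequently[OF F vague_nbhd_eventually[OF r \<mu>0 lim that]])
  have "\<mu>0 \<in> E \<and> ((\<lambda>\<mu>. strong_dist \<kappa> \<mu> \<mu>0) \<longlongrightarrow> 0) F"
    using kernel_consistent[unfolded consistent_def, rule_format, of F \<mu>0] F E 1 2 \<mu>0
    unfolding finite_energy_pos_eq by auto
  then have \<mu>0E: "\<mu>0 \<in> E" and l: "((\<lambda>\<mu>. strong_dist \<kappa> \<mu> \<mu>0) \<longlongrightarrow> 0) F" by auto
  show "\<mu>0 \<in> E" by (rule \<mu>0E)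
  have "((\<lambda>\<mu>. (strong_dist \<kappa> \<mu> \<mu>0)\<^sup>2) \<longlongrightarrow> 0\<^sup>2) F" by (intro tendsto_power l)
  moreover have "eventually (\<lambda>\<mu>. (strong_dist \<kappa> \<mu> \<mu>0)\<^sup>2 = dsq \<mu> \<mu>0) F"
    using E by eventually_elim (simp add: strong_dist_eq \<mu>0E dsq_nonneg)
  ultimately show "((\<lambda>\<mu>. dsq \<mu> \<mu>0) \<longlongrightarrow> 0) F" by (simp add: tendsto_cong)
qed

end

section \<open>Capacity and tightness\<close>

context kernel_space begin

text \<open>For \<open>c = 0\<close> the kernel is nonnegative, so restricting to \<open>C\<close>
  does not raise the energy; normalising divides it by \<open>m\<^sup>2\<close>.\<close>

lemma normalized_restriction:
  assumes c0: "c = 0" and \<mu>: "\<mu> \<in> E" and C: "compact C" and m: "emeasure \<mu> C = ennreal m" "0 < m"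
  obtains \<nu> where "\<nu> \<in> E" "emeasure \<nu> UNIV = 1" "compact (msupport \<nu>)" "msupport \<nu> \<subseteq> C"
    "ee \<nu> \<nu> \<le> ee \<mu> \<mu> / m\<^sup>2"
proof -
  have Cs: "C \<in> sets borel" by (rule borel_compact[OF C])
  have cC: "closed C" by (rule compact_imp_closed[OF C])
  have r: "\<mu> \<in> radon" by (rule E_radon[OF \<mu>])
  define \<rho> where "\<rho> = density \<mu> (indicator C)"
  note rr = radon_restrict[OF r Cs, folded \<rho>_def]
  have Jle: "J \<rho> \<rho> \<le> J \<mu> \<mu>" unfolding \<rho>_def by (rule J_restrict_le[OF r Cs])
  have J\<mu>: "J \<mu> \<mu> < \<infinity>" using \<mu> by (simp add: E_def)
  have \<rho>E: "\<rho> \<in> E" using rr(1) Jle J\<mu> by (auto simp: E_def intro: le_less_trans)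
  have ele: "ee \<rho> \<rho> \<le> ee \<mu> \<mu>"
    unfolding ee_def using c0 Jle J\<mu> by (simp add: enn2real_mono)
  define \<nu> where "\<nu> = comb (1 / m) \<rho> 0 \<rho>"
  have \<nu>E: "\<nu> \<in> E" unfolding \<nu>_def by (rule E_comb[OF \<rho>E \<rho>E])
  have em: "emeasure \<nu> B = ennreal (1 / m) * emeasure \<mu> (C \<inter> B)" if "B \<in> sets borel" for B
    unfolding \<nu>_def using emeasure_comb[OF rr(1,1) that] rr(2)[OF that] by simp
  have mass: "emeasure \<nu> UNIV = 1" using em[of UNIV] m by (simp flip: ennreal_mult)
  have "emeasure \<nu> (- C) = 0" using em[of "- C"] Cs by simp
  then have sub: "msupport \<nu> \<subseteq> C" using msupport_subset_iff[OF E_radon[OF \<nu>E] cC] by blast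
  then have "msupport \<nu> = C \<inter> msupport \<nu>" by auto
  then have cmp: "compact (msupport \<nu>)" using compact_Int_closed[OF C closed_msupport[of \<nu>]] by simp
  have "ee \<nu> \<nu> = (1 / m) * ((1 / m) * ee \<rho> \<rho>)"
    unfolding \<nu>_def using \<rho>E m by (simp add: ee_bilinear E_comb)
  also have "\<dots> \<le> ee \<mu> \<mu> / m\<^sup>2"
    using ele m by (simp add: power2_eq_square divide_right_mono)
  finally show thesis using that \<nu>E mass cmp sub by blast
qed

text \<open>If \<open>\<mu>\<close> charged a compact subset of \<open>N\<close>, its normalised
  restriction would be a competitor of finite energy in the definition of the capacity of
  \<open>N\<close>.\<close>

lemma capacity_zero_null:
  assumes c0: "c = 0" and \<mu>: "\<mu> \<in> E" and N: "N \<in> sets borel" and cap: "capacity \<kappa> N = 0"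
  shows "emeasure \<mu> N = 0"
proof -
  have r: "\<mu> \<in> radon" by (rule E_radon[OF \<mu>])
  have "emeasure \<mu> N \<le> 0"
    unfolding radon_inner[OF r N]
  proof (rule SUP_least)
    fix C assume "C \<in> {K. compact K \<and> K \<subseteq> N}"
    then have C: "compact C" "C \<subseteq> N" by auto
    show "emeasure \<mu> C \<le> 0"
    proof (rule ccontr)
      assume nz: "\<not> emeasure \<mu> C \<le> 0"
      obtain m where m: "emeasure \<mu> C = ennreal m" "0 < m"
        using radon_compact[OF r C(1)] nz by (cases "emeasure \<mu> C") (auto simp: ennreal_neg not_le)
      obtain \<nu> where \<nu>: "\<nu> \<in> E" "emeasure \<nu> UNIV = 1" "compact (msupport \<nu>)" "msupport \<nu> \<subseteq> C"
        using normalized_restriction[OF c0 \<mu> C(1) m] by metis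
      define i where "i = (INF \<nu>\<in>{\<nu> \<in> finite_energy_pos \<kappa>. emeasure \<nu> UNIV = 1 \<and> compact (msupport \<nu>) \<and> msupport \<nu> \<subseteq> N}.
          e2ennreal (mutual_energy \<kappa> \<nu> \<nu>))"
      have "i \<le> e2ennreal (mutual_energy \<kappa> \<nu> \<nu>)"
        unfolding i_def using \<nu> C(2) by (intro INF_lower) (auto simp: finite_energy_pos_eq)
      also have "\<dots> = ennreal (ee \<nu> \<nu>)"
        using mutual_energy_ee[OF E_radon E_radon, OF \<nu>(1) \<nu>(1)] \<nu>(1) by (simp add: E_def e2ennreal_ereal)
      also have "\<dots> < \<infinity>" by simp
      finally have "inverse i \<noteq> 0" by (simp add: ennreal_inverse_eq_0_iff less_top)
      then have "capacity \<kappa> N \<noteq> 0" unfolding capacity_def i_def .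
      then show False using cap by simp
    qed
  qed
  then show ?thesis by simp
qed

text \<open>Finite capacity means that the infimum of the energies is positive. The real bound
  \<open>d\<close> is taken strictly below it, as the infimum itself may be infinite.\<close>

lemma capacity_finite_lower:
  assumes cap: "capacity \<kappa> A < \<infinity>"
  obtains d where "0 < d" "\<And>\<nu>. \<nu> \<in> E \<Longrightarrow> emeasure \<nu> UNIV = 1 \<Longrightarrow> compact (msupport \<nu>) \<Longrightarrow> msupport \<nu> \<subseteq> A \<Longrightarrow> d < ee \<nu> \<nu>"
proof -
  define i where "i = (INF \<nu>\<in>{\<nu> \<in> finite_energy_pos \<kappa>. emeasure \<nu> UNIV = 1 \<and> compact (msupport \<nu>) \<and> msupport \<nu> \<subseteq> A}.
          e2ennreal (mutual_energy \<kappa> \<nu> \<nu>))"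
  have "i \<noteq> 0" using cap unfolding capacity_def i_def by auto
  then have "0 < i" by (simp add: zero_less_iff_neq_zero)
  then obtain t where t: "0 < t" "t < i" using dense by blast
  then obtain d where d: "t = ennreal d" "0 < d"
    by (cases t) (auto simp: top.not_eq_extremum[symmetric] ennreal_neg)
  show thesis
  proof (rule that[OF d(2)])
    fix \<nu> assume \<nu>: "\<nu> \<in> E" "emeasure \<nu> UNIV = 1" "compact (msupport \<nu>)" "msupport \<nu> \<subseteq> A"
    have "i \<le> e2ennreal (mutual_energy \<kappa> \<nu> \<nu>)"
      unfolding i_def using \<nu> by (intro INF_lower) (auto simp: finite_energy_pos_eq)
    also have "\<dots> = ennreal (ee \<nu> \<nu>)"
      using mutual_energy_ee[OF E_radon E_radon, OF \<nu>(1) \<nu>(1)] \<nu>(1) by (simp add: E_def e2ennreal_ereal)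
    finally have "ennreal d < ennreal (ee \<nu> \<nu>)" using t(2) d(1) by simp
    then show "d < ee \<nu> \<nu>" using d(2) by (simp add: ennreal_less_iff)
  qed
qed

lemma null_measure_E: "null_measure borel \<in> E" "ee (null_measure borel) \<nu> = 0" "ee \<nu> (null_measure borel) = 0"
proof -
  have "null_measure borel \<in> (radon :: 'a measure set)"
    unfolding radon_def by (auto intro!: antisym SUP_least)
  then show "null_measure borel \<in> E" by (simp add: E_def J_def)
  show "ee (null_measure borel) \<nu> = 0" "ee \<nu> (null_measure borel) = 0"
    by (simp_all add: ee_def J_def measure_def)
qed

end

context consistent_kernel begin

text \<open>If tightness fails, there are unit measures on \<open>A\<close> of bounded energy
  outside every compact set. A strong Cauchy filter of such measures leaves every compact set, so
  its vague limit is 0; consistency makes 0 the strong limit as well, against the positive lower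
  bound that finite capacity puts on their energies.\<close>

lemma finite_capacity_tight:
  assumes c0: "c = 0" and A: "closed A" and cap: "capacity \<kappa> A < \<infinity>" and e: "0 < (e :: real)"
  obtains K where "compact K"
    "\<And>\<mu>. \<mu> \<in> radon_on A \<Longrightarrow> \<mu> \<in> E \<Longrightarrow> ee \<mu> \<mu> \<le> B \<Longrightarrow> emeasure \<mu> (- K) \<le> ennreal e"
proof (rule ccontr)
  assume nt: "\<not> thesis"
  note th = that
  have ex: "\<exists>\<mu>. \<mu> \<in> radon_on A \<and> \<mu> \<in> E \<and> ee \<mu> \<mu> \<le> B \<and> ennreal e < emeasure \<mu> (- K)" if K: "compact K" for K
    using nt th[OF K] by (metis not_le)
  \<comment> \<open>\<open>B / e\<^sup>2\<close> bounds the energy after normalising a measure that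
    has mass more than \<open>e\<close> on a compact set outside \<open>K\<close>. These sets
    contain midpoints and decrease as \<open>K\<close> grows, which is the situation of
    \<open>Cauchy_filter_of_convex_sets\<close>.\<close>
  define Pr where "Pr K = {\<nu>\<in>E. emeasure \<nu> UNIV = 1 \<and> compact (msupport \<nu>) \<and> msupport \<nu> \<subseteq> A - K \<and> ee \<nu> \<nu> \<le> B / e\<^sup>2}" for K
  obtain d where d: "0 < d" "\<And>\<nu>. \<nu> \<in> E \<Longrightarrow> emeasure \<nu> UNIV = 1 \<Longrightarrow> compact (msupport \<nu>) \<Longrightarrow> msupport \<nu> \<subseteq> A \<Longrightarrow> d < ee \<nu> \<nu>"
    using capacity_finite_lower[OF cap] by metis
  let ?\<S> = "Pr ` {K. compact K}"
  have ne: "Pr K \<noteq> {}" if K: "compact K" for K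
  proof -
    obtain \<mu> where \<mu>: "\<mu> \<in> radon_on A" "\<mu> \<in> E" "ee \<mu> \<mu> \<le> B" "ennreal e < emeasure \<mu> (- K)" using ex[OF K] by blast
    have r: "\<mu> \<in> radon" by (rule E_radon[OF \<mu>(2)])
    have "- K \<in> sets borel" using K by (intro borel_open open_Compl compact_imp_closed)
    then obtain C where C: "compact C" "C \<subseteq> - K" "ennreal e < emeasure \<mu> C"
      using \<mu>(4) unfolding radon_inner[OF r \<open>- K \<in> sets borel\<close>] less_SUP_iff by blast
    have Cs: "C \<in> sets borel" "A \<in> sets borel" using borel_compact[OF C(1)] A by auto
    have CA: "emeasure \<mu> (C \<inter> A) = emeasure \<mu> C"
    proof (rule emeasure_eq_AE)
      show "AE x in \<mu>. x \<in> C \<inter> A \<longleftrightarrow> x \<in> C" using radon_on_AE[OF \<mu>(1) A] by auto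
    qed (use Cs radon_sets[OF r] in auto)
    have cCA: "compact (C \<inter> A)" using C(1) A by (rule compact_Int_closed)
    obtain m where m: "emeasure \<mu> (C \<inter> A) = ennreal m" "0 < m" "e < m"
      using radon_compact[OF r C(1)] C(3) e unfolding CA by (cases "emeasure \<mu> C") (auto simp: ennreal_less_iff)
    obtain \<nu> where \<nu>: "\<nu> \<in> E" "emeasure \<nu> UNIV = 1" "compact (msupport \<nu>)" "msupport \<nu> \<subseteq> C \<inter> A" "ee \<nu> \<nu> \<le> ee \<mu> \<mu> / m\<^sup>2"
      using normalized_restriction[OF c0 \<mu>(2) cCA m(1,2)] by metis
    have "ee \<mu> \<mu> / m\<^sup>2 \<le> B / e\<^sup>2"
      using \<mu>(3) ee_nonneg[OF \<mu>(2)] m e by (intro frac_le) (auto intro: power_mono)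
    then have "\<nu> \<in> Pr K" using \<nu> C(2) by (auto simp: Pr_def)
    then show ?thesis by blast
  qed
  have md: "mid \<mu> \<nu> \<in> Pr K" if "\<mu> \<in> Pr K" "\<nu> \<in> Pr K" for \<mu> \<nu> K
  proof -
    have \<mu>: "\<mu> \<in> E" "emeasure \<mu> UNIV = 1" "compact (msupport \<mu>)" "msupport \<mu> \<subseteq> A - K" "ee \<mu> \<mu> \<le> B / e\<^sup>2"
      and \<nu>: "\<nu> \<in> E" "emeasure \<nu> UNIV = 1" "compact (msupport \<nu>)" "msupport \<nu> \<subseteq> A - K" "ee \<nu> \<nu> \<le> B / e\<^sup>2"
      using that by (auto simp: Pr_def)
    let ?C = "msupport \<mu> \<union> msupport \<nu>"
    have "closed ?C" by (intro closed_Un closed_msupport)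
    have "mid \<mu> \<nu> \<in> radon_on ?C"
      by (rule mid_radon_on[OF _ _ \<open>closed ?C\<close>]) (use \<mu>(1) \<nu>(1) E_radon in \<open>auto simp: radon_on_def\<close>)
    then have sub: "msupport (mid \<mu> \<nu>) \<subseteq> ?C" by (simp add: radon_on_def)
    then have "msupport (mid \<mu> \<nu>) = ?C \<inter> msupport (mid \<mu> \<nu>)" by auto
    then have cmp: "compact (msupport (mid \<mu> \<nu>))"
      using compact_Int_closed[OF compact_Un[OF \<mu>(3) \<nu>(3)] closed_msupport[of "mid \<mu> \<nu>"]] by simp
    have "ennreal (1/2) + ennreal (1/2) = (1::ennreal)" by (subst ennreal_plus[symmetric]) auto
    then have mass: "emeasure (mid \<mu> \<nu>) UNIV = 1"
      using emeasure_mid[OF E_radon[OF \<mu>(1)] E_radon[OF \<nu>(1)], of UNIV] \<mu>(2) \<nu>(2) by simp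
    have "4 * ee (mid \<mu> \<nu>) (mid \<mu> \<nu>) \<le> 2 * ee \<mu> \<mu> + 2 * ee \<nu> \<nu>"
      using ee_mid(2)[OF \<mu>(1) \<nu>(1)] dsq_nonneg[OF \<mu>(1) \<nu>(1)] by simp
    then have "ee (mid \<mu> \<nu>) (mid \<mu> \<nu>) \<le> B / e\<^sup>2" using \<mu>(5) \<nu>(5) by simp
    then show ?thesis using ee_mid(1)[OF \<mu>(1) \<nu>(1)] mass cmp sub \<mu>(4) \<nu>(4) by (auto simp: Pr_def)
  qed
  obtain F where F: "F \<noteq> bot" "\<And>S. S \<in> ?\<S> \<Longrightarrow> eventually (\<lambda>x. x \<in> S) F"
    "\<And>e. 0 < e \<Longrightarrow> \<exists>S\<in>?\<S>. \<exists>P. eventually P F \<and> (\<forall>x. P x \<longrightarrow> x \<in> S) \<and>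
       (\<forall>x y. P x \<longrightarrow> P y \<longrightarrow> 2 * ee x x + 2 * ee y y - 4 * ee (mid x y) (mid x y) < e)"
  proof (rule Cauchy_filter_of_convex_sets[of ?\<S> mid "\<lambda>\<mu>. ee \<mu> \<mu>" "B / e\<^sup>2"])
    show "?\<S> \<noteq> {}" by (auto intro!: exI[of _ "{}"])
    show "S \<noteq> {}" if "S \<in> ?\<S>" for S using that ne by auto
    show "mid x y \<in> S" if "S \<in> ?\<S>" "x \<in> S" "y \<in> S" for S x y using that md by auto
    show "0 \<le> ee x x \<and> ee x x \<le> B / e\<^sup>2" if "S \<in> ?\<S>" "x \<in> S" for S x using that ee_nonneg by (auto simp: Pr_def)
    show "\<exists>U\<in>?\<S>. U \<subseteq> S \<inter> S'" if SS: "S \<in> ?\<S>" "S' \<in> ?\<S>" for S S'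
    proof -
      obtain K K' where "S = Pr K" "compact K" "S' = Pr K'" "compact K'" using SS by blast
      then show ?thesis by (intro bexI[of _ "Pr (K \<union> K')"]) (auto simp: Pr_def compact_Un)
    qed
  qed blast
  have PrE: "\<mu> \<in> E" if "\<mu> \<in> Pr K" for \<mu> K using that by (simp add: Pr_def)
  have ev0: "eventually (\<lambda>\<mu>. \<mu> \<in> Pr {}) F" by (intro F(2)) auto
  have evE: "eventually (\<lambda>\<mu>. \<mu> \<in> E) F" using ev0 by eventually_elim (rule PrE)
  have "((\<lambda>\<mu>. dsq \<mu> (null_measure borel)) \<longlongrightarrow> 0) F"
  proof (rule consistentD(2)[OF F(1) evE])
    show "\<exists>P. eventually P F \<and> (\<forall>\<mu> \<nu>. P \<mu> \<longrightarrow> P \<nu> \<longrightarrow> dsq \<mu> \<nu> < r)" if r: "0 < r" for r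
    proof -
      obtain S P where P: "S \<in> ?\<S>" "eventually P F" "\<And>x. P x \<Longrightarrow> x \<in> S"
        "\<And>x y. P x \<Longrightarrow> P y \<Longrightarrow> 2 * ee x x + 2 * ee y y - 4 * ee (mid x y) (mid x y) < r"
        using F(3)[OF r] by blast
      have "dsq x y < r" if "P x" "P y" for x y
        using P(4)[OF that] P(1) P(3)[OF that(1)] P(3)[OF that(2)] PrE ee_mid(2)[of x y] by auto
      then show ?thesis using P(2) by blast
    qed
    show "null_measure borel \<in> (radon :: 'a measure set)" by (rule E_radon[OF null_measure_E(1)])
    fix \<phi> :: "'a \<Rightarrow> real" assume "\<phi> \<in> Cc"
    then obtain K where K: "compact K" "\<And>x. x \<notin> K \<Longrightarrow> \<phi> x = 0" using CcE by metis
    have "eventually (\<lambda>\<mu>. \<mu> \<in> Pr K) F" using K(1) by (intro F(2)) auto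
    then have "eventually (\<lambda>\<mu>. integral\<^sup>L \<mu> \<phi> = 0) F"
    proof eventually_elim
      case (elim \<mu>)
      have "\<mu> \<in> radon_on (msupport \<mu>)" using elim PrE E_radon by (auto simp: radon_on_def)
      from radon_on_AE[OF this closed_msupport] have "AE x in \<mu>. \<phi> x = 0"
        by eventually_elim (use elim K(2) in \<open>auto simp: Pr_def\<close>)
      then show ?case by (rule integral_eq_zero_AE)
    qed
    then show "((\<lambda>\<mu>. integral\<^sup>L \<mu> \<phi>) \<longlongrightarrow> integral\<^sup>L (null_measure borel) \<phi>) F"
      by (simp add: tendsto_eventually)
  qed
  then have "eventually (\<lambda>\<mu>. dsq \<mu> (null_measure borel) < d) F" using d(1) by (rule order_tendstoD(2))
  then have "eventually (\<lambda>\<mu>. False) F" using ev0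
  proof eventually_elim
    case (elim \<mu>)
    then show ?case using d(2)[of \<mu>] by (auto simp: dsq_def null_measure_E Pr_def)
  qed
  then show False using F(1) by (simp add: trivial_limit_def)
qed

end

subsection \<open>Vector measures associated with a condenser\<close>

lemma nn_integral_count_space_UNIV:
  fixes h :: "'i \<Rightarrow> ennreal"
  shows "(\<integral>\<^sup>+i. h i \<partial>count_space X) = (\<integral>\<^sup>+i. h i * indicator X i \<partial>count_space UNIV)"
  by (cases "X = UNIV") (simp_all add: nn_integral_count_space_indicator)

lemma nn_integral_count_space_disjoint_Un:
  fixes h :: "'i \<Rightarrow> ennreal"
  assumes "X \<inter> Y = {}"
  shows "(\<integral>\<^sup>+i. h i \<partial>count_space (X \<union> Y)) = (\<integral>\<^sup>+i. h i \<partial>count_space X) + (\<integral>\<^sup>+i. h i \<partial>count_space Y)"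
proof -
  have "(\<integral>\<^sup>+i. h i \<partial>count_space (X \<union> Y)) = (\<integral>\<^sup>+i. h i * indicator X i + h i * indicator Y i \<partial>count_space UNIV)"
    unfolding nn_integral_count_space_UNIV[of "X \<union> Y"]
    using assms by (intro nn_integral_cong) (auto simp: indicator_def)
  also have "\<dots> = (\<integral>\<^sup>+i. h i \<partial>count_space X) + (\<integral>\<^sup>+i. h i \<partial>count_space Y)"
    unfolding nn_integral_count_space_UNIV[of X] nn_integral_count_space_UNIV[of Y]
    by (subst nn_integral_add) auto
  finally show ?thesis .
qed

lemma nn_integral_count_space_Times:
  fixes h :: "nat \<Rightarrow> nat \<Rightarrow> ennreal"
  shows "(\<integral>\<^sup>+(i, j). h i j \<partial>count_space (X \<times> Y)) = (\<integral>\<^sup>+i. \<integral>\<^sup>+j. h i j \<partial>count_space Y \<partial>count_space X)"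
proof -
  interpret sigma_finite_measure "count_space Y" by (rule sigma_finite_measure_count_space_countable) simp
  have "count_space (X \<times> Y) = count_space X \<Otimes>\<^sub>M count_space Y" by (rule pair_measure_countable[symmetric]) auto
  moreover have "case_prod h \<in> borel_measurable (count_space X \<Otimes>\<^sub>M count_space Y)"
    by (subst pair_measure_countable) auto
  ultimately show ?thesis using nn_integral_fst[of "case_prod h" "count_space X"] by (simp add: case_prod_beta')
qed

lemma nn_integral_count_space_finite_support:
  assumes "finite Z" "Z \<subseteq> X" "\<And>i. i \<in> X \<Longrightarrow> i \<notin> Z \<Longrightarrow> h i = (0::ennreal)"
  shows "(\<integral>\<^sup>+i. h i \<partial>count_space X) = (\<Sum>i\<in>Z. h i)"
  by (rule nn_integral_count_space') (use assms in auto)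

lemma ereal_integral_finiteD:
  assumes "\<bar>ereal_integral M u\<bar> \<noteq> \<infinity>"
  shows "(\<integral>\<^sup>+x. e2ennreal (u x) \<partial>M) < \<infinity>" "(\<integral>\<^sup>+x. e2ennreal (- u x) \<partial>M) < \<infinity>"
  using assms unfolding ereal_integral_def
  by (cases "\<integral>\<^sup>+x. e2ennreal (u x) \<partial>M"; cases "\<integral>\<^sup>+x. e2ennreal (- u x) \<partial>M"; auto simp: enn2ereal_ennreal)+

lemma ereal_series_finiteD:
  assumes "\<bar>ereal_series X u\<bar> \<noteq> \<infinity>"
  shows "(\<integral>\<^sup>+x. e2ennreal (\<bar>u x\<bar>) \<partial>count_space X) < \<infinity>"
proof -
  have "(\<integral>\<^sup>+x. e2ennreal \<bar>u x\<bar> \<partial>count_space X) \<le> (\<integral>\<^sup>+x. e2ennreal (u x) + e2ennreal (- u x) \<partial>count_space X)"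
  proof (rule nn_integral_mono)
    fix x
    have "\<bar>u x\<bar> = u x \<or> \<bar>u x\<bar> = - u x" by (cases "u x") auto
    then show "e2ennreal \<bar>u x\<bar> \<le> e2ennreal (u x) + e2ennreal (- u x)" by (elim disjE) simp_all
  qed
  also have "\<dots> = (\<integral>\<^sup>+x. e2ennreal (u x) \<partial>count_space X) + (\<integral>\<^sup>+x. e2ennreal (- u x) \<partial>count_space X)"
    by (subst nn_integral_add) auto
  also have "\<dots> < \<infinity>" using ereal_integral_finiteD[OF assms[unfolded ereal_series_def]] by simp
  finally show ?thesis .
qed

lemma Cc_integral_eqI:
  fixes \<phi> :: "'a::t2_space \<Rightarrow> real"
  assumes W: "W1 \<in> radon" "W2 \<in> radon" and \<phi>: "\<phi> \<in> Cc" "\<And>x. x \<notin> K \<Longrightarrow> \<phi> x = 0"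
    and eq: "\<And>v. v \<in> borel_measurable borel \<Longrightarrow> (\<And>x. x \<notin> K \<Longrightarrow> v x = 0) \<Longrightarrow> (\<integral>\<^sup>+x. v x \<partial>W1) = (\<integral>\<^sup>+x. v x \<partial>W2)"
  shows "integral\<^sup>L W1 \<phi> = integral\<^sup>L W2 \<phi>"
  unfolding real_lebesgue_integral_def[OF Cc_integrable[OF W(1) \<phi>(1)]] real_lebesgue_integral_def[OF Cc_integrable[OF W(2) \<phi>(1)]]
  using Cc_measurable[OF \<phi>(1)] \<phi>(2)
  by (intro arg_cong2[where f = minus] arg_cong[where f = enn2real] eq) auto

lemma wsum_mid:
  fixes \<mu> \<nu> :: "nat \<Rightarrow> 'a::t2_space measure"
  assumes r: "\<And>i. i \<in> I \<Longrightarrow> \<mu> i \<in> radon" "\<And>i. i \<in> I \<Longrightarrow> \<nu> i \<in> radon"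
    and R: "wsum I (\<lambda>_. 1) \<mu> \<in> radon" "wsum I (\<lambda>_. 1) \<nu> \<in> radon"
    and \<eta>: "\<And>i. i \<in> I \<Longrightarrow> \<eta> i = mid (\<mu> i) (\<nu> i)"
  shows "wsum I (\<lambda>_. 1) \<eta> = mid (wsum I (\<lambda>_. 1) \<mu>) (wsum I (\<lambda>_. 1) \<nu>)"
proof (rule measure_eqI)
  have s: "\<And>i. i \<in> I \<Longrightarrow> sets (\<mu> i) = sets borel" "\<And>i. i \<in> I \<Longrightarrow> sets (\<nu> i) = sets borel"
    "\<And>i. i \<in> I \<Longrightarrow> sets (\<eta> i) = sets borel"
    using r radon_sets \<eta> by (auto simp: mid_def sets_wsum)
  show "sets (wsum I (\<lambda>_. 1) \<eta>) = sets (mid (wsum I (\<lambda>_. 1) \<mu>) (wsum I (\<lambda>_. 1) \<nu>))"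
    by (simp add: mid_def sets_wsum)
  fix B assume "B \<in> sets (wsum I (\<lambda>_. 1) \<eta>)"
  then have B: "B \<in> sets borel" by (simp add: sets_wsum)
  have "emeasure (wsum I (\<lambda>_. 1) \<eta>) B = (\<integral>\<^sup>+i. ennreal (1/2) * emeasure (\<mu> i) B + ennreal (1/2) * emeasure (\<nu> i) B \<partial>count_space I)"
    using \<eta> r B by (subst emeasure_wsum[OF s(3) B]) (auto intro!: nn_integral_cong simp: emeasure_mid)
  also have "\<dots> = ennreal (1/2) * (\<integral>\<^sup>+i. emeasure (\<mu> i) B \<partial>count_space I) + ennreal (1/2) * (\<integral>\<^sup>+i. emeasure (\<nu> i) B \<partial>count_space I)"
    by (simp add: nn_integral_add nn_integral_cmult)
  also have "\<dots> = emeasure (mid (wsum I (\<lambda>_. 1) \<mu>) (wsum I (\<lambda>_. 1) \<nu>)) B"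
    by (simp add: emeasure_mid[OF R B] emeasure_wsum[OF s(1) B] emeasure_wsum[OF s(2) B])
  finally show "emeasure (wsum I (\<lambda>_. 1) \<eta>) B = emeasure (mid (wsum I (\<lambda>_. 1) \<mu>) (wsum I (\<lambda>_. 1) \<nu>)) B" .
qed

locale condenser_space = kernel_space T \<kappa> c for T :: "'a::t2_space itself" and \<kappa> c +
  fixes Ipos Ineg :: "nat set" and A :: "nat \<Rightarrow> 'a set"
  assumes condenser: "condenser Ipos Ineg A"
begin

abbreviation I where "I \<equiv> Ipos \<union> Ineg"

lemma I_disjoint: "Ipos \<inter> Ineg = {}"
  using condenser by (simp add: condenser_def)

lemma A_closed: "i \<in> I \<Longrightarrow> closed (A i)" and A_nonempty: "i \<in> I \<Longrightarrow> A i \<noteq> {}"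
  using condenser by (auto simp: condenser_def)

lemma A_locally_finite: "compact K \<Longrightarrow> finite {i \<in> I. A i \<inter> K \<noteq> {}}"
  using condenser by (auto simp: condenser_def)

lemma finite_meeting: "X \<subseteq> I \<Longrightarrow> compact K \<Longrightarrow> finite {i \<in> X. A i \<inter> K \<noteq> {}}"
  by (rule finite_subset[OF _ A_locally_finite]) auto

lemma vm_radon_on: "\<mu> \<in> vmeasures Ipos Ineg A \<Longrightarrow> i \<in> I \<Longrightarrow> \<mu> i \<in> radon_on (A i)"
  unfolding vmeasures_def by (rule PiE_mem)

lemma vm_radon: "\<mu> \<in> vmeasures Ipos Ineg A \<Longrightarrow> i \<in> I \<Longrightarrow> \<mu> i \<in> radon"
  using vm_radon_on by (simp add: radon_on_def)

lemma vm_null: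
  assumes \<mu>: "\<mu> \<in> vmeasures Ipos Ineg A" and i: "i \<in> I" and K: "A i \<inter> K = {}"
    and v: "\<And>x. x \<notin> K \<Longrightarrow> v x = 0"
  shows "(\<integral>\<^sup>+x. v x \<partial>\<mu> i) = (0 :: ennreal)"
proof -
  have "(\<integral>\<^sup>+x. v x \<partial>\<mu> i) = (\<integral>\<^sup>+x. 0 \<partial>\<mu> i)"
    by (rule radon_on_cong[OF vm_radon_on[OF \<mu> i] A_closed[OF i]]) (use K v in auto)
  then show ?thesis by simp
qed

text \<open>The measures \<open>R\<^sup>+ \<mu>\<close> and \<open>R\<^sup>- \<mu>\<close> are \<open>part Ipos \<mu>\<close> and \<open>part Ineg \<mu>\<close>.\<close>
definition part :: "nat set \<Rightarrow> (nat \<Rightarrow> 'a measure) \<Rightarrow> 'a measure" where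
  "part X \<mu> = wsum X (\<lambda>_. 1) \<mu>"

lemma nn_integral_part:
  assumes \<mu>: "\<mu> \<in> vmeasures Ipos Ineg A" and X: "X \<subseteq> I" and v: "v \<in> borel_measurable borel"
  shows "(\<integral>\<^sup>+x. v x \<partial>part X \<mu>) = (\<integral>\<^sup>+i. \<integral>\<^sup>+x. v x \<partial>\<mu> i \<partial>count_space X)"
  unfolding part_def using vm_radon[OF \<mu>] X radon_sets v by (subst nn_integral_wsum) auto

text \<open>Plates that do not meet \<open>K\<close> contribute nothing, and local finiteness of the
  condenser leaves finitely many others.\<close>

lemma nn_integral_part_local:
  assumes \<mu>: "\<mu> \<in> vmeasures Ipos Ineg A" and X: "X \<subseteq> I" and v: "v \<in> borel_measurable borel"
    and K: "\<And>x. x \<notin> K \<Longrightarrow> v x = 0" "compact K"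
  shows "(\<integral>\<^sup>+x. v x \<partial>part X \<mu>) = (\<Sum>i\<in>{i\<in>X. A i \<inter> K \<noteq> {}}. \<integral>\<^sup>+x. v x \<partial>\<mu> i)"
  unfolding nn_integral_part[OF \<mu> X v]
proof (rule nn_integral_count_space_finite_support)
  show "finite {i \<in> X. A i \<inter> K \<noteq> {}}" by (rule finite_meeting[OF X K(2)])
  show "(\<integral>\<^sup>+x. v x \<partial>\<mu> i) = 0" if "i \<in> X" "i \<notin> {i \<in> X. A i \<inter> K \<noteq> {}}" for i
    by (rule vm_null[OF \<mu>, of _ K]) (use that X K in auto)
qed auto

lemma part_radon:
  assumes \<mu>: "\<mu> \<in> vmeasures Ipos Ineg A" and X: "X \<subseteq> I"
  shows "part X \<mu> \<in> radon"
  unfolding part_def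
proof (rule radon_wsum)
  show "\<mu> i \<in> radon" if "i \<in> X" for i using vm_radon[OF \<mu>] X that by blast
  fix K :: "'a set" assume K: "compact K"
  have Ks: "K \<in> sets borel" by (rule borel_compact[OF K])
  have s: "\<And>i. i \<in> X \<Longrightarrow> sets (\<mu> i) = sets borel" using vm_radon[OF \<mu>] X radon_sets by blast
  have "(\<integral>\<^sup>+i. 1 * emeasure (\<mu> i) K \<partial>count_space X) = (\<integral>\<^sup>+x. indicator K x \<partial>part X \<mu>)"
    using Ks s unfolding nn_integral_part[OF \<mu> X borel_measurable_indicator[OF Ks]] by (auto intro!: nn_integral_cong)
  also have "\<dots> = (\<Sum>i\<in>{i\<in>X. A i \<inter> K \<noteq> {}}. \<integral>\<^sup>+x. indicator K x \<partial>\<mu> i)"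
    using Ks K by (intro nn_integral_part_local[OF \<mu> X]) auto
  also have "\<dots> < \<infinity>"
  proof -
    have f: "finite {i\<in>X. A i \<inter> K \<noteq> {}}" by (rule finite_meeting[OF X K])
    have "(\<integral>\<^sup>+x. indicator K x \<partial>\<mu> i) < top" if "i \<in> X" for i
      using radon_compact[OF vm_radon[OF \<mu>] K] that X s[OF that] Ks by auto
    then show ?thesis using f by (simp add: ennreal_sum_less_top)
  qed
  finally show "(\<integral>\<^sup>+i. 1 * emeasure (\<mu> i) K \<partial>count_space X) < \<infinity>" .
qed

lemma integral_part:
  assumes \<mu>: "\<mu> \<in> vmeasures Ipos Ineg A" and X: "X \<subseteq> I" and \<phi>: "\<phi> \<in> Cc" "\<And>x. x \<notin> K \<Longrightarrow> \<phi> x = 0" and K: "compact K"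
  shows "integral\<^sup>L (part X \<mu>) \<phi> = (\<Sum>i\<in>{i\<in>X. A i \<inter> K \<noteq> {}}. integral\<^sup>L (\<mu> i) \<phi>)"
proof -
  let ?Z = "{i\<in>X. A i \<inter> K \<noteq> {}}"
  have f: "finite ?Z" by (rule finite_meeting[OF X K])
  have ZX: "?Z \<subseteq> I" using X by auto
  have s: "\<And>i. i \<in> ?Z \<Longrightarrow> sets (\<mu> i) = sets borel" using vm_radon[OF \<mu>] X radon_sets by blast
  have "integral\<^sup>L (part X \<mu>) \<phi> = integral\<^sup>L (part ?Z \<mu>) \<phi>"
  proof (rule Cc_integral_eqI[OF part_radon[OF \<mu> X] part_radon[OF \<mu> ZX] \<phi>])
    fix v :: "'a \<Rightarrow> ennreal" assume v: "v \<in> borel_measurable borel" "\<And>x. x \<notin> K \<Longrightarrow> v x = 0"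
    have "{i \<in> ?Z. A i \<inter> K \<noteq> {}} = ?Z" by auto
    then show "(\<integral>\<^sup>+x. v x \<partial>part X \<mu>) = (\<integral>\<^sup>+x. v x \<partial>part ?Z \<mu>)"
      using nn_integral_part_local[OF \<mu> X v K] nn_integral_part_local[OF \<mu> ZX v K] by simp
  qed
  also have "\<dots> = integral\<^sup>L (wsum ?Z (\<lambda>_. ennreal 1) \<mu>) \<phi>" by (simp add: part_def)
  also have "\<dots> = (\<Sum>i\<in>?Z. 1 * integral\<^sup>L (\<mu> i) \<phi>)"
    by (rule integral_wsum(2)[OF s f Cc_measurable[OF \<phi>(1)]])
      (use Cc_integrable[OF vm_radon[OF \<mu>] \<phi>(1)] ZX in auto)
  finally show ?thesis by simp
qed

lemma J_part_left:
  assumes \<mu>: "\<mu> \<in> vmeasures Ipos Ineg A" and X: "X \<subseteq> I" and \<nu>: "\<nu> \<in> radon"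
  shows "J (part X \<mu>) \<nu> = (\<integral>\<^sup>+i. J (\<mu> i) \<nu> \<partial>count_space X)"
  unfolding part_def using vm_radon[OF \<mu>] X \<nu> by (subst J_wsum_left) auto

lemma J_part_right:
  assumes \<mu>: "\<mu> \<in> vmeasures Ipos Ineg A" and X: "X \<subseteq> I" and \<nu>: "\<nu> \<in> radon"
  shows "J \<nu> (part X \<mu>) = (\<integral>\<^sup>+i. J \<nu> (\<mu> i) \<partial>count_space X)"
  using part_radon[OF \<mu> X] vm_radon[OF \<mu>] X \<nu> unfolding part_def by (subst J_wsum_right) auto

section \<open>Energies of vector measures\<close>

text \<open>The correction for the shift of the kernel, kept in \<open>ennreal\<close> so that it
  can be summed over the plates together with \<open>J\<close>.\<close>

definition Mc :: "'a measure \<Rightarrow> 'a measure \<Rightarrow> ennreal" where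
  "Mc \<mu> \<nu> = ennreal c * emeasure \<mu> UNIV * emeasure \<nu> UNIV"

lemma Mc_finite: "\<mu> \<in> radon \<Longrightarrow> \<nu> \<in> radon \<Longrightarrow> Mc \<mu> \<nu> < \<infinity>"
  using radon_finite[of \<mu>] radon_finite[of \<nu>] by (auto simp: Mc_def ennreal_mult_less_top)

lemma ee_Mc: "\<mu> \<in> radon \<Longrightarrow> \<nu> \<in> radon \<Longrightarrow> ee \<mu> \<nu> = enn2real (J \<mu> \<nu>) - enn2real (Mc \<mu> \<nu>)"
  using c_nonneg by (simp add: ee_def Mc_def enn2real_mult measure_def)

lemma mutual_energy_Mc:
  assumes "\<mu> \<in> radon" "\<nu> \<in> radon"
  shows "mutual_energy \<kappa> \<mu> \<nu> = enn2ereal (J \<mu> \<nu>) - enn2ereal (Mc \<mu> \<nu>)"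
proof -
  have "Mc \<mu> \<nu> = ennreal (enn2real (Mc \<mu> \<nu>))" using Mc_finite[OF assms] by simp
  moreover have "enn2real (Mc \<mu> \<nu>) = c * measure \<mu> UNIV * measure \<nu> UNIV"
    using c_nonneg by (simp add: Mc_def enn2real_mult measure_def)
  ultimately have "enn2ereal (Mc \<mu> \<nu>) = ereal (c * measure \<mu> UNIV * measure \<nu> UNIV)"
    using c_nonneg by (metis enn2ereal_ennreal enn2real_nonneg)
  then show ?thesis by (simp add: mutual_energy_eq[OF assms])
qed

lemma mass_part:
  assumes \<mu>: "\<mu> \<in> vmeasures Ipos Ineg A" and X: "X \<subseteq> I"
  shows "emeasure (part X \<mu>) UNIV = (\<integral>\<^sup>+i. emeasure (\<mu> i) UNIV \<partial>count_space X)"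
  unfolding part_def using vm_radon[OF \<mu>] X radon_sets by (subst emeasure_wsum) auto

lemma Mc_part_left:
  assumes \<mu>: "\<mu> \<in> vmeasures Ipos Ineg A" and X: "X \<subseteq> I"
  shows "Mc (part X \<mu>) \<nu> = (\<integral>\<^sup>+i. Mc (\<mu> i) \<nu> \<partial>count_space X)"
  unfolding Mc_def mass_part[OF \<mu> X] by (simp add: nn_integral_cmult nn_integral_multc)

lemma Mc_part_right:
  assumes \<mu>: "\<mu> \<in> vmeasures Ipos Ineg A" and X: "X \<subseteq> I"
  shows "Mc \<nu> (part X \<mu>) = (\<integral>\<^sup>+i. Mc \<nu> (\<mu> i) \<partial>count_space X)"
  unfolding Mc_def mass_part[OF \<mu> X] by (simp add: nn_integral_cmult nn_integral_multc)

lemma part_E_subset: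
  assumes \<mu>: "\<mu> \<in> vmeasures Ipos Ineg A" and Y: "Y \<subseteq> X" "X \<subseteq> I" and E: "part X \<mu> \<in> E"
  shows "part Y \<mu> \<in> E"
proof -
  have YI: "Y \<subseteq> I" using Y by auto
  have s: "\<And>i. i \<in> X \<Longrightarrow> sets (\<mu> i) = sets borel" using vm_radon[OF \<mu>] Y radon_sets by blast
  have "emeasure (part Y \<mu>) B \<le> emeasure (part X \<mu>) B" if B: "B \<in> sets borel" for B
  proof -
    have "(\<integral>\<^sup>+i. emeasure (\<mu> i) B \<partial>count_space Y) \<le> (\<integral>\<^sup>+i. emeasure (\<mu> i) B \<partial>count_space X)"
      unfolding nn_integral_count_space_UNIV[of Y] nn_integral_count_space_UNIV[of X]
      using Y(1) by (intro nn_integral_mono) (auto simp: indicator_def)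
    then show ?thesis unfolding part_def using s Y(1) by (subst (1 2) emeasure_wsum[OF _ B]) auto
  qed
  then have "J (part Y \<mu>) (part Y \<mu>) \<le> J (part X \<mu>) (part X \<mu>)"
    by (intro J_mono) (auto simp: part_def sets_wsum)
  then show ?thesis using E part_radon[OF \<mu> YI] by (auto simp: E_def intro: le_less_trans)
qed

lemma single_E:
  assumes \<mu>: "\<mu> \<in> vmeasures Ipos Ineg A" and i: "i \<in> X" "X \<subseteq> I" and E: "part X \<mu> \<in> E"
  shows "\<mu> i \<in> E" "J (\<mu> i) (\<mu> i) \<le> J (part X \<mu>) (part X \<mu>)"
proof -
  have iI: "i \<in> I" using i by auto
  note r = vm_radon[OF \<mu> iI]
  have "emeasure (\<mu> i) B \<le> emeasure (part X \<mu>) B" if B: "B \<in> sets borel" for B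
  proof -
    have "emeasure (\<mu> i) B = (\<integral>\<^sup>+j. emeasure (\<mu> j) B \<partial>count_space {i})"
      by (simp add: nn_integral_count_space_finite)
    also have "\<dots> \<le> (\<integral>\<^sup>+j. emeasure (\<mu> j) B \<partial>count_space X)"
      unfolding nn_integral_count_space_UNIV[of "{i}"] nn_integral_count_space_UNIV[of X]
      using i(1) by (intro nn_integral_mono) (auto simp: indicator_def)
    also have "\<dots> = emeasure (part X \<mu>) B"
      unfolding part_def using vm_radon[OF \<mu>] i(2) radon_sets by (subst emeasure_wsum[OF _ B]) auto
    finally show ?thesis .
  qed
  then show le: "J (\<mu> i) (\<mu> i) \<le> J (part X \<mu>) (part X \<mu>)"
    using radon_sets[OF r] by (intro J_mono) (auto simp: part_def sets_wsum)
  show "\<mu> i \<in> E" using r le E by (auto simp: E_def intro: le_less_trans)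
qed

text \<open>The energy of the total measure consists of the energies of the two parts and of mixed
  terms, which are finite by \<open>energy_form\<close>.\<close>

lemma part_I_E:
  assumes \<mu>: "\<mu> \<in> vmeasures Ipos Ineg A"
  shows "part I \<mu> \<in> E \<longleftrightarrow> part Ipos \<mu> \<in> E \<and> part Ineg \<mu> \<in> E"
proof
  assume "part I \<mu> \<in> E"
  then show "part Ipos \<mu> \<in> E \<and> part Ineg \<mu> \<in> E" using part_E_subset[OF \<mu>, of _ I] by auto
next
  assume E: "part Ipos \<mu> \<in> E \<and> part Ineg \<mu> \<in> E"
  have split: "J (part I \<mu>) \<nu> = J (part Ipos \<mu>) \<nu> + J (part Ineg \<mu>) \<nu>" if "\<nu> \<in> radon" for \<nu>
    using that by (simp add: J_part_left[OF \<mu>] nn_integral_count_space_disjoint_Un[OF I_disjoint])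
  have split': "J \<nu> (part I \<mu>) = J \<nu> (part Ipos \<mu>) + J \<nu> (part Ineg \<mu>)" if "\<nu> \<in> radon" for \<nu>
    using that by (simp add: J_part_right[OF \<mu>] nn_integral_count_space_disjoint_Un[OF I_disjoint])
  have r: "part I \<mu> \<in> radon" "part Ipos \<mu> \<in> radon" "part Ineg \<mu> \<in> radon" by (auto intro: part_radon[OF \<mu>])
  show "part I \<mu> \<in> E"
    using E r energy_form(1)[of "part Ipos \<mu>" "part Ineg \<mu>"] energy_form(1)[of "part Ineg \<mu>" "part Ipos \<mu>"]
    by (auto simp: E_def split split')
qed

abbreviation sg where "sg \<equiv> plate_sign Ipos"

lemma sg_cases: "i \<in> Ipos \<Longrightarrow> sg i = 1" "i \<in> Ineg \<Longrightarrow> sg i = -1"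
  using I_disjoint by (auto simp: plate_sign_def)

lemma nn_integral_signed:
  fixes p q :: "nat \<Rightarrow> nat \<Rightarrow> ennreal"
  shows "(\<integral>\<^sup>+(i, j). (if sg i = sg j then p i j else q i j) \<partial>count_space (I \<times> I)) =
    ((\<integral>\<^sup>+i. \<integral>\<^sup>+j. p i j \<partial>count_space Ipos \<partial>count_space Ipos) + (\<integral>\<^sup>+i. \<integral>\<^sup>+j. q i j \<partial>count_space Ineg \<partial>count_space Ipos)) +
    ((\<integral>\<^sup>+i. \<integral>\<^sup>+j. q i j \<partial>count_space Ipos \<partial>count_space Ineg) + (\<integral>\<^sup>+i. \<integral>\<^sup>+j. p i j \<partial>count_space Ineg \<partial>count_space Ineg))"
proof -
  let ?h = "\<lambda>i j. if sg i = sg j then p i j else q i j"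
  have pp: "(\<integral>\<^sup>+j. ?h i j \<partial>count_space Ipos) = (\<integral>\<^sup>+j. p i j \<partial>count_space Ipos)"
    "(\<integral>\<^sup>+j. ?h i j \<partial>count_space Ineg) = (\<integral>\<^sup>+j. q i j \<partial>count_space Ineg)" if "i \<in> Ipos" for i
    using that by (auto intro!: nn_integral_cong simp: sg_cases)
  have nn: "(\<integral>\<^sup>+j. ?h i j \<partial>count_space Ipos) = (\<integral>\<^sup>+j. q i j \<partial>count_space Ipos)"
    "(\<integral>\<^sup>+j. ?h i j \<partial>count_space Ineg) = (\<integral>\<^sup>+j. p i j \<partial>count_space Ineg)" if "i \<in> Ineg" for i
    using that by (auto intro!: nn_integral_cong simp: sg_cases)
  have "(\<integral>\<^sup>+i. \<integral>\<^sup>+j. ?h i j \<partial>count_space I \<partial>count_space Ipos) =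
      (\<integral>\<^sup>+i. (\<integral>\<^sup>+j. p i j \<partial>count_space Ipos) + (\<integral>\<^sup>+j. q i j \<partial>count_space Ineg) \<partial>count_space Ipos)"
    by (intro nn_integral_cong) (simp add: nn_integral_count_space_disjoint_Un[OF I_disjoint] pp)
  moreover have "(\<integral>\<^sup>+i. \<integral>\<^sup>+j. ?h i j \<partial>count_space I \<partial>count_space Ineg) =
      (\<integral>\<^sup>+i. (\<integral>\<^sup>+j. q i j \<partial>count_space Ipos) + (\<integral>\<^sup>+j. p i j \<partial>count_space Ineg) \<partial>count_space Ineg)"
    by (intro nn_integral_cong) (simp add: nn_integral_count_space_disjoint_Un[OF I_disjoint] nn)
  ultimately show ?thesis
    unfolding nn_integral_count_space_Times
    by (simp add: nn_integral_count_space_disjoint_Un[OF I_disjoint] nn_integral_add)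
qed

text \<open>Each signed term is a difference of nonnegative ones: \<open>p\<close> collects
  \<open>J\<close> for equal signs and the correction \<open>Mc\<close> for opposite signs,
  \<open>n\<close> the remaining halves. Both sum up, block by block, to energies and corrections of
  the two parts, so \<open>ereal_integral_diff\<close> evaluates the series.\<close>

lemma vmutual_energy_eq:
  assumes \<mu>: "\<mu> \<in> vmeasures Ipos Ineg A" and E: "part Ipos \<mu> \<in> E" "part Ineg \<mu> \<in> E"
  shows "vmutual_energy \<kappa> Ipos Ineg \<mu> \<mu> = ereal (dsq (part Ipos \<mu>) (part Ineg \<mu>))"
proof -
  let ?P = "part Ipos \<mu>" and ?N = "part Ineg \<mu>"
  have r: "?P \<in> radon" "?N \<in> radon" using E E_radon by auto
  define p where "p = (\<lambda>(i, j). if sg i = sg j then J (\<mu> i) (\<mu> j) else Mc (\<mu> i) (\<mu> j))"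
  define n where "n = (\<lambda>(i, j). if sg i = sg j then Mc (\<mu> i) (\<mu> j) else J (\<mu> i) (\<mu> j))"
  have JJ: "(\<integral>\<^sup>+i. \<integral>\<^sup>+j. J (\<mu> i) (\<mu> j) \<partial>count_space Y \<partial>count_space X) = J (part X \<mu>) (part Y \<mu>)"
    if "X \<subseteq> I" "Y \<subseteq> I" for X Y
    using that by (subst J_part_left[OF \<mu>]) (auto intro!: nn_integral_cong J_part_right[OF \<mu>, symmetric] part_radon[OF \<mu>] vm_radon[OF \<mu>])
  have MM: "(\<integral>\<^sup>+i. \<integral>\<^sup>+j. Mc (\<mu> i) (\<mu> j) \<partial>count_space Y \<partial>count_space X) = Mc (part X \<mu>) (part Y \<mu>)"
    if "X \<subseteq> I" "Y \<subseteq> I" for X Y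
    using that by (subst Mc_part_left[OF \<mu>]) (auto intro!: nn_integral_cong Mc_part_right[OF \<mu>, symmetric])
  have ip: "(\<integral>\<^sup>+x. p x \<partial>count_space (I \<times> I)) = (J ?P ?P + Mc ?P ?N) + (Mc ?N ?P + J ?N ?N)"
    unfolding p_def nn_integral_signed by (simp add: JJ MM)
  have i_n: "(\<integral>\<^sup>+x. n x \<partial>count_space (I \<times> I)) = (Mc ?P ?P + J ?P ?N) + (J ?N ?P + Mc ?N ?N)"
    unfolding n_def nn_integral_signed by (simp add: JJ MM)
  have f: "J ?P ?P < \<infinity>" "J ?P ?N < \<infinity>" "J ?N ?P < \<infinity>" "J ?N ?N < \<infinity>"
    using energy_form(1) E by auto
  have fM: "Mc ?P ?P < \<infinity>" "Mc ?P ?N < \<infinity>" "Mc ?N ?P < \<infinity>" "Mc ?N ?N < \<infinity>" using Mc_finite r by auto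
  have "vmutual_energy \<kappa> Ipos Ineg \<mu> \<mu> = enn2ereal (\<integral>\<^sup>+x. p x \<partial>count_space (I \<times> I)) - enn2ereal (\<integral>\<^sup>+x. n x \<partial>count_space (I \<times> I))"
    unfolding vmutual_energy_def ereal_series_def
  proof (rule ereal_integral_diff)
    show "(\<integral>\<^sup>+x. n x \<partial>count_space (I \<times> I)) < \<infinity>" using f fM by (simp add: i_n)
    have "(case x of (i, j) \<Rightarrow> ereal (sg i * sg j) * mutual_energy \<kappa> (\<mu> i) (\<mu> j)) = enn2ereal (p x) - enn2ereal (n x)"
      if x: "x \<in> I \<times> I" for x
    proof -
      obtain i j where ij: "x = (i, j)" "i \<in> I" "j \<in> I" using x by auto
      note rr = vm_radon[OF \<mu> ij(2)] vm_radon[OF \<mu> ij(3)]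
      have s: "sg i = sg j \<and> sg i * sg j = 1 \<or> sg i \<noteq> sg j \<and> sg i * sg j = -1" by (simp add: plate_sign_def)
      obtain m where m: "Mc (\<mu> i) (\<mu> j) = ennreal m" "0 \<le> m"
        using Mc_finite[OF rr] by (cases "Mc (\<mu> i) (\<mu> j)") auto
      show ?thesis
        using s m by (cases "J (\<mu> i) (\<mu> j)")
          (auto simp: ij p_def n_def mutual_energy_Mc[OF rr] enn2ereal_ennreal)
    qed
    then show "AE x in count_space (I \<times> I). (case x of (i, j) \<Rightarrow> ereal (sg i * sg j) * mutual_energy \<kappa> (\<mu> i) (\<mu> j)) = enn2ereal (p x) - enn2ereal (n x)"
      by (simp add: AE_count_space)
  qed auto
  also have "\<dots> = ereal (dsq ?P ?N)"
  proof -
    have 1: "enn2ereal z = ereal (enn2real z)" if "z < \<infinity>" for z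
      using that by (cases z) (auto simp: enn2ereal_ennreal)
    have "enn2real ((J ?P ?P + Mc ?P ?N) + (Mc ?N ?P + J ?N ?N)) = enn2real (J ?P ?P) + enn2real (Mc ?P ?N) + (enn2real (Mc ?N ?P) + enn2real (J ?N ?N))"
      using f fM by (simp add: enn2real_plus)
    moreover have "enn2real ((Mc ?P ?P + J ?P ?N) + (J ?N ?P + Mc ?N ?N)) = enn2real (Mc ?P ?P) + enn2real (J ?P ?N) + (enn2real (J ?N ?P) + enn2real (Mc ?N ?N))"
      using f fM by (simp add: enn2real_plus)
    moreover have "ee ?N ?P = ee ?P ?N" by (rule ee_symE[OF E(2,1)])
    ultimately show ?thesis
      unfolding ip i_n using f fM by (simp add: 1 dsq_def ee_Mc[OF r(1,1)] ee_Mc[OF r(1,2)] ee_Mc[OF r(2,1)] ee_Mc[OF r(2,2)])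
  qed
  finally show ?thesis .
qed

text \<open>Absolute convergence discards the signs and, corrections being finite, bounds the double
  sum of all \<open>J (\<mu> i) (\<mu> j)\<close>, which is the energy of
  \<open>part I \<mu>\<close>; this measure dominates both parts.\<close>

lemma vfinite_energy_iff:
  "\<mu> \<in> vfinite_energy \<kappa> Ipos Ineg A \<longleftrightarrow> \<mu> \<in> vmeasures Ipos Ineg A \<and> part Ipos \<mu> \<in> E \<and> part Ineg \<mu> \<in> E"
proof
  assume "\<mu> \<in> vmeasures Ipos Ineg A \<and> part Ipos \<mu> \<in> E \<and> part Ineg \<mu> \<in> E"
  then show "\<mu> \<in> vfinite_energy \<kappa> Ipos Ineg A" by (simp add: vfinite_energy_def vmutual_energy_eq)
next
  assume a: "\<mu> \<in> vfinite_energy \<kappa> Ipos Ineg A"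
  then have \<mu>: "\<mu> \<in> vmeasures Ipos Ineg A" and fin: "\<bar>vmutual_energy \<kappa> Ipos Ineg \<mu> \<mu>\<bar> \<noteq> \<infinity>"
    by (auto simp: vfinite_energy_def)
  let ?u = "\<lambda>(i, j). ereal (sg i * sg j) * mutual_energy \<kappa> (\<mu> i) (\<mu> j)"
  have S: "(\<integral>\<^sup>+x. e2ennreal \<bar>?u x\<bar> \<partial>count_space (I \<times> I)) < \<infinity>"
    by (rule ereal_series_finiteD[OF fin[unfolded vmutual_energy_def]])
  have abs: "\<bar>?u (i, j)\<bar> = \<bar>mutual_energy \<kappa> (\<mu> i) (\<mu> j)\<bar>" for i j
    by (cases "mutual_energy \<kappa> (\<mu> i) (\<mu> j)") (auto simp: plate_sign_def)
  have "(\<integral>\<^sup>+(i, j). J (\<mu> i) (\<mu> j) \<partial>count_space (I \<times> I)) < \<infinity>"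
  proof -
    have le: "J (\<mu> i) (\<mu> j) \<le> e2ennreal \<bar>?u (i, j)\<bar> + Mc (\<mu> i) (\<mu> j)" if ij: "i \<in> I" "j \<in> I" for i j
    proof -
      note rr = vm_radon[OF \<mu> ij(1)] vm_radon[OF \<mu> ij(2)]
      obtain m where m: "Mc (\<mu> i) (\<mu> j) = ennreal m" "0 \<le> m"
        using Mc_finite[OF rr] by (cases "Mc (\<mu> i) (\<mu> j)") auto
      show ?thesis unfolding abs mutual_energy_Mc[OF rr] m
        by (cases "J (\<mu> i) (\<mu> j)") (use m in \<open>auto simp: enn2ereal_ennreal e2ennreal_ereal simp flip: ennreal_plus intro!: ennreal_leI\<close>)
    qed
    have M: "(\<integral>\<^sup>+(i, j). Mc (\<mu> i) (\<mu> j) \<partial>count_space (I \<times> I)) < \<infinity>"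
    proof -
      have "(\<integral>\<^sup>+(i, j). Mc (\<mu> i) (\<mu> j) \<partial>count_space (I \<times> I)) = Mc (part I \<mu>) (part I \<mu>)"
        unfolding nn_integral_count_space_Times
        by (subst Mc_part_left[OF \<mu>]) (auto intro!: nn_integral_cong Mc_part_right[OF \<mu>, symmetric])
      also have "\<dots> < \<infinity>" by (intro Mc_finite part_radon[OF \<mu>]) auto
      finally show ?thesis .
    qed
    have "(\<integral>\<^sup>+(i, j). J (\<mu> i) (\<mu> j) \<partial>count_space (I \<times> I)) \<le>
        (\<integral>\<^sup>+x. e2ennreal \<bar>?u x\<bar> + (case x of (i, j) \<Rightarrow> Mc (\<mu> i) (\<mu> j)) \<partial>count_space (I \<times> I))"
      using le by (intro nn_integral_mono) auto
    also have "\<dots> = (\<integral>\<^sup>+x. e2ennreal \<bar>?u x\<bar> \<partial>count_space (I \<times> I)) + (\<integral>\<^sup>+(i, j). Mc (\<mu> i) (\<mu> j) \<partial>count_space (I \<times> I))"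
      by (subst nn_integral_add) auto
    also have "\<dots> < \<infinity>" using S M by simp
    finally show ?thesis .
  qed
  moreover have "(\<integral>\<^sup>+(i, j). J (\<mu> i) (\<mu> j) \<partial>count_space (I \<times> I)) = J (part I \<mu>) (part I \<mu>)"
    unfolding nn_integral_count_space_Times
    by (subst J_part_left[OF \<mu>]) (auto intro!: nn_integral_cong J_part_right[OF \<mu>, symmetric] part_radon[OF \<mu>] vm_radon[OF \<mu>])
  ultimately have "part I \<mu> \<in> E" using part_radon[OF \<mu>] by (simp add: E_def)
  then show "\<mu> \<in> vmeasures Ipos Ineg A \<and> part Ipos \<mu> \<in> E \<and> part Ineg \<mu> \<in> E"
    using part_I_E[OF \<mu>] \<mu> by simp
qed

definition vmid :: "(nat \<Rightarrow> 'a measure) \<Rightarrow> (nat \<Rightarrow> 'a measure) \<Rightarrow> nat \<Rightarrow> 'a measure" where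
  "vmid \<mu> \<nu> = (\<lambda>i\<in>I. mid (\<mu> i) (\<nu> i))"

lemma vmid_vm:
  assumes "\<mu> \<in> vmeasures Ipos Ineg A" "\<nu> \<in> vmeasures Ipos Ineg A"
  shows "vmid \<mu> \<nu> \<in> vmeasures Ipos Ineg A"
  unfolding vmeasures_def
proof (rule PiE_I)
  show "vmid \<mu> \<nu> i \<in> radon_on (A i)" if "i \<in> I" for i
    using mid_radon_on[OF vm_radon_on[OF assms(1) that] vm_radon_on[OF assms(2) that] A_closed[OF that]] that
    by (simp add: vmid_def)
qed (simp add: vmid_def)

lemma part_vmid:
  assumes \<mu>: "\<mu> \<in> vmeasures Ipos Ineg A" and \<nu>: "\<nu> \<in> vmeasures Ipos Ineg A" and X: "X \<subseteq> I"
  shows "part X (vmid \<mu> \<nu>) = mid (part X \<mu>) (part X \<nu>)"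
  unfolding part_def
  by (rule wsum_mid)
    (use vm_radon[OF \<mu>] vm_radon[OF \<nu>] part_radon[OF \<mu> X] part_radon[OF \<nu> X] X in \<open>auto simp: vmid_def part_def\<close>)

text \<open>The parallelogram law for this sum yields the distances of both parts at once; that for
  the energy of the vector measure would only see their difference.\<close>

definition vH :: "(nat \<Rightarrow> 'a measure) \<Rightarrow> real" where
  "vH \<mu> = ee (part Ipos \<mu>) (part Ipos \<mu>) + ee (part Ineg \<mu>) (part Ineg \<mu>)"

lemma vmid_energy:
  assumes \<mu>: "\<mu> \<in> vfinite_energy \<kappa> Ipos Ineg A" and \<nu>: "\<nu> \<in> vfinite_energy \<kappa> Ipos Ineg A"
  shows "vmid \<mu> \<nu> \<in> vfinite_energy \<kappa> Ipos Ineg A"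
    "2 * vH \<mu> + 2 * vH \<nu> - 4 * vH (vmid \<mu> \<nu>) =
       dsq (part Ipos \<mu>) (part Ipos \<nu>) + dsq (part Ineg \<mu>) (part Ineg \<nu>)"
    "dsq (part Ipos (vmid \<mu> \<nu>)) (part Ineg (vmid \<mu> \<nu>)) \<le>
       (dsq (part Ipos \<mu>) (part Ineg \<mu>) + dsq (part Ipos \<nu>) (part Ineg \<nu>)) / 2"
proof -
  have vm: "\<mu> \<in> vmeasures Ipos Ineg A" "\<nu> \<in> vmeasures Ipos Ineg A"
    and E: "part Ipos \<mu> \<in> E" "part Ineg \<mu> \<in> E" "part Ipos \<nu> \<in> E" "part Ineg \<nu> \<in> E"
    using \<mu> \<nu> by (auto simp: vfinite_energy_iff)
  let ?P = "part Ipos \<mu>" and ?N = "part Ineg \<mu>" and ?P' = "part Ipos \<nu>" and ?N' = "part Ineg \<nu>"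
  have p: "part Ipos (vmid \<mu> \<nu>) = mid ?P ?P'" "part Ineg (vmid \<mu> \<nu>) = mid ?N ?N'"
    by (rule part_vmid[OF vm]; simp)+
  show "vmid \<mu> \<nu> \<in> vfinite_energy \<kappa> Ipos Ineg A"
    unfolding vfinite_energy_iff p using vmid_vm[OF vm] ee_mid(1) E by simp
  show "2 * vH \<mu> + 2 * vH \<nu> - 4 * vH (vmid \<mu> \<nu>) = dsq ?P ?P' + dsq ?N ?N'"
    unfolding vH_def p using ee_mid(2)[OF E(1,3)] ee_mid(2)[OF E(2,4)] by simp
  \<comment> \<open>Nonnegativity of
    \<open>\<parallel>(?P - ?N) - (?P' - ?N')\<parallel>\<^sup>2\<close>, with the negative terms
    moved across.\<close>
  have 1: "0 \<le> dsq (comb 1 ?P 1 ?N') (comb 1 ?P' 1 ?N)" by (intro dsq_nonneg E_comb E)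
  show "dsq (part Ipos (vmid \<mu> \<nu>)) (part Ineg (vmid \<mu> \<nu>)) \<le> (dsq ?P ?N + dsq ?P' ?N') / 2"
    using 1 E ee_symE[OF E(1,2)] ee_symE[OF E(1,3)] ee_symE[OF E(1,4)] ee_symE[OF E(2,3)] ee_symE[OF E(2,4)] ee_symE[OF E(3,4)]
    unfolding p mid_comb by (simp add: dsq_def ee_bilinear E_comb field_simps)
qed

end

subsection \<open>Passage to the limit\<close>

lemma tendsto_of_square_bound:
  fixes h :: "'b \<Rightarrow> real"
  assumes b: "eventually (\<lambda>x. (h x - l)\<^sup>2 \<le> d x) F" and d: "(d \<longlongrightarrow> 0) F"
  shows "(h \<longlongrightarrow> l) F"
proof -
  have "((\<lambda>x. (h x - l)\<^sup>2) \<longlongrightarrow> 0) F"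
    by (rule tendsto_sandwich[OF _ b tendsto_const d]) simp
  then have "((\<lambda>x. h x - l) \<longlongrightarrow> 0) F" by (simp add: tendsto_null_power)
  then show ?thesis by (rule LIM_zero_cancel)
qed

text \<open>A weight matters on its plate only. The value \<open>top\<close> elsewhere makes it
  lower semicontinuous on the whole space, since \<open>A\<close> is closed, and measures carried by
  \<open>A\<close> do not notice it.\<close>

lemma lsc_extend_top:
  fixes h :: "'a::topological_space \<Rightarrow> real"
  assumes A: "closed A" and h: "continuous_on A h" and nn: "\<And>x. x \<in> A \<Longrightarrow> 0 \<le> h x"
  shows "open {x. t < (if x \<in> A then ennreal (h x) else top)}"
proof (cases t)
  case (real s)
  have "{x. t < (if x \<in> A then ennreal (h x) else top)} = - (A \<inter> h -` {..s})"
    using real nn by (auto simp: ennreal_less_iff not_le split: if_splits)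
  moreover have "closed (A \<inter> h -` {..s})" by (rule continuous_closed_preimage[OF h A]) simp
  ultimately show ?thesis by (simp only: open_Compl)
qed simp

context kernel_space begin

lemma tendsto_ee_left:
  assumes P: "eventually (\<lambda>x. p x \<in> E) F" "p0 \<in> E" "((\<lambda>x. dsq (p x) p0) \<longlongrightarrow> 0) F" and \<sigma>: "\<sigma> \<in> E"
  shows "((\<lambda>x. ee (p x) \<sigma>) \<longlongrightarrow> ee p0 \<sigma>) F"
proof (rule tendsto_of_square_bound)
  show "eventually (\<lambda>x. (ee (p x) \<sigma> - ee p0 \<sigma>)\<^sup>2 \<le> dsq (p x) p0 * ee \<sigma> \<sigma>) F"
    using P(1) by eventually_elim (rule ee_CS[OF _ P(2) \<sigma>])
  show "((\<lambda>x. dsq (p x) p0 * ee \<sigma> \<sigma>) \<longlongrightarrow> 0) F" by (rule tendsto_mult_left_zero[OF P(3)])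
qed

text \<open>\<open>ee (p x) (q x)\<close> is compared with \<open>ee p0 (q x)\<close> by
  \<open>ee_CS\<close>, whose factor \<open>ee (q x) (q x)\<close> converges; the remaining
  comparison has one argument fixed.\<close>

lemma tendsto_ee:
  assumes P: "eventually (\<lambda>x. p x \<in> E) F" "p0 \<in> E" "((\<lambda>x. dsq (p x) p0) \<longlongrightarrow> 0) F"
    and Q: "eventually (\<lambda>x. q x \<in> E) F" "q0 \<in> E" "((\<lambda>x. dsq (q x) q0) \<longlongrightarrow> 0) F"
  shows "((\<lambda>x. ee (p x) (q x)) \<longlongrightarrow> ee p0 q0) F"
proof -
  have q: "((\<lambda>x. ee (q x) q0) \<longlongrightarrow> ee q0 q0) F" by (rule tendsto_ee_left[OF Q Q(2)])
  have "((\<lambda>x. dsq (q x) q0 + 2 * ee (q x) q0 - ee q0 q0) \<longlongrightarrow> 0 + 2 * ee q0 q0 - ee q0 q0) F"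
    by (intro tendsto_intros Q(3) q)
  then have qq: "((\<lambda>x. ee (q x) (q x)) \<longlongrightarrow> ee q0 q0) F" by (simp add: dsq_def)
  have 1: "((\<lambda>x. ee (p x) (q x) - ee p0 (q x)) \<longlongrightarrow> 0) F"
  proof (rule tendsto_of_square_bound)
    show "eventually (\<lambda>x. (ee (p x) (q x) - ee p0 (q x) - 0)\<^sup>2 \<le> dsq (p x) p0 * ee (q x) (q x)) F"
      using P(1) Q(1) by eventually_elim (simp add: ee_CS P(2))
    show "((\<lambda>x. dsq (p x) p0 * ee (q x) (q x)) \<longlongrightarrow> 0) F"
      using tendsto_mult[OF P(3) qq] by simp
  qed
  have "((\<lambda>x. ee (q x) p0) \<longlongrightarrow> ee q0 p0) F" by (rule tendsto_ee_left[OF Q P(2)])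
  moreover have "eventually (\<lambda>x. ee (q x) p0 = ee p0 (q x)) F"
    using Q(1) by eventually_elim (rule ee_symE[OF _ P(2)])
  ultimately have "((\<lambda>x. ee p0 (q x)) \<longlongrightarrow> ee p0 q0) F"
    using ee_symE[OF Q(2) P(2)] by (simp add: tendsto_cong)
  from tendsto_add[OF 1 this] show ?thesis by simp
qed

text \<open>In \<open>ereal\<close> the difference \<open>\<infinity> - \<infinity>\<close> is
  \<open>\<infinity>\<close>, so finite energy excludes an infinite sum of the
  self-energies.\<close>

lemma finite_energy_E:
  assumes "(\<sigma>1, \<sigma>2) \<in> finite_energy \<kappa>"
  shows "\<sigma>1 \<in> E" "\<sigma>2 \<in> E"
proof -
  have r: "\<sigma>1 \<in> radon" "\<sigma>2 \<in> radon" and fin: "\<bar>energy \<kappa> (\<sigma>1, \<sigma>2)\<bar> \<noteq> \<infinity>"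
    using assms by (auto simp: finite_energy_def signed_radon_def)
  have nm: "mutual_energy \<kappa> \<mu> \<nu> \<noteq> -\<infinity>" if "\<mu> \<in> radon" "\<nu> \<in> radon" for \<mu> \<nu>
    using mutual_energy_ee[OF that] mutual_energy_top[OF that] by (cases "J \<mu> \<nu> = \<infinity>") (auto simp: less_top)
  have "mutual_energy \<kappa> \<sigma>1 \<sigma>1 + mutual_energy \<kappa> \<sigma>2 \<sigma>2 \<noteq> \<infinity>"
    using fin by (auto simp: energy_def)
  then have "mutual_energy \<kappa> \<sigma>1 \<sigma>1 \<noteq> \<infinity>" "mutual_energy \<kappa> \<sigma>2 \<sigma>2 \<noteq> \<infinity>"
    using nm r by auto
  then show "\<sigma>1 \<in> E" "\<sigma>2 \<in> E"
    using r mutual_energy_top[OF r(1,1)] mutual_energy_top[OF r(2,2)] by (auto simp: E_def less_top[symmetric])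
qed

lemma tendsto_dsq:
  assumes P: "eventually (\<lambda>x. p x \<in> E) F" "p0 \<in> E" "((\<lambda>x. dsq (p x) p0) \<longlongrightarrow> 0) F"
    and Q: "eventually (\<lambda>x. q x \<in> E) F" "q0 \<in> E" "((\<lambda>x. dsq (q x) q0) \<longlongrightarrow> 0) F"
  shows "((\<lambda>x. dsq (p x) (q x)) \<longlongrightarrow> dsq p0 q0) F"
  unfolding dsq_def[of "p _"] dsq_def[of p0]
  by (intro tendsto_intros tendsto_ee P Q)

end

section \<open>Preservation of the weight constraint\<close>

text \<open>Lower semicontinuity of \<open>g\<close> gives one inequality. For the other,
  \<open>(G - g) * \<theta>\<close> with a cutoff \<open>\<theta>\<close> is also nonnegative and
  continuous on \<open>A\<close>, so its integral is lower semicontinuous, while the integral of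
  \<open>G * \<theta>\<close> converges; hence the integral of \<open>g * \<theta>\<close> is upper
  semicontinuous, and tightness controls what the cutoff omits.\<close>

lemma (in lch_space) weight_limit:
  fixes A :: "'a set" and g :: "'a \<Rightarrow> real" and \<nu> :: "'b \<Rightarrow> 'a measure"
  assumes A: "closed A" and g: "continuous_on A g" "\<And>x. x \<in> A \<Longrightarrow> 0 < g x" and F: "F \<noteq> bot"
    and \<nu>: "eventually (\<lambda>t. \<nu> t \<in> radon_on A) F" and \<nu>0: "\<nu>0 \<in> radon_on A"
    and lim: "\<And>\<phi>. \<phi> \<in> Cc \<Longrightarrow> ((\<lambda>t. integral\<^sup>L (\<nu> t) \<phi>) \<longlongrightarrow> integral\<^sup>L \<nu>0 \<phi>) F"
    and a: "0 \<le> a" "eventually (\<lambda>t. (\<integral>\<^sup>+x\<in>A. ennreal (g x) \<partial>\<nu> t) = ennreal a) F"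
    and tight: "\<And>e. 0 < e \<Longrightarrow> \<exists>K. compact K \<and> eventually (\<lambda>t. (\<integral>\<^sup>+x\<in>A - K. ennreal (g x) \<partial>\<nu> t) \<le> ennreal e) F"
  shows "(\<integral>\<^sup>+x\<in>A. ennreal (g x) \<partial>\<nu>0) = ennreal a"
proof (rule antisym)
  have r: "eventually (\<lambda>t. \<nu> t \<in> radon) F" using \<nu> by eventually_elim (simp add: radon_on_def)
  have r0: "\<nu>0 \<in> radon" using \<nu>0 by (simp add: radon_on_def)
  have gm: "(\<lambda>x. ennreal (h x) * indicator B x) \<in> borel_measurable borel"
    if "continuous_on A h" "B \<in> sets borel" "B \<subseteq> A" for h :: "'a \<Rightarrow> real" and B
  proof -
    have "(\<lambda>x. indicator A x *\<^sub>R h x) \<in> borel_measurable borel"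
      by (rule borel_measurable_continuous_on_indicator) (use that A in auto)
    then have "(\<lambda>x. ennreal (indicator A x *\<^sub>R h x) * indicator B x) \<in> borel_measurable borel"
      using that(2) by measurable
    moreover have "(\<lambda>x. ennreal (indicator A x *\<^sub>R h x) * indicator B x) = (\<lambda>x. ennreal (h x) * indicator B x)"
      using that(3) by (auto simp: indicator_def fun_eq_iff)
    ultimately show ?thesis by simp
  qed
  have ext: "(\<integral>\<^sup>+x. (if x \<in> A then ennreal (h x) else top) \<partial>\<rho>) = (\<integral>\<^sup>+x\<in>A. ennreal (h x) \<partial>\<rho>)"
    if "\<rho> \<in> radon_on A" for \<rho> and h :: "'a \<Rightarrow> real"
    by (rule radon_on_cong[OF that A]) auto
  show "(\<integral>\<^sup>+x\<in>A. ennreal (g x) \<partial>\<nu>0) \<le> ennreal a"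
  proof (rule ccontr)
    assume "\<not> ?thesis"
    then have "ennreal a < (\<integral>\<^sup>+x. (if x \<in> A then ennreal (g x) else top) \<partial>\<nu>0)" by (simp add: ext[OF \<nu>0])
    then have "eventually (\<lambda>t. ennreal a < (\<integral>\<^sup>+x. (if x \<in> A then ennreal (g x) else top) \<partial>\<nu> t)) F"
      by (intro nn_integral_lsc_vague_le[OF r r0 lim] lsc_extend_top A g) (auto dest: g(2))
    then have "eventually (\<lambda>t. False) F" using a(2) \<nu> by eventually_elim (simp add: ext)
    then show False using F by (simp add: trivial_limit_def)
  qed
  then have fin0: "(\<integral>\<^sup>+x\<in>A. ennreal (g x) \<partial>\<nu>0) < top" by (rule le_less_trans) simp
  show "ennreal a \<le> (\<integral>\<^sup>+x\<in>A. ennreal (g x) \<partial>\<nu>0)"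
  proof (rule ccontr)
    assume lt: "\<not> ?thesis"
    define b where "b = enn2real (\<integral>\<^sup>+x\<in>A. ennreal (g x) \<partial>\<nu>0)"
    have b: "(\<integral>\<^sup>+x\<in>A. ennreal (g x) \<partial>\<nu>0) = ennreal b" "0 \<le> b" using fin0 by (auto simp: b_def)
    have ba: "b < a" using lt b a(1) by (simp add: ennreal_le_iff)
    \<comment> \<open>A third of the gap each for the tail, for the convergence of the integral of
      \<open>G * \<theta>\<close> and for the semicontinuity of the integral of
      \<open>w\<close>.\<close>
    define e where "e = (a - b) / 3"
    have e: "0 < e" using ba by (simp add: e_def)
    obtain K where K: "compact K" "eventually (\<lambda>t. (\<integral>\<^sup>+x\<in>A - K. ennreal (g x) \<partial>\<nu> t) \<le> ennreal e) F"
      using tight[OF e] by blast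
    obtain \<theta> :: "'a \<Rightarrow> real" and C where \<theta>: "\<theta> \<in> Cc" "\<And>x. 0 \<le> \<theta> x" "\<And>x. \<theta> x \<le> 1" "\<And>x. x \<in> K \<Longrightarrow> \<theta> x = 1"
      "compact C" "\<And>x. x \<notin> C \<Longrightarrow> \<theta> x = 0" using urysohn[OF K(1) open_UNIV subset_UNIV] by metis
    have "compact (g ` (C \<inter> A))"
      using \<theta>(5) A g(1) by (intro compact_continuous_image compact_Int_closed) (auto intro: continuous_on_subset)
    then obtain G where G: "\<And>x. x \<in> C \<Longrightarrow> x \<in> A \<Longrightarrow> g x \<le> G" "0 \<le> G"
    proof -
      obtain G0 where "\<And>y. y \<in> g ` (C \<inter> A) \<Longrightarrow> norm y \<le> G0"
        using compact_imp_bounded[OF \<open>compact (g ` (C \<inter> A))\<close>] bounded_iff by metis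
      then show thesis using that[of "max G0 0"] by (force simp: le_max_iff_disj)
    qed
    define w where "w x = (G - g x) * \<theta> x" for x
    have wc: "continuous_on A w" unfolding w_def
      using g(1) Cc_cont[OF \<theta>(1)] by (intro continuous_intros) (auto intro: continuous_on_subset)
    have wnn: "0 \<le> w x" if "x \<in> A" for x
      using G(1)[of x] that \<theta>(2,6)[of x] by (cases "x \<in> C") (auto simp: w_def)
    have xc: "continuous_on A (\<lambda>x. \<theta> x * g x)"
      using g(1) Cc_cont[OF \<theta>(1)] by (intro continuous_intros) (auto intro: continuous_on_subset)
    have As: "A \<in> sets borel" using A by simp
    have G\<theta>: "(\<lambda>x. G * \<theta> x) \<in> Cc" by (rule Cc_cmult[OF \<theta>(1)])
    have main: "(\<integral>\<^sup>+x\<in>A. ennreal (w x) \<partial>\<rho>) + (\<integral>\<^sup>+x\<in>A. ennreal (\<theta> x * g x) \<partial>\<rho>) = ennreal (\<integral>x. G * \<theta> x \<partial>\<rho>)"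
      if \<rho>: "\<rho> \<in> radon_on A" for \<rho>
    proof -
      have \<rho>r: "\<rho> \<in> radon" using \<rho> by (simp add: radon_on_def)
      have "(\<integral>\<^sup>+x\<in>A. ennreal (w x) \<partial>\<rho>) + (\<integral>\<^sup>+x\<in>A. ennreal (\<theta> x * g x) \<partial>\<rho>) =
          (\<integral>\<^sup>+x. ennreal (w x) * indicator A x + ennreal (\<theta> x * g x) * indicator A x \<partial>\<rho>)"
        using gm[OF wc As subset_refl] gm[OF xc As subset_refl] radon_measurable[OF \<rho>r]
        by (intro nn_integral_add[symmetric]) blast+
      also have "\<dots> = (\<integral>\<^sup>+x. ennreal (G * \<theta> x) \<partial>\<rho>)"
      proof (rule radon_on_cong[OF \<rho> A])
        fix x assume x: "x \<in> A"
        have "ennreal (w x) + ennreal (\<theta> x * g x) = ennreal (w x + \<theta> x * g x)"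
          using wnn[OF x] \<theta>(2)[of x] g(2)[OF x] by (intro ennreal_plus[symmetric]) auto
        also have "w x + \<theta> x * g x = G * \<theta> x" by (simp add: w_def algebra_simps)
        finally show "ennreal (w x) * indicator A x + ennreal (\<theta> x * g x) * indicator A x = ennreal (G * \<theta> x)" using x by simp
      qed
      also have "\<dots> = ennreal (\<integral>x. G * \<theta> x \<partial>\<rho>)"
        by (rule nn_integral_eq_integral[OF Cc_integrable[OF \<rho>r G\<theta>]]) (use G(2) \<theta>(2) in simp)
      finally show ?thesis .
    qed
    have low: "ennreal a \<le> (\<integral>\<^sup>+x\<in>A. ennreal (\<theta> x * g x) \<partial>\<rho>) + ennreal e"
      if \<rho>: "\<rho> \<in> radon_on A" "(\<integral>\<^sup>+x\<in>A. ennreal (g x) \<partial>\<rho>) = ennreal a" "(\<integral>\<^sup>+x\<in>A - K. ennreal (g x) \<partial>\<rho>) \<le> ennreal e" for \<rho>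
    proof -
      have \<rho>r: "\<rho> \<in> radon" using \<rho> by (simp add: radon_on_def)
      have AK: "A - K \<in> sets borel" using As borel_compact[OF K(1)] by auto
      have "ennreal a \<le> (\<integral>\<^sup>+x. ennreal (\<theta> x * g x) * indicator A x + ennreal (g x) * indicator (A - K) x \<partial>\<rho>)"
        unfolding \<rho>(2)[symmetric]
        by (intro nn_integral_mono) (auto simp: indicator_def \<theta>(4))
      also have "\<dots> = (\<integral>\<^sup>+x\<in>A. ennreal (\<theta> x * g x) \<partial>\<rho>) + (\<integral>\<^sup>+x\<in>A - K. ennreal (g x) \<partial>\<rho>)"
        using gm[OF g(1) AK] gm[OF xc As subset_refl] radon_measurable[OF \<rho>r]
        by (intro nn_integral_add) blast+
      also have "\<dots> \<le> (\<integral>\<^sup>+x\<in>A. ennreal (\<theta> x * g x) \<partial>\<rho>) + ennreal e" using \<rho>(3) by (rule add_left_mono)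
      finally show ?thesis .
    qed
    define S where "S = (\<integral>x. G * \<theta> x \<partial>\<nu>0)"
    have Snn: "0 \<le> S" unfolding S_def using G(2) \<theta>(2) by (intro integral_nonneg_AE) simp
    obtain q where q: "(\<integral>\<^sup>+x\<in>A. ennreal (\<theta> x * g x) \<partial>\<nu>0) = ennreal q" "0 \<le> q"
      using main[OF \<nu>0] by (cases "\<integral>\<^sup>+x\<in>A. ennreal (\<theta> x * g x) \<partial>\<nu>0") (auto simp: add_top)
    obtain v where v: "(\<integral>\<^sup>+x\<in>A. ennreal (w x) \<partial>\<nu>0) = ennreal v" "0 \<le> v"
      using main[OF \<nu>0] by (cases "\<integral>\<^sup>+x\<in>A. ennreal (w x) \<partial>\<nu>0") auto
    have vqS: "v + q = S" using main[OF \<nu>0] v q Snn by (simp add: S_def flip: ennreal_plus)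
    have qb: "q \<le> b"
    proof -
      have "\<theta> x * g x \<le> g x" if "x \<in> A" for x
        using \<theta>(2,3)[of x] g(2)[OF that] by (intro mult_left_le_one_le) auto
      then have "(\<integral>\<^sup>+x\<in>A. ennreal (\<theta> x * g x) \<partial>\<nu>0) \<le> (\<integral>\<^sup>+x\<in>A. ennreal (g x) \<partial>\<nu>0)"
        by (intro nn_integral_mono) (auto simp: indicator_def intro!: ennreal_leI)
      then show ?thesis using q b by (simp add: ennreal_le_iff)
    qed
    \<comment> \<open>\<open>ennreal\<close> truncates at 0, so a negative lower bound has to be
      treated apart.\<close>
    have vgt: "max 0 (S + 2 * e - a) < v \<or> S + 2 * e - a < 0"
    proof -
      have "S + 2 * e - a < v" using vqS qb ba by (simp add: e_def field_simps)
      then show ?thesis by auto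
    qed
    have evS: "eventually (\<lambda>t. (\<integral>x. G * \<theta> x \<partial>\<nu> t) < S + e) F"
      by (rule order_tendstoD(2)[OF lim[OF G\<theta>]]) (use e in \<open>simp add: S_def\<close>)
    have evlow: "eventually (\<lambda>t. \<nu> t \<in> radon_on A \<and> ennreal a \<le> (\<integral>\<^sup>+x\<in>A. ennreal (\<theta> x * g x) \<partial>\<nu> t) + ennreal e) F"
      using \<nu> a(2) K(2) by eventually_elim (use low in blast)
    have contra: False if t: "\<nu>' \<in> radon_on A" "(\<integral>x. G * \<theta> x \<partial>\<nu>') < S + e"
      "ennreal a \<le> (\<integral>\<^sup>+x\<in>A. ennreal (\<theta> x * g x) \<partial>\<nu>') + ennreal e"
      "S + 2 * e - a < 0 \<or> ennreal (S + 2 * e - a) < (\<integral>\<^sup>+x\<in>A. ennreal (w x) \<partial>\<nu>')" for \<nu>'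
    proof -
      let ?S = "\<integral>x. G * \<theta> x \<partial>\<nu>'"
      have Snn': "0 \<le> ?S" using G(2) \<theta>(2) by (intro integral_nonneg_AE) simp
      obtain q' where q': "(\<integral>\<^sup>+x\<in>A. ennreal (\<theta> x * g x) \<partial>\<nu>') = ennreal q'" "0 \<le> q'"
        using main[OF t(1)] by (cases "\<integral>\<^sup>+x\<in>A. ennreal (\<theta> x * g x) \<partial>\<nu>'") (auto simp: add_top)
      obtain v' where v': "(\<integral>\<^sup>+x\<in>A. ennreal (w x) \<partial>\<nu>') = ennreal v'" "0 \<le> v'"
        using main[OF t(1)] by (cases "\<integral>\<^sup>+x\<in>A. ennreal (w x) \<partial>\<nu>'") auto
      have 1: "v' + q' = ?S" using main[OF t(1)] v' q' Snn' by (simp flip: ennreal_plus)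
      have 2: "a \<le> q' + e" using t(3) q' e a(1) by (simp add: ennreal_le_iff flip: ennreal_plus)
      have 3: "S + 2 * e - a < 0 \<or> S + 2 * e - a < v'"
        using t(4) v' by (cases "S + 2 * e - a < 0") (auto simp: ennreal_less_iff)
      show False using 1 2 3 t(2) v'(2) by linarith
    qed
    have "eventually (\<lambda>t. False) F"
    proof (cases "S + 2 * e - a < 0")
      case True
      show ?thesis using evS evlow by eventually_elim (use contra True in blast)
    next
      case False
      then have "ennreal (S + 2 * e - a) < (\<integral>\<^sup>+x. (if x \<in> A then ennreal (w x) else top) \<partial>\<nu>0)"
        using vgt v by (simp add: ext[OF \<nu>0] ennreal_less_iff)
      then have "eventually (\<lambda>t. ennreal (S + 2 * e - a) < (\<integral>\<^sup>+x. (if x \<in> A then ennreal (w x) else top) \<partial>\<nu> t)) F"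
        by (intro nn_integral_lsc_vague_le[OF r r0 lim] lsc_extend_top A wc wnn) auto
      then show ?thesis using evS evlow
      proof eventually_elim
        case (elim t)
        then show ?case using contra[of "\<nu> t"] ext[of "\<nu> t" w] by auto
      qed
    qed
    then show False using F by (simp add: trivial_limit_def)
  qed
qed

section \<open>Tightness of the weights\<close>

context consistent_kernel begin

text \<open>For compact \<open>A\<close> the tail is empty. Otherwise the space is not compact, so
  \<open>c = 0\<close>; small values of \<open>g\<close> are then handled by tightness of the
  masses, large ones by uniform integrability.\<close>

lemma tight_weight:
  assumes A: "closed A" "compact A \<or> capacity \<kappa> A < \<infinity>"
    and g: "continuous_on A g" "\<And>x. x \<in> A \<Longrightarrow> 0 < g x"
    and gb: "(SUP x\<in>A. ennreal (g x)) < \<infinity> \<or>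
           (\<exists>r \<omega>. 1 < r \<and> \<omega> \<in> finite_energy \<kappa> \<and>
              nearly_everywhere \<kappa> A
                (\<lambda>x. spotential_defined \<kappa> \<omega> x \<and> ereal (g x powr r) \<le> spotential \<kappa> \<omega> x))"
    and e: "0 < e"
  shows "\<exists>K. compact K \<and> (\<forall>\<nu>. \<nu> \<in> radon_on A \<longrightarrow> \<nu> \<in> E \<longrightarrow> (c = 0 \<longrightarrow> ee \<nu> \<nu> \<le> B) \<longrightarrow>
    (\<integral>\<^sup>+x\<in>A - K. ennreal (g x) \<partial>\<nu>) \<le> ennreal e)"
proof (cases "compact A")
  case True
  then show ?thesis by (intro exI[of _ A]) simp
next
  case False
  have "\<not> compact (UNIV :: 'a set)" using False A(1) compact_Int_closed[of UNIV A] by auto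
  then have c0: "c = 0" using c_compact by simp
  have cap: "capacity \<kappa> A < \<infinity>" using A(2) False by simp
  have As: "A \<in> sets borel" using A(1) by simp
  \<comment> \<open>The integrand is split at the height \<open>s\<close>: mass at most
    \<open>e / (2 * s)\<close> outside \<open>K\<close> leaves at most \<open>e / 2\<close> for the
    values up to \<open>s\<close>.\<close>
  have red: ?thesis
    if s: "0 < s" and rest: "\<And>\<nu>. \<nu> \<in> radon_on A \<Longrightarrow> \<nu> \<in> E \<Longrightarrow> ee \<nu> \<nu> \<le> B \<Longrightarrow>
        (\<integral>\<^sup>+x\<in>A. ennreal (if s < g x then g x else 0) \<partial>\<nu>) \<le> ennreal (e / 2)" for s
  proof -
    obtain K where K: "compact K" "\<And>\<mu>. \<mu> \<in> radon_on A \<Longrightarrow> \<mu> \<in> E \<Longrightarrow> ee \<mu> \<mu> \<le> B \<Longrightarrow> emeasure \<mu> (- K) \<le> ennreal (e / (2 * s))"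
      using finite_capacity_tight[OF c0 A(1) cap, of "e / (2 * s)" B] e s by auto
    have "(\<integral>\<^sup>+x\<in>A - K. ennreal (g x) \<partial>\<nu>) \<le> ennreal e" if \<nu>: "\<nu> \<in> radon_on A" "\<nu> \<in> E" "ee \<nu> \<nu> \<le> B" for \<nu>
    proof -
      have r: "\<nu> \<in> radon" by (rule E_radon[OF \<nu>(2)])
      have Kc: "- K \<in> sets \<nu>" using K(1) radon_sets[OF r] by (auto intro!: borel_open open_Compl compact_imp_closed)
      have "(\<lambda>x. indicator A x *\<^sub>R g x) \<in> borel_measurable borel"
        by (rule borel_measurable_continuous_on_indicator) (use A g in auto)
      then have "(\<lambda>x. if s < indicator A x *\<^sub>R g x then ennreal (indicator A x *\<^sub>R g x) else 0) \<in> borel_measurable borel"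
        by measurable
      moreover have "(\<lambda>x. if s < indicator A x *\<^sub>R g x then ennreal (indicator A x *\<^sub>R g x) else 0) =
          (\<lambda>x. ennreal (if s < g x then g x else 0) * indicator A x)"
        using s by (auto simp: indicator_def fun_eq_iff)
      ultimately have m: "(\<lambda>x. ennreal (if s < g x then g x else 0) * indicator A x) \<in> borel_measurable \<nu>"
        using radon_measurable[OF r] by metis
      have "(\<integral>\<^sup>+x\<in>A - K. ennreal (g x) \<partial>\<nu>) \<le>
          (\<integral>\<^sup>+x. ennreal s * indicator (- K) x + ennreal (if s < g x then g x else 0) * indicator A x \<partial>\<nu>)"
        by (intro nn_integral_mono) (auto simp: indicator_def intro!: ennreal_leI add_increasing)
      also have "\<dots> = ennreal s * emeasure \<nu> (- K) + (\<integral>\<^sup>+x\<in>A. ennreal (if s < g x then g x else 0) \<partial>\<nu>)"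
        using Kc m by (subst nn_integral_add) (auto simp: nn_integral_cmult_indicator)
      also have "\<dots> \<le> ennreal s * ennreal (e / (2 * s)) + ennreal (e / 2)"
        by (intro add_mono mult_left_mono K(2) rest \<nu>) auto
      also have "\<dots> = ennreal (s * (e / (2 * s)) + e / 2)" using s e by (subst ennreal_plus, simp, simp, subst ennreal_mult) auto
      also have "s * (e / (2 * s)) + e / 2 = e" using s by simp
      finally show ?thesis .
    qed
    then show ?thesis using K(1) c0 by blast
  qed
  show ?thesis using gb
  proof
    assume "(SUP x\<in>A. ennreal (g x)) < \<infinity>"
    then obtain G where G: "(SUP x\<in>A. ennreal (g x)) = ennreal G" "0 \<le> G" by (cases "SUP x\<in>A. ennreal (g x)") auto
    have le: "g x \<le> G" if "x \<in> A" for x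
      using SUP_upper[OF that, of "\<lambda>x. ennreal (g x)"] G by (simp add: ennreal_le_iff)
    show ?thesis
    proof (rule red[of "G + 1"])
      fix \<nu> :: "'a measure"
      have "(\<integral>\<^sup>+x\<in>A. ennreal (if G + 1 < g x then g x else 0) \<partial>\<nu>) = (\<integral>\<^sup>+x. 0 \<partial>\<nu>)"
        using le by (intro nn_integral_cong) (force simp: indicator_def)
      then show "(\<integral>\<^sup>+x\<in>A. ennreal (if G + 1 < g x then g x else 0) \<partial>\<nu>) \<le> ennreal (e / 2)" by simp
    qed (use G in simp)
  next
    assume "\<exists>r \<omega>. 1 < r \<and> \<omega> \<in> finite_energy \<kappa> \<and>
              nearly_everywhere \<kappa> A
                (\<lambda>x. spotential_defined \<kappa> \<omega> x \<and> ereal (g x powr r) \<le> spotential \<kappa> \<omega> x)"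
    then obtain r \<omega>1 \<omega>2 where r: "1 < r" and \<omega>: "(\<omega>1, \<omega>2) \<in> finite_energy \<kappa>"
      and ne: "nearly_everywhere \<kappa> A (\<lambda>x. spotential_defined \<kappa> (\<omega>1, \<omega>2) x \<and> ereal (g x powr r) \<le> spotential \<kappa> (\<omega>1, \<omega>2) x)"
      by auto
    have \<omega>E: "\<omega>1 \<in> E" "\<omega>2 \<in> E" using finite_energy_E[OF \<omega>] by auto
    let ?h1 = "\<lambda>x. \<integral>\<^sup>+y. kp (x, y) \<partial>\<omega>1" and ?h2 = "\<lambda>x. \<integral>\<^sup>+y. kp (x, y) \<partial>\<omega>2"
    have pot: "potential \<kappa> \<omega>1 x = enn2ereal (?h1 x)" "potential \<kappa> \<omega>2 x = enn2ereal (?h2 x)" for x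
      using potential_eq[OF E_radon] \<omega>E c0 by auto
    define N where "N = {x \<in> A. \<not> (spotential_defined \<kappa> (\<omega>1, \<omega>2) x \<and> ereal (g x powr r) \<le> spotential \<kappa> (\<omega>1, \<omega>2) x)}"
    have capN: "capacity \<kappa> N = 0" using ne by (simp add: nearly_everywhere_def N_def)
    have mh: "?h1 \<in> borel_measurable borel" "?h2 \<in> borel_measurable borel"
      using potential_measurable E_radon \<omega>E by auto
    have mg: "(\<lambda>x. indicator A x *\<^sub>R (g x powr r)) \<in> borel_measurable borel"
      by (rule borel_measurable_continuous_on_indicator) (use A g in \<open>auto intro!: continuous_intros dest: g(2)\<close>)
    have "N = A \<inter> {x \<in> space borel. (enn2ereal (?h1 x) = \<infinity> \<and> enn2ereal (?h2 x) = \<infinity>) \<or>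
        \<not> ereal (indicator A x *\<^sub>R (g x powr r)) \<le> enn2ereal (?h1 x) - enn2ereal (?h2 x)}"
      unfolding N_def spotential_defined_def spotential_def by (auto simp: pot)
    also have "\<dots> \<in> sets borel"
      using mh mg As by measurable
    finally have Ns: "N \<in> sets borel" .
    \<comment> \<open>This bounds \<open>ee \<nu> \<omega>1\<close> by \<open>energy_form\<close>;
      dropping the potential of \<open>\<omega>2\<close> only enlarges the bound on the power of
      \<open>g\<close>.\<close>
    define D where "D = (B + ee \<omega>1 \<omega>1) / 2"
    have bound: "(\<integral>\<^sup>+x\<in>A. ennreal (g x powr r) \<partial>\<nu>) \<le> ennreal D"
      if \<nu>: "\<nu> \<in> radon_on A" "\<nu> \<in> E" "ee \<nu> \<nu> \<le> B" for \<nu>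
    proof -
      have rd: "\<nu> \<in> radon" by (rule E_radon[OF \<nu>(2)])
      have "emeasure \<nu> N = 0" by (rule capacity_zero_null[OF c0 \<nu>(2) Ns capN])
      then have "AE x in \<nu>. x \<notin> N" using Ns radon_sets[OF rd] by (intro AE_not_in) auto
      then have "(\<integral>\<^sup>+x\<in>A. ennreal (g x powr r) \<partial>\<nu>) \<le> (\<integral>\<^sup>+x. ?h1 x \<partial>\<nu>)"
      proof (intro nn_integral_mono_AE, eventually_elim)
        case (elim x)
        show "ennreal (g x powr r) * indicator A x \<le> ?h1 x"
        proof (cases "x \<in> A")
          case True
          then have "ereal (g x powr r) \<le> enn2ereal (?h1 x) - enn2ereal (?h2 x)"
            using elim by (simp add: N_def spotential_def pot)
          also have "\<dots> \<le> enn2ereal (?h1 x)" by (intro ereal_diff_le_self) simp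
          finally have "e2ennreal (ereal (g x powr r)) \<le> e2ennreal (enn2ereal (?h1 x))" by (rule e2ennreal_mono)
          then show ?thesis using True by (simp add: e2ennreal_ereal)
        qed simp
      qed
      also have "\<dots> = J \<nu> \<omega>1" by (simp add: J_def)
      also have "\<dots> = ennreal (ee \<nu> \<omega>1)" unfolding ee_def using energy_form(1)[OF \<nu>(2) \<omega>E(1)] c0 by simp
      also have "\<dots> \<le> ennreal D"
        using energy_form(2)[OF \<nu>(2) \<omega>E(1)] \<nu>(3) by (intro ennreal_leI) (simp add: D_def)
      finally show ?thesis .
    qed
    \<comment> \<open>The maximum with 1 keeps \<open>D'\<close> positive; \<open>s\<close> below is
      then solved from \<open>s powr (1 - r) * D' = e / 2\<close>.\<close>
    define D' where "D' = max D 1"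
    define s where "s = (2 * D' / e) powr (1 / (r - 1))"
    have s: "0 < s" using e by (simp add: s_def D'_def)
    have sr: "s powr (1 - r) = e / (2 * D')"
    proof -
      have "s powr (1 - r) = (2 * D' / e) powr (1 / (r - 1) * (1 - r))" by (simp add: s_def powr_powr)
      also have "1 / (r - 1) * (1 - r) = - 1" using r by (simp add: field_simps)
      finally show ?thesis using e by (simp add: powr_minus_divide D'_def)
    qed
    show ?thesis
    proof (rule red[OF s])
      fix \<nu> assume \<nu>: "\<nu> \<in> radon_on A" "\<nu> \<in> E" "ee \<nu> \<nu> \<le> B"
      have rd: "\<nu> \<in> radon" by (rule E_radon[OF \<nu>(2)])
      \<comment> \<open>Above \<open>s\<close> the factor \<open>t powr (1 - r)\<close> is at most
        \<open>s powr (1 - r)\<close>, as the exponent is negative: the usual passage from a bounded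
        power with exponent above 1 to uniform integrability.\<close>
      have pw: "(if s < t then t else 0) \<le> s powr (1 - r) * t powr r" if t: "0 < t" for t :: real
      proof (cases "s < t")
        case True
        have "t = t powr (1 - r) * t powr r" using t by (simp flip: powr_add)
        also have "\<dots> \<le> s powr (1 - r) * t powr r"
          using True s r by (intro mult_right_mono powr_mono2') auto
        finally show ?thesis using True by simp
      qed simp
      have "(\<lambda>x. ennreal (indicator A x *\<^sub>R (g x powr r))) \<in> borel_measurable borel" using mg by measurable
      moreover have "(\<lambda>x. ennreal (indicator A x *\<^sub>R (g x powr r))) = (\<lambda>x. ennreal (g x powr r) * indicator A x)"
        by (auto simp: indicator_def fun_eq_iff)
      ultimately have m: "(\<lambda>x. ennreal (g x powr r) * indicator A x) \<in> borel_measurable \<nu>"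
        using radon_measurable[OF rd] by metis
      have "(\<integral>\<^sup>+x\<in>A. ennreal (if s < g x then g x else 0) \<partial>\<nu>) \<le>
          (\<integral>\<^sup>+x. ennreal (s powr (1 - r)) * (ennreal (g x powr r) * indicator A x) \<partial>\<nu>)"
      proof (rule nn_integral_mono)
        fix x
        show "ennreal (if s < g x then g x else 0) * indicator A x \<le> ennreal (s powr (1 - r)) * (ennreal (g x powr r) * indicator A x)"
          using pw[OF g(2), of x] by (cases "x \<in> A") (auto simp flip: ennreal_mult intro!: ennreal_leI)
      qed
      also have "\<dots> = ennreal (s powr (1 - r)) * (\<integral>\<^sup>+x\<in>A. ennreal (g x powr r) \<partial>\<nu>)" by (rule nn_integral_cmult[OF m])
      also have "\<dots> \<le> ennreal (s powr (1 - r)) * ennreal D'"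
        by (intro mult_left_mono order_trans[OF bound[OF \<nu>]] ennreal_leI) (auto simp: D'_def)
      also have "\<dots> = ennreal (e / (2 * D') * D')" unfolding sr using e by (subst ennreal_mult) (auto simp: D'_def)
      also have "e / (2 * D') * D' = e / 2" by (simp add: D'_def)
      finally show "(\<integral>\<^sup>+x\<in>A. ennreal (if s < g x then g x else 0) \<partial>\<nu>) \<le> ennreal (e / 2)" .
    qed
  qed
qed

end

subsection \<open>Compactness of the level sets\<close>

context condenser_space begin

definition vfinite_pairing :: "(nat \<Rightarrow> 'a \<Rightarrow> ereal) \<Rightarrow> (nat \<Rightarrow> 'a measure) set" where
  "vfinite_pairing f = {\<mu> \<in> vfinite_energy \<kappa> Ipos Ineg A. \<bar>vpairing Ipos Ineg f \<mu>\<bar> \<noteq> \<infinity>}"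

definition pairing_value :: "(nat \<Rightarrow> 'a \<Rightarrow> ereal) \<Rightarrow> (nat \<Rightarrow> 'a measure) \<Rightarrow> real" where
  "pairing_value f \<mu> = real_of_ereal (vpairing Ipos Ineg f \<mu>)"

definition weight_constrained :: "(nat \<Rightarrow> real) \<Rightarrow> (nat \<Rightarrow> 'a \<Rightarrow> real) \<Rightarrow> (nat \<Rightarrow> 'a measure) \<Rightarrow> bool" where
  "weight_constrained a g \<mu> \<longleftrightarrow> (\<forall>i\<in>I. (\<integral>\<^sup>+x\<in>A i. ennreal (g i x) \<partial>\<mu> i) = ennreal (a i))"

definition limit_of :: "(nat \<Rightarrow> 'a measure) filter \<Rightarrow> (nat \<Rightarrow> 'a measure) \<Rightarrow> bool" where
  "limit_of F \<mu>0 \<longleftrightarrow>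
     (\<forall>i\<in>I. \<forall>\<phi>\<in>Cc. ((\<lambda>\<mu>. integral\<^sup>L (\<mu> i) \<phi>) \<longlongrightarrow> integral\<^sup>L (\<mu>0 i) \<phi>) F) \<and>
     ((\<lambda>\<mu>. dsq (part Ipos \<mu>) (part Ipos \<mu>0)) \<longlongrightarrow> 0) F \<and>
     ((\<lambda>\<mu>. dsq (part Ineg \<mu>) (part Ineg \<mu>0)) \<longlongrightarrow> 0) F"

end

text \<open>
  Everything that is needed of the external field: its pairing is affine, it is lower semicontinuous
  along limits that are both vague and strong, and bounded values of the functional bound the energy.
  The assumption \<open>cross_bound\<close> turns a bound on \<open>\<parallel>R\<^sup>+ \<mu> - R\<^sup>- \<mu>\<parallel>\<close> into bounds on \<open>\<parallel>R\<^sup>+ \<mu>\<parallel>\<close> and \<open>\<parallel>R\<^sup>- \<mu>\<parallel>\<close>.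
\<close>
locale weighted_problem = consistent_kernel T \<kappa> c + condenser_space T \<kappa> c Ipos Ineg A
  for T :: "'a::t2_space itself" and \<kappa> c Ipos Ineg A +
  fixes a :: "nat \<Rightarrow> real" and g :: "nat \<Rightarrow> 'a \<Rightarrow> real" and f :: "nat \<Rightarrow> 'a \<Rightarrow> ereal"
  assumes a_pos: "i \<in> Ipos \<union> Ineg \<Longrightarrow> 0 < a i"
    and g_cont: "i \<in> Ipos \<union> Ineg \<Longrightarrow> continuous_on (A i) (g i)"
    and g_pos: "i \<in> Ipos \<union> Ineg \<Longrightarrow> x \<in> A i \<Longrightarrow> 0 < g i x"
    and tight: "i \<in> Ipos \<union> Ineg \<Longrightarrow> 0 < e \<Longrightarrow> \<exists>K. compact K \<and>
      (\<forall>\<nu>. \<nu> \<in> radon_on (A i) \<longrightarrow> \<nu> \<in> E \<longrightarrow> (c = 0 \<longrightarrow> ee \<nu> \<nu> \<le> B) \<longrightarrow>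
        (\<integral>\<^sup>+x\<in>A i - K. ennreal (g i x) \<partial>\<nu>) \<le> ennreal e)"
    and pairing_mid: "\<mu> \<in> vfinite_pairing f \<Longrightarrow> \<nu> \<in> vfinite_pairing f \<Longrightarrow>
      vmid \<mu> \<nu> \<in> vfinite_pairing f \<and> pairing_value f (vmid \<mu> \<nu>) = (pairing_value f \<mu> + pairing_value f \<nu>) / 2"
    and pairing_limit: "F \<noteq> bot \<Longrightarrow> eventually (\<lambda>\<mu>. \<mu> \<in> vfinite_pairing f) F \<Longrightarrow>
      \<mu>0 \<in> vfinite_energy \<kappa> Ipos Ineg A \<Longrightarrow> limit_of F \<mu>0 \<Longrightarrow> eventually (\<lambda>\<mu>. pairing_value f \<mu> \<le> s) F \<Longrightarrow>
      \<mu>0 \<in> vfinite_pairing f \<and> pairing_value f \<mu>0 \<le> s"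
    and energy_bound: "\<exists>r'. \<forall>\<mu>\<in>vfinite_pairing f. weight_constrained a g \<mu> \<longrightarrow>
      dsq (part Ipos \<mu>) (part Ineg \<mu>) + 2 * pairing_value f \<mu> \<le> r \<longrightarrow> dsq (part Ipos \<mu>) (part Ineg \<mu>) \<le> r'"
    and cross_bound: "\<exists>C. \<forall>\<mu>\<in>vfinite_energy \<kappa> Ipos Ineg A. weight_constrained a g \<mu> \<longrightarrow>
      ee (part Ipos \<mu>) (part Ineg \<mu>) \<le> C"
begin

abbreviation adm where "adm \<equiv> admissible \<kappa> Ipos Ineg f A a g"

lemma adm_iff: "\<mu> \<in> adm \<longleftrightarrow> \<mu> \<in> vfinite_pairing f \<and> weight_constrained a g \<mu>"
  by (auto simp: admissible_def vfinite_pairing_def weight_constrained_def)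

lemma admD_vmeasures: "\<mu> \<in> adm \<Longrightarrow> \<mu> \<in> vmeasures Ipos Ineg A"
  by (simp add: adm_iff vfinite_pairing_def vfinite_energy_def)

lemma admD_E: "\<mu> \<in> adm \<Longrightarrow> part Ipos \<mu> \<in> E \<and> part Ineg \<mu> \<in> E"
  by (simp add: adm_iff vfinite_pairing_def vfinite_energy_iff)

definition functional_value :: "(nat \<Rightarrow> 'a measure) \<Rightarrow> real" where
  "functional_value \<mu> = dsq (part Ipos \<mu>) (part Ineg \<mu>) + 2 * pairing_value f \<mu>"

definition sublevel :: "real \<Rightarrow> (nat \<Rightarrow> 'a measure) set" where
  "sublevel r = {\<mu> \<in> adm. functional_value \<mu> \<le> r}"

lemma weighted_energy_adm: "\<mu> \<in> adm \<Longrightarrow> weighted_energy \<kappa> Ipos Ineg f \<mu> = ereal (functional_value \<mu>)"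
proof -
  assume \<mu>: "\<mu> \<in> adm"
  then have "\<bar>vpairing Ipos Ineg f \<mu>\<bar> \<noteq> \<infinity>" by (simp add: adm_iff vfinite_pairing_def)
  then have "vpairing Ipos Ineg f \<mu> = ereal (pairing_value f \<mu>)"
    by (cases "vpairing Ipos Ineg f \<mu>") (auto simp: pairing_value_def)
  then show ?thesis
    using vmutual_energy_eq[OF admD_vmeasures[OF \<mu>]] admD_E[OF \<mu>] by (simp add: weighted_energy_def functional_value_def)
qed

text \<open>\<open>vH\<close> is the energy of the difference of the parts plus twice their mutual
  energy; \<open>energy_bound\<close> controls the former, \<open>cross_bound\<close> the
  latter.\<close>

lemma sublevel_bound: "\<exists>B. \<forall>\<mu>\<in>sublevel r. vH \<mu> \<le> B"
proof -
  obtain r' where r': "\<And>\<mu>. \<mu> \<in> vfinite_pairing f \<Longrightarrow> weight_constrained a g \<mu> \<Longrightarrow> functional_value \<mu> \<le> r \<Longrightarrow> dsq (part Ipos \<mu>) (part Ineg \<mu>) \<le> r'"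
    using energy_bound[of r] unfolding functional_value_def by blast
  obtain C where C: "\<And>\<mu>. \<mu> \<in> vfinite_energy \<kappa> Ipos Ineg A \<Longrightarrow> weight_constrained a g \<mu> \<Longrightarrow> ee (part Ipos \<mu>) (part Ineg \<mu>) \<le> C"
    using cross_bound by blast
  have "vH \<mu> \<le> r' + 2 * C" if \<mu>: "\<mu> \<in> sublevel r" for \<mu>
  proof -
    have "\<mu> \<in> vfinite_pairing f" "weight_constrained a g \<mu>" "functional_value \<mu> \<le> r" "\<mu> \<in> vfinite_energy \<kappa> Ipos Ineg A"
      using \<mu> by (auto simp: sublevel_def adm_iff vfinite_pairing_def)
    then show ?thesis using r'[of \<mu>] C[of \<mu>] by (simp add: vH_def dsq_def)
  qed
  then show ?thesis by blast
qed

lemma weight_measurable: "i \<in> I \<Longrightarrow> (\<lambda>x. ennreal (g i x) * indicator (A i) x) \<in> borel_measurable borel"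
proof -
  assume i: "i \<in> I"
  have "(\<lambda>x. indicator (A i) x *\<^sub>R g i x) \<in> borel_measurable borel"
    by (rule borel_measurable_continuous_on_indicator) (use A_closed g_cont i in auto)
  then have "(\<lambda>x. ennreal (indicator (A i) x *\<^sub>R g i x)) \<in> borel_measurable borel" by measurable
  moreover have "(\<lambda>x. ennreal (indicator (A i) x *\<^sub>R g i x)) = (\<lambda>x. ennreal (g i x) * indicator (A i) x)"
    by (auto simp: indicator_def fun_eq_iff)
  ultimately show ?thesis by simp
qed

lemma half_half: "ennreal (1/2) * x + ennreal (1/2) * x = x"
proof -
  have "ennreal (1/2) * x + ennreal (1/2) * x = (ennreal (1/2) + ennreal (1/2)) * x" by (simp only: distrib_right)
  also have "ennreal (1/2) + ennreal (1/2) = 1" by (subst ennreal_plus[symmetric]) auto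
  finally show ?thesis by simp
qed

lemma vmid_sublevel:
  assumes \<mu>: "\<mu> \<in> sublevel r" and \<nu>: "\<nu> \<in> sublevel r"
  shows "vmid \<mu> \<nu> \<in> sublevel r"
proof -
  have p: "\<mu> \<in> vfinite_pairing f" "\<nu> \<in> vfinite_pairing f" "weight_constrained a g \<mu>" "weight_constrained a g \<nu>"
    "functional_value \<mu> \<le> r" "functional_value \<nu> \<le> r"
    using \<mu> \<nu> by (auto simp: sublevel_def adm_iff)
  then have vf: "\<mu> \<in> vfinite_energy \<kappa> Ipos Ineg A" "\<nu> \<in> vfinite_energy \<kappa> Ipos Ineg A" by (auto simp: vfinite_pairing_def)
  then have vm: "\<mu> \<in> vmeasures Ipos Ineg A" "\<nu> \<in> vmeasures Ipos Ineg A" by (auto simp: vfinite_energy_def)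
  have "weight_constrained a g (vmid \<mu> \<nu>)"
    unfolding weight_constrained_def
  proof
    fix i assume i: "i \<in> I"
    have "(\<integral>\<^sup>+x\<in>A i. ennreal (g i x) \<partial>vmid \<mu> \<nu> i) =
        ennreal (1/2) * (\<integral>\<^sup>+x\<in>A i. ennreal (g i x) \<partial>\<mu> i) + ennreal (1/2) * (\<integral>\<^sup>+x\<in>A i. ennreal (g i x) \<partial>\<nu> i)"
      using nn_integral_mid[OF vm_radon[OF vm(1) i] vm_radon[OF vm(2) i] weight_measurable[OF i]] i by (simp add: vmid_def)
    also have "\<dots> = ennreal (a i)" using p(3,4) i unfolding weight_constrained_def by (simp only: half_half)
    finally show "(\<integral>\<^sup>+x\<in>A i. ennreal (g i x) \<partial>vmid \<mu> \<nu> i) = ennreal (a i)" .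
  qed
  moreover have "functional_value (vmid \<mu> \<nu>) \<le> (functional_value \<mu> + functional_value \<nu>) / 2"
    using vmid_energy(3)[OF vf] pairing_mid[OF p(1,2)] by (simp add: functional_value_def field_simps)
  ultimately show ?thesis using pairing_mid[OF p(1,2)] p(5,6) by (auto simp: sublevel_def adm_iff)
qed

text \<open>A net in the sublevel tending to \<open>\<mu>0\<close> need not have strongly Cauchy
  parts. Therefore a new filter of nearly \<open>vH\<close>-minimal elements close to
  \<open>\<mu>0\<close> is formed: it tends to \<open>\<mu>0\<close> because it refines the
  neighbourhoods, and it keeps the level \<open>r\<close> because all those neighbourhoods are taken
  in the sublevel.\<close>

lemma sublevel_limit:
  assumes \<mu>0: "\<mu>0 \<in> vmeasures Ipos Ineg A"
    and cl: "\<And>S (e::real). finite S \<Longrightarrow> S \<subseteq> I \<times> (Cc :: ('a \<Rightarrow> real) set) \<Longrightarrow> 0 < e \<Longrightarrow>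
      \<exists>\<mu>\<in>sublevel r. \<forall>(i, \<phi>)\<in>S. \<bar>integral\<^sup>L (\<mu> i) \<phi> - integral\<^sup>L (\<mu>0 i) \<phi>\<bar> < e"
  shows "\<mu>0 \<in> sublevel r"
proof -
  define Nb where "Nb = (\<lambda>(S :: (nat \<times> ('a \<Rightarrow> real)) set, e::real). {\<mu> \<in> sublevel r. \<forall>(i, \<phi>)\<in>S. \<bar>integral\<^sup>L (\<mu> i) \<phi> - integral\<^sup>L (\<mu>0 i) \<phi>\<bar> < e})"
  define Ix where "Ix = {(S, e). finite S \<and> S \<subseteq> I \<times> (Cc :: ('a \<Rightarrow> real) set) \<and> (0::real) < e}"
  obtain B where B: "\<And>\<mu>. \<mu> \<in> sublevel r \<Longrightarrow> vH \<mu> \<le> B" using sublevel_bound by blast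
  have vfl: "\<mu> \<in> vfinite_energy \<kappa> Ipos Ineg A" if "\<mu> \<in> sublevel r" for \<mu>
    using that by (auto simp: sublevel_def adm_iff vfinite_pairing_def)
  have vml: "\<mu> \<in> vmeasures Ipos Ineg A" if "\<mu> \<in> sublevel r" for \<mu> using vfl[OF that] by (simp add: vfinite_energy_def)
  have El: "part Ipos \<mu> \<in> E" "part Ineg \<mu> \<in> E" if "\<mu> \<in> sublevel r" for \<mu> using vfl[OF that] by (auto simp: vfinite_energy_iff)
  obtain F where F: "F \<noteq> bot" "\<And>S. S \<in> Nb ` Ix \<Longrightarrow> eventually (\<lambda>x. x \<in> S) F"
    "\<And>e. 0 < e \<Longrightarrow> \<exists>S\<in>Nb ` Ix. \<exists>P. eventually P F \<and> (\<forall>x. P x \<longrightarrow> x \<in> S) \<and>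
       (\<forall>x y. P x \<longrightarrow> P y \<longrightarrow> 2 * vH x + 2 * vH y - 4 * vH (vmid x y) < e)"
  proof (rule Cauchy_filter_of_convex_sets[of "Nb ` Ix" vmid vH B])
    have "({}, 1) \<in> Ix" by (simp add: Ix_def)
    then show "Nb ` Ix \<noteq> {}" by blast
    show "S \<noteq> {}" if S: "S \<in> Nb ` Ix" for S
    proof -
      obtain R e where "S = Nb (R, e)" "finite R" "R \<subseteq> I \<times> Cc" "0 < e" using S by (auto simp: Ix_def)
      then show ?thesis using cl[of R e] by (auto simp: Nb_def)
    qed
    show "\<exists>U\<in>Nb ` Ix. U \<subseteq> S \<inter> S'" if S: "S \<in> Nb ` Ix" "S' \<in> Nb ` Ix" for S S'
    proof -
      obtain R e R' e' where *: "S = Nb (R, e)" "finite R" "R \<subseteq> I \<times> Cc" "0 < e"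
        "S' = Nb (R', e')" "finite R'" "R' \<subseteq> I \<times> Cc" "0 < e'" using S by (auto simp: Ix_def)
      then have "(R \<union> R', min e e') \<in> Ix" by (auto simp: Ix_def)
      moreover have "Nb (R \<union> R', min e e') \<subseteq> S \<inter> S'" using * by (auto simp: Nb_def)
      ultimately show ?thesis by blast
    qed
    show "vmid x y \<in> S" if S: "S \<in> Nb ` Ix" "x \<in> S" "y \<in> S" for S x y
    proof -
      obtain R e where *: "S = Nb (R, e)" "R \<subseteq> I \<times> Cc" using S(1) by (auto simp: Ix_def)
      have xy: "x \<in> sublevel r" "y \<in> sublevel r" using S * by (auto simp: Nb_def)
      have "\<bar>integral\<^sup>L (vmid x y i) \<phi> - integral\<^sup>L (\<mu>0 i) \<phi>\<bar> < e" if p: "(i, \<phi>) \<in> R" for i \<phi>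
      proof -
        have i: "i \<in> I" "\<phi> \<in> Cc" using p *(2) by auto
        note rr = vm_radon[OF vml[OF xy(1)] i(1)] vm_radon[OF vml[OF xy(2)] i(1)]
        have "\<bar>integral\<^sup>L (x i) \<phi> - integral\<^sup>L (\<mu>0 i) \<phi>\<bar> < e" "\<bar>integral\<^sup>L (y i) \<phi> - integral\<^sup>L (\<mu>0 i) \<phi>\<bar> < e"
          using S(2,3) p by (auto simp: * Nb_def)
        moreover have "integral\<^sup>L (vmid x y i) \<phi> = (integral\<^sup>L (x i) \<phi> + integral\<^sup>L (y i) \<phi>) / 2"
          using integral_mid(2)[OF rr Cc_integrable[OF rr(1) i(2)] Cc_integrable[OF rr(2) i(2)]] i(1) by (simp add: vmid_def)
        ultimately show ?thesis by (simp only: abs_less_iff) argo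
      qed
      then show ?thesis using vmid_sublevel[OF xy] by (auto simp: * Nb_def)
    qed
    show "0 \<le> vH x \<and> vH x \<le> B" if "S \<in> Nb ` Ix" "x \<in> S" for S x
    proof -
      have "x \<in> sublevel r" using that by (auto simp: Nb_def)
      then show ?thesis using B El ee_nonneg by (simp add: vH_def)
    qed
  qed blast
  have Nblev: "S \<subseteq> sublevel r" if "S \<in> Nb ` Ix" for S using that by (auto simp: Nb_def)
  have evl: "eventually (\<lambda>\<mu>. \<mu> \<in> sublevel r) F"
  proof -
    have "({}, 1) \<in> Ix" by (simp add: Ix_def)
    then have "eventually (\<lambda>\<mu>. \<mu> \<in> Nb ({}, 1)) F" by (intro F(2)) blast
    then show ?thesis by eventually_elim (auto simp: Nb_def)
  qed
  have vconv: "((\<lambda>\<mu>. integral\<^sup>L (\<mu> i) \<phi>) \<longlongrightarrow> integral\<^sup>L (\<mu>0 i) \<phi>) F" if i: "i \<in> I" "\<phi> \<in> Cc" for i \<phi>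
  proof (rule tendstoI)
    fix e :: real assume "0 < e"
    then have "({(i, \<phi>)}, e) \<in> Ix" using i by (auto simp: Ix_def)
    then have "eventually (\<lambda>\<mu>. \<mu> \<in> Nb ({(i, \<phi>)}, e)) F" by (intro F(2)) blast
    then show "eventually (\<lambda>\<mu>. dist (integral\<^sup>L (\<mu> i) \<phi>) (integral\<^sup>L (\<mu>0 i) \<phi>) < e) F"
      by eventually_elim (auto simp: Nb_def dist_real_def)
  qed
  have conv: "part X \<mu>0 \<in> E \<and> ((\<lambda>\<mu>. dsq (part X \<mu>) (part X \<mu>0)) \<longlongrightarrow> 0) F"
    if X: "X = Ipos \<or> X = Ineg" for X
  proof -
    have XI: "X \<subseteq> I" using X by auto
    \<comment> \<open>Consistency is about filters of measures, so \<open>F\<close> is pushed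
      forward to each part separately.\<close>
    let ?G = "filtermap (part X) F"
    have Gb: "?G \<noteq> bot" using F(1) by (simp add: filtermap_bot_iff)
    have GE: "eventually (\<lambda>\<mu>. \<mu> \<in> E) ?G"
      unfolding eventually_filtermap using evl by eventually_elim (use El X in auto)
    have cau: "\<exists>P. eventually P ?G \<and> (\<forall>\<mu> \<nu>. P \<mu> \<longrightarrow> P \<nu> \<longrightarrow> dsq \<mu> \<nu> < e)" if e: "0 < e" for e
    proof -
      obtain S P where P: "S \<in> Nb ` Ix" "eventually P F" "\<And>x. P x \<Longrightarrow> x \<in> S"
        "\<And>x y. P x \<Longrightarrow> P y \<Longrightarrow> 2 * vH x + 2 * vH y - 4 * vH (vmid x y) < e" using F(3)[OF e] by blast
      have "dsq (part X x) (part X y) < e" if xy: "P x" "P y" for x y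
      proof -
        have l: "x \<in> sublevel r" "y \<in> sublevel r" using P(3) xy Nblev[OF P(1)] by blast+
        have "dsq (part Ipos x) (part Ipos y) + dsq (part Ineg x) (part Ineg y) < e"
          using P(4)[OF xy] vmid_energy(2)[OF vfl[OF l(1)] vfl[OF l(2)]] by simp
        then show ?thesis
          using X dsq_nonneg[OF El(1)[OF l(1)] El(1)[OF l(2)]] dsq_nonneg[OF El(2)[OF l(1)] El(2)[OF l(2)]] by auto
      qed
      moreover have "eventually (\<lambda>\<nu>. \<exists>x. P x \<and> \<nu> = part X x) ?G"
        unfolding eventually_filtermap using P(2) by eventually_elim blast
      ultimately show ?thesis by (intro exI[of _ "\<lambda>\<nu>. \<exists>x. P x \<and> \<nu> = part X x"]) blast
    qed
    have r0: "part X \<mu>0 \<in> radon" by (rule part_radon[OF \<mu>0 XI])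
    have lim: "((\<lambda>\<mu>. integral\<^sup>L \<mu> \<phi>) \<longlongrightarrow> integral\<^sup>L (part X \<mu>0) \<phi>) ?G" if \<phi>: "\<phi> \<in> Cc" for \<phi>
    proof -
      obtain K where K: "compact K" "\<And>x. x \<notin> K \<Longrightarrow> \<phi> x = 0" using CcE[OF \<phi>] by metis
      have "((\<lambda>\<mu>. \<Sum>i\<in>{i\<in>X. A i \<inter> K \<noteq> {}}. integral\<^sup>L (\<mu> i) \<phi>) \<longlongrightarrow> (\<Sum>i\<in>{i\<in>X. A i \<inter> K \<noteq> {}}. integral\<^sup>L (\<mu>0 i) \<phi>)) F"
        using XI \<phi> by (intro tendsto_sum vconv) auto
      moreover have "eventually (\<lambda>\<mu>. (\<Sum>i\<in>{i\<in>X. A i \<inter> K \<noteq> {}}. integral\<^sup>L (\<mu> i) \<phi>) = integral\<^sup>L (part X \<mu>) \<phi>) F"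
        using evl by eventually_elim (rule integral_part[OF vml XI \<phi> K(2) K(1), symmetric])
      ultimately have "((\<lambda>\<mu>. integral\<^sup>L (part X \<mu>) \<phi>) \<longlongrightarrow> integral\<^sup>L (part X \<mu>0) \<phi>) F"
        using integral_part[OF \<mu>0 XI \<phi> K(2) K(1)] by (simp add: tendsto_cong)
      then show ?thesis by (simp add: filterlim_filtermap)
    qed
    show ?thesis
      using consistentD(1)[OF Gb GE cau r0 lim] consistentD(2)[OF Gb GE cau r0 lim] by (simp add: filterlim_filtermap)
  qed
  have vf0: "\<mu>0 \<in> vfinite_energy \<kappa> Ipos Ineg A" unfolding vfinite_energy_iff using \<mu>0 conv by blast
  have lim: "limit_of F \<mu>0" unfolding limit_of_def using vconv conv by blast
  have E0: "part Ipos \<mu>0 \<in> E" "part Ineg \<mu>0 \<in> E" using conv by auto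
  have evE: "eventually (\<lambda>\<mu>. part Ipos \<mu> \<in> E) F" "eventually (\<lambda>\<mu>. part Ineg \<mu> \<in> E) F"
    using El by (auto intro: eventually_mono[OF evl])
  define d where "d = dsq (part Ipos \<mu>0) (part Ineg \<mu>0)"
  have dl: "((\<lambda>\<mu>. dsq (part Ipos \<mu>) (part Ineg \<mu>)) \<longlongrightarrow> d) F"
    unfolding d_def using conv by (intro tendsto_dsq evE E0) auto
  have evp: "eventually (\<lambda>\<mu>. \<mu> \<in> vfinite_pairing f) F" using evl by eventually_elim (simp add: sublevel_def adm_iff)
  \<comment> \<open>On the sublevel the pairing is at most half of \<open>r\<close> minus the
    energy, and the energy converges to \<open>d\<close> along \<open>F\<close>.\<close>
  have pl: "\<mu>0 \<in> vfinite_pairing f \<and> pairing_value f \<mu>0 \<le> (r - d) / 2 + e" if e: "0 < e" for e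
  proof (rule pairing_limit[OF F(1) evp vf0 lim])
    have "eventually (\<lambda>\<mu>. d - 2 * e < dsq (part Ipos \<mu>) (part Ineg \<mu>)) F"
      by (rule order_tendstoD(1)[OF dl]) (use e in simp)
    then show "eventually (\<lambda>\<mu>. pairing_value f \<mu> \<le> (r - d) / 2 + e) F" using evl
      by eventually_elim (simp add: sublevel_def functional_value_def field_simps)
  qed
  have "pairing_value f \<mu>0 \<le> (r - d) / 2" by (rule field_le_epsilon) (use pl in blast)
  then have gv: "functional_value \<mu>0 \<le> r" by (simp add: functional_value_def d_def field_simps)
  have "weight_constrained a g \<mu>0"
    unfolding weight_constrained_def
  proof
    fix i assume i: "i \<in> I"
    show "(\<integral>\<^sup>+x\<in>A i. ennreal (g i x) \<partial>\<mu>0 i) = ennreal (a i)"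
    proof (rule weight_limit[OF A_closed[OF i] g_cont[OF i] g_pos[OF i] F(1)])
      show "eventually (\<lambda>\<mu>. \<mu> i \<in> radon_on (A i)) F" using evl by eventually_elim (rule vm_radon_on[OF vml i])
      show "\<mu>0 i \<in> radon_on (A i)" by (rule vm_radon_on[OF \<mu>0 i])
      show "((\<lambda>t. integral\<^sup>L (t i) \<phi>) \<longlongrightarrow> integral\<^sup>L (\<mu>0 i) \<phi>) F" if "\<phi> \<in> Cc" for \<phi> by (rule vconv[OF i that])
      show "0 \<le> a i" using a_pos[OF i] by simp
      show "eventually (\<lambda>\<mu>. (\<integral>\<^sup>+x\<in>A i. ennreal (g i x) \<partial>\<mu> i) = ennreal (a i)) F"
        using evl by eventually_elim (use i in \<open>simp add: sublevel_def adm_iff weight_constrained_def\<close>)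
      fix e :: real assume e: "0 < e"
      obtain K where K: "compact K" "\<And>\<nu>. \<nu> \<in> radon_on (A i) \<Longrightarrow> \<nu> \<in> E \<Longrightarrow> (c = 0 \<Longrightarrow> ee \<nu> \<nu> \<le> B) \<Longrightarrow>
          (\<integral>\<^sup>+x\<in>A i - K. ennreal (g i x) \<partial>\<nu>) \<le> ennreal e"
        using tight[OF i e, of B] by blast
      have tail: "(\<integral>\<^sup>+x\<in>A i - K. ennreal (g i x) \<partial>\<mu> i) \<le> ennreal e" if \<mu>: "\<mu> \<in> sublevel r" for \<mu>
      proof (rule K(2))
        show "\<mu> i \<in> radon_on (A i)" by (rule vm_radon_on[OF vml[OF \<mu>] i])
        \<comment> \<open>A plate measure is dominated by its part; for \<open>c = 0\<close> the
          kernel is nonnegative and the energies compare as well. For \<open>c \<noteq> 0\<close>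
          the assumption \<open>tight\<close> imposes no bound on the energy.\<close>
        have X: "\<mu> i \<in> E \<and> (c = 0 \<longrightarrow> ee (\<mu> i) (\<mu> i) \<le> ee (part X \<mu>) (part X \<mu>))" if X: "i \<in> X" "X \<subseteq> I" "part X \<mu> \<in> E" for X
        proof -
          note s = single_E[OF vml[OF \<mu>] X]
          have "J (part X \<mu>) (part X \<mu>) < top" using X(3) by (simp add: E_def)
          then have "enn2real (J (\<mu> i) (\<mu> i)) \<le> enn2real (J (part X \<mu>) (part X \<mu>))" by (intro enn2real_mono s(2))
          then have "c = 0 \<longrightarrow> ee (\<mu> i) (\<mu> i) \<le> ee (part X \<mu>) (part X \<mu>)"
            unfolding ee_def by (intro impI, elim ssubst) simp
          then show ?thesis using s(1) by blast
        qed
        have vHge: "ee (part Ipos \<mu>) (part Ipos \<mu>) \<le> vH \<mu>" "ee (part Ineg \<mu>) (part Ineg \<mu>) \<le> vH \<mu>"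
          using ee_nonneg El[OF \<mu>] by (simp_all add: vH_def)
        have "\<mu> i \<in> E \<and> (c = 0 \<longrightarrow> ee (\<mu> i) (\<mu> i) \<le> vH \<mu>)"
        proof (cases "i \<in> Ipos")
          case True
          then show ?thesis using X[of Ipos] El[OF \<mu>] vHge by (meson order_trans sup_ge1)
        next
          case False
          then have "i \<in> Ineg" using i by blast
          then show ?thesis using X[of Ineg] El[OF \<mu>] vHge by (meson order_trans sup_ge2)
        qed
        then show "\<mu> i \<in> E" "c = 0 \<Longrightarrow> ee (\<mu> i) (\<mu> i) \<le> B" using B[OF \<mu>] by (blast intro: order_trans)+
      qed
      have "eventually (\<lambda>\<mu>. (\<integral>\<^sup>+x\<in>A i - K. ennreal (g i x) \<partial>\<mu> i) \<le> ennreal e) F"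
        by (rule eventually_mono[OF evl tail])
      then show "\<exists>K. compact K \<and> eventually (\<lambda>\<mu>. (\<integral>\<^sup>+x\<in>A i - K. ennreal (g i x) \<partial>\<mu> i) \<le> ennreal e) F"
        using K(1) by blast
    qed
  qed
  then show ?thesis using pl[of 1] gv by (simp add: sublevel_def adm_iff)
qed

section \<open>A vaguely compact set containing all admissible vector measures\<close>

text \<open>The quotient of \<open>\<bar>\<phi> x\<bar>\<close> and \<open>g i x\<close> is
  continuous on the compact set \<open>K \<inter> A i\<close>. So the constraint bounds integrals of
  test functions even when the infimum of \<open>g i\<close> over the plate is 0 and the masses are
  not bounded.\<close>

lemma weight_bound:
  assumes i: "i \<in> I" and \<phi>: "\<phi> \<in> Cc"
  shows "\<exists>C\<ge>0. \<forall>x\<in>A i. \<bar>\<phi> x\<bar> \<le> C * g i x"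
proof -
  obtain K where K: "compact K" "\<And>x. x \<notin> K \<Longrightarrow> \<phi> x = 0" using CcE[OF \<phi>] by metis
  have nz: "\<forall>x\<in>K \<inter> A i. g i x \<noteq> 0" using g_pos[OF i] by force
  have "continuous_on (K \<inter> A i) (\<lambda>x. \<bar>\<phi> x\<bar> / g i x)"
    using Cc_cont[OF \<phi>] g_cont[OF i] nz
    by (intro continuous_intros) (auto intro: continuous_on_subset)
  then have "compact ((\<lambda>x. \<bar>\<phi> x\<bar> / g i x) ` (K \<inter> A i))"
    using K(1) A_closed[OF i] by (intro compact_continuous_image compact_Int_closed)
  then obtain C0 where C0: "\<And>y. y \<in> (\<lambda>x. \<bar>\<phi> x\<bar> / g i x) ` (K \<inter> A i) \<Longrightarrow> norm y \<le> C0"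
    using compact_imp_bounded bounded_iff by metis
  show ?thesis
  proof (intro exI[of _ "max C0 0"] conjI ballI)
    fix x assume x: "x \<in> A i"
    show "\<bar>\<phi> x\<bar> \<le> max C0 0 * g i x"
    proof (cases "x \<in> K")
      case True
      then have "norm (\<bar>\<phi> x\<bar> / g i x) \<le> C0" using x by (intro C0 imageI) simp
      then have "\<bar>\<phi> x\<bar> / g i x \<le> C0" using abs_ge_self[of "\<bar>\<phi> x\<bar> / g i x"] by (simp only: real_norm_def)
      then have "\<bar>\<phi> x\<bar> / g i x \<le> max C0 0" by simp
      then show ?thesis using g_pos[OF i x] by (simp add: pos_divide_le_eq)
    qed (use K(2) g_pos[OF i x] in simp)
  qed simp
qed

text \<open>The chosen constant depends on the plate and the test function alone, so one compact set
  contains the i-th components of all admissible vector measures.\<close>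

definition test_bound :: "nat \<Rightarrow> ('a \<Rightarrow> real) \<Rightarrow> real" where
  "test_bound i \<phi> = (SOME C. 0 \<le> C \<and> (\<forall>x\<in>A i. \<bar>\<phi> x\<bar> \<le> C * g i x)) * a i"

definition bounded_plate :: "nat \<Rightarrow> 'a measure set" where
  "bounded_plate i = {\<nu> \<in> radon_on (A i). \<forall>\<phi>\<in>Cc. \<bar>integral\<^sup>L \<nu> \<phi>\<bar> \<le> test_bound i \<phi>}"

lemma adm_bounded_plate:
  assumes \<mu>: "\<mu> \<in> adm" and i: "i \<in> I"
  shows "\<mu> i \<in> bounded_plate i"
  unfolding bounded_plate_def
proof (intro CollectI conjI ballI)
  show on: "\<mu> i \<in> radon_on (A i)" by (rule vm_radon_on[OF admD_vmeasures[OF \<mu>] i])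
  fix \<phi> :: "'a \<Rightarrow> real" assume \<phi>: "\<phi> \<in> Cc"
  define C where "C = (SOME C. 0 \<le> C \<and> (\<forall>x\<in>A i. \<bar>\<phi> x\<bar> \<le> C * g i x))"
  have C: "0 \<le> C \<and> (\<forall>x\<in>A i. \<bar>\<phi> x\<bar> \<le> C * g i x)"
    unfolding C_def by (rule someI_ex) (use weight_bound[OF i \<phi>] in blast)
  have r: "\<mu> i \<in> radon" using on by (simp add: radon_on_def)
  have "ennreal \<bar>integral\<^sup>L (\<mu> i) \<phi>\<bar> \<le> ennreal (\<integral>x. \<bar>\<phi> x\<bar> \<partial>\<mu> i)" by (intro ennreal_leI integral_abs_bound)
  also have "\<dots> = (\<integral>\<^sup>+x. ennreal \<bar>\<phi> x\<bar> \<partial>\<mu> i)"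
    by (rule nn_integral_eq_integral[symmetric]) (use Cc_integrable[OF r Cc_abs[OF \<phi>]] in auto)
  also have "\<dots> \<le> (\<integral>\<^sup>+x. ennreal C * (ennreal (g i x) * indicator (A i) x) \<partial>\<mu> i)"
    using radon_on_AE[OF on A_closed[OF i]]
  proof (intro nn_integral_mono_AE, eventually_elim)
    case (elim x)
    then show ?case using C g_pos[OF i, of x] by (auto simp flip: ennreal_mult intro!: ennreal_leI)
  qed
  also have "\<dots> = ennreal C * (\<integral>\<^sup>+x\<in>A i. ennreal (g i x) \<partial>\<mu> i)"
    using weight_measurable[OF i] radon_measurable[OF r] by (intro nn_integral_cmult) blast
  also have "\<dots> = ennreal (C * a i)"
    using \<mu> i C a_pos[OF i] by (simp add: adm_iff weight_constrained_def ennreal_mult)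
  finally have "\<bar>integral\<^sup>L (\<mu> i) \<phi>\<bar> \<le> C * a i" using C a_pos[OF i] by (subst (asm) ennreal_le_iff) auto
  then show "\<bar>integral\<^sup>L (\<mu> i) \<phi>\<bar> \<le> test_bound i \<phi>" by (simp add: test_bound_def C_def)
qed

lemma continuous_map_vvague:
  assumes i: "i \<in> I" and \<phi>: "\<phi> \<in> Cc"
  shows "continuous_map (vvague Ipos Ineg A) euclideanreal (\<lambda>\<mu>. integral\<^sup>L (\<mu> i) \<phi>)"
proof -
  have 1: "continuous_map (vvague Ipos Ineg A) (subtopology vague (radon_on (A i))) (\<lambda>\<mu>. \<mu> i)"
    unfolding vvague_def using i by (rule continuous_map_product_projection)
  have "continuous_map (product_topology (\<lambda>_. euclideanreal) (Cc :: ('a \<Rightarrow> real) set)) euclideanreal (\<lambda>L. L \<phi>)"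
    by (rule continuous_map_product_projection[OF \<phi>])
  then have "continuous_map vague euclideanreal ((\<lambda>L. L \<phi>) \<circ> (\<lambda>\<mu>::'a measure. \<lambda>\<phi>\<in>Cc. integral\<^sup>L \<mu> \<phi>))"
    unfolding vague_def by (rule continuous_map_pullback)
  then have 2: "continuous_map vague euclideanreal (\<lambda>\<mu>::'a measure. integral\<^sup>L \<mu> \<phi>)" using \<phi> by (simp add: o_def)
  from continuous_map_compose[OF 1 continuous_map_from_subtopology[OF 2]] show ?thesis by (simp add: o_def)
qed

abbreviation bounded_family where "bounded_family \<equiv> \<Pi>\<^sub>E i\<in>I. bounded_plate i"

lemma compactin_bounded_family: "compactin (vvague Ipos Ineg A) bounded_family"
  unfolding vvague_def compactin_PiE
  using compactin_vague_bounded[OF A_closed] by (auto simp: compactin_subtopology bounded_plate_def)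

lemma sublevel_bounded_family: "sublevel r \<subseteq> bounded_family"
proof
  fix \<mu> assume "\<mu> \<in> sublevel r"
  then have \<mu>: "\<mu> \<in> adm" by (simp add: sublevel_def)
  show "\<mu> \<in> bounded_family"
  proof (rule PiE_I)
    show "\<mu> i \<in> bounded_plate i" if "i \<in> I" for i by (rule adm_bounded_plate[OF \<mu> that])
    show "\<mu> i = undefined" if "i \<notin> I" for i using admD_vmeasures[OF \<mu>] that unfolding vmeasures_def by (rule PiE_arb)
  qed
qed

lemma closedin_sublevel: "closedin (subtopology (vvague Ipos Ineg A) bounded_family) (sublevel r)"
proof -
  let ?X = "subtopology (vvague Ipos Ineg A) bounded_family"
  have ts: "topspace ?X = bounded_family" using compactin_subset_topspace[OF compactin_bounded_family] by auto
  have QQvm: "\<mu> \<in> vmeasures Ipos Ineg A" if "\<mu> \<in> bounded_family" for \<mu>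
    using that by (auto simp: vmeasures_def PiE_iff bounded_plate_def)
  have "?X closure_of sublevel r \<subseteq> sublevel r"
  proof
    fix \<mu>0 assume "\<mu>0 \<in> ?X closure_of sublevel r"
    then have \<mu>0: "\<mu>0 \<in> bounded_family" and cl: "\<And>U. openin ?X U \<Longrightarrow> \<mu>0 \<in> U \<Longrightarrow> \<exists>\<mu>\<in>sublevel r. \<mu> \<in> U"
      unfolding in_closure_of ts by auto
    show "\<mu>0 \<in> sublevel r"
    proof (rule sublevel_limit[OF QQvm[OF \<mu>0]])
      fix S :: "(nat \<times> ('a \<Rightarrow> real)) set" and e :: real assume S: "finite S" "S \<subseteq> I \<times> Cc" "0 < e"
      define U where "U = topspace ?X \<inter> (\<Inter>(i, \<phi>)\<in>S. {\<mu> \<in> topspace ?X. \<bar>integral\<^sup>L (\<mu> i) \<phi> - integral\<^sup>L (\<mu>0 i) \<phi>\<bar> < e})"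
      have "openin ?X {\<mu> \<in> topspace ?X. \<bar>integral\<^sup>L (\<mu> i) \<phi> - integral\<^sup>L (\<mu>0 i) \<phi>\<bar> < e}" if p: "(i, \<phi>) \<in> S" for i \<phi>
      proof -
        have i: "i \<in> I" "\<phi> \<in> Cc" using S(2) p by auto
        have "openin ?X {\<mu> \<in> topspace ?X. integral\<^sup>L (\<mu> i) \<phi> \<in> ball (integral\<^sup>L (\<mu>0 i) \<phi>) e}"
          by (rule openin_continuous_map_preimage[OF continuous_map_from_subtopology[OF continuous_map_vvague[OF i]]])
            (simp flip: open_openin)
        then show ?thesis by (simp add: ball_def dist_real_def abs_minus_commute)
      qed
      then have "openin ?X U"
        unfolding U_def by (subst Int_commute, intro openin_INT[OF S(1)]) (simp add: case_prod_beta)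
      moreover have "\<mu>0 \<in> U" using \<mu>0 S(3) unfolding U_def ts by auto
      ultimately obtain \<mu> where "\<mu> \<in> sublevel r" "\<mu> \<in> U" using cl by blast
      then show "\<exists>\<mu>\<in>sublevel r. \<forall>(i, \<phi>)\<in>S. \<bar>integral\<^sup>L (\<mu> i) \<phi> - integral\<^sup>L (\<mu>0 i) \<phi>\<bar> < e"
        by (auto simp: U_def)
    qed
  qed
  then show ?thesis using sublevel_bounded_family[of r] ts closure_of_subset_eq[of "sublevel r" ?X] by simp
qed

theorem equilibrium_nonempty_compact:
  assumes fin: "min_weighted_energy \<kappa> Ipos Ineg f A a g < \<infinity>"
  shows "equilibrium_measures \<kappa> Ipos Ineg f A a g \<noteq> {} \<and>
         compactin (vvague Ipos Ineg A) (equilibrium_measures \<kappa> Ipos Ineg f A a g)"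
proof -
  let ?X = "subtopology (vvague Ipos Ineg A) bounded_family"
  let ?Eq = "equilibrium_measures \<kappa> Ipos Ineg f A a g"
  define m where "m = min_weighted_energy \<kappa> Ipos Ineg f A a g"
  have ts: "topspace ?X = bounded_family" using compactin_subset_topspace[OF compactin_bounded_family] by auto
  have cX: "compactin ?X bounded_family" using compactin_bounded_family by (simp add: compactin_subtopology)
  \<comment> \<open>At this stage \<open>m\<close> could still be \<open>-\<infinity>\<close>, so
    the levels are the real numbers above \<open>m\<close>; on their intersection the functional
    equals \<open>m\<close>.\<close>
  let ?R = "{r. m < ereal r}"
  have mI: "m = (INF \<mu>\<in>adm. ereal (functional_value \<mu>))"
    unfolding m_def min_weighted_energy_def by (intro INF_cong refl weighted_energy_adm)
  have ne: "sublevel r \<noteq> {}" if mr: "m < ereal r" for r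
  proof -
    obtain \<mu> where "\<mu> \<in> adm" "ereal (functional_value \<mu>) < ereal r" using mr unfolding mI INF_less_iff by blast
    then show ?thesis by (auto simp: sublevel_def intro: less_imp_le)
  qed
  obtain r0 where r0: "m < ereal r0"
    using fin ereal_dense2[of m \<infinity>] unfolding m_def by auto
  have Eq: "?Eq = (\<Inter>r\<in>?R. sublevel r)"
  proof (intro equalityI subsetI)
    fix \<mu> assume "\<mu> \<in> ?Eq"
    then have \<mu>: "\<mu> \<in> adm" "weighted_energy \<kappa> Ipos Ineg f \<mu> = m" by (auto simp: equilibrium_measures_def m_def)
    then show "\<mu> \<in> (\<Inter>r\<in>?R. sublevel r)" using weighted_energy_adm[OF \<mu>(1)] by (auto simp: sublevel_def)
  next
    fix \<mu> assume \<mu>: "\<mu> \<in> (\<Inter>r\<in>?R. sublevel r)"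
    then have adm: "\<mu> \<in> adm" using r0 by (auto simp: sublevel_def)
    have "ereal (functional_value \<mu>) \<le> m"
    proof (rule ccontr)
      assume "\<not> ereal (functional_value \<mu>) \<le> m"
      then obtain z where z: "m < ereal z" "ereal z < ereal (functional_value \<mu>)" using ereal_dense2[of m "ereal (functional_value \<mu>)"] by (auto simp: not_le)
      then have "\<mu> \<in> sublevel z" using \<mu> by blast
      then show False using z(2) by (simp add: sublevel_def)
    qed
    moreover have "m \<le> ereal (functional_value \<mu>)" unfolding mI by (rule INF_lower[OF adm])
    ultimately show "\<mu> \<in> ?Eq"
      using adm weighted_energy_adm[OF adm] by (simp add: equilibrium_measures_def m_def)
  qed
  have fip: "(\<Inter>\<F>) \<inter> bounded_family \<noteq> {}" if \<F>: "finite \<F>" "\<F> \<subseteq> sublevel ` ?R" for \<F>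
  proof -
    obtain R where R: "R \<subseteq> ?R" "finite R" "\<F> = sublevel ` R" using \<F> by (metis finite_subset_image)
    \<comment> \<open>Sublevels increase with the level, so the smallest one decides; inserting
      \<open>r0\<close> covers the empty family.\<close>
    define z where "z = Min (insert r0 R)"
    have z: "z \<in> insert r0 R" unfolding z_def using R(2) by (intro Min_in) auto
    have zle: "z \<le> r" if "r \<in> R" for r unfolding z_def using R(2) that by (intro Min_le) auto
    have "m < ereal z" using z R(1) r0 by auto
    then obtain \<mu> where \<mu>: "\<mu> \<in> sublevel z" using ne by blast
    have "\<mu> \<in> sublevel r" if "r \<in> R" for r using \<mu> zle[OF that] by (auto simp: sublevel_def)
    then show ?thesis using \<mu> sublevel_bounded_family[of z] R(3) by blast
  qed
  have "bounded_family \<inter> \<Inter>(sublevel ` ?R) \<noteq> {}"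
  proof -
    have "\<forall>C\<in>sublevel ` ?R. closedin ?X C" using closedin_sublevel by blast
    moreover have "\<forall>\<F>. finite \<F> \<and> \<F> \<subseteq> sublevel ` ?R \<longrightarrow> bounded_family \<inter> \<Inter>\<F> \<noteq> {}" using fip by (simp add: Int_commute)
    ultimately show ?thesis
      by (intro cX[unfolded compactin_fip, THEN conjunct2, THEN spec, THEN mp] conjI)
  qed
  then have "?Eq \<noteq> {}" unfolding Eq by blast
  moreover have "closedin ?X ?Eq" unfolding Eq using r0 closedin_sublevel by (intro closedin_INT) auto
  moreover have "?Eq \<subseteq> bounded_family" unfolding Eq using sublevel_bounded_family r0 by blast
  ultimately show ?thesis
    using closed_compactin[OF cX, of ?Eq] by (simp add: compactin_subtopology)
qed

end

subsection \<open>The bounds on the mutual energy\<close>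

lemma nn_integral_count_space_le_finite:
  fixes h :: "nat \<Rightarrow> ennreal"
  assumes "\<And>Z. finite Z \<Longrightarrow> Z \<subseteq> X \<Longrightarrow> sum h Z \<le> S"
  shows "(\<integral>\<^sup>+i. h i \<partial>count_space X) \<le> S"
proof -
  have "(\<integral>\<^sup>+i. h i \<partial>count_space X) = (\<Sum>i. h i * indicator X i)"
    unfolding nn_integral_count_space_UNIV[of X] by (rule nn_integral_count_space_nat)
  also have "\<dots> \<le> S"
  proof -
    have "(\<Sum>i<n. h i * indicator X i) \<le> S" for n
    proof -
      have "(\<Sum>i<n. h i * indicator X i) = sum h ({..<n} \<inter> X)" by (simp add: sum.inter_restrict indicator_def if_distrib cong: if_cong)
      also have "\<dots> \<le> S" by (rule assms) auto
      finally show ?thesis .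
    qed
    then show ?thesis using ennreal_suminf_bound_add[of "\<lambda>i. h i * indicator X i" 0 S] by simp
  qed
  finally show ?thesis .
qed

lemma sum_le_nn_integral_count_space:
  fixes h :: "'i \<Rightarrow> ennreal"
  assumes "finite Z" "Z \<subseteq> X"
  shows "sum h Z \<le> (\<integral>\<^sup>+i. h i \<partial>count_space X)"
proof -
  have "sum h Z = (\<integral>\<^sup>+i. h i \<partial>count_space Z)" using assms(1) by (simp add: nn_integral_count_space_finite)
  also have "\<dots> \<le> (\<integral>\<^sup>+i. h i \<partial>count_space X)"
    unfolding nn_integral_count_space_UNIV[of Z] nn_integral_count_space_UNIV[of X]
    using assms(2) by (intro nn_integral_mono) (auto simp: indicator_def)
  finally show ?thesis .
qed

lemma ennreal_le_mult_inverse: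
  fixes m x y :: ennreal
  assumes "m * x \<le> y" "0 < m" "m < top"
  shows "x \<le> y * inverse m"
proof -
  obtain r where r: "m = ennreal r" "0 < r" using assms(2,3) by (cases m) (auto simp: ennreal_less_zero_iff)
  have "inverse m * m = 1" using r by (simp add: inverse_ennreal flip: ennreal_mult)
  then have "x = inverse m * (m * x)" by (simp flip: mult.assoc)
  also have "\<dots> \<le> inverse m * y" using assms(1) by (rule mult_left_mono) simp
  finally show ?thesis by (simp add: mult.commute)
qed

context condenser_space begin

text \<open>The constraint bounds the infimum of the weight times the mass. If that infimum is 0,
  its inverse is \<open>\<infinity>\<close> and \<open>0 < a i\<close> makes the right side
  infinite.\<close>

lemma mass_bound:
  assumes \<mu>: "\<mu> \<in> vmeasures Ipos Ineg A" and w: "weight_constrained a g \<mu>" and i: "i \<in> I" and a: "0 < a i"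
  shows "emeasure (\<mu> i) UNIV \<le> ennreal (a i) * inverse (INF x\<in>A i. ennreal (g i x))"
proof -
  let ?m = "INF x\<in>A i. ennreal (g i x)"
  note r = vm_radon[OF \<mu> i]
  obtain x0 where "x0 \<in> A i" using A_nonempty[OF i] by blast
  then have top: "?m < top" by (intro le_less_trans[OF INF_lower]) auto
  have "?m * emeasure (\<mu> i) UNIV = (\<integral>\<^sup>+x. ?m \<partial>\<mu> i)" using radon_space[OF r] by simp
  also have "\<dots> \<le> (\<integral>\<^sup>+x\<in>A i. ennreal (g i x) \<partial>\<mu> i)"
    using radon_on_AE[OF vm_radon_on[OF \<mu> i] A_closed[OF i]]
    by (intro nn_integral_mono_AE, eventually_elim) (auto intro: INF_lower)
  also have "\<dots> = ennreal (a i)" using w i by (simp add: weight_constrained_def)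
  finally have le: "?m * emeasure (\<mu> i) UNIV \<le> ennreal (a i)" .
  show ?thesis
  proof (cases "?m = 0")
    case True
    then show ?thesis unfolding True using a by (simp add: ennreal_mult_top)
  next
    case False
    then show ?thesis by (intro ennreal_le_mult_inverse le top) (simp add: zero_less_iff_neq_zero)
  qed
qed

lemma mass_part_bound:
  assumes \<mu>: "\<mu> \<in> vmeasures Ipos Ineg A" and w: "weight_constrained a g \<mu>" and X: "X \<subseteq> I"
    and a: "\<And>i. i \<in> I \<Longrightarrow> 0 < a i"
  shows "emeasure (part X \<mu>) UNIV \<le> (\<Sum>\<^sub>\<infinity>i\<in>I. ennreal (a i) * inverse (INF x\<in>A i. ennreal (g i x)))"
  unfolding mass_part[OF \<mu> X]
proof (rule nn_integral_count_space_le_finite)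
  fix Z assume Z: "finite Z" "Z \<subseteq> X"
  let ?h = "\<lambda>i. ennreal (a i) * inverse (INF x\<in>A i. ennreal (g i x))"
  have "(\<Sum>i\<in>Z. emeasure (\<mu> i) UNIV) \<le> sum ?h Z"
    using Z X by (intro sum_mono mass_bound[OF \<mu> w] a) auto
  also have "\<dots> \<le> (SUP F\<in>{F. finite F \<and> F \<subseteq> I}. sum ?h F)"
    using Z X by (intro SUP_upper) auto
  also have "\<dots> = (\<Sum>\<^sub>\<infinity>i\<in>I. ?h i)" by (rule nonneg_infsum_complete[symmetric]) simp
  finally show "(\<Sum>i\<in>Z. emeasure (\<mu> i) UNIV) \<le> (\<Sum>\<^sub>\<infinity>i\<in>I. ?h i)" .
qed

text \<open>A bound on the kernel over \<open>A\<^sup>+ \<times> A\<^sup>-\<close> times the masses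
  of the two parts, each at most \<open>S\<close>, bounds their mutual energy. Without negative
  plates the second part is the zero measure.\<close>

lemma cross_bound_of_bounded_kernel:
  assumes a: "\<And>i. i \<in> I \<Longrightarrow> 0 < a i"
    and h: "Ineg = {} \<or>
         (\<Sum>\<^sub>\<infinity>i\<in>I. ennreal (a i) * inverse (INF x\<in>A i. ennreal (g i x))) < \<infinity> \<and>
         (SUP (x, y)\<in>(\<Union>i\<in>Ipos. A i) \<times> (\<Union>j\<in>Ineg. A j). \<kappa> (x, y)) < \<infinity>"
  shows "\<exists>C. \<forall>\<mu>\<in>vfinite_energy \<kappa> Ipos Ineg A. weight_constrained a g \<mu> \<longrightarrow>
      ee (part Ipos \<mu>) (part Ineg \<mu>) \<le> C"
proof (cases "Ineg = {}")
  case True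
  have "ee (part Ipos \<mu>) (part Ineg \<mu>) \<le> 0" if "\<mu> \<in> vfinite_energy \<kappa> Ipos Ineg A" for \<mu>
  proof -
    have \<mu>: "\<mu> \<in> vmeasures Ipos Ineg A" using that by (simp add: vfinite_energy_def)
    have "J (part Ipos \<mu>) (part Ineg \<mu>) = 0"
      unfolding True using J_part_right[OF \<mu> empty_subsetI part_radon[OF \<mu>], of Ipos]
      by (simp add: nn_integral_count_space_finite)
    then show ?thesis using c_nonneg unfolding ee_def by simp
  qed
  then show ?thesis by blast
next
  case False
  define S where "S = (\<Sum>\<^sub>\<infinity>i\<in>I. ennreal (a i) * inverse (INF x\<in>A i. ennreal (g i x)))"
  have S: "S < \<infinity>" and sup: "(SUP (x, y)\<in>(\<Union>i\<in>Ipos. A i) \<times> (\<Union>j\<in>Ineg. A j). \<kappa> (x, y)) < \<infinity>"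
    using h False by (auto simp: S_def)
  obtain M where M: "(SUP (x, y)\<in>(\<Union>i\<in>Ipos. A i) \<times> (\<Union>j\<in>Ineg. A j). \<kappa> (x, y)) < ereal M"
    using ereal_dense2[OF sup] by auto
  define Q where "Q = ennreal (M + c)"
  have kpQ: "kp (x, y) \<le> Q" if "i \<in> Ipos" "j \<in> Ineg" "x \<in> A i" "y \<in> A j" for i j x y
  proof -
    have "(x, y) \<in> (\<Union>i\<in>Ipos. A i) \<times> (\<Union>j\<in>Ineg. A j)" using that by blast
    then have "\<kappa> (x, y) \<le> (SUP (x, y)\<in>(\<Union>i\<in>Ipos. A i) \<times> (\<Union>j\<in>Ineg. A j). \<kappa> (x, y))"
      by (rule SUP_upper2) simp
    then have "\<kappa> (x, y) \<le> ereal M" using M by simp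
    then have "\<kappa> (x, y) + ereal c \<le> ereal (M + c)" by (cases "\<kappa> (x, y)") auto
    then show ?thesis unfolding kp_def Q_def by (metis e2ennreal_ereal e2ennreal_mono)
  qed
  have "ee (part Ipos \<mu>) (part Ineg \<mu>) \<le> enn2real (Q * S * S)"
    if vf: "\<mu> \<in> vfinite_energy \<kappa> Ipos Ineg A" and w: "weight_constrained a g \<mu>" for \<mu>
  proof -
    have \<mu>: "\<mu> \<in> vmeasures Ipos Ineg A" using vf by (simp add: vfinite_energy_def)
    note rI = vm_radon[OF \<mu>]
    have sub: "Ipos \<subseteq> I" "Ineg \<subseteq> I" by auto
    have Jij: "J (\<mu> i) (\<mu> j) \<le> Q * emeasure (\<mu> i) UNIV * emeasure (\<mu> j) UNIV" if ij: "i \<in> Ipos" "j \<in> Ineg" for i j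
    proof -
      have iI: "i \<in> I" "j \<in> I" using ij by auto
      have "J (\<mu> i) (\<mu> j) \<le> (\<integral>\<^sup>+x. Q * emeasure (\<mu> j) UNIV \<partial>\<mu> i)"
        unfolding J_def
      proof (rule nn_integral_mono_AE)
        show "AE x in \<mu> i. (\<integral>\<^sup>+y. kp (x, y) \<partial>\<mu> j) \<le> Q * emeasure (\<mu> j) UNIV"
          using radon_on_AE[OF vm_radon_on[OF \<mu> iI(1)] A_closed[OF iI(1)]]
        proof eventually_elim
          case (elim x)
          have "(\<integral>\<^sup>+y. kp (x, y) \<partial>\<mu> j) \<le> (\<integral>\<^sup>+y. Q \<partial>\<mu> j)"
            using radon_on_AE[OF vm_radon_on[OF \<mu> iI(2)] A_closed[OF iI(2)]]
            by (intro nn_integral_mono_AE, eventually_elim) (rule kpQ[OF ij elim])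
          then show ?case using radon_space[OF rI[OF iI(2)]] by simp
        qed
      qed
      also have "\<dots> = Q * emeasure (\<mu> i) UNIV * emeasure (\<mu> j) UNIV"
        using radon_space[OF rI[OF iI(1)]] by (simp add: mult_ac)
      finally show ?thesis .
    qed
    have "J (part Ipos \<mu>) (part Ineg \<mu>) = (\<integral>\<^sup>+i. \<integral>\<^sup>+j. J (\<mu> i) (\<mu> j) \<partial>count_space Ineg \<partial>count_space Ipos)"
      unfolding J_part_left[OF \<mu> sub(1) part_radon[OF \<mu> sub(2)]]
      by (intro nn_integral_cong J_part_right[OF \<mu> sub(2)] rI) auto
    also have "\<dots> \<le> (\<integral>\<^sup>+i. \<integral>\<^sup>+j. Q * emeasure (\<mu> i) UNIV * emeasure (\<mu> j) UNIV \<partial>count_space Ineg \<partial>count_space Ipos)"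
      by (intro nn_integral_mono Jij) auto
    also have "\<dots> = Q * emeasure (part Ipos \<mu>) UNIV * emeasure (part Ineg \<mu>) UNIV"
      unfolding mass_part[OF \<mu> sub(1)] mass_part[OF \<mu> sub(2)] by (simp add: nn_integral_cmult nn_integral_multc)
    also have "\<dots> \<le> Q * S * S"
      unfolding S_def using sub by (intro mult_mono mass_part_bound[OF \<mu> w] a) auto
    finally have le: "J (part Ipos \<mu>) (part Ineg \<mu>) \<le> Q * S * S" .
    have "Q * S * S < top" using S by (simp add: Q_def ennreal_mult_less_top)
    then have "enn2real (J (part Ipos \<mu>) (part Ineg \<mu>)) \<le> enn2real (Q * S * S)" by (rule enn2real_mono[OF le])
    moreover have "0 \<le> c * measure (part Ipos \<mu>) UNIV * measure (part Ineg \<mu>) UNIV" using c_nonneg by simp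
    ultimately show ?thesis unfolding ee_def by linarith
  qed
  then show ?thesis by blast
qed

end

subsection \<open>External fields given by potentials\<close>

context condenser_space begin

definition pot :: "'a measure \<Rightarrow> 'a \<Rightarrow> ennreal" where
  "pot \<sigma> x = (\<integral>\<^sup>+y. kp (x, y) \<partial>\<sigma>)"

definition cst :: "'a measure \<Rightarrow> ennreal" where
  "cst \<sigma> = ennreal c * emeasure \<sigma> UNIV"

lemma cst_finite: "\<sigma> \<in> radon \<Longrightarrow> cst \<sigma> < top"
  using radon_finite[of \<sigma>] by (auto simp: cst_def ennreal_mult_less_top)

lemma potential_pot:
  assumes "\<sigma> \<in> radon"
  shows "potential \<kappa> \<sigma> x = enn2ereal (pot \<sigma> x) - enn2ereal (cst \<sigma>)"
proof -
  have "cst \<sigma> = ennreal (enn2real (cst \<sigma>))" using cst_finite[OF assms] by simp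
  moreover have "enn2real (cst \<sigma>) = c * measure \<sigma> UNIV"
    using c_nonneg by (simp add: cst_def enn2real_mult measure_def)
  ultimately have "enn2ereal (cst \<sigma>) = ereal (c * measure \<sigma> UNIV)"
    by (metis enn2ereal_ennreal enn2real_nonneg)
  then show ?thesis by (simp add: potential_eq[OF assms] pot_def)
qed

lemma nn_integral_pot:
  assumes "\<mu> \<in> radon" "\<sigma> \<in> radon"
  shows "pot \<sigma> \<in> borel_measurable \<mu>" "(\<integral>\<^sup>+x. pot \<sigma> x \<partial>\<mu>) = J \<mu> \<sigma>"
    "(\<integral>\<^sup>+x. pot \<sigma> x + cst \<tau> \<partial>\<mu>) = J \<mu> \<sigma> + Mc \<mu> \<tau>"
proof -
  have "(\<lambda>x. \<integral>\<^sup>+y. kp (x, y) \<partial>\<sigma>) \<in> borel_measurable \<mu>"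
    unfolding radon_measurable[OF assms(1)] by (rule potential_measurable[OF assms(2)])
  then show m: "pot \<sigma> \<in> borel_measurable \<mu>" by (simp add: pot_def[abs_def])
  show J: "(\<integral>\<^sup>+x. pot \<sigma> x \<partial>\<mu>) = J \<mu> \<sigma>" by (simp add: J_def pot_def)
  show "(\<integral>\<^sup>+x. pot \<sigma> x + cst \<tau> \<partial>\<mu>) = J \<mu> \<sigma> + Mc \<mu> \<tau>"
    using m by (simp add: nn_integral_add J radon_space[OF assms(1)] cst_def Mc_def mult_ac)
qed

text \<open>The conditions that \<open>weighted_problem\<close> imposes on the field, gathered in a
  predicate so that the three kinds of field can be treated before that locale is
  interpreted.\<close>

definition good_pairing :: "(nat \<Rightarrow> real) \<Rightarrow> (nat \<Rightarrow> 'a \<Rightarrow> real) \<Rightarrow> (nat \<Rightarrow> 'a \<Rightarrow> ereal) \<Rightarrow> bool" where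
  "good_pairing a g f \<longleftrightarrow>
    (\<forall>\<mu>\<in>vfinite_pairing f. \<forall>\<nu>\<in>vfinite_pairing f.
      vmid \<mu> \<nu> \<in> vfinite_pairing f \<and> pairing_value f (vmid \<mu> \<nu>) = (pairing_value f \<mu> + pairing_value f \<nu>) / 2) \<and>
    (\<forall>F \<mu>0 s. F \<noteq> bot \<longrightarrow> eventually (\<lambda>\<mu>. \<mu> \<in> vfinite_pairing f) F \<longrightarrow> \<mu>0 \<in> vfinite_energy \<kappa> Ipos Ineg A \<longrightarrow>
      limit_of F \<mu>0 \<longrightarrow> eventually (\<lambda>\<mu>. pairing_value f \<mu> \<le> s) F \<longrightarrow>
      \<mu>0 \<in> vfinite_pairing f \<and> pairing_value f \<mu>0 \<le> s) \<and>
    (\<forall>r. \<exists>r'. \<forall>\<mu>\<in>vfinite_pairing f. weight_constrained a g \<mu> \<longrightarrow>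
      dsq (part Ipos \<mu>) (part Ineg \<mu>) + 2 * pairing_value f \<mu> \<le> r \<longrightarrow> dsq (part Ipos \<mu>) (part Ineg \<mu>) \<le> r')"

text \<open>The formula is required only where both potentials are finite; elsewhere
  \<open>spotential\<close> and \<open>vpotential\<close> may follow a convention. The corrections
  \<open>cst\<close> are added crosswise so that both terms stay nonnegative.\<close>

definition potential_field :: "'a measure \<Rightarrow> 'a measure \<Rightarrow> (nat \<Rightarrow> 'a \<Rightarrow> ereal) \<Rightarrow> bool" where
  "potential_field \<sigma> \<tau> f \<longleftrightarrow> (\<forall>i\<in>I. \<forall>x. pot \<sigma> x < top \<longrightarrow> pot \<tau> x < top \<longrightarrow>
     f i x = ereal (sg i) * (enn2ereal (pot \<sigma> x + cst \<tau>) - enn2ereal (pot \<tau> x + cst \<sigma>)))"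

lemma vfinite_single_E:
  assumes "\<mu> \<in> vfinite_energy \<kappa> Ipos Ineg A" "i \<in> I"
  shows "\<mu> i \<in> E"
  using assms single_E(1)[of \<mu> i Ipos] single_E(1)[of \<mu> i Ineg] by (auto simp: vfinite_energy_iff)

text \<open>Each \<open>\<mu> i\<close> has finite mutual energy with \<open>\<sigma>\<close> and
  \<open>\<tau>\<close>, so the points where one of the potentials is infinite are null for it, and
  the pairing is determined by the formula of \<open>potential_field\<close>.\<close>

lemma vpairing_potential_field:
  assumes \<sigma>: "\<sigma> \<in> E" and \<tau>: "\<tau> \<in> E" and f: "potential_field \<sigma> \<tau> f" and vf: "\<mu> \<in> vfinite_energy \<kappa> Ipos Ineg A"
  shows "vpairing Ipos Ineg f \<mu> = ereal (ee (part Ipos \<mu>) \<sigma> - ee (part Ipos \<mu>) \<tau> - (ee (part Ineg \<mu>) \<sigma> - ee (part Ineg \<mu>) \<tau>))"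
proof -
  let ?P = "part Ipos \<mu>" and ?N = "part Ineg \<mu>"
  have \<mu>: "\<mu> \<in> vmeasures Ipos Ineg A" and E: "?P \<in> E" "?N \<in> E" using vf by (auto simp: vfinite_energy_iff)
  note r = E_radon[OF E(1)] E_radon[OF E(2)] and s = E_radon[OF \<sigma>] E_radon[OF \<tau>]
  define u where "u i = J (\<mu> i) \<sigma> + Mc (\<mu> i) \<tau>" for i
  define v where "v i = J (\<mu> i) \<tau> + Mc (\<mu> i) \<sigma>" for i
  define p where "p i = (if i \<in> Ipos then u i else v i)" for i
  define n where "n i = (if i \<in> Ipos then v i else u i)" for i
  have single: "ereal_integral (\<mu> i) (f i) = enn2ereal (p i) - enn2ereal (n i)" if i: "i \<in> I" for i
  proof -
    have Ei: "\<mu> i \<in> E" by (rule vfinite_single_E[OF vf i])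
    note ri = E_radon[OF Ei]
    note q = nn_integral_pot[OF ri s(1)] nn_integral_pot[OF ri s(2)]
    have JJ: "J (\<mu> i) \<sigma> < top" "J (\<mu> i) \<tau> < top" using energy_form(1)[OF Ei] \<sigma> \<tau> by auto
    have fin: "u i < top" "v i < top" using JJ Mc_finite[OF ri] s by (auto simp: u_def v_def)
    have AE: "AE x in \<mu> i. pot \<sigma> x \<noteq> top" "AE x in \<mu> i. pot \<tau> x \<noteq> top"
      using nn_integral_noteq_infinite[OF q(1)] nn_integral_noteq_infinite[OF q(4)] JJ q(2,5) by auto
    have m: "(\<lambda>x. pot \<sigma> x + cst \<tau>) \<in> borel_measurable (\<mu> i)" "(\<lambda>x. pot \<tau> x + cst \<sigma>) \<in> borel_measurable (\<mu> i)"
      using q(1,4) by auto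
    have iu: "(\<integral>\<^sup>+x. pot \<sigma> x + cst \<tau> \<partial>\<mu> i) = u i" and iv: "(\<integral>\<^sup>+x. pot \<tau> x + cst \<sigma> \<partial>\<mu> i) = v i"
      by (simp_all add: q u_def v_def)
    show ?thesis
    proof (cases "i \<in> Ipos")
      case True
      have "ereal_integral (\<mu> i) (f i) = enn2ereal (\<integral>\<^sup>+x. pot \<sigma> x + cst \<tau> \<partial>\<mu> i) - enn2ereal (\<integral>\<^sup>+x. pot \<tau> x + cst \<sigma> \<partial>\<mu> i)"
      proof (rule ereal_integral_diff[OF m])
        show "(\<integral>\<^sup>+x. pot \<tau> x + cst \<sigma> \<partial>\<mu> i) < \<infinity>" using fin by (simp add: iv)
        show "AE x in \<mu> i. f i x = enn2ereal (pot \<sigma> x + cst \<tau>) - enn2ereal (pot \<tau> x + cst \<sigma>)"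
          using AE
        proof eventually_elim
          case (elim x)
          then show ?case using f i sg_cases(1)[OF True] by (simp add: potential_field_def less_top)
        qed
      qed
      then show ?thesis using True by (simp add: iu iv p_def n_def)
    next
      case False
      then have iN: "i \<in> Ineg" using i by blast
      have "ereal_integral (\<mu> i) (f i) = enn2ereal (\<integral>\<^sup>+x. pot \<tau> x + cst \<sigma> \<partial>\<mu> i) - enn2ereal (\<integral>\<^sup>+x. pot \<sigma> x + cst \<tau> \<partial>\<mu> i)"
      proof (rule ereal_integral_diff[OF m(2,1)])
        show "(\<integral>\<^sup>+x. pot \<sigma> x + cst \<tau> \<partial>\<mu> i) < \<infinity>" using fin by (simp add: iu)
        show "AE x in \<mu> i. f i x = enn2ereal (pot \<tau> x + cst \<sigma>) - enn2ereal (pot \<sigma> x + cst \<tau>)"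
          using AE
        proof eventually_elim
          case (elim x)
          then have "f i x = ereal (-1) * (enn2ereal (pot \<sigma> x + cst \<tau>) - enn2ereal (pot \<tau> x + cst \<sigma>))"
            using f i sg_cases(2)[OF iN] by (simp add: potential_field_def less_top)
          moreover have "pot \<sigma> x + cst \<tau> < top" "pot \<tau> x + cst \<sigma> < top"
            using elim cst_finite s by (auto simp: less_top[symmetric])
          ultimately show ?case
            by (cases "pot \<sigma> x + cst \<tau>"; cases "pot \<tau> x + cst \<sigma>") (auto simp: enn2ereal_ennreal)
        qed
      qed
      then show ?thesis using False by (simp add: iu iv p_def n_def)
    qed
  qed
  have uv: "(\<integral>\<^sup>+i. u i \<partial>count_space X) = J (part X \<mu>) \<sigma> + Mc (part X \<mu>) \<tau>"
    "(\<integral>\<^sup>+i. v i \<partial>count_space X) = J (part X \<mu>) \<tau> + Mc (part X \<mu>) \<sigma>" if "X \<subseteq> I" for X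
    by (simp_all add: u_def v_def nn_integral_add J_part_left[OF \<mu> that] Mc_part_left[OF \<mu> that] s)
  have ip: "(\<integral>\<^sup>+i. p i \<partial>count_space I) = (J ?P \<sigma> + Mc ?P \<tau>) + (J ?N \<tau> + Mc ?N \<sigma>)"
  proof -
    have "(\<integral>\<^sup>+i. p i \<partial>count_space Ipos) = (\<integral>\<^sup>+i. u i \<partial>count_space Ipos)" "(\<integral>\<^sup>+i. p i \<partial>count_space Ineg) = (\<integral>\<^sup>+i. v i \<partial>count_space Ineg)"
      using I_disjoint by (auto intro!: nn_integral_cong simp: p_def)
    then show ?thesis by (simp add: nn_integral_count_space_disjoint_Un[OF I_disjoint] uv)
  qed
  have i_n: "(\<integral>\<^sup>+i. n i \<partial>count_space I) = (J ?P \<tau> + Mc ?P \<sigma>) + (J ?N \<sigma> + Mc ?N \<tau>)"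
  proof -
    have "(\<integral>\<^sup>+i. n i \<partial>count_space Ipos) = (\<integral>\<^sup>+i. v i \<partial>count_space Ipos)" "(\<integral>\<^sup>+i. n i \<partial>count_space Ineg) = (\<integral>\<^sup>+i. u i \<partial>count_space Ineg)"
      using I_disjoint by (auto intro!: nn_integral_cong simp: n_def)
    then show ?thesis by (simp add: nn_integral_count_space_disjoint_Un[OF I_disjoint] uv)
  qed
  have fJ: "J ?P \<sigma> < top" "J ?P \<tau> < top" "J ?N \<sigma> < top" "J ?N \<tau> < top"
    using energy_form(1) E \<sigma> \<tau> by auto
  have fM: "Mc ?P \<sigma> < top" "Mc ?P \<tau> < top" "Mc ?N \<sigma> < top" "Mc ?N \<tau> < top" using Mc_finite r s by auto
  have fn: "(\<integral>\<^sup>+i. n i \<partial>count_space I) < \<infinity>" using fJ fM by (simp add: i_n)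
  have "vpairing Ipos Ineg f \<mu> = enn2ereal (\<integral>\<^sup>+i. p i \<partial>count_space I) - enn2ereal (\<integral>\<^sup>+i. n i \<partial>count_space I)"
    unfolding vpairing_def ereal_series_def
    by (rule ereal_integral_diff[OF _ _ fn]) (use single in \<open>auto simp: AE_count_space\<close>)
  also have "\<dots> = ereal (ee ?P \<sigma> - ee ?P \<tau> - (ee ?N \<sigma> - ee ?N \<tau>))"
  proof -
    have 1: "enn2ereal z = ereal (enn2real z)" if "z < top" for z
      using that by (cases z) (auto simp: enn2ereal_ennreal)
    have "enn2real ((J ?P \<sigma> + Mc ?P \<tau>) + (J ?N \<tau> + Mc ?N \<sigma>)) = enn2real (J ?P \<sigma>) + enn2real (Mc ?P \<tau>) + (enn2real (J ?N \<tau>) + enn2real (Mc ?N \<sigma>))"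
      using fJ fM by (simp add: enn2real_plus)
    moreover have "enn2real ((J ?P \<tau> + Mc ?P \<sigma>) + (J ?N \<sigma> + Mc ?N \<tau>)) = enn2real (J ?P \<tau>) + enn2real (Mc ?P \<sigma>) + (enn2real (J ?N \<sigma>) + enn2real (Mc ?N \<tau>))"
      using fJ fM by (simp add: enn2real_plus)
    ultimately show ?thesis
      unfolding ip i_n using fJ fM by (simp add: 1 ee_Mc[OF r(1) s(1)] ee_Mc[OF r(1) s(2)] ee_Mc[OF r(2) s(1)] ee_Mc[OF r(2) s(2)])
  qed
  finally show ?thesis .
qed

lemma good_pairing_potential_field:
  assumes \<sigma>: "\<sigma> \<in> E" and \<tau>: "\<tau> \<in> E" and f: "potential_field \<sigma> \<tau> f"
  shows "good_pairing a g f"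
proof -
  define l where "l \<mu> = ee (part Ipos \<mu>) \<sigma> - ee (part Ipos \<mu>) \<tau> - (ee (part Ineg \<mu>) \<sigma> - ee (part Ineg \<mu>) \<tau>)" for \<mu>
  note vp = vpairing_potential_field[OF \<sigma> \<tau> f]
  have vfp: "vfinite_pairing f = vfinite_energy \<kappa> Ipos Ineg A" using vp by (auto simp: vfinite_pairing_def)
  have pv: "pairing_value f \<mu> = l \<mu>" if "\<mu> \<in> vfinite_energy \<kappa> Ipos Ineg A" for \<mu>
    using vp[OF that] by (simp add: pairing_value_def l_def)
  have parts: "part Ipos \<mu> \<in> E" "part Ineg \<mu> \<in> E" "\<mu> \<in> vmeasures Ipos Ineg A"
    if "\<mu> \<in> vfinite_energy \<kappa> Ipos Ineg A" for \<mu>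
    using that by (auto simp: vfinite_energy_iff)
  have "vmid \<mu> \<nu> \<in> vfinite_energy \<kappa> Ipos Ineg A \<and> l (vmid \<mu> \<nu>) = (l \<mu> + l \<nu>) / 2"
    if v: "\<mu> \<in> vfinite_energy \<kappa> Ipos Ineg A" "\<nu> \<in> vfinite_energy \<kappa> Ipos Ineg A" for \<mu> \<nu>
    using vmid_energy(1)[OF v] ee_mid(3)[OF parts(1)[OF v(1)] parts(1)[OF v(2)]] ee_mid(3)[OF parts(2)[OF v(1)] parts(2)[OF v(2)]]
      part_vmid[OF parts(3)[OF v(1)] parts(3)[OF v(2)]] \<sigma> \<tau>
    by (simp add: l_def field_simps)
  then have 1: "\<forall>\<mu>\<in>vfinite_pairing f. \<forall>\<nu>\<in>vfinite_pairing f.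
      vmid \<mu> \<nu> \<in> vfinite_pairing f \<and> pairing_value f (vmid \<mu> \<nu>) = (pairing_value f \<mu> + pairing_value f \<nu>) / 2"
    unfolding vfp using pv by simp
  have 2: "l \<mu>0 \<le> s" if F: "F \<noteq> bot" and ev: "eventually (\<lambda>\<mu>. \<mu> \<in> vfinite_energy \<kappa> Ipos Ineg A) F"
    and \<mu>0: "\<mu>0 \<in> vfinite_energy \<kappa> Ipos Ineg A" and lim: "limit_of F \<mu>0" and s: "eventually (\<lambda>\<mu>. pairing_value f \<mu> \<le> s) F" for F \<mu>0 s
  proof (rule tendsto_upperbound[OF _ _ F])
    have evE: "eventually (\<lambda>\<mu>. part Ipos \<mu> \<in> E) F" "eventually (\<lambda>\<mu>. part Ineg \<mu> \<in> E) F"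
      using parts by (auto intro: eventually_mono[OF ev])
    have d: "((\<lambda>\<mu>. dsq (part Ipos \<mu>) (part Ipos \<mu>0)) \<longlongrightarrow> 0) F" "((\<lambda>\<mu>. dsq (part Ineg \<mu>) (part Ineg \<mu>0)) \<longlongrightarrow> 0) F"
      using lim by (auto simp: limit_of_def)
    show "(l \<longlongrightarrow> l \<mu>0) F"
      unfolding l_def[abs_def] by (intro tendsto_diff tendsto_ee_left evE d parts[OF \<mu>0] \<sigma> \<tau>)
    show "eventually (\<lambda>\<mu>. l \<mu> \<le> s) F" using ev s by eventually_elim (simp add: pv)
  qed
  have 3: "dsq (part Ipos \<mu>) (part Ineg \<mu>) \<le> 2 * r + 4 * dsq \<sigma> \<tau>"
    if v: "\<mu> \<in> vfinite_energy \<kappa> Ipos Ineg A" and le: "dsq (part Ipos \<mu>) (part Ineg \<mu>) + 2 * l \<mu> \<le> r" for \<mu> r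
  proof -
    let ?P = "part Ipos \<mu>" and ?N = "part Ineg \<mu>"
    note E = parts[OF v]
    \<comment> \<open>Completing the square: \<open>\<parallel>?P - ?N + 2 (\<sigma> -
      \<tau>)\<parallel>\<^sup>2\<close> is nonnegative. Eliminating \<open>l \<mu>\<close> with the
      help of \<open>le\<close> gives the constant
      \<open>2 * r + 4 * dsq \<sigma> \<tau>\<close>.\<close>
    have "0 \<le> dsq (comb 1 ?P 2 \<sigma>) (comb 1 ?N 2 \<tau>)" by (intro dsq_nonneg E_comb E \<sigma> \<tau>)
    also have "\<dots> = dsq ?P ?N + 4 * l \<mu> + 4 * dsq \<sigma> \<tau>"
      using E \<sigma> \<tau> ee_symE[OF E(1) \<sigma>] ee_symE[OF E(1) \<tau>] ee_symE[OF E(2) \<sigma>] ee_symE[OF E(2) \<tau>]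
      by (simp add: dsq_def l_def ee_bilinear E_comb)
    finally show ?thesis using le by simp
  qed
  have lim': "\<forall>F \<mu>0 s. F \<noteq> bot \<longrightarrow> eventually (\<lambda>\<mu>. \<mu> \<in> vfinite_pairing f) F \<longrightarrow> \<mu>0 \<in> vfinite_energy \<kappa> Ipos Ineg A \<longrightarrow>
      limit_of F \<mu>0 \<longrightarrow> eventually (\<lambda>\<mu>. pairing_value f \<mu> \<le> s) F \<longrightarrow>
      \<mu>0 \<in> vfinite_pairing f \<and> pairing_value f \<mu>0 \<le> s"
    unfolding vfp using 2 pv by simp
  have bound': "\<forall>r. \<exists>r'. \<forall>\<mu>\<in>vfinite_pairing f. weight_constrained a g \<mu> \<longrightarrow>
      dsq (part Ipos \<mu>) (part Ineg \<mu>) + 2 * pairing_value f \<mu> \<le> r \<longrightarrow> dsq (part Ipos \<mu>) (part Ineg \<mu>) \<le> r'"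
    unfolding vfp using 3 pv by metis
  show ?thesis unfolding good_pairing_def by (intro conjI 1 lim' bound')
qed

lemma potential_field_spotential:
  assumes \<sigma>: "\<sigma> \<in> finite_energy \<kappa>" and f: "\<And>i. i \<in> I \<Longrightarrow> f i = (\<lambda>x. ereal (sg i) * spotential \<kappa> \<sigma> x)"
  shows "good_pairing a g f"
proof -
  obtain \<sigma>1 \<sigma>2 where s: "\<sigma> = (\<sigma>1, \<sigma>2)" by fastforce
  note E = finite_energy_E[OF \<sigma>[unfolded s]]
  note r = E_radon[OF E(1)] E_radon[OF E(2)]
  have "potential_field \<sigma>1 \<sigma>2 f"
    unfolding potential_field_def
  proof (intro ballI allI impI)
    fix i x assume i: "i \<in> I" and fin: "pot \<sigma>1 x < top" "pot \<sigma>2 x < top"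
    have "spotential \<kappa> \<sigma> x = enn2ereal (pot \<sigma>1 x + cst \<sigma>2) - enn2ereal (pot \<sigma>2 x + cst \<sigma>1)"
      using fin cst_finite[OF r(1)] cst_finite[OF r(2)]
      by (cases "pot \<sigma>1 x"; cases "pot \<sigma>2 x"; cases "cst \<sigma>1"; cases "cst \<sigma>2")
        (auto simp: s spotential_def potential_pot r enn2ereal_ennreal simp flip: ennreal_plus)
    then show "f i x = ereal (sg i) * (enn2ereal (pot \<sigma>1 x + cst \<sigma>2) - enn2ereal (pot \<sigma>2 x + cst \<sigma>1))"
      by (simp add: f[OF i])
  qed
  then show ?thesis by (rule good_pairing_potential_field[OF E])
qed

text \<open>Where finite, the i-th potential of \<open>\<nu>\<close> is \<open>sg i\<close> times
  the potential of the difference of its two parts; these take the roles of \<open>\<sigma>\<close>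
  and \<open>\<tau>\<close>.\<close>

lemma potential_field_vpotential:
  assumes \<nu>: "\<nu> \<in> vfinite_energy \<kappa> Ipos Ineg A" and f: "\<And>i. i \<in> I \<Longrightarrow> f i = vpotential \<kappa> Ipos Ineg \<nu> i"
  shows "good_pairing a g f"
proof -
  let ?P = "part Ipos \<nu>" and ?N = "part Ineg \<nu>"
  have vm: "\<nu> \<in> vmeasures Ipos Ineg A" and E: "?P \<in> E" "?N \<in> E" using \<nu> by (auto simp: vfinite_energy_iff)
  note r = E_radon[OF E(1)] E_radon[OF E(2)]
  have kx: "(\<lambda>y. kp (x, y)) \<in> borel_measurable borel" for x
    using open_vimage[OF kp_lsc, of "Pair x"] by (intro lsc_measurable) (simp add: vimage_def continuous_on_Pair)
  have pp: "(\<integral>\<^sup>+j. pot (\<nu> j) x \<partial>count_space X) = pot (part X \<nu>) x" if "X \<subseteq> I" for X x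
    unfolding pot_def by (rule nn_integral_part[OF vm that kx, symmetric])
  have cc: "(\<integral>\<^sup>+j. cst (\<nu> j) \<partial>count_space X) = cst (part X \<nu>)" if "X \<subseteq> I" for X
    unfolding cst_def mass_part[OF vm that] by (simp add: nn_integral_cmult)
  have "potential_field ?P ?N f"
    unfolding potential_field_def
  proof (intro ballI allI impI)
    fix i x assume i: "i \<in> I" and fin: "pot ?P x < top" "pot ?N x < top"
    define p where "p j = (if sg i = sg j then pot (\<nu> j) x else cst (\<nu> j))" for j
    define n where "n j = (if sg i = sg j then cst (\<nu> j) else pot (\<nu> j) x)" for j
    have pn: "(\<integral>\<^sup>+j. p j \<partial>count_space I) = (if i \<in> Ipos then pot ?P x + cst ?N else pot ?N x + cst ?P) \<and>
      (\<integral>\<^sup>+j. n j \<partial>count_space I) = (if i \<in> Ipos then pot ?N x + cst ?P else pot ?P x + cst ?N)"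
    proof (cases "i \<in> Ipos")
      case True
      have "(\<integral>\<^sup>+j. p j \<partial>count_space Ipos) = (\<integral>\<^sup>+j. pot (\<nu> j) x \<partial>count_space Ipos)" "(\<integral>\<^sup>+j. p j \<partial>count_space Ineg) = (\<integral>\<^sup>+j. cst (\<nu> j) \<partial>count_space Ineg)"
        "(\<integral>\<^sup>+j. n j \<partial>count_space Ipos) = (\<integral>\<^sup>+j. cst (\<nu> j) \<partial>count_space Ipos)" "(\<integral>\<^sup>+j. n j \<partial>count_space Ineg) = (\<integral>\<^sup>+j. pot (\<nu> j) x \<partial>count_space Ineg)"
        using True by (auto intro!: nn_integral_cong simp: p_def n_def sg_cases)
      then show ?thesis using True by (simp add: nn_integral_count_space_disjoint_Un[OF I_disjoint] pp cc add.commute)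
    next
      case False
      then have iN: "i \<in> Ineg" using i by blast
      have "(\<integral>\<^sup>+j. p j \<partial>count_space Ipos) = (\<integral>\<^sup>+j. cst (\<nu> j) \<partial>count_space Ipos)" "(\<integral>\<^sup>+j. p j \<partial>count_space Ineg) = (\<integral>\<^sup>+j. pot (\<nu> j) x \<partial>count_space Ineg)"
        "(\<integral>\<^sup>+j. n j \<partial>count_space Ipos) = (\<integral>\<^sup>+j. pot (\<nu> j) x \<partial>count_space Ipos)" "(\<integral>\<^sup>+j. n j \<partial>count_space Ineg) = (\<integral>\<^sup>+j. cst (\<nu> j) \<partial>count_space Ineg)"
        using iN by (auto intro!: nn_integral_cong simp: p_def n_def sg_cases)
      then show ?thesis using False by (simp add: nn_integral_count_space_disjoint_Un[OF I_disjoint] pp cc add.commute)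
    qed
    have fc: "cst ?P < top" "cst ?N < top" using cst_finite r by auto
    have eq: "f i x = enn2ereal (\<integral>\<^sup>+j. p j \<partial>count_space I) - enn2ereal (\<integral>\<^sup>+j. n j \<partial>count_space I)"
      unfolding f[OF i] vpotential_def ereal_series_def
    proof (rule ereal_integral_diff)
      show "(\<integral>\<^sup>+j. n j \<partial>count_space I) < \<infinity>" using pn fin fc by simp
      have "ereal (sg i * sg j) * potential \<kappa> (\<nu> j) x = enn2ereal (p j) - enn2ereal (n j)" if j: "j \<in> I" for j
      proof -
        note rj = vm_radon[OF vm j]
        have s: "sg i = sg j \<and> sg i * sg j = 1 \<or> sg i \<noteq> sg j \<and> sg i * sg j = -1" by (simp add: plate_sign_def)
        obtain m where m: "cst (\<nu> j) = ennreal m" "0 \<le> m" using cst_finite[OF rj] by (cases "cst (\<nu> j)") auto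
        show ?thesis using s m by (cases "pot (\<nu> j) x") (auto simp: p_def n_def potential_pot[OF rj] enn2ereal_ennreal)
      qed
      then show "AE j in count_space I. ereal (sg i * sg j) * potential \<kappa> (\<nu> j) x = enn2ereal (p j) - enn2ereal (n j)"
        by (simp add: AE_count_space)
    qed auto
    show "f i x = ereal (sg i) * (enn2ereal (pot ?P x + cst ?N) - enn2ereal (pot ?N x + cst ?P))"
    proof (cases "i \<in> Ipos")
      case False
      have "pot ?P x + cst ?N < top" "pot ?N x + cst ?P < top" using fin fc by auto
      then show ?thesis
        using False i eq pn sg_cases(2)[of i]
        by (cases "pot ?P x + cst ?N"; cases "pot ?N x + cst ?P") (auto simp: enn2ereal_ennreal)
    qed (simp add: eq pn sg_cases)
  qed
  then show ?thesis by (rule good_pairing_potential_field[OF E])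
qed

end

subsection \<open>Lower semicontinuous external fields\<close>

text \<open>A function that takes a negative value lies in \<open>lsc_class\<close> only over a
  compact space, which the open sets where it exceeds a given negative number exhaust.\<close>

lemma lsc_class_bounded_below:
  fixes \<psi> :: "'b::topological_space \<Rightarrow> ereal"
  assumes "\<psi> \<in> lsc_class"
  shows "\<exists>b\<ge>0. (b = 0 \<or> compact (UNIV :: 'b set)) \<and> (\<forall>x. - ereal b \<le> \<psi> x)"
proof (cases "\<forall>x. 0 \<le> \<psi> x")
  case True
  then show ?thesis by (intro exI[of _ 0]) (simp flip: zero_ereal_def)
next
  case False
  then have comp: "compact (UNIV :: 'b set)" and op: "\<And>t. open {x. t < \<psi> x}" and ninf: "\<And>x. \<psi> x \<noteq> -\<infinity>"
    using assms by (auto simp: lsc_class_def)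
  have "\<exists>b\<in>{0..}. \<forall>z\<in>UNIV. - ereal b < \<psi> z"
  proof (rule compact_directed[OF comp])
    show "\<exists>k\<in>{0..}. \<forall>z. - ereal i < \<psi> z \<or> - ereal j < \<psi> z \<longrightarrow> - ereal k < \<psi> z" if "i \<in> {0..}" "j \<in> {0..}" for i j
    proof (intro bexI[of _ "max i j"] allI impI)
      fix z assume "- ereal i < \<psi> z \<or> - ereal j < \<psi> z"
      moreover have "- ereal (max i j) \<le> - ereal i" "- ereal (max i j) \<le> - ereal j"
        unfolding ereal_minus_le_minus ereal_less_eq by simp_all
      ultimately show "- ereal (max i j) < \<psi> z" by (blast intro: le_less_trans)
    qed (use that in auto)
    show "\<exists>i\<in>{0..}. \<exists>N. open N \<and> x \<in> N \<and> (\<forall>z\<in>N. - ereal i < \<psi> z)" for x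
    proof -
      obtain q where q: "ereal q < \<psi> x" using ninf[of x] ereal_dense2[of "-\<infinity>" "\<psi> x"] by auto
      have "- ereal (max 0 (- q)) \<le> ereal q" unfolding uminus_ereal.simps ereal_less_eq by simp
      then have "- ereal (max 0 (- q)) < \<psi> x" using q by (rule le_less_trans)
      then show ?thesis
        by (intro bexI[of _ "max 0 (- q)"] exI[of _ "{z. - ereal (max 0 (- q)) < \<psi> z}"]) (auto simp: op)
    qed
  qed auto
  then show ?thesis using comp by (auto intro: less_imp_le)
qed

context condenser_space begin

text \<open>A common shift by \<open>b\<close> makes all \<open>f i\<close> nonnegative; the pairing
  is then a sum \<open>UU\<close> of nonnegative lower semicontinuous terms minus the correction
  \<open>BB\<close>. The latter is vaguely continuous and bounded under the constraints, because
  \<open>b \<noteq> 0\<close> occurs only on a compact space, where there are finitely many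
  plates.\<close>

lemma good_pairing_lsc:
  assumes f: "\<And>i. i \<in> I \<Longrightarrow> f i \<in> lsc_class"
    and a: "\<And>i. i \<in> I \<Longrightarrow> 0 < a i"
    and g: "\<And>i. i \<in> I \<Longrightarrow> continuous_on (A i) (g i)" "\<And>i x. i \<in> I \<Longrightarrow> x \<in> A i \<Longrightarrow> 0 < g i x"
  shows "good_pairing a g f"
proof -
  obtain b0 where b0: "\<And>i. i \<in> I \<Longrightarrow> 0 \<le> b0 i \<and> (b0 i = 0 \<or> compact (UNIV :: 'a set)) \<and> (\<forall>x. - ereal (b0 i) \<le> f i x)"
    using lsc_class_bounded_below[OF f] by metis
  \<comment> \<open>For infinite \<open>I\<close> this sum is 0 by convention, which is the right
    value: the space is then not compact, so all \<open>b0 i\<close> are 0.\<close>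
  define b where "b = sum b0 I"
  have b: "0 \<le> b" "b = 0 \<or> compact (UNIV :: 'a set)"
    using b0 unfolding b_def by (auto intro: sum_nonneg sum.neutral)
  have cfin: "finite I" if "compact (UNIV :: 'a set)"
  proof -
    have "{i \<in> I. A i \<inter> UNIV \<noteq> {}} = I" using A_nonempty by auto
    then show ?thesis using A_locally_finite[OF that] by simp
  qed
  have low: "- ereal b \<le> f i x" if i: "i \<in> I" for i x
  proof -
    have "b0 i \<le> b"
    proof (cases "finite I")
      case True
      then show ?thesis unfolding b_def using i b0 by (intro member_le_sum) auto
    next
      case False
      then have "b0 i = 0" using cfin b0[OF i] by blast
      then show ?thesis using b(1) by simp
    qed
    then have "- ereal b \<le> - ereal (b0 i)" by simp
    then show ?thesis using b0[OF i] by (blast intro: order_trans)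
  qed
  define u where "u i x = e2ennreal (f i x + ereal b)" for i x
  have ul: "open {x. t < u i x}" if "i \<in> I" for i t
    unfolding u_def by (rule lsc_shift[OF f[OF that] low[OF that]])
  have um: "u i \<in> borel_measurable borel" if "i \<in> I" for i by (rule lsc_measurable[OF ul[OF that]])
  define U where "U i \<mu> = (\<integral>\<^sup>+x. u i x \<partial>\<mu> i)" for i and \<mu> :: "nat \<Rightarrow> 'a measure"
  define B where "B i \<mu> = ennreal b * emeasure (\<mu> i) UNIV" for i and \<mu> :: "nat \<Rightarrow> 'a measure"
  define UU where "UU \<mu> = (\<integral>\<^sup>+i. U i \<mu> \<partial>count_space I)" for \<mu>
  define BB where "BB \<mu> = (\<integral>\<^sup>+i. B i \<mu> \<partial>count_space I)" for \<mu>
  have Bfin: "B i \<mu> < top" if "\<mu> \<in> vmeasures Ipos Ineg A" "i \<in> I" for \<mu> i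
    using b radon_compact[OF vm_radon[OF that], of UNIV] by (auto simp: B_def ennreal_mult_less_top)
  have BBsum: "BB \<mu> = (\<Sum>i\<in>I. B i \<mu>)" if "compact (UNIV :: 'a set)" for \<mu>
    using cfin[OF that] by (simp add: BB_def nn_integral_count_space_finite)
  have BBfin: "BB \<mu> < top" if "\<mu> \<in> vmeasures Ipos Ineg A" for \<mu>
  proof (cases "b = 0")
    case True
    then show ?thesis by (simp add: BB_def B_def)
  next
    case False
    then show ?thesis using b cfin Bfin[OF that] by (subst BBsum) (auto simp: ennreal_sum_less_top)
  qed
  have single: "ereal_integral (\<mu> i) (f i) = enn2ereal (U i \<mu>) - enn2ereal (B i \<mu>)"
    if \<mu>: "\<mu> \<in> vmeasures Ipos Ineg A" and i: "i \<in> I" for \<mu> i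
  proof -
    note r = vm_radon[OF \<mu> i]
    have pw: "f i x = enn2ereal (u i x) - enn2ereal (ennreal b)" for x
    proof -
      have "0 \<le> f i x + ereal b" using low[OF i, of x] by (cases "f i x") auto
      then show ?thesis using b(1) by (cases "f i x") (auto simp: u_def enn2ereal_e2ennreal enn2ereal_ennreal)
    qed
    have iB: "(\<integral>\<^sup>+x. ennreal b \<partial>\<mu> i) = B i \<mu>" by (simp add: B_def radon_space[OF r])
    have "ereal_integral (\<mu> i) (f i) = enn2ereal (\<integral>\<^sup>+x. u i x \<partial>\<mu> i) - enn2ereal (\<integral>\<^sup>+x. ennreal b \<partial>\<mu> i)"
      by (rule ereal_integral_diff) (use um[OF i] radon_measurable[OF r] Bfin[OF \<mu> i] iB pw in auto)
    then show ?thesis unfolding iB by (simp add: U_def)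
  qed
  have vp: "vpairing Ipos Ineg f \<mu> = enn2ereal (UU \<mu>) - enn2ereal (BB \<mu>)" if \<mu>: "\<mu> \<in> vmeasures Ipos Ineg A" for \<mu>
    unfolding vpairing_def ereal_series_def UU_def BB_def
    by (rule ereal_integral_diff) (use single[OF \<mu>] BBfin[OF \<mu>] in \<open>auto simp: AE_count_space BB_def\<close>)
  define bb where "bb \<mu> = enn2real (BB \<mu>)" for \<mu>
  have vfp: "\<mu> \<in> vfinite_pairing f \<longleftrightarrow> UU \<mu> < top"
    and pv: "UU \<mu> < top \<Longrightarrow> pairing_value f \<mu> = enn2real (UU \<mu>) - bb \<mu>"
    if v: "\<mu> \<in> vfinite_energy \<kappa> Ipos Ineg A" for \<mu>
  proof -
    have \<mu>: "\<mu> \<in> vmeasures Ipos Ineg A" using v by (simp add: vfinite_energy_def)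
    obtain m where "BB \<mu> = ennreal m" "0 \<le> m" using BBfin[OF \<mu>] by (cases "BB \<mu>") auto
    then show "\<mu> \<in> vfinite_pairing f \<longleftrightarrow> UU \<mu> < top" "UU \<mu> < top \<Longrightarrow> pairing_value f \<mu> = enn2real (UU \<mu>) - bb \<mu>"
      using v by (cases "UU \<mu>"; simp add: vfinite_pairing_def pairing_value_def vp[OF \<mu>] enn2ereal_ennreal bb_def)+
  qed
  have vfpE: "\<mu> \<in> vfinite_energy \<kappa> Ipos Ineg A" "\<mu> \<in> vmeasures Ipos Ineg A" "UU \<mu> < top"
    "pairing_value f \<mu> = enn2real (UU \<mu>) - bb \<mu>" if "\<mu> \<in> vfinite_pairing f" for \<mu>
  proof -
    show v: "\<mu> \<in> vfinite_energy \<kappa> Ipos Ineg A" using that by (simp add: vfinite_pairing_def)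
    then show "\<mu> \<in> vmeasures Ipos Ineg A" by (simp add: vfinite_energy_def)
    show "UU \<mu> < top" using vfp[OF v] that by simp
    then show "pairing_value f \<mu> = enn2real (UU \<mu>) - bb \<mu>" by (rule pv[OF v])
  qed
  have mid: "vmid \<mu> \<nu> \<in> vfinite_pairing f \<and> pairing_value f (vmid \<mu> \<nu>) = (pairing_value f \<mu> + pairing_value f \<nu>) / 2"
    if \<mu>: "\<mu> \<in> vfinite_pairing f" and \<nu>: "\<nu> \<in> vfinite_pairing f" for \<mu> \<nu>
  proof -
    note m = vfpE[OF \<mu>] and n = vfpE[OF \<nu>]
    have UBi: "U i (vmid \<mu> \<nu>) = ennreal (1/2) * U i \<mu> + ennreal (1/2) * U i \<nu>"
      "B i (vmid \<mu> \<nu>) = ennreal (1/2) * B i \<mu> + ennreal (1/2) * B i \<nu>" if i: "i \<in> I" for i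
      using nn_integral_mid[OF vm_radon[OF m(2) i] vm_radon[OF n(2) i] um[OF i]]
        emeasure_mid[OF vm_radon[OF m(2) i] vm_radon[OF n(2) i], of UNIV] i
      by (simp_all add: U_def B_def vmid_def distrib_left mult_ac)
    have half: "(\<integral>\<^sup>+i. h i \<partial>count_space I) = ennreal (1/2) * (\<integral>\<^sup>+i. p i \<partial>count_space I) + ennreal (1/2) * (\<integral>\<^sup>+i. q i \<partial>count_space I)"
      if "\<And>i. i \<in> I \<Longrightarrow> h i = ennreal (1/2) * p i + ennreal (1/2) * q i" for h p q
    proof -
      have "(\<integral>\<^sup>+i. h i \<partial>count_space I) = (\<integral>\<^sup>+i. ennreal (1/2) * p i + ennreal (1/2) * q i \<partial>count_space I)"
        by (intro nn_integral_cong) (simp only: that space_count_space)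
      then show ?thesis by (simp add: nn_integral_add nn_integral_cmult)
    qed
    have UB: "UU (vmid \<mu> \<nu>) = ennreal (1/2) * UU \<mu> + ennreal (1/2) * UU \<nu>"
      "BB (vmid \<mu> \<nu>) = ennreal (1/2) * BB \<mu> + ennreal (1/2) * BB \<nu>"
      unfolding UU_def BB_def by (intro half UBi; assumption)+
    have fin: "UU (vmid \<mu> \<nu>) < top" unfolding UB using m(3) n(3) by (simp add: ennreal_mult_less_top inverse_2_less_top)
    have v: "vmid \<mu> \<nu> \<in> vfinite_energy \<kappa> Ipos Ineg A" by (rule vmid_energy(1)[OF m(1) n(1)])
    have "enn2real (ennreal (1/2)) = 1/2" by (rule enn2real_ennreal) simp
    then have i2: "enn2real (inverse 2) = 1/2" by simp
    have "enn2real (UU (vmid \<mu> \<nu>)) = (enn2real (UU \<mu>) + enn2real (UU \<nu>)) / 2" "bb (vmid \<mu> \<nu>) = (bb \<mu> + bb \<nu>) / 2"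
      unfolding UB bb_def using m(3) n(3) BBfin[OF m(2)] BBfin[OF n(2)]
      by (simp_all add: enn2real_plus enn2real_mult ennreal_mult_less_top inverse_2_less_top i2)
    then show ?thesis using vfp[OF v] fin pv[OF v fin] m(4) n(4) by (simp add: field_simps)
  qed
  have lim: "\<mu>0 \<in> vfinite_pairing f \<and> pairing_value f \<mu>0 \<le> s"
    if F: "F \<noteq> bot" and ev: "eventually (\<lambda>\<mu>. \<mu> \<in> vfinite_pairing f) F" and v0: "\<mu>0 \<in> vfinite_energy \<kappa> Ipos Ineg A"
      and lim: "limit_of F \<mu>0" and s: "eventually (\<lambda>\<mu>. pairing_value f \<mu> \<le> s) F" for F \<mu>0 s
  proof -
    have m0: "\<mu>0 \<in> vmeasures Ipos Ineg A" using v0 by (simp add: vfinite_energy_def)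
    have vc: "((\<lambda>\<mu>. integral\<^sup>L (\<mu> i) \<phi>) \<longlongrightarrow> integral\<^sup>L (\<mu>0 i) \<phi>) F" if "i \<in> I" "\<phi> \<in> Cc" for i \<phi>
      using lim that unfolding limit_of_def by blast
    have bblim: "(bb \<longlongrightarrow> bb \<mu>0) F"
    proof (cases "b = 0")
      case True
      then have "bb = (\<lambda>\<mu>. 0)" by (simp add: bb_def BB_def B_def fun_eq_iff)
      then show ?thesis by simp
    next
      case False
      then have comp: "compact (UNIV :: 'a set)" using b(2) by simp
      \<comment> \<open>On a compact space the constant 1 is a test function, so vague convergence
        includes convergence of the total masses.\<close>
      have one: "(\<lambda>x::'a. 1 :: real) \<in> Cc" by (rule CcI[OF _ comp]) auto
      have eq: "(\<Sum>i\<in>I. b * integral\<^sup>L (\<mu> i) (\<lambda>x. 1)) = bb \<mu>" if \<mu>: "\<mu> \<in> vmeasures Ipos Ineg A" for \<mu>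
      proof -
        have "bb \<mu> = (\<Sum>i\<in>I. enn2real (B i \<mu>))"
          unfolding bb_def BBsum[OF comp] using Bfin[OF \<mu>] by (subst enn2real_sum) (auto simp: less_top)
        also have "\<dots> = (\<Sum>i\<in>I. b * integral\<^sup>L (\<mu> i) (\<lambda>x. 1))"
          using b(1) radon_space[OF vm_radon[OF \<mu>]] by (intro sum.cong) (auto simp: B_def enn2real_mult measure_def)
        finally show ?thesis by (rule sym)
      qed
      have "((\<lambda>\<mu>. \<Sum>i\<in>I. b * integral\<^sup>L (\<mu> i) (\<lambda>x. 1)) \<longlongrightarrow> (\<Sum>i\<in>I. b * integral\<^sup>L (\<mu>0 i) (\<lambda>x. 1))) F"
        by (intro tendsto_sum tendsto_mult tendsto_const vc one)
      then have "((\<lambda>\<mu>. \<Sum>i\<in>I. b * integral\<^sup>L (\<mu> i) (\<lambda>x. 1)) \<longlongrightarrow> bb \<mu>0) F" unfolding eq[OF m0] .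
      then show ?thesis
        by (rule Lim_transform_eventually) (use eq vfpE(2) in \<open>auto intro: eventually_mono[OF ev]\<close>)
    qed
    have "UU \<mu>0 \<le> ennreal (s + bb \<mu>0) \<and> 0 \<le> s + bb \<mu>0"
    proof -
      \<comment> \<open>Semicontinuity of a possibly infinite sum: it is tested on finitely many
        plates with one test function below each \<open>u i\<close>, and the suprema are taken
        afterwards.\<close>
      have key: "(\<Sum>i\<in>Z. integral\<^sup>L (\<mu>0 i) (k i)) \<le> s + bb \<mu>0"
        if Z: "finite Z" "Z \<subseteq> I" and k: "\<forall>i\<in>Z. k i \<in> {\<phi>\<in>Cc. \<forall>x. 0 \<le> \<phi> x \<and> ennreal (\<phi> x) \<le> u i x}" for Z k
      proof (rule tendsto_le[OF F])
        show "((\<lambda>\<mu>. s + bb \<mu>) \<longlongrightarrow> s + bb \<mu>0) F" by (intro tendsto_add tendsto_const bblim)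
        show "((\<lambda>\<mu>. \<Sum>i\<in>Z. integral\<^sup>L (\<mu> i) (k i)) \<longlongrightarrow> (\<Sum>i\<in>Z. integral\<^sup>L (\<mu>0 i) (k i))) F"
          using Z k by (intro tendsto_sum vc) auto
        show "eventually (\<lambda>\<mu>. (\<Sum>i\<in>Z. integral\<^sup>L (\<mu> i) (k i)) \<le> s + bb \<mu>) F"
          using ev s
        proof eventually_elim
          case (elim \<mu>)
          note m = vfpE[OF elim(1)]
          have "ennreal (\<Sum>i\<in>Z. integral\<^sup>L (\<mu> i) (k i)) = (\<Sum>i\<in>Z. ennreal (integral\<^sup>L (\<mu> i) (k i)))"
            using k by (intro sum_ennreal[symmetric] integral_nonneg_AE) auto
          also have "\<dots> \<le> (\<Sum>i\<in>Z. U i \<mu>)"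
          proof (rule sum_mono)
            fix i assume i: "i \<in> Z"
            have "ennreal (integral\<^sup>L (\<mu> i) (k i)) = (\<integral>\<^sup>+x. ennreal (k i x) \<partial>\<mu> i)"
              using i k Z(2) by (intro nn_integral_eq_integral[symmetric] Cc_integrable vm_radon[OF m(2)]) auto
            also have "\<dots> \<le> U i \<mu>" unfolding U_def using i k by (intro nn_integral_mono) auto
            finally show "ennreal (integral\<^sup>L (\<mu> i) (k i)) \<le> U i \<mu>" .
          qed
          also have "\<dots> \<le> UU \<mu>" unfolding UU_def by (rule sum_le_nn_integral_count_space[OF Z])
          finally have "enn2real (ennreal (\<Sum>i\<in>Z. integral\<^sup>L (\<mu> i) (k i))) \<le> enn2real (UU \<mu>)" using m(3) by (intro enn2real_mono)
          moreover have "0 \<le> (\<Sum>i\<in>Z. integral\<^sup>L (\<mu> i) (k i))" using k by (intro sum_nonneg integral_nonneg_AE) auto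
          ultimately show ?case using m(4) elim(2) by simp
        qed
      qed
      \<comment> \<open>The empty family of plates yields nonnegativity, so that
        \<open>ennreal\<close> does not truncate.\<close>
      have nn: "0 \<le> s + bb \<mu>0" using key[of "{}" undefined] by simp
      have "UU \<mu>0 \<le> ennreal (s + bb \<mu>0)"
        unfolding UU_def
      proof (rule nn_integral_count_space_le_finite)
        fix Z assume Z: "finite Z" "Z \<subseteq> I"
        have "(\<Sum>i\<in>Z. U i \<mu>0) = 0 + (\<Sum>i\<in>Z. SUP \<phi>\<in>{\<phi>\<in>Cc. \<forall>x. 0 \<le> \<phi> x \<and> ennreal (\<phi> x) \<le> u i x}. \<integral>\<^sup>+x. ennreal (\<phi> x) \<partial>\<mu>0 i)"
          unfolding U_def add_0 using Z(2) by (intro sum.cong refl nn_integral_lsc_Cc vm_radon[OF m0] ul) auto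
        also have "\<dots> \<le> ennreal (s + bb \<mu>0)"
        proof (rule sum_SUP_le_ennreal[OF Z(1)])
          show "{\<phi>\<in>Cc. \<forall>x. 0 \<le> \<phi> x \<and> ennreal (\<phi> x) \<le> u i x} \<noteq> {}" for i
          proof -
            have "(\<lambda>x. 0) \<in> {\<phi>\<in>Cc. \<forall>x. 0 \<le> \<phi> x \<and> ennreal (\<phi> x) \<le> u i x}" using Cc_zero by simp
            then show ?thesis by blast
          qed
          fix k assume k: "\<forall>i\<in>Z. k i \<in> {\<phi>\<in>Cc. \<forall>x. 0 \<le> \<phi> x \<and> ennreal (\<phi> x) \<le> u i x}"
          have "(\<Sum>i\<in>Z. \<integral>\<^sup>+x. ennreal (k i x) \<partial>\<mu>0 i) = (\<Sum>i\<in>Z. ennreal (integral\<^sup>L (\<mu>0 i) (k i)))"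
            using k Z(2) by (intro sum.cong refl nn_integral_eq_integral Cc_integrable vm_radon[OF m0]) auto
          also have "\<dots> = ennreal (\<Sum>i\<in>Z. integral\<^sup>L (\<mu>0 i) (k i))"
            using k by (intro sum_ennreal integral_nonneg_AE) auto
          also have "\<dots> \<le> ennreal (s + bb \<mu>0)" by (intro ennreal_leI key[OF Z k])
          finally show "0 + (\<Sum>i\<in>Z. \<integral>\<^sup>+x. ennreal (k i x) \<partial>\<mu>0 i) \<le> ennreal (s + bb \<mu>0)" by simp
        qed
        finally show "(\<Sum>i\<in>Z. U i \<mu>0) \<le> ennreal (s + bb \<mu>0)" .
      qed
      then show ?thesis using nn by simp
    qed
    then have le: "UU \<mu>0 \<le> ennreal (s + bb \<mu>0)" and nn: "0 \<le> s + bb \<mu>0" by auto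
    have fin: "UU \<mu>0 < top" using le by (rule le_less_trans) simp
    have "enn2real (UU \<mu>0) \<le> enn2real (ennreal (s + bb \<mu>0))" by (intro enn2real_mono le) simp
    then show ?thesis using vfp[OF v0] fin pv[OF v0 fin] nn by simp
  qed
  \<comment> \<open>On a compact space each \<open>g i\<close> attains a positive minimum on its
    plate, so the constraint bounds the masses.\<close>
  have "\<exists>C. \<forall>\<mu>\<in>vmeasures Ipos Ineg A. weight_constrained a g \<mu> \<longrightarrow> bb \<mu> \<le> C"
  proof (cases "b = 0")
    case True
    then show ?thesis by (intro exI[of _ 0]) (simp add: bb_def BB_def B_def)
  next
    case False
    then have comp: "compact (UNIV :: 'a set)" using b(2) by simp
    define C where "C = (\<Sum>i\<in>I. ennreal b * (ennreal (a i) * inverse (INF x\<in>A i. ennreal (g i x))))"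
    have "C < top"
      unfolding C_def
    proof (subst ennreal_sum_less_top[OF cfin[OF comp]], intro ballI)
      fix i assume i: "i \<in> I"
      have "compact (A i)" using compact_Int_closed[OF comp A_closed[OF i]] by simp
      then obtain x0 where x0: "x0 \<in> A i" "\<And>x. x \<in> A i \<Longrightarrow> g i x0 \<le> g i x"
        using continuous_attains_inf[OF _ A_nonempty[OF i] g(1)[OF i]] by blast
      have "(INF x\<in>A i. ennreal (g i x)) = ennreal (g i x0)"
        using x0 by (intro antisym INF_lower INF_greatest ennreal_leI) auto
      then show "ennreal b * (ennreal (a i) * inverse (INF x\<in>A i. ennreal (g i x))) < top"
        using g(2)[OF i x0(1)] by (simp add: inverse_ennreal ennreal_mult_less_top)
    qed
    moreover have "BB \<mu> \<le> C" if "\<mu> \<in> vmeasures Ipos Ineg A" "weight_constrained a g \<mu>" for \<mu>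
      unfolding BBsum[OF comp] C_def B_def by (intro sum_mono mult_left_mono mass_bound[OF that] a) auto
    ultimately have "bb \<mu> \<le> enn2real C" if "\<mu> \<in> vmeasures Ipos Ineg A" "weight_constrained a g \<mu>" for \<mu>
      unfolding bb_def using that by (intro enn2real_mono) auto
    then show ?thesis by blast
  qed
  then obtain C where C: "\<And>\<mu>. \<mu> \<in> vmeasures Ipos Ineg A \<Longrightarrow> weight_constrained a g \<mu> \<Longrightarrow> bb \<mu> \<le> C" by blast
  have "dsq (part Ipos \<mu>) (part Ineg \<mu>) \<le> r + 2 * C"
    if \<mu>: "\<mu> \<in> vfinite_pairing f" and w: "weight_constrained a g \<mu>"
      and le: "dsq (part Ipos \<mu>) (part Ineg \<mu>) + 2 * pairing_value f \<mu> \<le> r" for \<mu> r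
  proof -
    note m = vfpE[OF \<mu>]
    have "0 \<le> enn2real (UU \<mu>)" by simp
    then show ?thesis using le m(4) C[OF m(2) w] by linarith
  qed
  then have bound: "\<forall>r. \<exists>r'. \<forall>\<mu>\<in>vfinite_pairing f. weight_constrained a g \<mu> \<longrightarrow>
      dsq (part Ipos \<mu>) (part Ineg \<mu>) + 2 * pairing_value f \<mu> \<le> r \<longrightarrow> dsq (part Ipos \<mu>) (part Ineg \<mu>) \<le> r'"
    by blast
  show ?thesis unfolding good_pairing_def using mid lim bound by (intro conjI) blast+
qed

end

subsection \<open>Existence and compactness of equilibrium measures\<close>

theorem theorem8p1:
  fixes \<kappa> :: "('a::t2_space) \<times> 'a \<Rightarrow> ereal"
    and Ipos Ineg :: "nat set"
    and A :: "nat \<Rightarrow> 'a set"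
    and a :: "nat \<Rightarrow> real"
    and g :: "nat \<Rightarrow> 'a \<Rightarrow> real"
    and f :: "nat \<Rightarrow> 'a \<Rightarrow> ereal"
  assumes "locally_compact_space (euclidean :: 'a topology)"
    and "\<kappa> \<in> lsc_class" and "positive_definite \<kappa>" and "consistent \<kappa>"
    and "condenser Ipos Ineg A"
    and "\<forall>i\<in>Ipos \<union> Ineg. 0 < a i"
    and "\<forall>i\<in>Ipos \<union> Ineg. continuous_on (A i) (g i) \<and> (\<forall>x\<in>A i. 0 < g i x)"
    and "Ineg = {} \<or>
         (\<Sum>\<^sub>\<infinity>i\<in>Ipos \<union> Ineg. ennreal (a i) * inverse (INF x\<in>A i. ennreal (g i x))) < \<infinity> \<and>
         (SUP (x, y)\<in>(\<Union>i\<in>Ipos. A i) \<times> (\<Union>j\<in>Ineg. A j). \<kappa> (x, y)) < \<infinity>"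
    and "(\<exists>\<nu>\<in>vfinite_energy \<kappa> Ipos Ineg A. \<forall>i\<in>Ipos \<union> Ineg. f i = vpotential \<kappa> Ipos Ineg \<nu> i) \<or>
         (\<exists>\<sigma>\<in>finite_energy \<kappa>. \<forall>i\<in>Ipos \<union> Ineg. f i = (\<lambda>x. ereal (plate_sign Ipos i) * spotential \<kappa> \<sigma> x)) \<or>
         (\<forall>i\<in>Ipos \<union> Ineg. f i \<in> lsc_class)"
    and "min_weighted_energy \<kappa> Ipos Ineg f A a g < \<infinity>"
    and "\<forall>i\<in>Ipos \<union> Ineg.
           (SUP x\<in>A i. ennreal (g i x)) < \<infinity> \<or>
           (\<exists>r \<omega>. 1 < r \<and> \<omega> \<in> finite_energy \<kappa> \<and>
              nearly_everywhere \<kappa> (A i)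
                (\<lambda>x. spotential_defined \<kappa> \<omega> x \<and> ereal (g i x powr r) \<le> spotential \<kappa> \<omega> x))"
    and "\<forall>i\<in>Ipos \<union> Ineg. compact (A i) \<or> capacity \<kappa> (A i) < \<infinity>"
  shows "equilibrium_measures \<kappa> Ipos Ineg f A a g \<noteq> {} \<and>
         compactin (vvague Ipos Ineg A) (equilibrium_measures \<kappa> Ipos Ineg f A a g)"
proof -
  \<comment> \<open>\<open>- c\<close> is a lower bound of the kernel on the square. If
    \<open>c\<close> is not 0, the square is compact, and so is the space as its projection.\<close>
  obtain c where c: "0 \<le> c" "c = 0 \<or> compact (UNIV :: ('a \<times> 'a) set)" "\<And>p. - ereal c \<le> \<kappa> p"
    using lsc_class_bounded_below[OF assms(2)] by blast
  have "compact (UNIV :: 'a set)" if "compact (UNIV :: ('a \<times> 'a) set)"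
    using compact_continuous_image[OF continuous_on_fst[OF continuous_on_id] that] by simp
  with c(2) have c': "c = 0 \<or> compact (UNIV :: 'a set)" by blast
  interpret consistent_kernel "TYPE('a)" \<kappa> c
    by unfold_locales (use assms(1-4) c c' in auto)
  interpret condenser_space "TYPE('a)" \<kappa> c Ipos Ineg A
    by unfold_locales (rule assms(5))
  have apos: "0 < a i" and gc: "continuous_on (A i) (g i)" and gp: "\<And>x. x \<in> A i \<Longrightarrow> 0 < g i x" if "i \<in> Ipos \<union> Ineg" for i
    using assms(6,7) that by auto
  have good: "good_pairing a g f"
    using assms(9)
  proof (elim disjE bexE)
    fix \<nu> assume "\<nu> \<in> vfinite_energy \<kappa> Ipos Ineg A" "\<forall>i\<in>Ipos \<union> Ineg. f i = vpotential \<kappa> Ipos Ineg \<nu> i"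
    then show ?thesis using potential_field_vpotential by blast
  next
    fix \<sigma> assume "\<sigma> \<in> finite_energy \<kappa>" "\<forall>i\<in>Ipos \<union> Ineg. f i = (\<lambda>x. ereal (plate_sign Ipos i) * spotential \<kappa> \<sigma> x)"
    then show ?thesis using potential_field_spotential by blast
  next
    assume "\<forall>i\<in>Ipos \<union> Ineg. f i \<in> lsc_class"
    then show ?thesis using good_pairing_lsc apos gc gp by blast
  qed
  interpret weighted_problem "TYPE('a)" \<kappa> c Ipos Ineg A a g f
  proof unfold_locales
    show "\<exists>K. compact K \<and> (\<forall>\<nu>. \<nu> \<in> radon_on (A i) \<longrightarrow> \<nu> \<in> E \<longrightarrow> (c = 0 \<longrightarrow> ee \<nu> \<nu> \<le> B) \<longrightarrow>
        (\<integral>\<^sup>+x\<in>A i - K. ennreal (g i x) \<partial>\<nu>) \<le> ennreal e)" if i: "i \<in> Ipos \<union> Ineg" and e: "0 < e" for i e B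
      by (rule tight_weight[OF A_closed[OF i] _ gc[OF i] gp[OF i] _ e]) (use assms(11,12) i in auto)
    show "\<exists>C. \<forall>\<mu>\<in>vfinite_energy \<kappa> Ipos Ineg A. weight_constrained a g \<mu> \<longrightarrow> ee (part Ipos \<mu>) (part Ineg \<mu>) \<le> C"
      by (rule cross_bound_of_bounded_kernel[OF apos assms(8)])
  qed (use apos gc gp good in \<open>auto simp: good_pairing_def\<close>)
  show ?thesis by (rule equilibrium_nonempty_compact[OF assms(10)])
qed

end
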